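(* There is a Las Vegas randomized comparison-based algorithm which, given an $n\times n$ matrix $A$ with pairwise distinct entries, finds the strict saddlepoint of $A$ or reports that none exists, uses only $O(\log n)$ random bits, and terminates after $O(n)$ time with probability at least $1-O\!\left(\frac{\log n\,\log\log n}{n}\right)$.
   Context: A strict saddlepoint of a matrix is an entry that is the strict maximum of its row and the strict minimum of its column. The entries come from a totally ordered set and are accessed only via unit-cost binary comparisons; the computation model is the word RAM. A Las Vegas algorithm always returns the correct answer; only its running time is random. *)

theory Defs
  imports
    "HOL-Probability.Probability"
    "HOL-Library.Landau_Symbols"
    "Jordan_Normal_Form.Matrix"
begin

text \<open>
  Matrices have entries in an arbitrary totally ordered set, given as a reflexive relation \<open>r\<close>.
\<close>

definition less_in :: "'a rel \<Rightarrow> 'a \<Rightarrow> 'a \<Rightarrow> bool" where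
  "less_in r x y \<longleftrightarrow> (x, y) \<in> r \<and> x \<noteq> y"

definition strict_saddlepoint :: "'a rel \<Rightarrow> 'a mat \<Rightarrow> nat \<Rightarrow> nat \<Rightarrow> bool" where
  "strict_saddlepoint r A i j \<longleftrightarrow>
     i < dim_row A \<and> j < dim_col A \<and>
     (\<forall>j'<dim_col A. j' \<noteq> j \<longrightarrow> less_in r (A $$ (i, j')) (A $$ (i, j))) \<and>
     (\<forall>i'<dim_row A. i' \<noteq> i \<longrightarrow> less_in r (A $$ (i, j)) (A $$ (i', j)))"

text \<open>
  A word RAM with word length \<open>w\<close>: registers and memory cells hold naturals below \<open>2 ^ w\<close>.
  A program is a fixed finite list of instructions, so it uses a constant number of registers.
  Every instruction takes one time unit. The matrix is not stored in memory; the instruction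
  \<open>Compare d i j k l\<close> is the only access to it.
\<close>

datatype binop = Add | Sub | Mul | Div | Mod | And | Or | Xor | Shl | Shr

type_synonym reg = nat

datatype instr =
    Set reg nat
  | Op binop reg reg reg
  | Load reg reg
  | Store reg reg
  | Jump nat
  | Jump_Less reg reg nat
  | Compare reg reg reg reg reg
  | Coin reg

fun binop_val :: "nat \<Rightarrow> binop \<Rightarrow> nat \<Rightarrow> nat \<Rightarrow> nat" where
  "binop_val w Add x y = (x + y) mod 2 ^ w"
| "binop_val w Sub x y = (x + 2 ^ w - y) mod 2 ^ w"
| "binop_val w Mul x y = (x * y) mod 2 ^ w"
| "binop_val w Div x y = x div y"
| "binop_val w Mod x y = x mod y"
| "binop_val w And x y = Bit_Operations.and x y"
| "binop_val w Or x y = Bit_Operations.or x y"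
| "binop_val w Xor x y = Bit_Operations.xor x y"
| "binop_val w Shl x y = (x * 2 ^ y) mod 2 ^ w"
| "binop_val w Shr x y = x div 2 ^ y"

record config =
  pc :: nat
  regs :: "reg \<Rightarrow> nat"
  mem :: "nat \<Rightarrow> nat"
  coins :: nat  \<comment> \<open>number of random bits drawn so far\<close>

definition set_reg :: "reg \<Rightarrow> nat \<Rightarrow> config \<Rightarrow> config" where
  "set_reg d v s = s\<lparr>pc := Suc (pc s), regs := (regs s)(d := v)\<rparr>"

type_synonym comparator = "nat \<Rightarrow> nat \<Rightarrow> nat \<Rightarrow> nat \<Rightarrow> bool"

fun exec :: "nat \<Rightarrow> comparator \<Rightarrow> instr \<Rightarrow> config \<Rightarrow> config pmf" where
  "exec w lt (Set d v) s = return_pmf (set_reg d (v mod 2 ^ w) s)"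
| "exec w lt (Op f d x y) s = return_pmf (set_reg d (binop_val w f (regs s x) (regs s y)) s)"
| "exec w lt (Load d a) s = return_pmf (set_reg d (mem s (regs s a)) s)"
| "exec w lt (Store a x) s =
     return_pmf (s\<lparr>pc := Suc (pc s), mem := (mem s)(regs s a := regs s x)\<rparr>)"
| "exec w lt (Jump l) s = return_pmf (s\<lparr>pc := l\<rparr>)"
| "exec w lt (Jump_Less x y l) s =
     return_pmf (s\<lparr>pc := (if regs s x < regs s y then l else Suc (pc s))\<rparr>)"
| "exec w lt (Compare d i j k l) s =
     return_pmf (set_reg d (of_bool (lt (regs s i) (regs s j) (regs s k) (regs s l))) s)"
| "exec w lt (Coin d) s =
     map_pmf (\<lambda>b. set_reg d (of_bool b) (s\<lparr>coins := Suc (coins s)\<rparr>))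
       (bernoulli_pmf (1 / 2))"

definition halted :: "instr list \<Rightarrow> config \<Rightarrow> bool" where
  "halted P s \<longleftrightarrow> length P \<le> pc s"

definition step :: "nat \<Rightarrow> comparator \<Rightarrow> instr list \<Rightarrow> config \<Rightarrow> config pmf" where
  "step w lt P s = (if halted P s then return_pmf s else exec w lt (P ! pc s) s)"

text \<open>
  Distribution of the configuration after \<open>t\<close> time units; halted configurations stay put.
\<close>

primrec run :: "nat \<Rightarrow> comparator \<Rightarrow> instr list \<Rightarrow> nat \<Rightarrow> config \<Rightarrow> config pmf" where
  "run w lt P 0 s = return_pmf s"
| "run w lt P (Suc t) s = bind_pmf (step w lt P s) (run w lt P t)"

definition init :: "nat \<Rightarrow> config" where
  "init n = \<lparr>pc = 0, regs = (\<lambda>_. 0)(0 := n), mem = (\<lambda>_. 0), coins = 0\<rparr>"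

text \<open>Comparisons with an index outside the matrix answer False and so reveal nothing.\<close>

definition entry_less :: "'a rel \<Rightarrow> 'a mat \<Rightarrow> comparator" where
  "entry_less r A i j k l \<longleftrightarrow>
     i < dim_row A \<and> j < dim_col A \<and> k < dim_row A \<and> l < dim_col A \<and>
     less_in r (A $$ (i, j)) (A $$ (k, l))"

text \<open>
  Output convention: register 0 holds 1 if a strict saddlepoint exists, whose row and column are
  then in registers 1 and 2, and holds 0 otherwise.
\<close>

definition correct_output :: "'a rel \<Rightarrow> 'a mat \<Rightarrow> config \<Rightarrow> bool" where
  "correct_output r A s \<longleftrightarrow>
     (if \<exists>i j. strict_saddlepoint r A i j
      then regs s 0 = 1 \<and> strict_saddlepoint r A (regs s 1) (regs s 2)
      else regs s 0 = 0)"

end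

theory Submission
  imports Defs "HOL-Number_Theory.Cong" "HOL-Real_Asymp.Real_Asymp"
begin

text \<open>
  The algorithm maintains a list of rows and a list of columns which contain those of the
  saddlepoint, if there is one. A reduction draws small samples of both lists. For \<open>r = 1, 2, \<dots>\<close> it takes
  as pivot the smallest entry that lies in the top \<open>2 ^ (- r)\<close> part of its sampled row. A staircase walk
  of linear cost shows that every row has an entry above the pivot or that every column has an entry
  not above it. In the first case the value of the saddlepoint, a row maximum, exceeds the pivot, and so
  do all entries of its column; only the columns in which the row of the pivot is above the pivot
  survive. In the second case the value, a column minimum, does not exceed the pivot, and a row with a
  larger entry can be discarded; most rows have many such entries and are caught by a few random tests.
  The same is done with rows and columns exchanged, alternating between the two.

  Pairwise independence suffices for the samples, so multiply-shift hashing needs only \<open>O(log n)\<close>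
  random bits. With \<open>y\<close> about \<open>n powr (1 / 20)\<close>, a reduction takes linear time always and, except with
  probability \<open>O(log n / y)\<close>, shrinks one of the lists by a factor of order \<open>y\<close>. A constant number of
  reductions thus leaves \<open>O(n)\<close> entries, among which the minimum of the row maxima is the only candidate;
  it is verified against its row and column. If 40 attempts with independent seeds all fail, an event of
  probability \<open>O((log n) ^ 40 / n ^ 2)\<close>, the candidate is searched in the whole matrix.
\<close>

section \<open>A structured language on the word RAM\<close>

text \<open>A balance of costs is the reason for the levels \<open>r\<close> and for the alternation
  of rows and columns. After a failed walk at level \<open>r\<close>, a row worth discarding may
  exceed the pivot in as little as a fraction \<open>1 / 2 ^ r\<close> of the sampled columns, so
  about \<open>2 ^ r\<close> tests are needed to catch it. By then the earlier filterings have cut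
  the list of rows to \<open>O(n / 2 ^ r)\<close>, and the product is linear. The lengths of the
  lists themselves form a geometric series, which pays for the walks and the filterings.

  The obstacle to few random bits is that up to \<open>n\<close> rows need test sequences. They are
  hashed twice: the parameters of the sequence of a row are hash values of its position, computed
  from eight seeds. Sequences of two rows are then independent, and this suffices for a Chebyshev
  bound on the total cost.

  No random event enters the correctness. Entries are discarded only on the evidence of comparisons
  that hold for every seed; unlucky seeds merely leave long lists, and budgets turn this into a
  bounded loss of time. Hence all bad events concern sizes and costs only.\<close>

fun dexec :: "nat \<Rightarrow> comparator \<Rightarrow> instr \<Rightarrow> config \<times> bool list \<Rightarrow> config \<times> bool list" where
  "dexec w lt (Set d v) (s, bs) = (set_reg d (v mod 2 ^ w) s, bs)"
| "dexec w lt (Op f d x y) (s, bs) = (set_reg d (binop_val w f (regs s x) (regs s y)) s, bs)"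
| "dexec w lt (Load d a) (s, bs) = (set_reg d (mem s (regs s a)) s, bs)"
| "dexec w lt (Store a x) (s, bs) =
     (s\<lparr>pc := Suc (pc s), mem := (mem s)(regs s a := regs s x)\<rparr>, bs)"
| "dexec w lt (Jump l) (s, bs) = (s\<lparr>pc := l\<rparr>, bs)"
| "dexec w lt (Jump_Less x y l) (s, bs) =
     (s\<lparr>pc := (if regs s x < regs s y then l else Suc (pc s))\<rparr>, bs)"
| "dexec w lt (Compare d i j k l) (s, bs) =
     (set_reg d (of_bool (lt (regs s i) (regs s j) (regs s k) (regs s l))) s, bs)"
| "dexec w lt (Coin d) (s, bs) =
     (set_reg d (of_bool (bs \<noteq> [] \<and> hd bs)) (s\<lparr>coins := Suc (coins s)\<rparr>), tl bs)"

definition dstep :: "nat \<Rightarrow> comparator \<Rightarrow> instr list \<Rightarrow> config \<times> bool list \<Rightarrow> config \<times> bool list" where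
  "dstep w lt P x = (if halted P (fst x) then x else dexec w lt (P ! pc (fst x)) x)"

definition drun where "drun w lt P t = (dstep w lt P) ^^ t"

lemma drun_0 [simp]: "drun w lt P 0 x = x"
  by (simp add: drun_def)

lemma drun_Suc: "drun w lt P (Suc t) x = drun w lt P t (dstep w lt P x)"
  by (simp add: drun_def funpow_swap1)

lemma drun_add: "drun w lt P (a + b) x = drun w lt P b (drun w lt P a x)"
  by (simp add: drun_def funpow_add add.commute[of a b])

lemma drun_halted: "halted P (fst x) \<Longrightarrow> drun w lt P t x = x"
  by (induction t) (auto simp: drun_Suc dstep_def)

text \<open>The hypothesis on \<open>t\<close> steps leaves the number \<open>N\<close> of flips
  open, since a \<open>Coin\<close> step consumes one flip and continues with
  \<open>N - 1\<close>.\<close>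

lemma exec_dexec_replicate:
  assumes "N \<ge> Suc t"
    and IH: "\<And>s N. N \<ge> t \<Longrightarrow> run w lt P t s =
      map_pmf (\<lambda>bs. fst (drun w lt P t (s, bs))) (replicate_pmf N (bernoulli_pmf (1/2)))"
  shows "bind_pmf (exec w lt i s) (run w lt P t) =
    map_pmf (\<lambda>bs. fst (drun w lt P t (dexec w lt i (s, bs)))) (replicate_pmf N (bernoulli_pmf (1/2)))"
proof (cases i)
  case (Coin d)
  obtain N' where N: "N = Suc N'" "N' \<ge> t"
    using assms(1) by (cases N) auto
  show ?thesis
    unfolding Coin N by (simp add: map_bind_pmf bind_map_pmf IH[OF N(2)] map_pmf_def bind_assoc_pmf bind_return_pmf)
qed (use assms(1) in \<open>auto simp: bind_return_pmf IH[of N]\<close>)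

text \<open>A step consumes at most one flip, so \<open>t\<close> steps never run past a list of
  \<open>N \<ge> t\<close> flips. Everything below can thus argue about a single deterministic run;
  probability enters only through the list.\<close>

lemma run_eq_drun:
  "N \<ge> t \<Longrightarrow> run w lt P t s =
    map_pmf (\<lambda>bs. fst (drun w lt P t (s, bs))) (replicate_pmf N (bernoulli_pmf (1/2)))"
proof (induction t arbitrary: s N)
  case (Suc t)
  show ?case
  proof (cases "halted P s")
    case True
    thus ?thesis using Suc.prems Suc.IH[of N s]
      by (simp add: step_def drun_Suc dstep_def bind_return_pmf)
  next
    case False
    thus ?thesis using exec_dexec_replicate[OF Suc.prems Suc.IH]
      by (simp add: step_def drun_Suc dstep_def)
  qed
qed simp

text \<open>
  Every stored value stays below a bound \<open>B\<close> polynomial in \<open>n\<close>, and an expression of weight at most 20 over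
  such values stays below \<open>B ^ 20 \<le> 2 ^ w\<close>; hence machine arithmetic never wraps around. In a state, \<open>mm c i\<close>
  is cell \<open>i\<close> of array \<open>c < 8\<close>, kept at address \<open>8 * i + c\<close>; \<open>bt\<close> are the coin flips still to come, \<open>nf\<close> counts
  the flips consumed, and the ghost component \<open>tk\<close> counts loop iterations, which is the running time up
  to the length of the program.
\<close>

datatype exp = Nm nat | Vr nat | Plus exp exp | Times exp exp | Divi exp exp | Modu exp exp | Ld exp exp

datatype com = Skip | Assign nat exp ("_ ::= _" [1000, 61] 61) | Pow nat nat | Sto exp exp exp
  | Cmp nat exp exp exp exp | Flip nat | Seq com com (infixr ";;" 60)
  | Cond exp exp com com | While exp exp com

record st =
  rg :: "nat \<Rightarrow> nat"
  mm :: "nat \<Rightarrow> nat \<Rightarrow> nat"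
  bt :: "bool list"
  nf :: nat
  tk :: nat

primrec ev :: "st \<Rightarrow> exp \<Rightarrow> nat" where
  "ev s (Nm v) = v"
| "ev s (Vr x) = rg s x"
| "ev s (Plus a b) = ev s a + ev s b"
| "ev s (Times a b) = ev s a * ev s b"
| "ev s (Divi a b) = ev s a div ev s b"
| "ev s (Modu a b) = ev s a mod ev s b"
| "ev s (Ld c i) = mm s (ev s c) (ev s i)"

primrec gd :: "st \<Rightarrow> exp \<Rightarrow> bool" where
  "gd s (Nm v) = True"
| "gd s (Vr x) = True"
| "gd s (Plus a b) = (gd s a \<and> gd s b)"
| "gd s (Times a b) = (gd s a \<and> gd s b)"
| "gd s (Divi a b) = (gd s a \<and> gd s b)"
| "gd s (Modu a b) = (gd s a \<and> gd s b)"
| "gd s (Ld c i) = (gd s c \<and> gd s i \<and> ev s c < 8)"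

text \<open>An assignment, power or store whose value reaches \<open>B\<close> has no rule, so a
  derivation is at the same time a proof that nothing overflows.\<close>

inductive bigstep :: "comparator \<Rightarrow> nat \<Rightarrow> com \<Rightarrow> st \<Rightarrow> st \<Rightarrow> bool" for lt B where
  bs_Skip: "bigstep lt B Skip s s"
| bs_Assign: "gd s e \<Longrightarrow> ev s e < B \<Longrightarrow> bigstep lt B (x ::= e) s (s\<lparr>rg := (rg s)(x := ev s e)\<rparr>)"
| bs_Pow: "2 ^ rg s y < B \<Longrightarrow> bigstep lt B (Pow x y) s (s\<lparr>rg := (rg s)(x := 2 ^ rg s y)\<rparr>)"
| bs_Sto: "gd s c \<Longrightarrow> gd s i \<Longrightarrow> gd s e \<Longrightarrow> ev s c < 8 \<Longrightarrow> ev s e < B \<Longrightarrow>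
    bigstep lt B (Sto c i e) s (s\<lparr>mm := (mm s)(ev s c := (mm s (ev s c))(ev s i := ev s e))\<rparr>)"
| bs_Cmp: "gd s a \<Longrightarrow> gd s b \<Longrightarrow> gd s c \<Longrightarrow> gd s d \<Longrightarrow>
    bigstep lt B (Cmp x a b c d) s (s\<lparr>rg := (rg s)(x := of_bool (lt (ev s a) (ev s b) (ev s c) (ev s d)))\<rparr>)"
| bs_Flip: "bigstep lt B (Flip x) s
    (s\<lparr>rg := (rg s)(x := of_bool (bt s \<noteq> [] \<and> hd (bt s))), bt := tl (bt s), nf := Suc (nf s)\<rparr>)"
| bs_Seq: "bigstep lt B a s s' \<Longrightarrow> bigstep lt B b s' s'' \<Longrightarrow> bigstep lt B (a ;; b) s s''"
| bs_If1: "gd s e \<Longrightarrow> gd s f \<Longrightarrow> ev s e < ev s f \<Longrightarrow> bigstep lt B a s s' \<Longrightarrow> bigstep lt B (Cond e f a b) s s'"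
| bs_If2: "gd s e \<Longrightarrow> gd s f \<Longrightarrow> \<not> ev s e < ev s f \<Longrightarrow> bigstep lt B b s s' \<Longrightarrow> bigstep lt B (Cond e f a b) s s'"
| bs_While1: "gd s e \<Longrightarrow> gd s f \<Longrightarrow> ev s e < ev s f \<Longrightarrow> bigstep lt B a s s' \<Longrightarrow>
    bigstep lt B (While e f a) (s'\<lparr>tk := Suc (tk s')\<rparr>) s'' \<Longrightarrow> bigstep lt B (While e f a) s s''"
| bs_While2: "gd s e \<Longrightarrow> gd s f \<Longrightarrow> \<not> ev s e < ev s f \<Longrightarrow> bigstep lt B (While e f a) s s"

definition bdd :: "nat \<Rightarrow> st \<Rightarrow> bool" where
  "bdd B s \<longleftrightarrow> (\<forall>x. rg s x < B) \<and> (\<forall>c i. mm s c i < B)"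

primrec wt :: "exp \<Rightarrow> nat" where
  "wt (Nm v) = 1"
| "wt (Vr x) = 1"
| "wt (Plus a b) = wt a + wt b"
| "wt (Times a b) = wt a + wt b"
| "wt (Divi a b) = wt a + wt b"
| "wt (Modu a b) = wt a + wt b"
| "wt (Ld c i) = wt c + wt i + 2"

text \<open>Registers from 100 on are scratch space for the evaluation of expressions.\<close>

primrec wfe :: "nat \<Rightarrow> exp \<Rightarrow> bool" where
  "wfe B (Nm v) = (v < B)"
| "wfe B (Vr x) = (x < 100)"
| "wfe B (Plus a b) = (wfe B a \<and> wfe B b)"
| "wfe B (Times a b) = (wfe B a \<and> wfe B b)"
| "wfe B (Divi a b) = (wfe B a \<and> wfe B b)"
| "wfe B (Modu a b) = (wfe B a \<and> wfe B b)"
| "wfe B (Ld c i) = (wfe B c \<and> wfe B i)"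

text \<open>Weight 20 would still fit into a word. The bound is 18 because a store forms the address
  \<open>8 * i + c\<close> from its index, which costs up to one more factor \<open>B\<close>
  (\<open>address_less\<close>).\<close>

definition oke :: "nat \<Rightarrow> exp \<Rightarrow> bool" where
  "oke B e \<longleftrightarrow> wfe B e \<and> wt e \<le> 18"

primrec wfc :: "nat \<Rightarrow> com \<Rightarrow> bool" where
  "wfc B Skip = True"
| "wfc B (x ::= e) = (x < 100 \<and> oke B e)"
| "wfc B (Pow x y) = (x < 100 \<and> y < 100)"
| "wfc B (Sto c i e) = (oke B c \<and> oke B i \<and> oke B e)"
| "wfc B (Cmp x a b c d) = (x < 100 \<and> oke B a \<and> oke B b \<and> oke B c \<and> oke B d)"
| "wfc B (Flip x) = (x < 100)"
| "wfc B (a ;; b) = (wfc B a \<and> wfc B b)"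
| "wfc B (Cond e f a b) = (oke B e \<and> oke B f \<and> wfc B a \<and> wfc B b)"
| "wfc B (While e f a) = (oke B e \<and> oke B f \<and> wfc B a)"

text \<open>The registers from \<open>k\<close> on serve as an evaluation stack. \<open>Or\<close>
  of a register with itself replaces a copy instruction.\<close>

primrec ce :: "nat \<Rightarrow> exp \<Rightarrow> instr list" where
  "ce k (Nm v) = [Set k v]"
| "ce k (Vr x) = [Op Or k x x]"
| "ce k (Plus a b) = ce k a @ ce (Suc k) b @ [Op Add k k (Suc k)]"
| "ce k (Times a b) = ce k a @ ce (Suc k) b @ [Op Mul k k (Suc k)]"
| "ce k (Divi a b) = ce k a @ ce (Suc k) b @ [Op Div k k (Suc k)]"
| "ce k (Modu a b) = ce k a @ ce (Suc k) b @ [Op Mod k k (Suc k)]"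
| "ce k (Ld c i) = ce k i @ [Set (Suc k) 8, Op Mul k k (Suc k)] @ ce (Suc k) c @
    [Op Add k k (Suc k), Load k k]"

definition cnd :: "exp \<Rightarrow> exp \<Rightarrow> instr list" where
  "cnd e f = ce 100 e @ ce 101 f"

text \<open>Jump targets are absolute, so \<open>cc\<close> has to know the length of code that it
  has not yet generated; this length does not depend on the position.\<close>

primrec clen :: "com \<Rightarrow> nat" where
  "clen Skip = 1"
| "clen (x ::= e) = length (ce 100 e) + 1"
| "clen (Pow x y) = 2"
| "clen (Sto c i e) = length (ce 100 i) + 2 + length (ce 101 c) + 1 + length (ce 101 e) + 1"
| "clen (Cmp x a b c d) = length (ce 100 a) + length (ce 101 b) + length (ce 102 c) + length (ce 103 d) + 1"
| "clen (Flip x) = 1"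
| "clen (a ;; b) = clen a + clen b"
| "clen (Cond e f a b) = length (cnd e f) + 2 + clen a + clen b"
| "clen (While e f a) = length (cnd e f) + 3 + clen a"

primrec cc :: "nat \<Rightarrow> com \<Rightarrow> instr list" where
  "cc p Skip = [Jump (Suc p)]"
| "cc p (x ::= e) = ce 100 e @ [Op Or x 100 100]"
| "cc p (Pow x y) = [Set 100 1, Op Shl x 100 y]"
| "cc p (Sto c i e) = ce 100 i @ [Set 101 8, Op Mul 100 100 101] @ ce 101 c @ [Op Add 100 100 101] @
    ce 101 e @ [Store 100 101]"
| "cc p (Cmp x a b c d) = ce 100 a @ ce 101 b @ ce 102 c @ ce 103 d @ [Compare x 100 101 102 103]"
| "cc p (Flip x) = [Coin x]"
| "cc p (a ;; b) = cc p a @ cc (p + clen a) b"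
| "cc p (Cond e f a b) = (let q = p + length (cnd e f) in
    cnd e f @ [Jump_Less 100 101 (q + 2 + clen b)] @ cc (q + 1) b @
    [Jump (q + 2 + clen b + clen a)] @ cc (q + 2 + clen b) a)"
| "cc p (While e f a) = (let q = p + length (cnd e f) in
    cnd e f @ [Jump_Less 100 101 (q + 2), Jump (q + 3 + clen a)] @ cc (q + 2) a @ [Jump p])"

lemma length_cc [simp]: "length (cc p c) = clen c"
  by (induction c arbitrary: p) (auto simp: Let_def cnd_def)

lemma clen_pos: "clen c \<ge> 1"
  by (induction c) auto

section \<open>Correctness and running time of the compiled code\<close>

primrec straight :: "instr \<Rightarrow> bool" where
  "straight (Set d v) = True"
| "straight (Op f d x y) = True"
| "straight (Load d a) = True"
| "straight (Store a x) = True"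
| "straight (Jump l) = False"
| "straight (Jump_Less x y l) = False"
| "straight (Compare d i j k l) = True"
| "straight (Coin d) = True"

definition sexec :: "nat \<Rightarrow> comparator \<Rightarrow> instr list \<Rightarrow> config \<times> bool list \<Rightarrow> config \<times> bool list" where
  "sexec w lt xs = fold (dexec w lt) xs"

lemma sexec_simps [simp]:
  "sexec w lt [] x = x"
  "sexec w lt (i # xs) x = sexec w lt xs (dexec w lt i x)"
  "sexec w lt (xs @ ys) x = sexec w lt ys (sexec w lt xs x)"
  by (simp_all add: sexec_def)

definition code_at :: "instr list \<Rightarrow> nat \<Rightarrow> instr list \<Rightarrow> bool" where
  "code_at P p xs \<longleftrightarrow> (\<forall>i<length xs. p + i < length P \<and> P ! (p + i) = xs ! i)"

lemma code_at_Nil [simp]: "code_at P p []"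
  by (simp add: code_at_def)

lemma code_at_Cons [simp]:
  "code_at P p (x # xs) \<longleftrightarrow> p < length P \<and> P ! p = x \<and> code_at P (Suc p) xs"
  by (auto simp: code_at_def All_less_Suc2)

lemma code_at_append [simp]:
  "code_at P p (xs @ ys) \<longleftrightarrow> code_at P p xs \<and> code_at P (p + length xs) ys"
  by (induction xs arbitrary: p) auto

lemma code_at_self: "code_at P 0 P"
  by (simp add: code_at_def)

lemma dexec_pc: "straight i \<Longrightarrow> pc (fst (dexec w lt i x)) = Suc (pc (fst x))"
  by (cases x; cases i) (auto simp: set_reg_def)

lemma drun_straight:
  "list_all straight xs \<Longrightarrow> code_at P (pc (fst x)) xs \<Longrightarrow>
    drun w lt P (length xs) x = sexec w lt xs x"
  by (induction xs arbitrary: x) (auto simp: drun_Suc dstep_def halted_def dexec_pc)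

lemma straight_ce: "list_all straight (ce k e)"
  by (induction e arbitrary: k) auto

definition sim :: "st \<Rightarrow> config \<times> bool list \<Rightarrow> bool" where
  "sim z x \<longleftrightarrow> (\<forall>r<100. regs (fst x) r = rg z r) \<and>
    (\<forall>c<8. \<forall>i. mem (fst x) (8 * i + c) = mm z c i) \<and>
    coins (fst x) = nf z \<and> snd x = bt z"

text \<open>Sums can be weighted like products because both powers of \<open>B\<close> are at least
  2, so that \<open>x < A\<close> and \<open>y < C\<close> give
  \<open>x + y < A * C\<close>.\<close>

lemma ev_less:
  assumes "bdd B z" "B \<ge> 8"
  shows "wfe B e \<Longrightarrow> ev z e < B ^ wt e \<and> wt e \<ge> 1"
proof (induction e)
  case (Plus a b)
  have "B \<le> B ^ wt a" "B \<le> B ^ wt b"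
    using Plus.IH Plus.prems assms(2) self_le_power[of B] by simp_all
  hence "2 \<le> B ^ wt a" "2 \<le> B ^ wt b" using assms(2) by linarith+
  moreover have "x + y < A * C" if "x < A" "y < C" "2 \<le> A" "2 \<le> C" for x y A C :: nat
  proof -
    obtain A' C' where AC: "A = A' + 2" "C = C' + 2"
      using \<open>2 \<le> A\<close> \<open>2 \<le> C\<close> by (metis le_add_diff_inverse2)
    show ?thesis using that unfolding AC by (simp add: algebra_simps)
  qed
  ultimately show ?case using Plus by (simp add: power_add)
next
  case (Times a b)
  thus ?case using assms(2) by (auto simp: power_add intro!: mult_strict_mono)
next
  case (Divi a b)
  have "ev z a div ev z b \<le> ev z a" by simp
  also have "\<dots> < B ^ wt a" using Divi by simp
  also have "\<dots> \<le> B ^ wt (Divi a b)" using assms by (intro power_increasing) auto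
  finally show ?case using Divi by simp
next
  case (Modu a b)
  have "ev z a mod ev z b \<le> ev z a" by simp
  also have "\<dots> < B ^ wt a" using Modu by simp
  also have "\<dots> \<le> B ^ wt (Modu a b)" using assms by (intro power_increasing) auto
  finally show ?case using Modu by simp
next
  case (Ld c i)
  have "ev z (Ld c i) < B" using assms(1) by (simp add: bdd_def)
  also have "B = B ^ 1" by simp
  also have "\<dots> \<le> B ^ wt (Ld c i)" using assms by (intro power_increasing) auto
  finally show ?case by simp
qed (use assms in \<open>auto simp: bdd_def\<close>)

locale width =
  fixes w :: nat and B :: nat and lt :: comparator
  assumes B8: "8 \<le> B" and Bw: "B ^ 20 \<le> 2 ^ w"
begin

lemma fits: "bdd B z \<Longrightarrow> wfe B e \<Longrightarrow> wt e \<le> 20 \<Longrightarrow> ev z e < 2 ^ w"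
  using ev_less[of B z e] power_increasing[of "wt e" 20 B] B8 Bw
  by (meson le_trans less_le_trans one_le_numeral)

lemma B_less: "B < 2 ^ w"
proof -
  have "B ^ 1 < B ^ 20" using B8 by (intro power_strict_increasing) auto
  thus ?thesis using Bw by simp
qed

lemma address_less:
  assumes "bdd B z" "wfe B i" "wt i \<le> 18" "c < 8"
  shows "ev z i * 8 + c < 2 ^ w"
proof -
  have i: "ev z i < B ^ wt i" using ev_less[OF assms(1) B8 assms(2)] by simp
  have "ev z i * 8 + c < (ev z i + 1) * 8" using assms(4) by simp
  also have "\<dots> \<le> B ^ wt i * B" using i B8 by (intro mult_mono) auto
  also have "\<dots> = B ^ (wt i + 1)" by simp
  also have "\<dots> \<le> B ^ 20" using B8 assms(3) by (intro power_increasing) auto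
  finally show ?thesis using Bw by simp
qed

lemma ce_correct:
  assumes "bdd B z" "wfe B e" "wt e \<le> 20" "gd z e" "100 \<le> k" "sim z (s, bl)"
  shows "\<exists>s'. sexec w lt (ce k e) (s, bl) = (s', bl) \<and> regs s' k = ev z e \<and>
    (\<forall>x<k. regs s' x = regs s x) \<and> mem s' = mem s \<and> coins s' = coins s \<and>
    pc s' = pc s + length (ce k e)"
  using assms(2-)
proof (induction e arbitrary: k s)
  case (Nm v)
  have "v < 2 ^ w" using Nm B_less by simp
  thus ?case by (auto simp: set_reg_def)
next
  case (Vr x)
  thus ?case by (auto simp: set_reg_def sim_def)
next
  case (Ld c i)
  obtain s1 where s1: "sexec w lt (ce k i) (s, bl) = (s1, bl)" "regs s1 k = ev z i"
    "\<forall>x<k. regs s1 x = regs s x" "mem s1 = mem s" "coins s1 = coins s"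
    "pc s1 = pc s + length (ce k i)"
    using Ld.IH(2)[of k s] Ld.prems by auto
  have 8: "(8::nat) < 2 ^ w" using B8 B_less by simp
  have a: "ev z i * 8 + ev z c < 2 ^ w" "ev z i * 8 < 2 ^ w"
    using address_less[OF assms(1), of i "ev z c"] address_less[OF assms(1), of i 0] Ld.prems by auto
  define s2 where "s2 = s1\<lparr>pc := pc s1 + 2, regs := (regs s1)(Suc k := 8, k := ev z i * 8)\<rparr>"
  have e2: "sexec w lt [Set (Suc k) 8, Op Mul k k (Suc k)] (s1, bl) = (s2, bl)"
    using s1(2) 8 a(2) by (auto simp: set_reg_def s2_def)
  have "sim z (s2, bl)" using Ld.prems(4,5) s1 by (auto simp: sim_def s2_def)
  then obtain s3 where s3: "sexec w lt (ce (Suc k) c) (s2, bl) = (s3, bl)" "regs s3 (Suc k) = ev z c"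
    "\<forall>x<Suc k. regs s3 x = regs s2 x" "mem s3 = mem s2" "coins s3 = coins s2"
    "pc s3 = pc s2 + length (ce (Suc k) c)"
    using Ld.IH(1)[of "Suc k" s2] Ld.prems by auto
  have "mem s (ev z i * 8 + ev z c) = mm z (ev z c) (ev z i)"
    using Ld.prems by (auto simp: sim_def mult.commute)
  thus ?case
    unfolding ce.simps sexec_simps(3) s1(1) e2 s3(1)
    using a s3 s1 by (auto simp: set_reg_def s2_def)
next
  case (Plus a b)
  obtain s1 where s1: "sexec w lt (ce k a) (s, bl) = (s1, bl)" "regs s1 k = ev z a"
    "\<forall>x<k. regs s1 x = regs s x" "mem s1 = mem s" "coins s1 = coins s"
    "pc s1 = pc s + length (ce k a)"
    using Plus.IH(1)[of k s] Plus.prems by auto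
  have "sim z (s1, bl)" using Plus.prems(4,5) s1 by (auto simp: sim_def)
  then obtain s3 where s3: "sexec w lt (ce (Suc k) b) (s1, bl) = (s3, bl)" "regs s3 (Suc k) = ev z b"
    "\<forall>x<Suc k. regs s3 x = regs s1 x" "mem s3 = mem s1" "coins s3 = coins s1"
    "pc s3 = pc s1 + length (ce (Suc k) b)"
    using Plus.IH(2)[of "Suc k" s1] Plus.prems by auto
  have f: "ev z a + ev z b < 2 ^ w" using fits[OF assms(1), of "Plus a b"] Plus.prems by simp
  show ?case
    unfolding ce.simps sexec_simps(3) s1(1) s3(1) using s1 s3 f by (auto simp: set_reg_def)
next
  case (Times a b)
  obtain s1 where s1: "sexec w lt (ce k a) (s, bl) = (s1, bl)" "regs s1 k = ev z a"
    "\<forall>x<k. regs s1 x = regs s x" "mem s1 = mem s" "coins s1 = coins s"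
    "pc s1 = pc s + length (ce k a)"
    using Times.IH(1)[of k s] Times.prems by auto
  have "sim z (s1, bl)" using Times.prems(4,5) s1 by (auto simp: sim_def)
  then obtain s3 where s3: "sexec w lt (ce (Suc k) b) (s1, bl) = (s3, bl)" "regs s3 (Suc k) = ev z b"
    "\<forall>x<Suc k. regs s3 x = regs s1 x" "mem s3 = mem s1" "coins s3 = coins s1"
    "pc s3 = pc s1 + length (ce (Suc k) b)"
    using Times.IH(2)[of "Suc k" s1] Times.prems by auto
  have f: "ev z a * ev z b < 2 ^ w" using fits[OF assms(1), of "Times a b"] Times.prems by simp
  show ?case
    unfolding ce.simps sexec_simps(3) s1(1) s3(1) using s1 s3 f by (auto simp: set_reg_def)
next
  case (Divi a b)
  obtain s1 where s1: "sexec w lt (ce k a) (s, bl) = (s1, bl)" "regs s1 k = ev z a"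
    "\<forall>x<k. regs s1 x = regs s x" "mem s1 = mem s" "coins s1 = coins s"
    "pc s1 = pc s + length (ce k a)"
    using Divi.IH(1)[of k s] Divi.prems by auto
  have "sim z (s1, bl)" using Divi.prems(4,5) s1 by (auto simp: sim_def)
  then obtain s3 where s3: "sexec w lt (ce (Suc k) b) (s1, bl) = (s3, bl)" "regs s3 (Suc k) = ev z b"
    "\<forall>x<Suc k. regs s3 x = regs s1 x" "mem s3 = mem s1" "coins s3 = coins s1"
    "pc s3 = pc s1 + length (ce (Suc k) b)"
    using Divi.IH(2)[of "Suc k" s1] Divi.prems by auto
  show ?case
    unfolding ce.simps sexec_simps(3) s1(1) s3(1) using s1 s3 by (auto simp: set_reg_def)
next
  case (Modu a b)
  obtain s1 where s1: "sexec w lt (ce k a) (s, bl) = (s1, bl)" "regs s1 k = ev z a"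
    "\<forall>x<k. regs s1 x = regs s x" "mem s1 = mem s" "coins s1 = coins s"
    "pc s1 = pc s + length (ce k a)"
    using Modu.IH(1)[of k s] Modu.prems by auto
  have "sim z (s1, bl)" using Modu.prems(4,5) s1 by (auto simp: sim_def)
  then obtain s3 where s3: "sexec w lt (ce (Suc k) b) (s1, bl) = (s3, bl)" "regs s3 (Suc k) = ev z b"
    "\<forall>x<Suc k. regs s3 x = regs s1 x" "mem s3 = mem s1" "coins s3 = coins s1"
    "pc s3 = pc s1 + length (ce (Suc k) b)"
    using Modu.IH(2)[of "Suc k" s1] Modu.prems by auto
  show ?case
    unfolding ce.simps sexec_simps(3) s1(1) s3(1) using s1 s3 by (auto simp: set_reg_def)
qed

definition reach :: "instr list \<Rightarrow> nat \<Rightarrow> config \<times> bool list \<Rightarrow> config \<times> bool list \<Rightarrow> bool" where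
  "reach P t x y \<longleftrightarrow> (\<exists>t'\<le>t. drun w lt P t' x = y)"

lemma reach_trans: "reach P t x y \<Longrightarrow> reach P t' y z \<Longrightarrow> reach P (t + t') x z"
  by (auto simp: reach_def) (metis add_mono drun_add)

lemma reach_mono: "reach P t x y \<Longrightarrow> t \<le> t' \<Longrightarrow> reach P t' x y"
  by (auto simp: reach_def intro: order_trans)

lemma reach_straight:
  "list_all straight xs \<Longrightarrow> code_at P (pc (fst x)) xs \<Longrightarrow> sexec w lt xs x = y \<Longrightarrow>
    reach P (length xs) x y"
  using drun_straight[of xs P x w lt] by (auto simp: reach_def)

lemma reach_step:
  "pc (fst x) < length P \<Longrightarrow> dexec w lt (P ! pc (fst x)) x = y \<Longrightarrow> reach P 1 x y"
  unfolding reach_def by (rule exI[of _ 1]) (auto simp: drun_Suc dstep_def halted_def)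

lemma cnd_correct:
  assumes "bdd B z" "oke B e" "oke B f" "gd z e" "gd z f" "sim z (s, bl)"
    "code_at P (pc s) (cnd e f)"
  shows "\<exists>s'. reach P (length (cnd e f)) (s, bl) (s', bl) \<and> regs s' 100 = ev z e \<and>
    regs s' 101 = ev z f \<and> sim z (s', bl) \<and> pc s' = pc s + length (cnd e f)"
proof -
  obtain s1 where s1: "sexec w lt (ce 100 e) (s, bl) = (s1, bl)" "regs s1 100 = ev z e"
    "\<forall>x<100. regs s1 x = regs s x" "mem s1 = mem s" "coins s1 = coins s"
    "pc s1 = pc s + length (ce 100 e)"
    using ce_correct[of z e 100 s bl] assms by (auto simp: oke_def)
  have "sim z (s1, bl)" using assms(6) s1 by (auto simp: sim_def)
  then obtain s3 where s3: "sexec w lt (ce 101 f) (s1, bl) = (s3, bl)" "regs s3 101 = ev z f"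
    "\<forall>x<101. regs s3 x = regs s1 x" "mem s3 = mem s1" "coins s3 = coins s1"
    "pc s3 = pc s1 + length (ce 101 f)"
    using ce_correct[of z f 101 s1 bl] assms by (auto simp: oke_def)
  have "reach P (length (cnd e f)) (s, bl) (s3, bl)"
    using s1 s3 assms(7) by (intro reach_straight) (auto simp: cnd_def straight_ce)
  thus ?thesis
    using s1 s3 assms(6) by (intro exI[of _ s3]) (auto simp: sim_def cnd_def)
qed

lemma straight_correct:
  assumes "list_all straight xs" "code_at P (pc s) xs" "length xs = n"
    and "sexec w lt xs (s, bl) = (s', bl')" "pc s' = pc s + n" "sim z' (s', bl')"
    and "k \<ge> 1"
  shows "\<exists>y. reach P (n * k) (s, bl) y \<and> sim z' y \<and> pc (fst y) = pc s + n"
  using assms reach_mono[OF reach_straight[OF assms(1), of P "(s, bl)"], of "(s', bl')" "n * k"]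
  by (intro exI[of _ "(s', bl')"]) auto

text \<open>Without loops each instruction of \<open>c\<close> runs at most once. A tick is one
  iteration of some loop inside \<open>c\<close> and causes at most one further pass over that loop,
  so it is charged \<open>clen c\<close> steps.\<close>

lemma bigstep_correct:
  "bigstep lt B c z z' \<Longrightarrow> bdd B z \<Longrightarrow> wfc B c \<Longrightarrow> sim z (s, bl) \<Longrightarrow> code_at P (pc s) (cc (pc s) c) \<Longrightarrow>
    bdd B z' \<and> tk z \<le> tk z' \<and>
    (\<exists>y. reach P (clen c * (1 + (tk z' - tk z))) (s, bl) y \<and> sim z' y \<and> pc (fst y) = pc s + clen c)"
proof (induction arbitrary: s bl rule: bigstep.induct)
  case (bs_Skip z)
  have "reach P 1 (s, bl) (s\<lparr>pc := Suc (pc s)\<rparr>, bl)"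
    using bs_Skip.prems by (intro reach_step) auto
  thus ?case using bs_Skip.prems by (auto simp: sim_def)
next
  case (bs_Assign z e x)
  obtain s1 where s1: "sexec w lt (ce 100 e) (s, bl) = (s1, bl)" "regs s1 100 = ev z e"
    "\<forall>x<100. regs s1 x = regs s x" "mem s1 = mem s" "coins s1 = coins s"
    "pc s1 = pc s + length (ce 100 e)"
    using ce_correct[of z e 100 s bl] bs_Assign by (auto simp: oke_def)
  have "\<exists>y. reach P (clen (x ::= e) * 1) (s, bl) y \<and> sim (z\<lparr>rg := (rg z)(x := ev z e)\<rparr>) y \<and>
      pc (fst y) = pc s + clen (x ::= e)"
  proof (rule straight_correct[where xs = "cc (pc s) (x ::= e)"])
    show "sexec w lt (cc (pc s) (x ::= e)) (s, bl) = (set_reg x (ev z e) s1, bl)"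
      using s1 by (simp add: set_reg_def)
  qed (use s1 bs_Assign in \<open>auto simp: straight_ce sim_def set_reg_def\<close>)
  thus ?case using bs_Assign by (auto simp: bdd_def)
next
  case (bs_Pow z y x)
  have lt: "2 ^ rg z y < (2::nat) ^ w" using bs_Pow.hyps B_less by (rule less_trans)
  have lt1: "(1::nat) < 2 ^ w" using B_less B8 by linarith
  have "\<exists>q. reach P (clen (Pow x y) * 1) (s, bl) q \<and> sim (z\<lparr>rg := (rg z)(x := 2 ^ rg z y)\<rparr>) q \<and>
      pc (fst q) = pc s + clen (Pow x y)"
  proof (rule straight_correct[where xs = "cc (pc s) (Pow x y)"])
    show "sexec w lt (cc (pc s) (Pow x y)) (s, bl) =
      (s\<lparr>pc := pc s + 2, regs := (regs s)(100 := 1, x := 2 ^ rg z y)\<rparr>, bl)"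
      using bs_Pow.prems lt lt1 by (simp add: set_reg_def sim_def)
  qed (use bs_Pow in \<open>auto simp: sim_def\<close>)
  thus ?case using bs_Pow by (auto simp: bdd_def)
next
  case (bs_Sto z c i e)
  obtain s1 where s1: "sexec w lt (ce 100 i) (s, bl) = (s1, bl)" "regs s1 100 = ev z i"
    "\<forall>x<100. regs s1 x = regs s x" "mem s1 = mem s" "coins s1 = coins s"
    "pc s1 = pc s + length (ce 100 i)"
    using ce_correct[of z i 100 s bl] bs_Sto by (auto simp: oke_def)
  have 8: "(8::nat) < 2 ^ w" using B8 B_less by simp
  have a: "ev z i * 8 + ev z c < 2 ^ w" "ev z i * 8 < 2 ^ w"
    using address_less[of z i "ev z c"] address_less[of z i 0] bs_Sto by (auto simp: oke_def)
  define s2 where "s2 = s1\<lparr>pc := pc s1 + 2, regs := (regs s1)(101 := 8, 100 := ev z i * 8)\<rparr>"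
  have e2: "sexec w lt [Set 101 8, Op Mul 100 100 101] (s1, bl) = (s2, bl)"
    using s1(2) 8 a(2) by (auto simp: set_reg_def s2_def fun_upd_twist)
  have "sim z (s2, bl)" using bs_Sto s1 by (auto simp: sim_def s2_def)
  then obtain s3 where s3: "sexec w lt (ce 101 c) (s2, bl) = (s3, bl)" "regs s3 101 = ev z c"
    "\<forall>x<101. regs s3 x = regs s2 x" "mem s3 = mem s2" "coins s3 = coins s2"
    "pc s3 = pc s2 + length (ce 101 c)"
    using ce_correct[of z c 101 s2 bl] bs_Sto by (auto simp: oke_def)
  define s4 where "s4 = s3\<lparr>pc := pc s3 + 1, regs := (regs s3)(100 := ev z i * 8 + ev z c)\<rparr>"
  have e4: "sexec w lt [Op Add 100 100 101] (s3, bl) = (s4, bl)"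
    using s3(2,3) a by (auto simp: set_reg_def s4_def s2_def)
  have "sim z (s4, bl)" using bs_Sto s1 s3 by (auto simp: sim_def s2_def s4_def)
  then obtain s5 where s5: "sexec w lt (ce 101 e) (s4, bl) = (s5, bl)" "regs s5 101 = ev z e"
    "\<forall>x<101. regs s5 x = regs s4 x" "mem s5 = mem s4" "coins s5 = coins s4"
    "pc s5 = pc s4 + length (ce 101 e)"
    using ce_correct[of z e 101 s4 bl] bs_Sto by (auto simp: oke_def)
  let ?z = "z\<lparr>mm := (mm z)(ev z c := (mm z (ev z c))(ev z i := ev z e))\<rparr>"
  let ?s = "s5\<lparr>pc := Suc (pc s5), mem := (mem s5)(ev z i * 8 + ev z c := ev z e)\<rparr>"
  have idx: "8 * j + d = ev z i * 8 + ev z c \<longleftrightarrow> j = ev z i \<and> d = ev z c" if "d < 8" for j d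
    using that bs_Sto(4) by presburger
  have "\<exists>y. reach P (clen (Sto c i e) * 1) (s, bl) y \<and> sim ?z y \<and> pc (fst y) = pc s + clen (Sto c i e)"
  proof (rule straight_correct[where xs = "cc (pc s) (Sto c i e)"])
    show "sexec w lt (cc (pc s) (Sto c i e)) (s, bl) = (?s, bl)"
      unfolding cc.simps sexec_simps(3) s1(1) e2 s3(1) e4 s5(1) using s5 by (simp add: s4_def)
    show "sim ?z (?s, bl)"
      using s5 s3 s1 bs_Sto by (auto simp: sim_def s4_def s2_def idx)
  qed (use s1 s3 s5 bs_Sto in \<open>auto simp: straight_ce s4_def s2_def\<close>)
  thus ?case using bs_Sto by (auto simp: bdd_def)
next
  case (bs_Cmp z a b c d x)
  obtain s1 where s1: "sexec w lt (ce 100 a) (s, bl) = (s1, bl)" "regs s1 100 = ev z a"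
    "\<forall>x<100. regs s1 x = regs s x" "mem s1 = mem s" "coins s1 = coins s"
    "pc s1 = pc s + length (ce 100 a)"
    using ce_correct[of z a 100 s bl] bs_Cmp by (auto simp: oke_def)
  have "sim z (s1, bl)" using bs_Cmp s1 by (auto simp: sim_def)
  then obtain s2 where s2: "sexec w lt (ce 101 b) (s1, bl) = (s2, bl)" "regs s2 101 = ev z b"
    "\<forall>x<101. regs s2 x = regs s1 x" "mem s2 = mem s1" "coins s2 = coins s1"
    "pc s2 = pc s1 + length (ce 101 b)"
    using ce_correct[of z b 101 s1 bl] bs_Cmp by (auto simp: oke_def)
  have "sim z (s2, bl)" using bs_Cmp s1 s2 by (auto simp: sim_def)
  then obtain s3 where s3: "sexec w lt (ce 102 c) (s2, bl) = (s3, bl)" "regs s3 102 = ev z c"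
    "\<forall>x<102. regs s3 x = regs s2 x" "mem s3 = mem s2" "coins s3 = coins s2"
    "pc s3 = pc s2 + length (ce 102 c)"
    using ce_correct[of z c 102 s2 bl] bs_Cmp by (auto simp: oke_def)
  have "sim z (s3, bl)" using bs_Cmp s1 s2 s3 by (auto simp: sim_def)
  then obtain s4 where s4: "sexec w lt (ce 103 d) (s3, bl) = (s4, bl)" "regs s4 103 = ev z d"
    "\<forall>x<103. regs s4 x = regs s3 x" "mem s4 = mem s3" "coins s4 = coins s3"
    "pc s4 = pc s3 + length (ce 103 d)"
    using ce_correct[of z d 103 s3 bl] bs_Cmp by (auto simp: oke_def)
  let ?v = "of_bool (lt (ev z a) (ev z b) (ev z c) (ev z d)) :: nat"
  have "\<exists>y. reach P (clen (Cmp x a b c d) * 1) (s, bl) y \<and> sim (z\<lparr>rg := (rg z)(x := ?v)\<rparr>) y \<and>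
      pc (fst y) = pc s + clen (Cmp x a b c d)"
  proof (rule straight_correct[where xs = "cc (pc s) (Cmp x a b c d)"])
    show "sexec w lt (cc (pc s) (Cmp x a b c d)) (s, bl) = (set_reg x ?v s4, bl)"
      unfolding cc.simps sexec_simps s1(1) s2(1) s3(1) s4(1) using s1 s2 s3 s4 by simp
  qed (use s1 s2 s3 s4 bs_Cmp in \<open>auto simp: straight_ce sim_def set_reg_def\<close>)
  thus ?case using bs_Cmp B8 by (auto simp: bdd_def)
next
  case (bs_Flip x z)
  have "reach P 1 (s, bl) (dexec w lt (Coin x) (s, bl))"
    using bs_Flip.prems by (intro reach_step) auto
  moreover have "sim (z\<lparr>rg := (rg z)(x := of_bool (bt z \<noteq> [] \<and> hd (bt z))), bt := tl (bt z),
      nf := Suc (nf z)\<rparr>) (dexec w lt (Coin x) (s, bl))"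
    using bs_Flip.prems by (simp add: sim_def set_reg_def)
  moreover have "bdd B (z\<lparr>rg := (rg z)(x := of_bool (bt z \<noteq> [] \<and> hd (bt z))), bt := tl (bt z),
      nf := Suc (nf z)\<rparr>)"
    using bs_Flip.prems B8 by (simp add: bdd_def)
  ultimately show ?case
    by (intro conjI exI[of _ "dexec w lt (Coin x) (s, bl)"]) (simp_all add: set_reg_def)
next
  case (bs_Seq a z z1 b z2)
  have "wfc B a" "wfc B b" "code_at P (pc s) (cc (pc s) a)" "code_at P (pc s + clen a) (cc (pc s + clen a) b)"
    using bs_Seq.prems by auto
  note w = this
  from bs_Seq.IH(1)[OF bs_Seq.prems(1) w(1) bs_Seq.prems(3) w(3)] obtain s1 bl1 where
    1: "bdd B z1" "tk z \<le> tk z1" "reach P (clen a * (1 + (tk z1 - tk z))) (s, bl) (s1, bl1)"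
    "sim z1 (s1, bl1)" "pc s1 = pc s + clen a"
    by auto
  from bs_Seq.IH(2)[OF 1(1) w(2) 1(4)] w(4) 1(5) obtain y where
    2: "bdd B z2" "tk z1 \<le> tk z2" "reach P (clen b * (1 + (tk z2 - tk z1))) (s1, bl1) y"
    "sim z2 y" "pc (fst y) = pc s1 + clen b"
    by auto
  have "clen a * (1 + (tk z1 - tk z)) + clen b * (1 + (tk z2 - tk z1)) \<le>
      clen a * (1 + (tk z2 - tk z)) + clen b * (1 + (tk z2 - tk z))"
    using 1(2) 2(2) by (intro add_mono mult_left_mono) auto
  also have "\<dots> = clen (a ;; b) * (1 + (tk z2 - tk z))" by (simp add: algebra_simps)
  finally show ?case
    using reach_mono[OF reach_trans[OF 1(3) 2(3)]] 1 2 by (intro conjI exI[of _ y]) auto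
next
  case (bs_If1 z e f a z' b)
  obtain s1 where s1: "reach P (length (cnd e f)) (s, bl) (s1, bl)" "regs s1 100 = ev z e"
    "regs s1 101 = ev z f" "sim z (s1, bl)" "pc s1 = pc s + length (cnd e f)"
    using cnd_correct[of z e f s bl P] bs_If1 by (auto simp: Let_def)
  let ?s2 = "s1\<lparr>pc := pc s1 + 2 + clen b\<rparr>"
  have r2: "reach P 1 (s1, bl) (?s2, bl)"
    using bs_If1 s1 by (intro reach_step) (auto simp: Let_def)
  from bs_If1.IH[OF bs_If1.prems(1), of ?s2 bl] bs_If1.prems s1 obtain y where
    2: "bdd B z'" "tk z \<le> tk z'" "reach P (clen a * (1 + (tk z' - tk z))) (?s2, bl) y"
    "sim z' y" "pc (fst y) = pc s1 + 2 + clen b + clen a"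
    by (auto simp: Let_def sim_def)
  have "length (cnd e f) + 1 + clen a * (1 + (tk z' - tk z)) \<le> clen (Cond e f a b) * (1 + (tk z' - tk z))"
    by (simp add: algebra_simps)
  thus ?case
    using reach_mono[OF reach_trans[OF reach_trans[OF s1(1) r2] 2(3)]] 2 s1
    by (intro conjI exI[of _ y]) auto
next
  case (bs_If2 z e f b z' a)
  obtain s1 where s1: "reach P (length (cnd e f)) (s, bl) (s1, bl)" "regs s1 100 = ev z e"
    "regs s1 101 = ev z f" "sim z (s1, bl)" "pc s1 = pc s + length (cnd e f)"
    using cnd_correct[of z e f s bl P] bs_If2 by (auto simp: Let_def)
  let ?s2 = "s1\<lparr>pc := Suc (pc s1)\<rparr>"
  have r2: "reach P 1 (s1, bl) (?s2, bl)"
    using bs_If2 s1 by (intro reach_step) (auto simp: Let_def)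
  from bs_If2.IH[OF bs_If2.prems(1), of ?s2 bl] bs_If2.prems s1 obtain s3 bl3 where
    2: "bdd B z'" "tk z \<le> tk z'" "reach P (clen b * (1 + (tk z' - tk z))) (?s2, bl) (s3, bl3)"
    "sim z' (s3, bl3)" "pc s3 = Suc (pc s1) + clen b"
    by (auto simp: Let_def sim_def)
  let ?s4 = "s3\<lparr>pc := pc s + clen (Cond e f a b)\<rparr>"
  have r3: "reach P 1 (s3, bl3) (?s4, bl3)"
    using bs_If2 s1 2 by (intro reach_step) (auto simp: Let_def)
  have "sim z' (?s4, bl3)" using 2 by (simp add: sim_def)
  moreover have "length (cnd e f) + 1 + clen b * (1 + (tk z' - tk z)) + 1 \<le>
      clen (Cond e f a b) * (1 + (tk z' - tk z))"
    by (simp add: algebra_simps)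
  ultimately show ?case
    using reach_mono[OF reach_trans[OF reach_trans[OF reach_trans[OF s1(1) r2] 2(3)] r3]] 2(1,2) s1
    by (intro conjI exI[of _ "(?s4, bl3)"]) auto
next
  case (bs_While1 z e f a z1 z2)
  obtain s1 where s1: "reach P (length (cnd e f)) (s, bl) (s1, bl)" "regs s1 100 = ev z e"
    "regs s1 101 = ev z f" "sim z (s1, bl)" "pc s1 = pc s + length (cnd e f)"
    using cnd_correct[of z e f s bl P] bs_While1 by (auto simp: Let_def)
  let ?s2 = "s1\<lparr>pc := pc s1 + 2\<rparr>"
  have r2: "reach P 1 (s1, bl) (?s2, bl)"
    using bs_While1 s1 by (intro reach_step) (auto simp: Let_def)
  from bs_While1.IH(1)[OF bs_While1.prems(1), of ?s2 bl] bs_While1.prems s1 obtain s3 bl3 where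
    2: "bdd B z1" "tk z \<le> tk z1" "reach P (clen a * (1 + (tk z1 - tk z))) (?s2, bl) (s3, bl3)"
    "sim z1 (s3, bl3)" "pc s3 = pc s1 + 2 + clen a"
    by (auto simp: Let_def sim_def)
  let ?s4 = "s3\<lparr>pc := pc s\<rparr>"
  let ?z1 = "z1\<lparr>tk := Suc (tk z1)\<rparr>"
  have r3: "reach P 1 (s3, bl3) (?s4, bl3)"
    using bs_While1 s1 2 by (intro reach_step) (auto simp: Let_def)
  from bs_While1.IH(2)[of ?s4 bl3] bs_While1.prems 2 obtain y where
    3: "bdd B z2" "Suc (tk z1) \<le> tk z2"
    "reach P (clen (While e f a) * (1 + (tk z2 - Suc (tk z1)))) (?s4, bl3) y"
    "sim z2 y" "pc (fst y) = pc s + clen (While e f a)"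
    by (auto simp: Let_def sim_def bdd_def)
  let ?L = "clen (While e f a)"
  obtain d1 where d1: "tk z1 = tk z + d1" using 2(2) le_Suc_ex by blast
  obtain d2 where d2: "tk z2 = Suc (tk z1) + d2" using 3(2) le_Suc_ex by blast
  \<comment> \<open>The tick of this iteration pays for one pass over condition, body and jumps; the
    \<open>d1\<close> ticks of inner loops are charged at the larger rate \<open>?L\<close>.\<close>
  have "clen a * d1 \<le> ?L * d1" by simp
  hence "length (cnd e f) + 1 + clen a * (1 + (tk z1 - tk z)) + 1 + ?L * (1 + (tk z2 - Suc (tk z1))) \<le>
      ?L * (1 + (tk z2 - tk z))"
    unfolding d1 d2 by (simp add: algebra_simps)
  thus ?case
    using reach_mono[OF reach_trans[OF reach_trans[OF reach_trans[OF reach_trans[OF s1(1) r2] 2(3)] r3] 3(3)]]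
      2(2) 3 by (intro conjI exI[of _ y]) auto
next
  case (bs_While2 z e f a)
  obtain s1 where s1: "reach P (length (cnd e f)) (s, bl) (s1, bl)" "regs s1 100 = ev z e"
    "regs s1 101 = ev z f" "sim z (s1, bl)" "pc s1 = pc s + length (cnd e f)"
    using cnd_correct[of z e f s bl P] bs_While2 by (auto simp: Let_def)
  let ?s2 = "s1\<lparr>pc := Suc (pc s1)\<rparr>"
  let ?s3 = "s1\<lparr>pc := pc s + clen (While e f a)\<rparr>"
  have r2: "reach P 1 (s1, bl) (?s2, bl)"
    using bs_While2 s1 by (intro reach_step) (auto simp: Let_def)
  have r3: "reach P 1 (?s2, bl) (?s3, bl)"
    using bs_While2 s1 by (intro reach_step) (auto simp: Let_def)
  have "sim z (?s3, bl)" using s1 by (simp add: sim_def)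
  moreover have "length (cnd e f) + 1 + 1 \<le> clen (While e f a)" by simp
  ultimately show ?case
    using reach_mono[OF reach_trans[OF reach_trans[OF s1(1) r2] r3]] bs_While2.prems
    by (intro conjI exI[of _ "(?s3, bl)"]) auto
qed

end

section \<open>Weakest preconditions for total correctness, framing and counting loops\<close>

definition wp :: "comparator \<Rightarrow> nat \<Rightarrow> com \<Rightarrow> (st \<Rightarrow> bool) \<Rightarrow> st \<Rightarrow> bool" where
  "wp lt B c Q s \<longleftrightarrow> (\<exists>s'. bigstep lt B c s s' \<and> Q s')"

inductive_cases bs_SkipE: "bigstep lt B Skip s s'"
inductive_cases bs_AssignE: "bigstep lt B (x ::= e) s s'"
inductive_cases bs_PowE: "bigstep lt B (Pow x y) s s'"
inductive_cases bs_StoE: "bigstep lt B (Sto c i e) s s'"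
inductive_cases bs_CmpE: "bigstep lt B (Cmp x a b c d) s s'"
inductive_cases bs_FlipE: "bigstep lt B (Flip x) s s'"
inductive_cases bs_SeqE: "bigstep lt B (a ;; b) s s'"
inductive_cases bs_CondE: "bigstep lt B (Cond e f a b) s s'"

lemma wp_Skip [simp]: "wp lt B Skip Q s = Q s"
  by (auto simp: wp_def elim!: bs_SkipE intro: bs_Skip)

lemma wp_Assign [simp]:
  "wp lt B (x ::= e) Q s \<longleftrightarrow> gd s e \<and> ev s e < B \<and> Q (s\<lparr>rg := (rg s)(x := ev s e)\<rparr>)"
  by (auto simp: wp_def elim!: bs_AssignE intro: bs_Assign)

lemma wp_Pow [simp]:
  "wp lt B (Pow x y) Q s \<longleftrightarrow> 2 ^ rg s y < B \<and> Q (s\<lparr>rg := (rg s)(x := 2 ^ rg s y)\<rparr>)"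
  by (auto simp: wp_def elim!: bs_PowE intro: bs_Pow)

lemma wp_Sto [simp]:
  "wp lt B (Sto c i e) Q s \<longleftrightarrow> gd s c \<and> gd s i \<and> gd s e \<and> ev s c < 8 \<and> ev s e < B \<and>
    Q (s\<lparr>mm := (mm s)(ev s c := (mm s (ev s c))(ev s i := ev s e))\<rparr>)"
  by (auto simp: wp_def elim!: bs_StoE intro: bs_Sto)

lemma wp_Cmp [simp]:
  "wp lt B (Cmp x a b c d) Q s \<longleftrightarrow> gd s a \<and> gd s b \<and> gd s c \<and> gd s d \<and>
    Q (s\<lparr>rg := (rg s)(x := of_bool (lt (ev s a) (ev s b) (ev s c) (ev s d)))\<rparr>)"
  by (auto simp: wp_def elim!: bs_CmpE intro: bs_Cmp)

lemma wp_Flip [simp]: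
  "wp lt B (Flip x) Q s \<longleftrightarrow>
    Q (s\<lparr>rg := (rg s)(x := of_bool (bt s \<noteq> [] \<and> hd (bt s))), bt := tl (bt s), nf := Suc (nf s)\<rparr>)"
  unfolding wp_def by (metis bs_Flip bs_FlipE)

lemma wp_Seq [simp]: "wp lt B (a ;; b) Q s \<longleftrightarrow> wp lt B a (wp lt B b Q) s"
  unfolding wp_def by (meson bs_Seq bs_SeqE)

lemma wp_Cond [simp]:
  "wp lt B (Cond e f a b) Q s \<longleftrightarrow> gd s e \<and> gd s f \<and>
    (ev s e < ev s f \<longrightarrow> wp lt B a Q s) \<and> (\<not> ev s e < ev s f \<longrightarrow> wp lt B b Q s)"
  unfolding wp_def by (meson bs_If1 bs_If2 bs_CondE)

lemma wp_mono: "wp lt B c P s \<Longrightarrow> (\<And>s'. P s' \<Longrightarrow> Q s') \<Longrightarrow> wp lt B c Q s"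
  by (auto simp: wp_def)

lemma wp_While_step:
  assumes "gd s e" "gd s f" "ev s e < ev s f"
    and "wp lt B a (\<lambda>s'. wp lt B (While e f a) Q (s'\<lparr>tk := Suc (tk s')\<rparr>)) s"
  shows "wp lt B (While e f a) Q s"
  using assms unfolding wp_def by (blast intro: bs_While1)

lemma wp_While_end:
  assumes "gd s e" "gd s f" "\<not> ev s e < ev s f" "Q s"
  shows "wp lt B (While e f a) Q s"
  using assms unfolding wp_def by (blast intro: bs_While2)

primrec writes :: "com \<Rightarrow> nat set" where
  "writes Skip = {}"
| "writes (x ::= e) = {x}"
| "writes (Pow x y) = {x}"
| "writes (Sto c i e) = {}"
| "writes (Cmp x a b c d) = {x}"
| "writes (Flip x) = {x}"
| "writes (a ;; b) = writes a \<union> writes b"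
| "writes (Cond e f a b) = writes a \<union> writes b"
| "writes (While e f a) = writes a"

primrec nosto :: "com \<Rightarrow> bool" where
  "nosto Skip = True"
| "nosto (x ::= e) = True"
| "nosto (Pow x y) = True"
| "nosto (Sto c i e) = False"
| "nosto (Cmp x a b c d) = True"
| "nosto (Flip x) = True"
| "nosto (a ;; b) = (nosto a \<and> nosto b)"
| "nosto (Cond e f a b) = (nosto a \<and> nosto b)"
| "nosto (While e f a) = nosto a"

primrec noflip :: "com \<Rightarrow> bool" where
  "noflip Skip = True"
| "noflip (x ::= e) = True"
| "noflip (Pow x y) = True"
| "noflip (Sto c i e) = True"
| "noflip (Cmp x a b c d) = True"
| "noflip (Flip x) = False"
| "noflip (a ;; b) = (noflip a \<and> noflip b)"
| "noflip (Cond e f a b) = (noflip a \<and> noflip b)"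
| "noflip (While e f a) = noflip a"

text \<open>Effects that can be read off the syntax. They spare the loop invariants a list of all
  the registers and arrays that a body leaves alone.\<close>

definition frame :: "com \<Rightarrow> st \<Rightarrow> st \<Rightarrow> bool" where
  "frame c s s' \<longleftrightarrow> (\<forall>r. r \<notin> writes c \<longrightarrow> rg s' r = rg s r) \<and> (nosto c \<longrightarrow> mm s' = mm s) \<and>
    (noflip c \<longrightarrow> bt s' = bt s \<and> nf s' = nf s)"

lemma bigstep_frame: "bigstep lt B c s s' \<Longrightarrow> frame c s s'"
  by (induction rule: bigstep.induct) (auto simp: frame_def)

lemma wp_frame:
  assumes "wp lt B c P s" "\<And>s'. P s' \<Longrightarrow> frame c s s' \<Longrightarrow> Q s'"
  shows "wp lt B c Q s"
  using assms bigstep_frame by (auto simp: wp_def)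

definition For :: "nat \<Rightarrow> exp \<Rightarrow> com \<Rightarrow> com" where
  "For x e c = (x ::= Nm 0 ;; While (Vr x) e (c ;; x ::= Plus (Vr x) (Nm 1)))"

lemma For_props [simp]:
  "writes (For x e c) = insert x (writes c)"
  "nosto (For x e c) = nosto c" "noflip (For x e c) = noflip c"
  "wfc B (For x e c) \<longleftrightarrow> x < 100 \<and> oke B (Nm 0) \<and> oke B e \<and> wfc B c \<and> oke B (Nm 1)"
  by (auto simp: For_def oke_def)

text \<open>The premise \<open>step\<close> folds the increment of the counter and the tick into
  \<open>J (Suc i)\<close>. Every later premise may use \<open>frame\<close> with respect to the
  state before the loop, so \<open>J\<close> has to mention only what the body changes.\<close>

lemma wp_For:
  assumes x: "x \<notin> writes c" and mB: "m < B"
    and init: "J 0 (s\<lparr>rg := (rg s)(x := 0)\<rparr>)"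
    and bound: "\<And>i s'. i \<le> m \<Longrightarrow> J i s' \<Longrightarrow> frame (For x e c) s s' \<Longrightarrow> rg s' x = i \<Longrightarrow> gd s' e \<and> ev s' e = m"
    and step: "\<And>i s'. i < m \<Longrightarrow> J i s' \<Longrightarrow> frame (For x e c) s s' \<Longrightarrow> rg s' x = i \<Longrightarrow>
      wp lt B c (\<lambda>s''. J (Suc i) (s''\<lparr>rg := (rg s'')(x := Suc i), tk := Suc (tk s'')\<rparr>)) s'"
    and fin: "\<And>s'. J m s' \<Longrightarrow> frame (For x e c) s s' \<Longrightarrow> rg s' x = m \<Longrightarrow> Q s'"
  shows "wp lt B (For x e c) Q s"
proof -
  let ?W = "While (Vr x) e (c ;; x ::= Plus (Vr x) (Nm 1))"
  have "wp lt B ?W Q s'" if "J i s'" "frame (For x e c) s s'" "rg s' x = i" "i \<le> m" for i s'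
    using that
  proof (induction "m - i" arbitrary: i s')
    case 0
    hence "i = m" by simp
    thus ?case using 0 bound[of m s'] by (intro wp_While_end fin) auto
  next
    case (Suc d)
    hence i: "i < m" by simp
    show ?case
    proof (rule wp_While_step)
      show "gd s' (Vr x)" "gd s' e" "ev s' (Vr x) < ev s' e"
        using bound[of i s'] Suc i by auto
      have "wp lt B c (\<lambda>s''. J (Suc i) (s''\<lparr>rg := (rg s'')(x := Suc i), tk := Suc (tk s'')\<rparr>) \<and>
          frame (For x e c) s s'' \<and> rg s'' x = i) s'"
        by (rule wp_frame[OF step[OF i Suc.prems(1,2,3)]])
          (use Suc.prems x in \<open>auto simp: frame_def\<close>)
      thus "wp lt B (c ;; x ::= Plus (Vr x) (Nm 1)) (\<lambda>s'. wp lt B ?W Q (s'\<lparr>tk := Suc (tk s')\<rparr>)) s'"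
        unfolding wp_Seq
      proof (rule wp_mono)
        fix s'' assume a: "J (Suc i) (s''\<lparr>rg := (rg s'')(x := Suc i), tk := Suc (tk s'')\<rparr>) \<and>
          frame (For x e c) s s'' \<and> rg s'' x = i"
        have "wp lt B ?W Q (s''\<lparr>rg := (rg s'')(x := Suc i), tk := Suc (tk s'')\<rparr>)"
          using a Suc.hyps i by (intro Suc.hyps(1)[of "Suc i"]) (auto simp: frame_def)
        thus "wp lt B (x ::= Plus (Vr x) (Nm 1)) (\<lambda>s'. wp lt B ?W Q (s'\<lparr>tk := Suc (tk s')\<rparr>)) s''"
          using a i mB by simp
      qed
    qed
  qed
  from this[of 0 "s\<lparr>rg := (rg s)(x := 0)\<rparr>"] show ?thesis
    using init mB by (auto simp: For_def frame_def)
qed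

section \<open>Multiply-shift hashing and pairwise independence\<close>

definition U :: "nat \<Rightarrow> nat pmf" where
  "U k = pmf_of_set {..<2 ^ k}"

lemma pow2_set: "finite {..<(2::nat) ^ k}" "{..<(2::nat) ^ k} \<noteq> {}"
  by (auto simp: lessThan_empty_iff)

lemma set_U [simp]: "set_pmf (U k) = {..<2 ^ k}"
  using pow2_set by (simp add: U_def)

lemma U_map_bij: "bij_betw f {..<2 ^ k} {..<2 ^ k} \<Longrightarrow> map_pmf f (U k) = U k"
  unfolding U_def using pow2_set by (intro map_pmf_of_set_bij_betw) auto

lemma U_map_inj:
  assumes "inj_on f {..<2 ^ k}" "f ` {..<2 ^ k} \<subseteq> {..<2 ^ k}"
  shows "map_pmf f (U k) = U k"
  using assms by (intro U_map_bij) (simp add: bij_betw_def endo_inj_surj)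

lemma U_shift: "map_pmf (\<lambda>b. (c + b) mod 2 ^ L) (U L) = U L"
proof (rule U_map_inj)
  show "inj_on (\<lambda>b. (c + b) mod 2 ^ L) {..<2 ^ L}"
  proof (rule inj_onI)
    fix x y assume *: "x \<in> {..<2 ^ L}" "y \<in> {..<2 ^ L}" "(c + x) mod 2 ^ L = (c + y) mod 2 ^ L"
    hence "x mod 2 ^ L = y mod 2 ^ L"
      by (metis cong_add_lcancel_nat cong_def)
    thus "x = y" using * by simp
  qed
qed auto

lemma U_odd_mult:
  assumes "odd (c::nat)"
  shows "map_pmf (\<lambda>a. (a * c) mod 2 ^ L) (U L) = U L"
proof (rule U_map_inj)
  have "coprime c (2 ^ L)" using assms by simp
  show "inj_on (\<lambda>a. (a * c) mod 2 ^ L) {..<2 ^ L}"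
  proof (rule inj_onI)
    fix x y assume *: "x \<in> {..<2 ^ L}" "y \<in> {..<2 ^ L}" "(x * c) mod 2 ^ L = (y * c) mod 2 ^ L"
    hence "x mod 2 ^ L = y mod 2 ^ L"
      using \<open>coprime c (2 ^ L)\<close> by (metis cong_def cong_mult_rcancel_nat)
    thus "x = y" using * by simp
  qed
qed auto

lemma pair_pmf_of_set:
  assumes "finite A" "A \<noteq> {}" "finite B" "B \<noteq> {}"
  shows "pair_pmf (pmf_of_set A) (pmf_of_set B) = pmf_of_set (A \<times> B)"
proof (rule pmf_eqI)
  fix x :: "'a \<times> 'b"
  show "pmf (pair_pmf (pmf_of_set A) (pmf_of_set B)) x = pmf (pmf_of_set (A \<times> B)) x"
    using assms by (cases x) (auto simp: pmf_pair indicator_def card_cartesian_product)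
qed

lemma U_split: "map_pmf (\<lambda>(h, l). h * 2 ^ j + l) (pair_pmf (U i) (U j)) = U (i + j)"
proof -
  have "bij_betw (\<lambda>(h, l). h * 2 ^ j + l) ({..<2 ^ i} \<times> {..<2 ^ j}) {..<(2::nat) ^ (i + j)}"
  proof (rule bij_betwI[where g = "\<lambda>x. (x div 2 ^ j, x mod 2 ^ j)"])
    show "(\<lambda>(h, l). h * 2 ^ j + l) \<in> {..<2 ^ i} \<times> {..<2 ^ j} \<rightarrow> {..<(2::nat) ^ (i + j)}"
    proof (clarsimp)
      fix h l :: nat assume "h < 2 ^ i" "l < 2 ^ j"
      hence "h * 2 ^ j + l < (h + 1) * 2 ^ j" by simp
      also have "\<dots> \<le> 2 ^ i * 2 ^ j" using \<open>h < 2 ^ i\<close> by (intro mult_right_mono) auto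
      finally show "h * 2 ^ j + l < 2 ^ (i + j)" by (simp add: power_add)
    qed
    show "(\<lambda>x. (x div 2 ^ j, x mod 2 ^ j)) \<in> {..<(2::nat) ^ (i + j)} \<rightarrow> {..<2 ^ i} \<times> {..<2 ^ j}"
      by (auto simp: power_add less_mult_imp_div_less)
  qed (auto simp: div_mult_mod_eq)
  thus ?thesis
    unfolding U_def using pow2_set by (subst pair_pmf_of_set) (auto intro!: map_pmf_of_set_bij_betw)
qed

lemma U_div: assumes "m \<le> L" shows "map_pmf (\<lambda>x. x div 2 ^ m) (U L) = U (L - m)"
proof -
  have "map_pmf (\<lambda>x. x div 2 ^ m) (U L) =
      map_pmf (\<lambda>x. x div 2 ^ m) (map_pmf (\<lambda>(h, l). h * 2 ^ m + l) (pair_pmf (U (L - m)) (U m)))"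
    using assms by (simp add: U_split)
  also have "\<dots> = map_pmf fst (pair_pmf (U (L - m)) (U m))"
    unfolding pmf.map_comp by (intro map_pmf_cong) auto
  finally show ?thesis by (simp add: map_fst_pair_pmf)
qed

lemma U_mod: assumes "m \<le> L" shows "map_pmf (\<lambda>x. x mod 2 ^ m) (U L) = U m"
proof -
  have "map_pmf (\<lambda>x. x mod 2 ^ m) (U L) =
      map_pmf (\<lambda>x. x mod 2 ^ m) (map_pmf (\<lambda>(h, l). h * 2 ^ m + l) (pair_pmf (U (L - m)) (U m)))"
    using assms by (simp add: U_split)
  also have "\<dots> = map_pmf snd (pair_pmf (U (L - m)) (U m))"
    unfolding pmf.map_comp by (intro map_pmf_cong) auto
  finally show ?thesis by (simp add: map_snd_pair_pmf)
qed

definition ms :: "nat \<Rightarrow> nat \<Rightarrow> nat \<Rightarrow> nat \<Rightarrow> nat \<Rightarrow> nat" where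
  "ms m L a b k = ((a * k + b) mod 2 ^ L) div 2 ^ m"

text \<open>Write \<open>d = 2 ^ t * c\<close> with \<open>c\<close> odd. The low \<open>t\<close>
  bits of \<open>a * d + z\<close> are those of \<open>z\<close>; the bits above them are uniform
  because multiplication by \<open>c\<close> permutes the residues. As \<open>d < 2 ^ m\<close>
  forces \<open>t < m\<close>, the final shift removes all the fixed bits.\<close>

lemma U_affine:
  assumes "0 < d" "d < 2 ^ m" "m \<le> L"
  shows "map_pmf (\<lambda>a. ((a * d + z) mod 2 ^ L) div 2 ^ m) (U L) = U (L - m)"
proof -
  obtain t c where dc: "d = 2 ^ t * c" "odd c"
    using assms(1) by (metis multiplicity_decompose' not_gr_zero two_is_prime_nat not_prime_unit)
  have "(2::nat) ^ t \<le> d" using dc assms(1) by (cases c) auto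
  hence "(2::nat) ^ t < 2 ^ m" using assms(2) by (rule le_less_trans)
  hence t: "t < m" by simp
  have eq: "((a * d + z) mod 2 ^ L) div 2 ^ m =
      ((((z div 2 ^ t) + (a * c) mod 2 ^ L) mod 2 ^ L) mod 2 ^ (L - t)) div 2 ^ (m - t)" for a
  proof -
    have L: "(2::nat) ^ L = 2 ^ t * 2 ^ (L - t)" and m: "(2::nat) ^ m = 2 ^ t * 2 ^ (m - t)"
      using t assms by (simp_all flip: power_add)
    have "((a * d + z) mod 2 ^ L) div 2 ^ m = (((a * c * 2 ^ t + z) mod 2 ^ L) div 2 ^ t) div 2 ^ (m - t)"
      unfolding m by (simp add: dc div_mult2_eq mult_ac)
    also have "((a * c * 2 ^ t + z) mod 2 ^ L) div 2 ^ t = ((a * c * 2 ^ t + z) div 2 ^ t) mod 2 ^ (L - t)"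
      unfolding L by (simp add: mod_mult2_eq)
    also have "(a * c * 2 ^ t + z) div 2 ^ t = z div 2 ^ t + a * c"
      by simp
    also have "(z div 2 ^ t + a * c) mod 2 ^ (L - t) =
        (((z div 2 ^ t) + (a * c) mod 2 ^ L) mod 2 ^ L) mod 2 ^ (L - t)"
    proof -
      have "(2::nat) ^ (L - t) dvd 2 ^ L" by (simp add: le_imp_power_dvd)
      thus ?thesis by (simp add: mod_mod_cancel mod_add_right_eq)
    qed
    finally show ?thesis .
  qed
  have "map_pmf (\<lambda>a. ((a * d + z) mod 2 ^ L) div 2 ^ m) (U L) =
      map_pmf (\<lambda>x. x div 2 ^ (m - t)) (map_pmf (\<lambda>x. x mod 2 ^ (L - t))
        (map_pmf (\<lambda>b. (z div 2 ^ t + b) mod 2 ^ L) (map_pmf (\<lambda>a. (a * c) mod 2 ^ L) (U L))))"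
    unfolding eq pmf.map_comp by (simp add: o_def)
  also have "\<dots> = U (L - m)"
    using t assms dc(2) by (simp add: U_odd_mult U_shift U_mod U_div)
  finally show ?thesis .
qed

text \<open>Put \<open>z = (a * k + b) mod 2 ^ L\<close>. The first hash value depends on
  \<open>z\<close> only, and the second is affine in \<open>a\<close> with slope
  \<open>k' - k\<close> and offset \<open>z\<close>. For each \<open>a\<close> the value
  \<open>z\<close> is uniform, so \<open>z\<close> may be drawn first and \<open>a\<close>
  afterwards; then \<open>U_affine\<close> applies for every fixed \<open>z\<close>.\<close>

lemma ms_pair_less:
  assumes "k < k'" "k' < 2 ^ m" "m \<le> L"
  shows "map_pmf (\<lambda>(a, b). (ms m L a b k, ms m L a b k')) (pair_pmf (U L) (U L)) =
    pair_pmf (U (L - m)) (U (L - m))"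
proof -
  define d where "d = k' - k"
  have d: "0 < d" "d < 2 ^ m" "k' = k + d" using assms by (auto simp: d_def)
  let ?f = "\<lambda>a z. ((a * d + z) mod 2 ^ L) div 2 ^ m"
  have eq: "ms m L a b k' = ?f a ((a * k + b) mod 2 ^ L)" for a b
  proof -
    have "(a * d + (a * k + b) mod 2 ^ L) mod 2 ^ L = (a * d + (a * k + b)) mod 2 ^ L"
      by (rule mod_add_right_eq)
    thus ?thesis by (simp add: ms_def d(3) algebra_simps)
  qed
  have "map_pmf (\<lambda>(a, b). (ms m L a b k, ms m L a b k')) (pair_pmf (U L) (U L)) =
      bind_pmf (U L) (\<lambda>a. map_pmf (\<lambda>b. (((a * k + b) mod 2 ^ L) div 2 ^ m, ?f a ((a * k + b) mod 2 ^ L))) (U L))"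
    by (simp add: pair_pmf_def map_pmf_def bind_assoc_pmf bind_return_pmf eq) (simp add: ms_def)
  also have "\<dots> = bind_pmf (U L) (\<lambda>a. map_pmf (\<lambda>z. (z div 2 ^ m, ?f a z))
      (map_pmf (\<lambda>b. (a * k + b) mod 2 ^ L) (U L)))"
    by (simp add: pmf.map_comp o_def)
  also have "\<dots> = bind_pmf (U L) (\<lambda>a. bind_pmf (U L) (\<lambda>z. return_pmf (z div 2 ^ m, ?f a z)))"
    by (simp add: U_shift) (simp add: map_pmf_def)
  also have "\<dots> = bind_pmf (U L) (\<lambda>z. bind_pmf (U L) (\<lambda>a. return_pmf (z div 2 ^ m, ?f a z)))"
    by (rule bind_commute_pmf)
  also have "\<dots> = bind_pmf (U L) (\<lambda>z. map_pmf (\<lambda>x. (z div 2 ^ m, x)) (map_pmf (\<lambda>a. ?f a z) (U L)))"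
    by (simp add: pmf.map_comp map_pmf_def bind_assoc_pmf bind_return_pmf)
  also have "\<dots> = bind_pmf (U L) (\<lambda>z. map_pmf (\<lambda>x. (z div 2 ^ m, x)) (U (L - m)))"
    using d assms by (simp add: U_affine)
  also have "\<dots> = bind_pmf (map_pmf (\<lambda>z. z div 2 ^ m) (U L)) (\<lambda>y. map_pmf (\<lambda>x. (y, x)) (U (L - m)))"
    by (simp add: bind_map_pmf)
  also have "\<dots> = pair_pmf (U (L - m)) (U (L - m))"
    using assms by (simp add: U_div) (simp add: pair_pmf_def map_pmf_def)
  finally show ?thesis .
qed

section \<open>Pairwise independent, identically distributed families\<close>

definition PWU :: "'a pmf \<Rightarrow> (nat \<Rightarrow> 'a \<Rightarrow> 'b) \<Rightarrow> nat \<Rightarrow> 'b pmf \<Rightarrow> bool" where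
  "PWU p f K D \<longleftrightarrow> (\<forall>k<K. map_pmf (f k) p = D) \<and>
    (\<forall>k<K. \<forall>k'<K. k \<noteq> k' \<longrightarrow> map_pmf (\<lambda>x. (f k x, f k' x)) p = pair_pmf D D)"

lemma ms_single:
  assumes "m \<le> L"
  shows "map_pmf (\<lambda>(a, b). ms m L a b k) (pair_pmf (U L) (U L)) = U (L - m)"
proof -
  have "map_pmf (\<lambda>(a, b). ms m L a b k) (pair_pmf (U L) (U L)) =
      bind_pmf (U L) (\<lambda>a. map_pmf (\<lambda>z. z div 2 ^ m) (map_pmf (\<lambda>b. (a * k + b) mod 2 ^ L) (U L)))"
    by (simp add: pair_pmf_def map_pmf_def bind_assoc_pmf bind_return_pmf ms_def)
  also have "\<dots> = U (L - m)" using assms by (simp add: U_shift U_div)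
  finally show ?thesis .
qed

lemma PWU_ms: "m \<le> L \<Longrightarrow> PWU (pair_pmf (U L) (U L)) (\<lambda>k (a, b). ms m L a b k) (2 ^ m) (U (L - m))"
  unfolding PWU_def
proof (intro conjI allI impI)
  fix k k' :: nat assume *: "m \<le> L" "k < 2 ^ m" "k' < 2 ^ m" "k \<noteq> k'"
  let ?g = "\<lambda>k k' (a, b). (ms m L a b k, ms m L a b k')"
  have "map_pmf (?g k k') (pair_pmf (U L) (U L)) = pair_pmf (U (L - m)) (U (L - m))"
  proof (cases "k < k'")
    case True thus ?thesis using * by (intro ms_pair_less)
  next
    case False
    hence "map_pmf (?g k' k) (pair_pmf (U L) (U L)) = pair_pmf (U (L - m)) (U (L - m))"
      using * by (intro ms_pair_less) auto
    hence "map_pmf prod.swap (map_pmf (?g k' k) (pair_pmf (U L) (U L))) =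
        map_pmf prod.swap (pair_pmf (U (L - m)) (U (L - m)))" by simp
    also have "\<dots> = pair_pmf (U (L - m)) (U (L - m))"
      by (subst (2) pair_commute_pmf) (simp add: case_prod_beta' prod.swap_def[abs_def])
    finally show ?thesis by (simp add: pmf.map_comp o_def case_prod_beta' prod.swap_def[abs_def])
  qed
  thus "map_pmf (\<lambda>x. (case x of (a, b) \<Rightarrow> ms m L a b k, case x of (a, b) \<Rightarrow> ms m L a b k'))
      (pair_pmf (U L) (U L)) = pair_pmf (U (L - m)) (U (L - m))"
    by (simp add: case_prod_beta')
qed (auto simp: ms_single)

lemma map_pair_prod:
  "map_pmf (\<lambda>(x, y). (f x, g y)) (pair_pmf p q) = pair_pmf (map_pmf f p) (map_pmf g q)"
  by (simp add: pair_pmf_def map_pmf_def bind_assoc_pmf bind_return_pmf)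

lemma PWU_pair:
  assumes "PWU p f K D" "PWU q h K E"
  shows "PWU (pair_pmf p q) (\<lambda>k (x, y). (f k x, h k y)) K (pair_pmf D E)"
  unfolding PWU_def
proof (intro conjI allI impI)
  fix k k' assume *: "k < K" "k' < K" "k \<noteq> k'"
  have "map_pmf (\<lambda>x. (case x of (x, y) \<Rightarrow> (f k x, h k y), case x of (x, y) \<Rightarrow> (f k' x, h k' y))) (pair_pmf p q) =
      map_pmf (\<lambda>((a, b), (c, d)). ((a, c), (b, d)))
        (map_pmf (\<lambda>(x, y). ((f k x, f k' x), (h k y, h k' y))) (pair_pmf p q))"
    by (simp add: pmf.map_comp o_def case_prod_beta')
  also have "\<dots> = map_pmf (\<lambda>((a, b), (c, d)). ((a, c), (b, d))) (pair_pmf (pair_pmf D D) (pair_pmf E E))"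
    unfolding map_pair_prod using assms * by (simp add: PWU_def)
  also have "\<dots> = pair_pmf (pair_pmf D E) (pair_pmf D E)"
    by (simp add: pair_pmf_def map_pmf_def bind_assoc_pmf bind_return_pmf)
      (subst bind_commute_pmf, simp)
  finally show "map_pmf (\<lambda>x. (case x of (x, y) \<Rightarrow> (f k x, h k y), case x of (x, y) \<Rightarrow> (f k' x, h k' y))) (pair_pmf p q) =
      pair_pmf (pair_pmf D E) (pair_pmf D E)" .
qed (use assms in \<open>auto simp: PWU_def map_pair_prod\<close>)

section \<open>Tail bounds from second moments, and sampling\<close>

abbreviation (input) prb :: "'a pmf \<Rightarrow> 'a set \<Rightarrow> real" where
  "prb p A \<equiv> measure_pmf.prob p A"

abbreviation (input) ex :: "'a pmf \<Rightarrow> ('a \<Rightarrow> real) \<Rightarrow> real" where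
  "ex p f \<equiv> measure_pmf.expectation p f"

lemma ex_bind:
  assumes "finite (set_pmf p)" "\<And>x. x \<in> set_pmf p \<Longrightarrow> finite (set_pmf (f x))"
  shows "ex (bind_pmf p f) h = ex p (\<lambda>x. ex (f x) h)"
  using assms by (subst pmf_expectation_bind[of "set_pmf p"])
    (auto simp: integral_measure_pmf[of "set_pmf p"])

lemma ex_map: "ex (map_pmf f p) h = ex p (\<lambda>x. h (f x))"
  by simp

lemma ex_mono:
  assumes "finite (set_pmf p)" "\<And>x. x \<in> set_pmf p \<Longrightarrow> f x \<le> g x"
  shows "ex p f \<le> ex p g"
  using assms by (intro integral_mono_AE integrable_measure_pmf_finite) (auto simp: AE_measure_pmf_iff)

lemma prb_ex: "prb p A = ex p (indicator A)"
  by simp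

lemma prb_map: "prb (map_pmf f p) A = prb p {x. f x \<in> A}"
  by (simp add: vimage_def)

lemma prb_mono: "(\<And>x. x \<in> set_pmf p \<Longrightarrow> x \<in> A \<Longrightarrow> x \<in> B) \<Longrightarrow> prb p A \<le> prb p B"
  by (intro measure_pmf.finite_measure_mono_AE) (auto simp: AE_measure_pmf_iff)

lemma prb_bind_le:
  assumes "finite (set_pmf p)" "\<And>x. x \<in> set_pmf p \<Longrightarrow> finite (set_pmf (f x))"
    and "\<And>x. x \<in> set_pmf p \<Longrightarrow> prb (f x) A \<le> c"
  shows "prb (bind_pmf p f) A \<le> c"
proof -
  have "prb (bind_pmf p f) A = ex p (\<lambda>x. prb (f x) A)"
    unfolding prb_ex by (subst ex_bind) (use assms in auto)
  also have "\<dots> \<le> ex p (\<lambda>_. c)" using assms by (intro ex_mono) auto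
  finally show ?thesis by simp
qed

lemma ex_pair:
  assumes "finite (set_pmf p)" "finite (set_pmf q)"
  shows "ex (pair_pmf p q) (\<lambda>(x, y). f x * g y) = ex p f * ex q g"
proof -
  have "ex (pair_pmf p q) (\<lambda>(x, y). f x * g y) = ex p (\<lambda>x. ex q (\<lambda>y. f x * g y))"
    unfolding pair_pmf_def by (simp add: ex_bind assms)
  thus ?thesis by simp
qed

lemma prb_pair:
  assumes "finite (set_pmf p)" "finite (set_pmf q)"
  shows "prb (pair_pmf p q) (A \<times> B) = prb p A * prb q B"
proof -
  have "prb (pair_pmf p q) (A \<times> B) = ex (pair_pmf p q) (\<lambda>(x, y). indicator A x * indicator B y)"
    unfolding prb_ex by (rule Bochner_Integration.integral_cong) (auto simp: indicator_def)
  also have "\<dots> = prb p A * prb q B" by (simp add: ex_pair assms)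
  finally show ?thesis .
qed

lemma markov_le:
  assumes "finite (set_pmf p)" "\<And>x. 0 \<le> f x" "0 < t"
  shows "prb p {x. t \<le> f x} \<le> ex p f / t"
proof -
  have "prb p {x. t \<le> f x} = ex p (indicator {x. t \<le> f x})" by simp
  also have "\<dots> \<le> ex p (\<lambda>x. f x / t)"
    using assms by (intro ex_mono) (auto simp: indicator_def)
  finally show ?thesis by simp
qed

text \<open>Chebyshev's inequality for pairwise uncorrelated summands, with variances bounded by
  second moments.\<close>

lemma deviation_bound:
  fixes Y :: "'i \<Rightarrow> 'a \<Rightarrow> real"
  assumes fin: "finite (set_pmf p)" and K: "finite K"
    and unc: "\<And>k l. k \<in> K \<Longrightarrow> l \<in> K \<Longrightarrow> k \<noteq> l \<Longrightarrow> ex p (\<lambda>x. Y k x * Y l x) = ex p (Y k) * ex p (Y l)"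
    and t: "0 < t"
  shows "prb p {x. t \<le> \<bar>(\<Sum>k\<in>K. Y k x) - (\<Sum>k\<in>K. ex p (Y k))\<bar>} \<le> (\<Sum>k\<in>K. ex p (\<lambda>x. (Y k x)\<^sup>2)) / t\<^sup>2"
proof -
  define Z where "Z k x = Y k x - ex p (Y k)" for k x
  have int [simp]: "integrable p f" for f :: "'a \<Rightarrow> real"
    using fin by (rule integrable_measure_pmf_finite)
  have Zkl: "ex p (\<lambda>x. Z k x * Z l x) = ex p (\<lambda>x. Y k x * Y l x) - ex p (Y k) * ex p (Y l)" for k l
    unfolding Z_def by (simp add: algebra_simps)
  have "ex p (\<lambda>x. (\<Sum>k\<in>K. Z k x)\<^sup>2) = (\<Sum>k\<in>K. \<Sum>l\<in>K. ex p (\<lambda>x. Z k x * Z l x))"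
    by (simp add: power2_eq_square sum_product)
  also have "\<dots> = (\<Sum>k\<in>K. ex p (\<lambda>x. Z k x * Z k x))"
  proof (rule sum.cong[OF refl])
    fix k assume k: "k \<in> K"
    have "(\<Sum>l\<in>K. ex p (\<lambda>x. Z k x * Z l x)) = (\<Sum>l\<in>K. if l = k then ex p (\<lambda>x. Z k x * Z k x) else 0)"
      using k unc by (intro sum.cong) (auto simp: Zkl)
    thus "(\<Sum>l\<in>K. ex p (\<lambda>x. Z k x * Z l x)) = ex p (\<lambda>x. Z k x * Z k x)" using k K by simp
  qed
  also have "\<dots> \<le> (\<Sum>k\<in>K. ex p (\<lambda>x. (Y k x)\<^sup>2))"
    by (intro sum_mono) (simp add: Zkl power2_eq_square)
  finally have var: "ex p (\<lambda>x. (\<Sum>k\<in>K. Z k x)\<^sup>2) \<le> (\<Sum>k\<in>K. ex p (\<lambda>x. (Y k x)\<^sup>2))" .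
  have "prb p {x. t \<le> \<bar>(\<Sum>k\<in>K. Y k x) - (\<Sum>k\<in>K. ex p (Y k))\<bar>} \<le> prb p {x. t\<^sup>2 \<le> (\<Sum>k\<in>K. Z k x)\<^sup>2}"
    using t by (intro prb_mono) (auto simp: Z_def sum_subtractf abs_le_square_iff[symmetric])
  also have "\<dots> \<le> ex p (\<lambda>x. (\<Sum>k\<in>K. Z k x)\<^sup>2) / t\<^sup>2"
    using fin t by (intro markov_le) auto
  also have "\<dots> \<le> (\<Sum>k\<in>K. ex p (\<lambda>x. (Y k x)\<^sup>2)) / t\<^sup>2"
    using var by (intro divide_right_mono) auto
  finally show ?thesis .
qed

lemma PWU_ex:
  assumes "PWU p f K D" "k < K"
  shows "ex p (\<lambda>x. g (f k x)) = ex D g"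
  using assms ex_map[of "f k" p g] by (simp add: PWU_def)

lemma PWU_finite:
  assumes "PWU p f K D" "k < K" "finite (set_pmf p)"
  shows "finite (set_pmf D)"
proof -
  have "D = map_pmf (f k) p" using assms by (simp add: PWU_def)
  thus ?thesis using assms by simp
qed

lemma PWU_ex_mult:
  assumes "PWU p f K D" "k < K" "l < K" "k \<noteq> l" "finite (set_pmf p)"
  shows "ex p (\<lambda>x. g (f k x) * h (f l x)) = ex D g * ex D h"
proof -
  have "ex p (\<lambda>x. g (f k x) * h (f l x)) = ex (map_pmf (\<lambda>x. (f k x, f l x)) p) (\<lambda>(x, y). g x * h y)"
    by simp
  also have "\<dots> = ex D g * ex D h"
    using assms PWU_finite[OF assms(1,2,5)] by (simp add: PWU_def ex_pair)
  finally show ?thesis .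
qed

text \<open>An indicator equals its square, so the second moments add up to the mean.\<close>

lemma PWU_count:
  fixes s :: nat
  assumes "PWU p f K D" "finite (set_pmf p)" "s \<le> K" "0 < t"
  shows "prb p {x. t \<le> \<bar>real (card {k. k < s \<and> f k x \<in> T}) - s * prb D T\<bar>} \<le> s * prb D T / t\<^sup>2"
proof -
  let ?Y = "\<lambda>k x. indicator T (f k x) :: real"
  have 1: "ex p (?Y k) = prb D T" if "k < s" for k
    using PWU_ex[OF assms(1), of k "indicator T"] that assms(3) by simp
  have 2: "(\<Sum>k<s. ?Y k x) = card {k. k < s \<and> f k x \<in> T}" for x
    by (simp add: indicator_def sum.If_cases lessThan_def Int_def)
  have "(?Y k x)\<^sup>2 = ?Y k x" for k x by (simp add: indicator_def)
  hence 3: "(\<Sum>k<s. ex p (\<lambda>x. (?Y k x)\<^sup>2)) = s * prb D T" using 1 by simp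
  have "prb p {x. t \<le> \<bar>(\<Sum>k<s. ?Y k x) - (\<Sum>k<s. ex p (?Y k))\<bar>} \<le> (\<Sum>k<s. ex p (\<lambda>x. (?Y k x)\<^sup>2)) / t\<^sup>2"
    using assms PWU_ex_mult[OF assms(1), of _ _ "indicator T" "indicator T"]
      PWU_ex[OF assms(1), of _ "indicator T"]
    by (intro deviation_bound) auto
  thus ?thesis using 1 by (simp add: 2 3)
qed

lemma PWU_count_low:
  fixes s :: nat
  assumes "PWU p f K D" "finite (set_pmf p)" "s \<le> K" "0 < m" "m \<le> s * prb D T"
  shows "prb p {x. real (card {k. k < s \<and> f k x \<in> T}) < m / 2} \<le> 4 / m"
proof -
  let ?m = "s * prb D T"
  have "prb p {x. real (card {k. k < s \<and> f k x \<in> T}) < m / 2} \<le>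
      prb p {x. ?m / 2 \<le> \<bar>real (card {k. k < s \<and> f k x \<in> T}) - ?m\<bar>}"
    using assms by (intro prb_mono) auto
  also have "\<dots> \<le> ?m / (?m / 2)\<^sup>2" using assms by (intro PWU_count) auto
  also have "\<dots> = 4 / ?m" using assms by (simp add: power2_eq_square)
  also have "\<dots> \<le> 4 / m" using assms by (intro divide_left_mono) auto
  finally show ?thesis .
qed

lemma PWU_count_zero:
  fixes s :: nat
  assumes "PWU p f K D" "finite (set_pmf p)" "s \<le> K" "0 < m" "m \<le> s * prb D T"
  shows "prb p {x. \<forall>k<s. f k x \<notin> T} \<le> 1 / m"
proof -
  let ?m = "s * prb D T"
  have "prb p {x. \<forall>k<s. f k x \<notin> T} \<le> prb p {x. ?m \<le> \<bar>real (card {k. k < s \<and> f k x \<in> T}) - ?m\<bar>}"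
  proof (rule prb_mono)
    fix x assume "x \<in> {x. \<forall>k<s. f k x \<notin> T}"
    hence e: "{k. k < s \<and> f k x \<in> T} = {}" by auto
    show "x \<in> {x. ?m \<le> \<bar>real (card {k. k < s \<and> f k x \<in> T}) - ?m\<bar>}"
      unfolding mem_Collect_eq e by simp
  qed
  also have "\<dots> \<le> ?m / ?m\<^sup>2" using assms by (intro PWU_count) auto
  also have "\<dots> = 1 / ?m" using assms by (simp add: power2_eq_square)
  also have "\<dots> \<le> 1 / m" using assms by (intro divide_left_mono) auto
  finally show ?thesis .
qed

lemma finite_U [simp]: "finite (set_pmf (U k))" by simp

lemma finite_pair [simp]: "finite (set_pmf p) \<Longrightarrow> finite (set_pmf q) \<Longrightarrow> finite (set_pmf (pair_pmf p q))"
  by simp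

lemma prb_U: "T \<subseteq> {..<2 ^ k} \<Longrightarrow> prb (U k) T = card T / 2 ^ k"
  unfolding U_def using pow2_set by (subst measure_pmf_of_set) (auto simp: Int_absorb1)

text \<open>Reduction modulo \<open>len\<close> is not exactly uniform. The
  \<open>2 ^ k div len \<ge> 1\<close> complete blocks of residues fill at least half of the range,
  so each residue keeps at least half of its fair probability.\<close>

lemma prb_U_mod:
  assumes "0 < len" "len \<le> 2 ^ k" "T \<subseteq> {..<len}"
  shows "card T / (2 * len) \<le> prb (U k) {x. x mod len \<in> T}"
proof -
  define c where "c = 2 ^ k div len"
  have fin: "finite T" using assms(3) finite_subset by blast
  have c: "1 \<le> c" using assms by (simp add: c_def div_greater_zero_iff Suc_le_eq)
  have "2 ^ k < (c + 1) * len" using assms(1) unfolding c_def by (metis dividend_less_div_times add.commute mult.commute mult_Suc Suc_eq_plus1)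
  also have "\<dots> \<le> 2 * c * len" using c by (intro mult_right_mono) auto
  finally have c2: "2 ^ k \<le> 2 * c * len" by simp
  have sub: "(\<lambda>(i, t). i * len + t) ` ({..<c} \<times> T) \<subseteq> {x. x mod len \<in> T} \<inter> {..<2 ^ k}"
  proof (clarsimp, safe)
    fix i t assume i: "i < c" "t \<in> T"
    hence t: "t < len" using assms by auto
    show "(i * len + t) mod len \<in> T" using i t by simp
    have "i * len + t < (i + 1) * len" using t by simp
    also have "\<dots> \<le> c * len" using i by (intro mult_right_mono) auto
    also have "\<dots> \<le> 2 ^ k" by (simp add: c_def)
    finally show "i * len + t < 2 ^ k" .
  qed
  have inj: "inj_on (\<lambda>(i, t). i * len + t) ({..<c} \<times> T)"
  proof (rule inj_onI, clarsimp)
    fix i t i' t' assume *: "i * len + t = i' * len + t'" "t \<in> T" "t' \<in> T"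
    hence tt: "t < len" "t' < len" using assms by auto
    have "i = (i * len + t) div len" "t = (i * len + t) mod len" using tt by auto
    moreover have "i' = (i * len + t) div len" "t' = (i * len + t) mod len"
      unfolding *(1) using tt by auto
    ultimately show "i = i' \<and> t = t'" by simp
  qed
  have "c * card T = card ((\<lambda>(i, t). i * len + t) ` ({..<c} \<times> T))"
    using inj by (simp add: card_image card_cartesian_product)
  also have "\<dots> \<le> card ({x. x mod len \<in> T} \<inter> {..<2 ^ k})"
    using sub by (intro card_mono) auto
  finally have "c * card T \<le> card ({x. x mod len \<in> T} \<inter> {..<2 ^ k})" .
  hence "real (c * card T) \<le> real (card ({x. x mod len \<in> T} \<inter> {..<2 ^ k}))" by (rule of_nat_mono)
  hence "real (c * card T) / 2 ^ k \<le> card ({x. x mod len \<in> T} \<inter> {..<2 ^ k}) / 2 ^ k"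
    by (intro divide_right_mono) auto
  also have "\<dots> = prb (U k) {x. x mod len \<in> T}"
    unfolding U_def using pow2_set by (subst measure_pmf_of_set) (auto simp: Int_commute)
  finally have 1: "real (c * card T) / 2 ^ k \<le> prb (U k) {x. x mod len \<in> T}" .
  have "real (2 ^ k) \<le> real (2 * c * len)" using c2 by (rule of_nat_mono)
  hence "real (card T) * 2 ^ k \<le> real (card T) * (2 * c * len)" by (intro mult_left_mono) auto
  hence "card T / (2 * len) \<le> real (c * card T) / 2 ^ k"
    using assms(1) by (simp add: field_simps)
  thus ?thesis using 1 by linarith
qed

text \<open>The 4 combines two losses of one half each: the nonuniform reduction modulo
  \<open>len\<close> and the permitted deviation below the mean.\<close>

lemma sample_count:
  assumes "0 < len" "len \<le> 2 ^ k" "T \<subseteq> {..<len}" "T \<noteq> {}" "0 < s" "s \<le> 2 ^ k"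
  shows "prb (pair_pmf (U (2 * k)) (U (2 * k)))
    {(a, b). real (card {q. q < s \<and> ms k (2 * k) a b q mod len \<in> T}) < s * card T / (4 * len)}
    \<le> 8 * len / (s * card T)"
proof -
  have "finite T" using assms(3) finite_subset by blast
  hence cT: "card T > 0" using assms(4) by (simp add: card_gt_0_iff)
  define m where "m = s * card T / (2 * real len)"
  have "m = s * (card T / (2 * len))" by (simp add: m_def)
  also have "\<dots> \<le> s * prb (U k) {x. x mod len \<in> T}"
    using prb_U_mod[OF assms(1-3)] by (intro mult_left_mono) auto
  finally have m: "0 < m" "m \<le> s * prb (U k) {x. x mod len \<in> T}"
    using assms cT by (auto simp: m_def)
  have "PWU (pair_pmf (U (2 * k)) (U (2 * k))) (\<lambda>q (a, b). ms k (2 * k) a b q) (2 ^ k) (U k)"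
    using PWU_ms[of k "2 * k"] by (simp add: mult_2)
  from PWU_count_low[OF this _ assms(6) m] show ?thesis
    by (simp add: m_def case_prod_beta' field_simps)
qed

text \<open>
  A quadruple \<open>((v, u), (v', u'))\<close> describes the test sequence of a row: two independent
  pairwise uniform sequences of sample positions. One such sequence of length \<open>q\<close> misses a set of
  density \<open>1 / r\<close> with probability at most \<open>r / q\<close>; two of them bring this down to its square,
  which is what makes the expected number of tests finite.
\<close>

definition misses :: "nat \<Rightarrow> nat \<Rightarrow> nat set \<Rightarrow> (nat \<times> nat) \<times> (nat \<times> nat) \<Rightarrow> nat \<Rightarrow> bool" where
  "misses k z H x q \<longleftrightarrow> (\<forall>q'<q. ms (k - z) k (fst (fst x)) (snd (fst x)) q' \<notin> H \<and>
     ms (k - z) k (fst (snd x)) (snd (snd x)) q' \<notin> H)"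

text \<open>Round \<open>q\<close> takes place iff all earlier rounds missed, so this is the number
  of rounds performed, capped at \<open>d\<close>. In this form its expectation is the sum of the
  miss probabilities.\<close>

definition cost :: "nat \<Rightarrow> nat \<Rightarrow> nat set \<Rightarrow> nat \<Rightarrow> (nat \<times> nat) \<times> (nat \<times> nat) \<Rightarrow> nat" where
  "cost k z H d x = card {q. q < d \<and> misses k z H x q}"

abbreviation UU :: "nat \<Rightarrow> (nat \<times> nat) pmf" where "UU k \<equiv> pair_pmf (U k) (U k)"

lemma prb_misses:
  assumes "z \<le> k" "0 < q" "q \<le> 2 ^ (k - z)" "H \<subseteq> {..<2 ^ z}" "2 ^ z \<le> card H * r" "0 < r"
  shows "prb (pair_pmf (UU k) (UU k)) {x. misses k z H x q} \<le> (r / q)\<^sup>2"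
proof -
  let ?A = "{(a, b). \<forall>q'<q. ms (k - z) k a b q' \<notin> H}"
  have H: "card H > 0" using assms(5) by (cases "card H") auto
  have "PWU (UU k) (\<lambda>q (a, b). ms (k - z) k a b q) (2 ^ (k - z)) (U z)"
    using PWU_ms[of "k - z" k] assms(1) by simp
  moreover have "q / real r \<le> q * prb (U z) H"
  proof -
    have "real (2 ^ z) \<le> card H * r" using assms(5) by (metis of_nat_mono of_nat_mult)
    hence "1 / real r \<le> card H / 2 ^ z" using assms(6) by (simp add: field_simps)
    hence "q * (1 / real r) \<le> q * (card H / 2 ^ z)" by (intro mult_left_mono) auto
    thus ?thesis using assms(4) by (simp add: prb_U)
  qed
  ultimately have "prb (UU k) ?A \<le> 1 / (q / r)"
    using PWU_count_zero[of "UU k" "\<lambda>q (a, b). ms (k - z) k a b q" "2 ^ (k - z)" "U z" q "q / r" H] assms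
    by (simp add: case_prod_beta')
  hence A: "prb (UU k) ?A \<le> r / q" by simp
  have "{x. misses k z H x q} = ?A \<times> ?A"
    by (auto simp: misses_def)
  hence "prb (pair_pmf (UU k) (UU k)) {x. misses k z H x q} = prb (UU k) ?A * prb (UU k) ?A"
    by (simp add: prb_pair)
  also have "\<dots> \<le> (r / q) * (r / q)" using A by (intro mult_mono) auto
  finally show ?thesis by (simp add: power2_eq_square)
qed

lemma sum_inverse_squares:
  fixes r :: nat
  assumes "0 < r"
  shows "(\<Sum>q<d. if q \<le> r then 1 else (r / q)\<^sup>2) \<le> 3 * real r"
proof -
  \<comment> \<open>The form that goes through the induction: the first \<open>r + 1\<close> terms
    are 1, and a later term \<open>(r / d)\<^sup>2\<close> is at most the telescoping difference of
    \<open>r\<^sup>2 / (d - 1)\<close> and \<open>r\<^sup>2 / d\<close>.\<close>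
  have "(\<Sum>q<d. if q \<le> r then 1 else (r / q)\<^sup>2) \<le>
      (if d \<le> Suc r then real d else 2 * real r + 1 - r\<^sup>2 / (real d - 1))"
  proof (induction d)
    case (Suc d)
    show ?case
    proof (cases "d \<le> r")
      case True
      thus ?thesis using Suc by auto
    next
      case False
      have d1: "real d > 1" using False assms by simp
      have "(r / d)\<^sup>2 \<le> r\<^sup>2 / (real d - 1) - r\<^sup>2 / real d"
      proof -
        have "r\<^sup>2 / (real d - 1) - r\<^sup>2 / real d = r\<^sup>2 / (real d * (real d - 1))"
          using d1 by (simp add: field_simps)
        moreover have "r\<^sup>2 / (real d * real d) \<le> r\<^sup>2 / (real d * (real d - 1))"
          using d1 by (intro divide_left_mono mult_left_mono) auto
        ultimately show ?thesis by (simp add: power_divide power2_eq_square)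
      qed
      moreover have "d \<le> Suc r \<longrightarrow> real d \<le> 2 * real r + 1 - r\<^sup>2 / (real d - 1)"
      proof
        assume "d \<le> Suc r"
        hence "d = Suc r" using False by simp
        thus "real d \<le> 2 * real r + 1 - r\<^sup>2 / (real d - 1)"
          using assms by (simp add: power2_eq_square)
      qed
      ultimately show ?thesis using Suc False by (auto split: if_splits)
    qed
  qed auto
  also have "\<dots> \<le> 3 * real r"
  proof (cases "d \<le> Suc r")
    case False
    have "0 \<le> r\<^sup>2 / (real d - 1)" using False by simp
    moreover have "1 \<le> real r" using assms by simp
    ultimately show ?thesis using False by (simp only: if_False)
  qed (use assms in auto)
  finally show ?thesis .
qed

lemma ex_cost:
  assumes "z \<le> k" "d \<le> 2 ^ (k - z)" "H \<subseteq> {..<2 ^ z}" "2 ^ z \<le> card H * r" "0 < r"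
  shows "ex (pair_pmf (UU k) (UU k)) (\<lambda>x. real (cost k z H d x)) \<le> 3 * real r"
proof -
  let ?D = "pair_pmf (UU k) (UU k)"
  have fin: "finite (set_pmf ?D)" by simp
  have int [simp]: "integrable ?D f" for f :: "_ \<Rightarrow> real"
    using fin by (rule integrable_measure_pmf_finite)
  have "real (cost k z H d x) = (\<Sum>q<d. indicator {x. misses k z H x q} x)" for x
    by (simp add: cost_def indicator_def sum.If_cases lessThan_def Int_def)
  hence "ex ?D (\<lambda>x. real (cost k z H d x)) = (\<Sum>q<d. prb ?D {x. misses k z H x q})"
    by simp
  also have "\<dots> \<le> (\<Sum>q<d. if q \<le> r then 1 else (r / q)\<^sup>2)"
  proof (rule sum_mono)
    fix q assume q: "q \<in> {..<d}"
    have "prb ?D {x. misses k z H x q} \<le> 1" by simp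
    moreover have "\<not> q \<le> r \<longrightarrow> prb ?D {x. misses k z H x q} \<le> (r / q)\<^sup>2"
      using q assms by (auto intro!: prb_misses)
    ultimately show "prb ?D {x. misses k z H x q} \<le> (if q \<le> r then 1 else (r / q)\<^sup>2)" by auto
  qed
  also have "\<dots> \<le> 3 * real r" by (rule sum_inverse_squares[OF assms(5)])
  finally show ?thesis .
qed

text \<open>The upper level of hashing: eight seeds give every position \<open>p\<close> its own
  four parameters, uniform and independent for any two positions (\<open>PWU_quad\<close>). The
  lower level, in \<open>misses\<close>, turns the parameters into sample positions.\<close>

definition quad :: "nat \<Rightarrow> nat \<Rightarrow> ((nat \<times> nat) \<times> nat \<times> nat) \<times> (nat \<times> nat) \<times> nat \<times> nat \<Rightarrow>
    (nat \<times> nat) \<times> (nat \<times> nat)" where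
  "quad k p = (\<lambda>(((a1, b1), (a2, b2)), ((a3, b3), (a4, b4))).
     ((ms k (2 * k) a1 b1 p, ms k (2 * k) a2 b2 p), (ms k (2 * k) a3 b3 p, ms k (2 * k) a4 b4 p)))"

definition quad_seeds where
  "quad_seeds k = pair_pmf (pair_pmf (UU (2 * k)) (UU (2 * k))) (pair_pmf (UU (2 * k)) (UU (2 * k)))"

lemma PWU_quad: "PWU (quad_seeds k) (quad k) (2 ^ k) (pair_pmf (UU k) (UU k))"
proof -
  have 1: "PWU (UU (2 * k)) (\<lambda>q (a, b). ms k (2 * k) a b q) (2 ^ k) (U k)"
    using PWU_ms[of k "2 * k"] by (simp add: mult_2)
  have "quad k = (\<lambda>q (x, y). ((\<lambda>(x1, x2). ((\<lambda>(a, b). ms k (2 * k) a b q) x1, (\<lambda>(a, b). ms k (2 * k) a b q) x2)) x,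
      (\<lambda>(x1, x2). ((\<lambda>(a, b). ms k (2 * k) a b q) x1, (\<lambda>(a, b). ms k (2 * k) a b q) x2)) y))"
    by (auto simp: quad_def fun_eq_iff)
  thus ?thesis
    unfolding quad_seeds_def by (simp only:) (intro PWU_pair 1)
qed

lemma finite_quad_seeds [simp]: "finite (set_pmf (quad_seeds k))"
  by (simp add: quad_seeds_def)

text \<open>Costs of different rows are uncorrelated, so their variances add. A cost capped at
  \<open>d\<close> has second moment at most \<open>d\<close> times its mean, which bounds the sum
  by \<open>d\<close> times the bound \<open>3 * r * card G\<close> on the mean.\<close>

lemma tests_cost:
  fixes t :: real
  assumes "z \<le> k" "d \<le> 2 ^ (k - z)" "G \<subseteq> {..<2 ^ k}" "0 < r" "0 < t"
    and H: "\<And>p. p \<in> G \<Longrightarrow> H p \<subseteq> {..<2 ^ z} \<and> 2 ^ z \<le> card (H p) * r"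
  shows "prb (quad_seeds k) {x. 3 * r * card G + t \<le> (\<Sum>p\<in>G. real (cost k z (H p) d (quad k p x)))}
    \<le> 3 * r * card G * d / t\<^sup>2"
proof -
  let ?D = "pair_pmf (UU k) (UU k)"
  let ?c = "\<lambda>p x. real (cost k z (H p) d x)"
  let ?Y = "\<lambda>p x. ?c p (quad k p x)"
  have finG: "finite G" using assms(3) finite_subset by blast
  have G: "p < 2 ^ k" if "p \<in> G" for p using that assms(3) by auto
  have Y: "ex (quad_seeds k) (?Y p) = ex ?D (?c p)" if "p \<in> G" for p
    by (rule PWU_ex[OF PWU_quad G[OF that]])
  have e: "ex ?D (?c p) \<le> 3 * real r" if "p \<in> G" for p
    using H[OF that] assms by (intro ex_cost) auto
  have sum: "(\<Sum>p\<in>G. ex (quad_seeds k) (?Y p)) \<le> 3 * r * card G"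
    using sum_bounded_above[of G "\<lambda>p. ex (quad_seeds k) (?Y p)" "3 * real r"] e Y
    by (simp add: mult_ac)
  have c_le: "cost k z (H p) d x \<le> d" for p x
    unfolding cost_def by (rule order_trans[OF card_mono[of "{..<d}"]]) auto
  have sq: "ex (quad_seeds k) (\<lambda>x. (?Y p x)\<^sup>2) \<le> d * ex (quad_seeds k) (?Y p)" if "p \<in> G" for p
  proof -
    have "ex (quad_seeds k) (\<lambda>x. (?Y p x)\<^sup>2) \<le> ex (quad_seeds k) (\<lambda>x. d * ?Y p x)"
      unfolding power2_eq_square by (intro ex_mono mult_right_mono) (simp_all add: c_le)
    thus ?thesis by simp
  qed
  have "prb (quad_seeds k) {x. 3 * r * card G + t \<le> (\<Sum>p\<in>G. ?Y p x)} \<le>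
      prb (quad_seeds k) {x. t \<le> \<bar>(\<Sum>p\<in>G. ?Y p x) - (\<Sum>p\<in>G. ex (quad_seeds k) (?Y p))\<bar>}"
    using sum by (intro prb_mono) auto
  also have "\<dots> \<le> (\<Sum>p\<in>G. ex (quad_seeds k) (\<lambda>x. (?Y p x)\<^sup>2)) / t\<^sup>2"
  proof (rule deviation_bound)
    fix p p' assume "p \<in> G" "p' \<in> G" "p \<noteq> p'"
    thus "ex (quad_seeds k) (\<lambda>x. ?Y p x * ?Y p' x) = ex (quad_seeds k) (?Y p) * ex (quad_seeds k) (?Y p')"
      using PWU_ex_mult[OF PWU_quad, of p k p' "?c p" "?c p'"] G Y by auto
  qed (use finG assms in auto)
  also have "\<dots> \<le> (\<Sum>p\<in>G. d * ex (quad_seeds k) (?Y p)) / t\<^sup>2"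
    using sq by (intro divide_right_mono sum_mono) auto
  also have "\<dots> = d * (\<Sum>p\<in>G. ex (quad_seeds k) (?Y p)) / t\<^sup>2" by (simp add: sum_distrib_left)
  also have "\<dots> \<le> real d * real (3 * r * card G) / t\<^sup>2"
    using sum by (intro divide_right_mono mult_left_mono) auto
  finally show ?thesis by (simp add: mult_ac)
qed

lemma tests_survivors:
  fixes t :: real
  assumes "z \<le> k" "d \<le> 2 ^ (k - z)" "G \<subseteq> {..<2 ^ k}" "0 < r" "0 < t" "0 < d"
    and H: "\<And>p. p \<in> G \<Longrightarrow> H p \<subseteq> {..<2 ^ z} \<and> 2 ^ z \<le> card (H p) * r"
  shows "prb (quad_seeds k) {x. t \<le> real (card {p \<in> G. misses k z (H p) (quad k p x) d})}
    \<le> card G * (r / d)\<^sup>2 / t"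
proof -
  let ?D = "pair_pmf (UU k) (UU k)"
  let ?Y = "\<lambda>p x. indicator {x. misses k z (H p) x d} (quad k p x) :: real"
  have int [simp]: "integrable (quad_seeds k) f" for f :: "_ \<Rightarrow> real"
    by (rule integrable_measure_pmf_finite) simp
  have finG: "finite G" using assms(3) finite_subset by blast
  have G: "p < 2 ^ k" if "p \<in> G" for p using that assms(3) by auto
  have Y: "ex (quad_seeds k) (?Y p) \<le> (r / d)\<^sup>2" if "p \<in> G" for p
    using PWU_ex[OF PWU_quad G[OF that], of "indicator {x. misses k z (H p) x d}"]
      prb_misses[of z k d "H p" r] H[OF that] assms by simp
  have c: "real (card {p \<in> G. misses k z (H p) (quad k p x) d}) = (\<Sum>p\<in>G. ?Y p x)" for x
    using finG by (simp add: indicator_def sum.If_cases Int_def)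
  have "prb (quad_seeds k) {x. t \<le> real (card {p \<in> G. misses k z (H p) (quad k p x) d})} \<le>
      ex (quad_seeds k) (\<lambda>x. real (card {p \<in> G. misses k z (H p) (quad k p x) d})) / t"
    using assms by (intro markov_le) auto
  also have "\<dots> = (\<Sum>p\<in>G. ex (quad_seeds k) (?Y p)) / t" by (simp add: c)
  also have "\<dots> \<le> (card G * (r / d)\<^sup>2) / t"
    using sum_bounded_above[of G "\<lambda>p. ex (quad_seeds k) (?Y p)" "(r / d)\<^sup>2"] Y assms
    by (intro divide_right_mono) auto
  finally show ?thesis .
qed

section \<open>The reduction\<close>

text \<open>
  A staircase walk through the matrix with rows \<open>I\<close> and columns \<open>J\<close>: it takes at most \<open>length I + length J\<close>
  steps, and its two answers are certificates that need not exclude each other.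
\<close>

fun walk :: "(nat \<Rightarrow> nat \<Rightarrow> bool) \<Rightarrow> nat list \<Rightarrow> nat list \<Rightarrow> bool" where
  "walk P [] J = True"
| "walk P (i # I) [] = False"
| "walk P (i # I) (j # J) = (if P i j then walk P I (j # J) else walk P (i # I) J)"

lemma walk_True: "walk P I J \<Longrightarrow> \<forall>i\<in>set I. \<exists>j\<in>set J. P i j"
  by (induction P I J rule: walk.induct) (auto split: if_splits)

lemma walk_False: "\<not> walk P I J \<Longrightarrow> \<forall>j\<in>set J. \<exists>i\<in>set I. \<not> P i j"
  by (induction P I J rule: walk.induct) (auto split: if_splits)

text \<open>A minimal element outside the set has all strictly smaller elements inside it; if the
  set had fewer than \<open>K\<close> elements, the rank of that element would be below
  \<open>K\<close> as well. Ties can only enlarge the set.\<close>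

lemma rank_card:
  fixes f :: "'a \<Rightarrow> 'b::linorder"
  assumes "finite P" "K \<le> card P"
  shows "K \<le> card {p \<in> P. card {p' \<in> P. f p' < f p} < K}"
proof (rule ccontr)
  let ?T = "{p \<in> P. card {p' \<in> P. f p' < f p} < K}"
  assume *: "\<not> K \<le> card ?T"
  have "?T \<noteq> P" using * assms(2) by auto
  hence ne: "P - ?T \<noteq> {}" by blast
  have fin: "finite (P - ?T)" using assms(1) by simp
  have "Min (f ` (P - ?T)) \<in> f ` (P - ?T)" using fin ne by (intro Min_in) auto
  then obtain p where p0: "Min (f ` (P - ?T)) = f p" "p \<in> P - ?T" by (rule imageE)
  have p: "p \<in> P - ?T" "\<And>q. q \<in> P - ?T \<Longrightarrow> f p \<le> f q"
    using p0(2) Min_le[of "f ` (P - ?T)"] fin unfolding p0(1)[symmetric] by auto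
  have "{p' \<in> P. f p' < f p} \<subseteq> ?T" using p(2) by (force simp: not_less)
  hence "card {p' \<in> P. f p' < f p} \<le> card ?T" using assms(1) by (intro card_mono) auto
  thus False using p(1) * by auto
qed

lemma card_positions:
  "card {q. q < length xs \<and> P (xs ! q)} = length (filter P xs)"
  by (simp add: length_filter_conv_card)

type_synonym seeds = "(((nat \<times> nat) \<times> (nat \<times> nat)) \<times> (nat \<times> nat) \<times> (nat \<times> nat)) \<times>
  ((nat \<times> nat) \<times> nat \<times> nat) \<times> (nat \<times> nat) \<times> nat \<times> nat"

definition seedR :: "nat \<Rightarrow> seeds \<Rightarrow> nat \<times> nat" where
  "seedR o' sd = (if o' = 0 then fst (fst (fst sd)) else fst (snd (fst sd)))"

definition seedS :: "nat \<Rightarrow> seeds \<Rightarrow> nat \<times> nat" where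
  "seedS o' sd = (if o' = 0 then snd (fst (fst sd)) else snd (snd (fst sd)))"

section \<open>The reduction as a function of lists and seeds\<close>

locale game =
  fixes V :: "nat \<Rightarrow> nat \<Rightarrow> int" and n :: nat and k :: nat
  assumes n_pos: "1 \<le> n"
    and V_inj: "\<And>i j i' j'. i < n \<Longrightarrow> j < n \<Longrightarrow> i' < n \<Longrightarrow> j' < n \<Longrightarrow> V i j = V i' j' \<Longrightarrow> i = i' \<and> j = j'"
    and n_less: "n < 2 ^ k" and k_le: "2 ^ k \<le> 2 * n"
begin

text \<open>The exponent of the parameter \<open>y\<close>, with \<open>y ^ 20 \<le> n\<close>. The
  exhaustive pivot search over the samples costs about \<open>YR * YS * YS = y ^ 16\<close> in each
  of \<open>2 * g\<close> half-rounds, and this has to stay linear (\<open>PV_le\<close>).\<close>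

definition g :: nat where "g = (k - 1) div 20"

definition y :: nat where "y = 2 ^ g"

text \<open>The exponents 4, 6 and 3 make each failure probability \<open>O(1 / y)\<close>. A set of
  rows of density \<open>1 / y ^ 3\<close> expects about \<open>YR / y ^ 3 = y\<close> sampled rows
  (\<open>prb_bad2\<close>); \<open>YR\<close> sampled rows, each misjudged with probability at most
  \<open>y / YS\<close>, contribute \<open>1 / y\<close> (\<open>prb_bad1\<close>);
  \<open>YD\<close> test rounds all miss with probability at most \<open>(y / YD) ^ 2\<close>
  (\<open>prb_bad3\<close>). Powers of two make the thresholds \<open>YS div 2 ^ r\<close> exact and
  let the inner hash address the column sample directly.\<close>

definition YR :: nat where "YR = 2 ^ (4 * g)"

definition YS :: nat where "YS = 2 ^ (6 * g)"

definition YD :: nat where "YD = 2 ^ (3 * g)"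

text \<open>
  Orientation \<open>0\<close> is the matrix itself and orientation \<open>1\<close> its negated transpose, which has the
  same saddlepoint. In orientation \<open>d\<close> the rows are listed in \<open>L d\<close> and the columns
  in \<open>L (1 - d)\<close>.
\<close>

definition Vo :: "nat \<Rightarrow> nat \<Rightarrow> nat \<Rightarrow> int" where
  "Vo d a b = (if d = 0 then V a b else - V b a)"

definition cnt :: "nat \<Rightarrow> nat list \<Rightarrow> nat \<Rightarrow> nat \<Rightarrow> nat" where
  "cnt d S a b = length (filter (\<lambda>j. Vo d a b < Vo d a j) S)"

definition isPiv :: "nat \<Rightarrow> nat list \<Rightarrow> nat list \<Rightarrow> nat \<Rightarrow> nat \<times> nat \<Rightarrow> bool" where
  "isPiv d R S th x \<longleftrightarrow> fst x \<in> set R \<and> snd x \<in> set S \<and> cnt d S (fst x) (snd x) < th \<and>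
    (\<forall>a\<in>set R. \<forall>b\<in>set S. cnt d S a b < th \<longrightarrow> Vo d (fst x) (snd x) \<le> Vo d a b)"

text \<open>For samples inside the matrix the entries are distinct, so the choice is unique
  (\<open>isPiv_unique\<close>) and any search for a smallest candidate finds this one.\<close>

definition piv :: "nat \<Rightarrow> nat list \<Rightarrow> nat list \<Rightarrow> nat \<Rightarrow> nat \<times> nat" where
  "piv d R S th = (SOME x. isPiv d R S th x)"

definition idx :: "nat \<times> nat \<Rightarrow> nat \<Rightarrow> nat \<Rightarrow> nat" where
  "idx ab len q = ms k (2 * k) (fst ab) (snd ab) q mod len"

definition Rs :: "(nat \<Rightarrow> nat list) \<Rightarrow> seeds \<Rightarrow> nat \<Rightarrow> nat list" where
  "Rs L sd d = map (\<lambda>q. L d ! idx (seedR d sd) (length (L d)) q) [0..<YR]"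

definition Ss :: "(nat \<Rightarrow> nat list) \<Rightarrow> seeds \<Rightarrow> nat \<Rightarrow> nat list" where
  "Ss L sd d = map (\<lambda>q. L (1 - d) ! idx (seedS d sd) (length (L (1 - d))) q) [0..<YS]"

text \<open>The samples come from the initial lists, so all pivots of a reduction are determined by
  \<open>L\<close> and the seeds, whatever earlier half-rounds removed. This is what allows a plain
  union bound over the half-rounds.\<close>

definition pv :: "(nat \<Rightarrow> nat list) \<Rightarrow> seeds \<Rightarrow> nat \<Rightarrow> nat \<times> nat" where
  "pv L sd i = piv (i mod 2) (Rs L sd (i mod 2)) (Ss L sd (i mod 2)) (YS div 2 ^ (i div 2 + 1))"

definition above :: "nat \<Rightarrow> nat \<times> nat \<Rightarrow> nat \<Rightarrow> nat \<Rightarrow> bool" where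
  "above d x a b \<longleftrightarrow> Vo d (fst x) (snd x) < Vo d a b"

text \<open>
  Half-round \<open>i\<close> works in orientation \<open>i mod 2\<close> with \<open>r = i div 2 + 1\<close>. As long as the walks answer True
  and the total length \<open>wtc\<close> stays linear, the columns are filtered; the first half-round for which this
  fails ends the reduction. The tests of the final half-round share a budget \<open>fuel\<close> of \<open>60 * n\<close>; rows reached
  after it is used up are kept, which costs time but not correctness.
\<close>

primrec casc :: "(nat \<Rightarrow> nat list) \<Rightarrow> seeds \<Rightarrow> nat \<Rightarrow> nat \<Rightarrow> nat list" where
  "casc L sd 0 = L"
| "casc L sd (Suc i) = (casc L sd i)(1 - i mod 2 :=
     filter (above (i mod 2) (pv L sd i) (fst (pv L sd i))) (casc L sd i (1 - i mod 2)))"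

definition wtc :: "(nat \<Rightarrow> nat list) \<Rightarrow> seeds \<Rightarrow> nat \<Rightarrow> nat" where
  "wtc L sd i = (\<Sum>i'<i. length (casc L sd i' 0) + length (casc L sd i' 1))"

definition walks :: "(nat \<Rightarrow> nat list) \<Rightarrow> seeds \<Rightarrow> nat \<Rightarrow> bool" where
  "walks L sd i = walk (above (i mod 2) (pv L sd i)) (casc L sd i (i mod 2)) (casc L sd i (1 - i mod 2))"

definition hits :: "(nat \<Rightarrow> nat list) \<Rightarrow> seeds \<Rightarrow> nat \<Rightarrow> nat \<Rightarrow> nat set" where
  "hits L sd i p = {q. q < YS \<and> above (i mod 2) (pv L sd i) (casc L sd i (i mod 2) ! p) (Ss L sd (i mod 2) ! q)}"

definition tcost :: "(nat \<Rightarrow> nat list) \<Rightarrow> seeds \<Rightarrow> nat \<Rightarrow> nat \<Rightarrow> nat" where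
  "tcost L sd i p = cost k (6 * g) (hits L sd i p) YD (quad k p (snd sd))"

definition tmiss :: "(nat \<Rightarrow> nat list) \<Rightarrow> seeds \<Rightarrow> nat \<Rightarrow> nat \<Rightarrow> bool" where
  "tmiss L sd i p = misses k (6 * g) (hits L sd i p) (quad k p (snd sd)) YD"

primrec fuel :: "(nat \<Rightarrow> nat list) \<Rightarrow> seeds \<Rightarrow> nat \<Rightarrow> nat \<Rightarrow> nat" where
  "fuel L sd i 0 = 0"
| "fuel L sd i (Suc p) = fuel L sd i p + (if fuel L sd i p < 60 * n then tcost L sd i p else 0)"

definition killed :: "(nat \<Rightarrow> nat list) \<Rightarrow> seeds \<Rightarrow> nat \<Rightarrow> nat \<Rightarrow> bool" where
  "killed L sd i p \<longleftrightarrow> fuel L sd i p < 60 * n \<and> \<not> tmiss L sd i p"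

definition strong :: "(nat \<Rightarrow> nat list) \<Rightarrow> seeds \<Rightarrow> nat \<Rightarrow> nat list" where
  "strong L sd i = map (nth (casc L sd i (i mod 2)))
     (filter (\<lambda>p. \<not> killed L sd i p) [0..<length (casc L sd i (i mod 2))])"

definition stop :: "(nat \<Rightarrow> nat list) \<Rightarrow> seeds \<Rightarrow> nat \<Rightarrow> bool" where
  "stop L sd i \<longleftrightarrow> 64 * n < wtc L sd (Suc i) \<or> \<not> walks L sd i"

definition outcome :: "(nat \<Rightarrow> nat list) \<Rightarrow> seeds \<Rightarrow> nat \<Rightarrow> nat \<Rightarrow> nat list" where
  "outcome L sd i = (if 64 * n < wtc L sd (Suc i) then casc L sd i
     else (casc L sd i)(i mod 2 := strong L sd i))"

definition reduce :: "(nat \<Rightarrow> nat list) \<Rightarrow> seeds \<Rightarrow> nat \<Rightarrow> nat list" where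
  "reduce L sd = (if L 0 = [] \<or> L 1 = [] then L
     else if \<exists>i<2 * g. stop L sd i then outcome L sd (LEAST i. stop L sd i)
     else casc L sd (2 * g))"

definition proper :: "(nat \<Rightarrow> nat list) \<Rightarrow> bool" where
  "proper L \<longleftrightarrow> (\<forall>d<2. distinct (L d) \<and> set (L d) \<subseteq> {..<n})"

lemma properD: "proper L \<Longrightarrow> d < 2 \<Longrightarrow> a \<in> set (L d) \<Longrightarrow> a < n"
  by (auto simp: proper_def)

lemma proper_length: "proper L \<Longrightarrow> d < 2 \<Longrightarrow> length (L d) \<le> n"
  unfolding proper_def by (metis card_lessThan card_mono distinct_card finite_lessThan)

lemma Vo_inj: "a < n \<Longrightarrow> b < n \<Longrightarrow> a' < n \<Longrightarrow> b' < n \<Longrightarrow> Vo d a b = Vo d a' b' \<Longrightarrow> a = a' \<and> b = b'"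
  using V_inj by (auto simp: Vo_def split: if_splits)

lemma y_pos: "1 \<le> y" and YS_eq: "YS = y ^ 6" and YR_eq: "YR = y ^ 4" and YD_eq: "YD = y ^ 3"
  by (auto simp: y_def YS_def YR_def YD_def power_mult[symmetric] mult.commute)

lemma k_pos: "1 \<le> k"
  using n_less n_pos by (cases k) auto

lemma y20: "y ^ 20 \<le> n"
proof -
  have "y ^ 20 = 2 ^ (g * 20)" by (simp add: y_def power_mult)
  also have "\<dots> \<le> 2 ^ (k - 1)" unfolding g_def by (intro power_increasing) auto
  finally have "2 * y ^ 20 \<le> 2 ^ k" using k_pos by (cases k) auto
  thus ?thesis using k_le by simp
qed

lemma gk: "20 * g \<le> k" by (simp add: g_def)

lemma set_Rs: "L d \<noteq> [] \<Longrightarrow> set (Rs L sd d) \<subseteq> set (L d)"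
  by (auto simp: Rs_def idx_def)

lemma set_Ss: "L (1 - d) \<noteq> [] \<Longrightarrow> set (Ss L sd d) \<subseteq> set (L (1 - d))"
  by (auto simp: Ss_def idx_def)

lemma length_Rs [simp]: "length (Rs L sd d) = YR" and length_Ss [simp]: "length (Ss L sd d) = YS"
  by (simp_all add: Rs_def Ss_def)

lemma YR_pos: "0 < YR" and YS_pos: "0 < YS" and YD_pos: "0 < YD"
  by (simp_all add: YR_def YS_def YD_def)

lemma cnt_zero_exists:
  assumes "S \<noteq> []"
  shows "\<exists>b\<in>set S. cnt d S a b = 0"
proof -
  obtain b where "b \<in> set S" "\<forall>j\<in>set S. Vo d a j \<le> Vo d a b"
    using assms Max_in[of "Vo d a ` set S"] Max_ge[of "Vo d a ` set S"] by fastforce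
  thus ?thesis by (intro bexI[of _ b]) (auto simp: cnt_def filter_empty_conv not_less)
qed

lemma isPiv_exists:
  assumes "R \<noteq> []" "S \<noteq> []" "0 < th"
  shows "\<exists>x. isPiv d R S th x"
proof -
  let ?C = "{(a, b). a \<in> set R \<and> b \<in> set S \<and> cnt d S a b < th}"
  have fin: "finite ?C" by (rule finite_subset[of _ "set R \<times> set S"]) auto
  obtain b where b: "b \<in> set S" "cnt d S (hd R) b = 0" using cnt_zero_exists[OF assms(2)] by blast
  hence "(hd R, b) \<in> ?C" using assms by auto
  hence ne: "?C \<noteq> {}" by blast
  let ?F = "\<lambda>(a, b). Vo d a b"
  have "Min (?F ` ?C) \<in> ?F ` ?C" using fin ne by (intro Min_in) auto
  then obtain x where x: "Min (?F ` ?C) = ?F x" "x \<in> ?C" by (rule imageE)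
  have "?F x \<le> ?F z" if "z \<in> ?C" for z
    unfolding x(1)[symmetric] using that fin by (intro Min_le) auto
  thus ?thesis using x(2) by (intro exI[of _ x]) (force simp: isPiv_def case_prod_beta')
qed

lemma isPiv_unique:
  assumes "isPiv d R S th x" "isPiv d R S th z" "set R \<subseteq> {..<n}" "set S \<subseteq> {..<n}"
  shows "x = z"
proof -
  have "Vo d (fst x) (snd x) = Vo d (fst z) (snd z)"
    using assms(1,2) by (meson antisym isPiv_def)
  moreover have "fst x < n" "snd x < n" "fst z < n" "snd z < n"
    using assms by (auto simp: isPiv_def)
  ultimately show ?thesis using Vo_inj by (simp add: prod_eq_iff)
qed

lemma piv_isPiv: "R \<noteq> [] \<Longrightarrow> S \<noteq> [] \<Longrightarrow> 0 < th \<Longrightarrow> isPiv d R S th (piv d R S th)"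
  unfolding piv_def using isPiv_exists by (metis someI_ex)

lemma piv_eqI:
  assumes "isPiv d R S th x" "set R \<subseteq> {..<n}" "set S \<subseteq> {..<n}"
  shows "piv d R S th = x"
proof -
  have "isPiv d R S th (piv d R S th)" unfolding piv_def by (rule someI[of _ x]) (rule assms)
  thus ?thesis using isPiv_unique assms by blast
qed

lemma th_pos: assumes "i < 2 * g" shows "0 < YS div 2 ^ (i div 2 + 1)"
proof -
  have "(2::nat) ^ (i div 2 + 1) \<le> 2 ^ (6 * g)" using assms by (intro power_increasing) auto
  thus ?thesis unfolding YS_def by (simp only: div_greater_zero_iff) simp
qed

lemma YS_div: "i < 2 * g \<Longrightarrow> YS div 2 ^ (i div 2 + 1) * 2 ^ (i div 2 + 1) = YS"
  unfolding YS_def by (intro dvd_div_mult_self le_imp_power_dvd) simp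

lemma pv_isPiv:
  "i < 2 * g \<Longrightarrow> isPiv (i mod 2) (Rs L sd (i mod 2)) (Ss L sd (i mod 2)) (YS div 2 ^ (i div 2 + 1)) (pv L sd i)"
  unfolding pv_def using th_pos[of i] YR_pos YS_pos
  by (intro piv_isPiv) (auto simp flip: length_0_conv)

lemma casc_props:
  "proper L \<Longrightarrow> d < 2 \<Longrightarrow> distinct (casc L sd i d) \<and> set (casc L sd i d) \<subseteq> set (L d) \<and>
     length (casc L sd i d) \<le> length (L d)"
  by (induction i) (auto simp: proper_def intro: le_trans[OF length_filter_le])

lemma proper_casc: "proper L \<Longrightarrow> proper (casc L sd i)"
  unfolding proper_def using casc_props[of L _ sd i] by (meson proper_def subset_trans)

lemma strong_props:
  assumes "proper L"
  shows "distinct (strong L sd i) \<and> set (strong L sd i) \<subseteq> set (casc L sd i (i mod 2)) \<and>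
    length (strong L sd i) \<le> length (casc L sd i (i mod 2))"
proof -
  have "distinct (casc L sd i (i mod 2))" using casc_props[OF assms, of "i mod 2"] by simp
  hence "distinct (strong L sd i)"
    unfolding strong_def by (subst distinct_map) (auto simp: inj_on_def nth_eq_iff_index_eq)
  moreover have "length (strong L sd i) \<le> length (casc L sd i (i mod 2))"
    unfolding strong_def by (simp, rule le_trans[OF length_filter_le]) simp
  ultimately show ?thesis by (auto simp: strong_def)
qed

lemma outcome_props:
  assumes "proper L" "d < 2"
  shows "distinct (outcome L sd i d) \<and> set (outcome L sd i d) \<subseteq> set (L d) \<and>
    length (outcome L sd i d) \<le> length (L d)"
  using strong_props[OF assms(1), of sd i] casc_props[OF assms, of sd i] casc_props[OF assms(1), of "i mod 2" sd i]
  by (auto simp: outcome_def intro: le_trans)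

lemma reduce_props:
  assumes "proper L" "d < 2"
  shows "distinct (reduce L sd d) \<and> set (reduce L sd d) \<subseteq> set (L d) \<and>
    length (reduce L sd d) \<le> length (L d)"
  using outcome_props[OF assms] casc_props[OF assms] assms by (auto simp: reduce_def proper_def)

lemma proper_reduce: "proper L \<Longrightarrow> proper (reduce L sd)"
  unfolding proper_def using reduce_props[of L _ sd] by (meson proper_def subset_trans)

text \<open>\<open>e 0\<close> is the row and \<open>e 1\<close> the column. Orientation 0 makes the
  entry a row maximum, orientation 1, through the negation, a column minimum. Distinct entries turn
  the weak inequalities into strict ones.\<close>

definition sad :: "(nat \<Rightarrow> nat) \<Rightarrow> bool" where
  "sad e \<longleftrightarrow> (\<forall>d<2. e d < n \<and> (\<forall>b<n. Vo d (e d) b \<le> Vo d (e d) (e (1 - d))))"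

lemma sad_row: "sad e \<Longrightarrow> d < 2 \<Longrightarrow> b < n \<Longrightarrow> Vo d (e d) b \<le> Vo d (e d) (e (1 - d))"
  by (auto simp: sad_def)

lemma sad_col: "sad e \<Longrightarrow> d < 2 \<Longrightarrow> a < n \<Longrightarrow> Vo d (e d) (e (1 - d)) \<le> Vo d a (e (1 - d))"
  using sad_row[of e "1 - d" a] by (auto simp: Vo_def less_2_cases_iff)

section \<open>Reductions keep the saddlepoint\<close>

definition keeps :: "(nat \<Rightarrow> nat) \<Rightarrow> (nat \<Rightarrow> nat list) \<Rightarrow> bool" where
  "keeps e L \<longleftrightarrow> (\<forall>d<2. e d \<in> set (L d))"

lemma pv_less:
  assumes "proper L" "L 0 \<noteq> []" "L 1 \<noteq> []" "i < 2 * g"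
  shows "fst (pv L sd i) < n \<and> snd (pv L sd i) < n"
proof -
  have d: "i mod 2 < 2" "1 - i mod 2 < 2" by auto
  hence ne: "L (i mod 2) \<noteq> []" "L (1 - i mod 2) \<noteq> []"
    using assms(2,3) by (auto simp: less_2_cases_iff)
  show ?thesis
    using pv_isPiv[OF assms(4), of L sd] set_Rs[of L "i mod 2" sd] set_Ss[of L "i mod 2" sd] ne assms(1) d
    unfolding isPiv_def proper_def by blast
qed

lemma keeps_casc_Suc:
  assumes "proper L" "L 0 \<noteq> []" "L 1 \<noteq> []" "i < 2 * g" "sad e" "keeps e (casc L sd i)" "walks L sd i"
  shows "keeps e (casc L sd (Suc i))"
proof -
  let ?d = "i mod 2" and ?x = "pv L sd i"
  have d: "?d < 2" "1 - ?d < 2" by auto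
  have "e ?d \<in> set (casc L sd i ?d)" using assms(6) d by (auto simp: keeps_def)
  then obtain j where j: "j \<in> set (casc L sd i (1 - ?d))" "above ?d ?x (e ?d) j"
    using walk_True[OF assms(7)[unfolded walks_def]] by blast
  have jn: "j < n" using properD[OF proper_casc[OF assms(1)] d(2) j(1)] .
  have "Vo ?d (fst ?x) (snd ?x) < Vo ?d (e ?d) j" using j(2) by (simp add: above_def)
  also have "\<dots> \<le> Vo ?d (e ?d) (e (1 - ?d))" using sad_row[OF assms(5) d(1) jn] .
  also have "\<dots> \<le> Vo ?d (fst ?x) (e (1 - ?d))"
    using sad_col[OF assms(5) d(1)] pv_less[OF assms(1-4)] by blast
  finally have "above ?d ?x (fst ?x) (e (1 - ?d))" by (simp add: above_def)
  thus ?thesis using assms(6) by (auto simp: keeps_def)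
qed

lemma keeps_strong:
  assumes "proper L" "i < 2 * g" "L 0 \<noteq> []" "L 1 \<noteq> []" "sad e" "keeps e (casc L sd i)" "\<not> walks L sd i"
  shows "e (i mod 2) \<in> set (strong L sd i)"
proof -
  let ?d = "i mod 2" and ?x = "pv L sd i"
  let ?xs = "casc L sd i ?d"
  have d: "?d < 2" "1 - ?d < 2" by auto
  have "e (1 - ?d) \<in> set (casc L sd i (1 - ?d))" using assms(6) d by (auto simp: keeps_def)
  then obtain a where a: "a \<in> set ?xs" "\<not> above ?d ?x a (e (1 - ?d))"
    using walk_False[OF assms(7)[unfolded walks_def]] by blast
  have "a < n" using properD[OF proper_casc[OF assms(1)] d(1) a(1)] .
  hence v: "Vo ?d (e ?d) (e (1 - ?d)) \<le> Vo ?d (fst ?x) (snd ?x)"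
    using sad_col[OF assms(5) d(1), of a] a(2) by (simp add: above_def)
  obtain p where p: "p < length ?xs" "?xs ! p = e ?d"
    using assms(6) d(1) unfolding keeps_def in_set_conv_nth by blast
  have "\<not> killed L sd i p"
  proof
    assume "killed L sd i p"
    then obtain q where q: "q < YS" "above ?d ?x (e ?d) (Ss L sd ?d ! q)"
      by (auto simp: killed_def tmiss_def misses_def hits_def p)
    have "Ss L sd ?d ! q \<in> set (L (1 - ?d))"
      using set_Ss[of L ?d sd] q(1) assms(3,4) d by (metis length_Ss less_2_cases nth_mem subsetD One_nat_def)
    hence "Ss L sd ?d ! q < n" by (rule properD[OF assms(1) d(2)])
    thus False using q(2) v sad_row[OF assms(5) d(1), of "Ss L sd ?d ! q"] by (simp add: above_def)
  qed
  thus ?thesis unfolding strong_def using p by (auto intro!: image_eqI[of _ _ p])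
qed

lemma keeps_reduce:
  assumes "proper L" "sad e" "keeps e L"
  shows "keeps e (reduce L sd)"
proof (cases "L 0 = [] \<or> L 1 = []")
  case False
  have casc: "keeps e (casc L sd i)" if "i \<le> 2 * g" "\<forall>i'<i. \<not> stop L sd i'" for i
    using that
  proof (induction i)
    case (Suc i)
    hence "walks L sd i" by (simp add: stop_def)
    thus ?case using False assms Suc by (intro keeps_casc_Suc) auto
  qed (use assms in auto)
  show ?thesis
  proof (cases "\<exists>i<2 * g. stop L sd i")
    case True
    let ?i = "LEAST i. stop L sd i"
    from True obtain i0 where i0: "i0 < 2 * g" "stop L sd i0" by blast
    have i: "stop L sd ?i" "?i < 2 * g" using i0 LeastI[of "stop L sd"] Least_le[of "stop L sd" i0] by auto
    have c: "keeps e (casc L sd ?i)" using casc[of ?i] i not_less_Least by (metis less_imp_le)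
    have "keeps e (outcome L sd ?i)"
      using c keeps_strong[OF assms(1) i(2) _ _ assms(2) c] False i(1)
      by (auto simp: outcome_def stop_def keeps_def)
    thus ?thesis using True False by (simp add: reduce_def)
  next
    case nostop: False
    thus ?thesis using casc[of "2 * g"] False by (auto simp: reduce_def)
  qed
qed (use assms in \<open>auto simp: reduce_def\<close>)

end

section \<open>Conditioning and counting tools\<close>

lemma prb_pair_snd_le:
  assumes "finite (set_pmf p)" "finite (set_pmf q)" "\<And>x. x \<in> set_pmf p \<Longrightarrow> prb q {y. (x, y) \<in> A} \<le> c"
  shows "prb (pair_pmf p q) A \<le> c"
proof -
  have "prb (bind_pmf p (\<lambda>x. map_pmf (\<lambda>y. (x, y)) q)) A \<le> c"
    using assms by (intro prb_bind_le) (auto simp: vimage_def)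
  thus ?thesis by (simp add: pair_pmf_def map_pmf_def)
qed

lemma prb_pair_fst_le:
  assumes "finite (set_pmf p)" "finite (set_pmf q)" "\<And>y. y \<in> set_pmf q \<Longrightarrow> prb p {x. (x, y) \<in> A} \<le> c"
  shows "prb (pair_pmf p q) A \<le> c"
proof -
  have "prb (bind_pmf q (\<lambda>y. map_pmf (\<lambda>x. (x, y)) p)) A \<le> c"
    using assms by (intro prb_bind_le) (auto simp: vimage_def)
  moreover have "bind_pmf q (\<lambda>y. map_pmf (\<lambda>x. (x, y)) p) = pair_pmf p q"
    unfolding pair_pmf_def map_pmf_def by (subst bind_commute_pmf) simp
  ultimately show ?thesis by simp
qed

lemma prb_Un_le: "prb p (A \<union> B) \<le> prb p A + prb p B"
  by (rule measure_Un_le) auto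

lemma prb_UN_le:
  assumes "finite I" "\<And>i. i \<in> I \<Longrightarrow> prb p (A i) \<le> c" "real (card I) \<le> m" "0 \<le> c"
  shows "prb p (\<Union>i\<in>I. A i) \<le> m * c"
proof -
  have "prb p (\<Union>i\<in>I. A i) \<le> (\<Sum>i\<in>I. prb p (A i))"
    using assms by (intro measure_pmf.finite_measure_subadditive_finite) auto
  also have "\<dots> \<le> card I * c" using sum_bounded_above[of I "\<lambda>i. prb p (A i)" c] assms by simp
  also have "\<dots> \<le> m * c" using assms by (intro mult_right_mono) auto
  finally show ?thesis .
qed

lemma length_filter_distinct_le:
  assumes "distinct xs" "set xs \<subseteq> set ys"
  shows "length (filter P xs) \<le> length (filter P ys)"
proof -
  have "length (filter P xs) = card (set (filter P xs))"
    using assms by (intro distinct_card[symmetric]) auto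
  also have "\<dots> \<le> card (set (filter P ys))" using assms by (intro card_mono) auto
  also have "\<dots> \<le> length (filter P ys)" by (rule card_length)
  finally show ?thesis .
qed

lemma nat_ceiling_bounds:
  fixes x :: real
  assumes "0 < x"
  shows "x \<le> nat \<lceil>x\<rceil>" "0 < nat \<lceil>x\<rceil>" "c < nat \<lceil>x\<rceil> \<longleftrightarrow> real c < x"
proof -
  show "x \<le> nat \<lceil>x\<rceil>" by linarith
  show "0 < nat \<lceil>x\<rceil>" using assms by simp
  show "c < nat \<lceil>x\<rceil> \<longleftrightarrow> real c < x" by linarith
qed

lemma divide_mult_antimono:
  fixes a b c s :: real
  shows "0 < a \<Longrightarrow> a \<le> b \<Longrightarrow> 0 < s \<Longrightarrow> 0 \<le> c \<Longrightarrow> c / (s * b) \<le> c / (s * a)"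
  by (intro divide_left_mono mult_left_mono mult_pos_pos) auto

context game
begin

section \<open>Success probability of a reduction\<close>

text \<open>
  The three ways in which the samples can mislead a reduction: the column sample underrepresents the top
  part of a sampled row (\<open>bad1\<close>); the row sample avoids the rows with the lowest empirical quantiles \<open>tau\<close>
  (\<open>bad2\<close>), so that the pivot is too large; the tests are too expensive or spare too many rows (\<open>bad3\<close>).
\<close>

definition TT :: "(nat \<Rightarrow> nat list) \<Rightarrow> nat \<Rightarrow> nat \<Rightarrow> nat \<Rightarrow> nat set" where
  "TT L d r a = {p \<in> {..<length (L (1 - d))}.
     card {p' \<in> {..<length (L (1 - d))}. - Vo d a (L (1 - d) ! p') < - Vo d a (L (1 - d) ! p)}
       < nat \<lceil>8 * real (length (L (1 - d))) / 2 ^ r\<rceil>}"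

definition bad1 :: "(nat \<Rightarrow> nat list) \<Rightarrow> seeds \<Rightarrow> nat \<Rightarrow> nat \<Rightarrow> bool" where
  "bad1 L sd d r \<longleftrightarrow> 3 \<le> r \<and> (\<exists>a\<in>set (Rs L sd d).
     real (card {q. q < YS \<and> idx (seedS d sd) (length (L (1 - d))) q \<in> TT L d r a})
       < YS * card (TT L d r a) / (4 * length (L (1 - d))))"

definition tau :: "nat \<Rightarrow> nat list \<Rightarrow> nat \<Rightarrow> nat \<Rightarrow> int" where
  "tau d S th a = Min (Vo d a ` {b \<in> set S. cnt d S a b < th})"

text \<open>Positions of the rows with smallest quantile, a fraction \<open>1 / y ^ 3\<close>. A
  sampled row from this set bounds the pivot by its own quantile, so that only few rows can have a
  quantile below the pivot.\<close>

definition T2 :: "(nat \<Rightarrow> nat list) \<Rightarrow> nat \<Rightarrow> nat list \<Rightarrow> nat \<Rightarrow> nat set" where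
  "T2 L d S th = {p \<in> {..<length (L d)}.
     card {p' \<in> {..<length (L d)}. tau d S th (L d ! p') < tau d S th (L d ! p)}
       < nat \<lceil>real (length (L d)) / y ^ 3\<rceil>}"

definition bad2 :: "(nat \<Rightarrow> nat list) \<Rightarrow> seeds \<Rightarrow> nat \<Rightarrow> nat \<Rightarrow> bool" where
  "bad2 L sd d r \<longleftrightarrow> real (card {q. q < YR \<and> idx (seedR d sd) (length (L d)) q \<in> T2 L d (Ss L sd d) (YS div 2 ^ r)})
       < YR * card (T2 L d (Ss L sd d) (YS div 2 ^ r)) / (4 * length (L d))"

text \<open>The rows for which the tests are reliable: at least a fraction \<open>1 / 2 ^ r\<close>
  of the sampled columns is above the pivot (\<open>card_hits\<close>). The row of the pivot is
  excluded since it may merely attain the pivot value.\<close>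

definition GG :: "(nat \<Rightarrow> nat list) \<Rightarrow> seeds \<Rightarrow> nat \<Rightarrow> nat set" where
  "GG L sd i = {p. p < length (casc L sd i (i mod 2)) \<and> casc L sd i (i mod 2) ! p \<noteq> fst (pv L sd i) \<and>
     Vo (i mod 2) (fst (pv L sd i)) (snd (pv L sd i))
       \<le> tau (i mod 2) (Ss L sd (i mod 2)) (YS div 2 ^ (i div 2 + 1)) (casc L sd i (i mod 2) ! p)}"

text \<open>The size condition belongs to the event, so that the probability can be bounded with all
  other seeds fixed; outside \<open>bad\<close> it holds by
  \<open>casc_current_size\<close>.\<close>

definition bad3 :: "(nat \<Rightarrow> nat list) \<Rightarrow> seeds \<Rightarrow> nat \<Rightarrow> bool" where
  "bad3 L sd i \<longleftrightarrow> length (casc L sd i (i mod 2)) * 2 ^ (i div 2 + 1) \<le> 16 * length (L (i mod 2)) \<and>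
     (3 * 2 ^ (i div 2 + 1) * real (card (GG L sd i)) + n \<le> (\<Sum>p\<in>GG L sd i. real (tcost L sd i p)) \<or>
      length (L (i mod 2)) / real y \<le> card {p \<in> GG L sd i. tmiss L sd i p})"

definition bad :: "(nat \<Rightarrow> nat list) \<Rightarrow> seeds \<Rightarrow> bool" where
  "bad L sd \<longleftrightarrow> (\<exists>i<2 * g. bad1 L sd (i mod 2) (i div 2 + 1) \<or> bad2 L sd (i mod 2) (i div 2 + 1) \<or> bad3 L sd i)"

abbreviation W :: "(nat \<times> nat) pmf" where "W \<equiv> UU (2 * k)"

definition SD :: "seeds pmf" where
  "SD = pair_pmf (pair_pmf (pair_pmf W W) (pair_pmf W W)) (quad_seeds k)"

lemma YS_le: "YS \<le> 2 ^ k" and YR_le: "YR \<le> 2 ^ k"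
  using gk unfolding YS_def YR_def by (auto intro!: power_increasing)

text \<open>Conditioning on everything except the seeds of one column sample: the case distinction
  reassembles all seeds from the pair \<open>ss\<close> of orientation \<open>d\<close> and the
  rest.\<close>

lemma SD_S_le:
  assumes "\<And>rr x. prb W {ss. ((if d = 0 then (((rr, ss), fst x), snd x) else ((fst x, (rr, ss)), snd x)) :: seeds) \<in> A} \<le> c" "d < 2"
  shows "prb SD A \<le> c"
proof (cases "d = 0")
  case True
  have "prb W {ss. (((rr, ss), x), z) \<in> A} \<le> c" for rr x z using assms(1)[of rr "(x, z)"] True by simp
  thus ?thesis unfolding SD_def
    by - (rule prb_pair_fst_le, simp, simp, rule prb_pair_fst_le, simp, simp, rule prb_pair_snd_le, simp, simp, simp)
next
  case False
  have "prb W {ss. ((x, (rr, ss)), z) \<in> A} \<le> c" for rr x z using assms(1)[of rr "(x, z)"] False by simp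
  thus ?thesis unfolding SD_def
    by - (rule prb_pair_fst_le, simp, simp, rule prb_pair_snd_le, simp, simp, rule prb_pair_snd_le, simp, simp, simp)
qed

lemma SD_R_le:
  assumes "\<And>ss x. prb W {rr. ((if d = 0 then (((rr, ss), fst x), snd x) else ((fst x, (rr, ss)), snd x)) :: seeds) \<in> A} \<le> c" "d < 2"
  shows "prb SD A \<le> c"
proof (cases "d = 0")
  case True
  have "prb W {rr. (((rr, ss), x), z) \<in> A} \<le> c" for ss x z using assms(1)[of ss "(x, z)"] True by simp
  thus ?thesis unfolding SD_def
    by - (rule prb_pair_fst_le, simp, simp, rule prb_pair_fst_le, simp, simp, rule prb_pair_fst_le, simp, simp, simp)
next
  case False
  have "prb W {rr. ((x, (rr, ss)), z) \<in> A} \<le> c" for ss x z using assms(1)[of ss "(x, z)"] False by simp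
  thus ?thesis unfolding SD_def
    by - (rule prb_pair_fst_le, simp, simp, rule prb_pair_snd_le, simp, simp, rule prb_pair_fst_le, simp, simp, simp)
qed

lemma y_real: "1 \<le> real y" using y_pos by simp

lemma power_r_le: "i < 2 * g \<Longrightarrow> (2::nat) ^ (i div 2 + 1) \<le> y"
  unfolding y_def by (intro power_increasing) auto

lemma card_TT:
  assumes "3 \<le> r" "L (1 - d) \<noteq> []"
  shows "8 * real (length (L (1 - d))) / 2 ^ r \<le> card (TT L d r a)"
proof -
  let ?m = "length (L (1 - d))"
  have "(8::real) \<le> 2 ^ r" using power_increasing[of 3 r "2::real"] assms by simp
  hence "8 * real ?m \<le> 2 ^ r * real ?m" by (rule mult_right_mono) simp
  hence "8 * real ?m / 2 ^ r \<le> ?m" by (simp add: field_simps)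
  hence h: "nat \<lceil>8 * real ?m / 2 ^ r\<rceil> \<le> card {..<?m}" by simp
  have "nat \<lceil>8 * real ?m / 2 ^ r\<rceil> \<le> card (TT L d r a)"
    unfolding TT_def by (rule rank_card[OF finite_lessThan h])
  thus ?thesis by linarith
qed

text \<open>The row sample has seeds of its own. Once these are fixed, \<open>Rs\<close> is a fixed
  list of \<open>YR\<close> rows, each misrepresented by the column sample with probability at most
  \<open>2 ^ r / YS\<close>; the union bound gives at most \<open>y ^ 4 * y / y ^ 6\<close>.\<close>

lemma prb_bad1:
  assumes "proper L" "L 0 \<noteq> []" "L 1 \<noteq> []" "i < 2 * g"
  shows "prb SD {sd. bad1 L sd (i mod 2) (i div 2 + 1)} \<le> 1 / y"
proof (cases "3 \<le> i div 2 + 1")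
  case True
  let ?d = "i mod 2" and ?r = "i div 2 + 1"
  let ?m = "length (L (1 - ?d))"
  have ne: "L (1 - ?d) \<noteq> []" using assms(2,3) by (cases "?d = 0") auto
  have "?m \<le> n" by (rule proper_length[OF assms(1)]) simp
  hence m: "0 < ?m" "?m \<le> 2 ^ k" using ne n_less by auto
  define E where "E a = {ab. real (card {q. q < YS \<and> idx ab ?m q \<in> TT L ?d ?r a}) <
      YS * card (TT L ?d ?r a) / (4 * ?m)}" for a
  have E: "prb W (E a) \<le> 2 ^ ?r / YS" for a
  proof -
    have c: "8 * real ?m / 2 ^ ?r \<le> card (TT L ?d ?r a)" using card_TT[of ?r L ?d a] True ne by blast
    hence pos: "0 < real (card (TT L ?d ?r a))" using m by (smt (verit) divide_pos_pos of_nat_0_less_iff zero_less_power)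
    have sub: "TT L ?d ?r a \<subseteq> {..<?m}" by (auto simp: TT_def)
    have ne': "TT L ?d ?r a \<noteq> {}" using pos by auto
    have "prb W (E a) \<le> 8 * real ?m / (real YS * real (card (TT L ?d ?r a)))"
      using sample_count[OF m sub ne' YS_pos YS_le] unfolding E_def idx_def by (simp add: case_prod_beta')
    also have "\<dots> \<le> 8 * real ?m / (real YS * (8 * real ?m / 2 ^ ?r))"
    proof (rule divide_mult_antimono)
      show "0 < 8 * real ?m / 2 ^ ?r" using m(1) by simp
    qed (use c YS_pos in simp_all)
    also have "\<dots> = 2 ^ ?r / YS" using m by (simp add: field_simps)
    finally show ?thesis .
  qed
  show ?thesis
  proof (rule SD_S_le[where d = ?d])
    fix rr x
    define mk where "mk ss = ((if ?d = 0 then (((rr, ss), fst x), snd x) else ((fst x, (rr, ss)), snd x)) :: seeds)" for ss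
    define R0 where "R0 = Rs L (mk (0, 0)) ?d"
    have R: "Rs L (mk ss) ?d = R0" for ss
      by (simp add: R0_def Rs_def mk_def seedR_def)
    have S: "seedS ?d (mk ss) = ss" for ss by (simp add: mk_def seedS_def)
    have "{ss. mk ss \<in> {sd. bad1 L sd ?d ?r}} \<subseteq> (\<Union>a\<in>set R0. E a)"
      unfolding bad1_def E_def by (auto simp: S R)
    hence "prb W {ss. mk ss \<in> {sd. bad1 L sd ?d ?r}} \<le> prb W (\<Union>a\<in>set R0. E a)"
      by (intro prb_mono) auto
    also have "\<dots> \<le> real YR * (2 ^ ?r / YS)"
      using E card_length[of R0] R0_def by (intro prb_UN_le) auto
    also have "\<dots> \<le> real YR * (real y / YS)"
      using of_nat_mono[OF power_r_le[OF assms(4)], where 'a = real]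
      by (intro mult_left_mono divide_right_mono) auto
    also have "\<dots> = 1 / y" using y_real by (simp add: YR_eq YS_eq field_simps eval_nat_numeral)
    finally show "prb W {ss. ((if ?d = 0 then (((rr, ss), fst x), snd x) else ((fst x, (rr, ss)), snd x)) :: seeds)
        \<in> {sd. bad1 L sd ?d ?r}} \<le> 1 / y" by (simp add: mk_def)
  qed simp
qed (simp add: bad1_def)

text \<open>Here the column sample is fixed first. It determines \<open>tau\<close> and with it
  \<open>T2\<close>, while the row sample is still fresh.\<close>

lemma prb_bad2:
  assumes "proper L" "L 0 \<noteq> []" "L 1 \<noteq> []" "i < 2 * g"
  shows "prb SD {sd. bad2 L sd (i mod 2) (i div 2 + 1)} \<le> 8 / y"
proof -
  let ?d = "i mod 2" and ?r = "i div 2 + 1"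
  let ?m = "length (L ?d)"
  have ne: "L ?d \<noteq> []" using assms(2,3) by (cases "?d = 0") auto
  have m: "0 < ?m" "?m \<le> 2 ^ k"
    using ne proper_length[OF assms(1), of "?d"] n_less by auto
  have c: "?m / y ^ 3 \<le> card (T2 L ?d S th)" for S th
  proof -
    have "real ?m / y ^ 3 \<le> ?m / 1" using y_real m by (intro divide_left_mono) auto
    hence h: "nat \<lceil>?m / y ^ 3\<rceil> \<le> card {..<?m}" by simp
    have "nat \<lceil>?m / y ^ 3\<rceil> \<le> card (T2 L ?d S th)"
      unfolding T2_def by (rule rank_card[OF finite_lessThan h])
    thus ?thesis by linarith
  qed
  have E: "prb W {ab. real (card {q. q < YR \<and> idx ab ?m q \<in> T2 L ?d S th}) < YR * card (T2 L ?d S th) / (4 * ?m)}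
      \<le> 8 / y" for S th
  proof -
    have pos0: "0 < ?m / y ^ 3" using m y_real by simp
    hence pos: "0 < real (card (T2 L ?d S th))" using c[of S th] by linarith
    have sub: "T2 L ?d S th \<subseteq> {..<?m}" by (auto simp: T2_def)
    have ne': "T2 L ?d S th \<noteq> {}" using pos by auto
    have "prb W {ab. real (card {q. q < YR \<and> idx ab ?m q \<in> T2 L ?d S th}) < YR * card (T2 L ?d S th) / (4 * ?m)}
        \<le> 8 * real ?m / (real YR * real (card (T2 L ?d S th)))"
      using sample_count[OF m sub ne' YR_pos YR_le] unfolding idx_def by (simp add: case_prod_beta')
    also have "\<dots> \<le> 8 * real ?m / (real YR * (?m / y ^ 3))"
      using c[of S th] pos0 YR_pos by (intro divide_mult_antimono) simp_all
    also have "\<dots> = 8 / y" using m y_real by (simp add: YR_eq field_simps eval_nat_numeral)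
    finally show ?thesis .
  qed
  show ?thesis
  proof (rule SD_R_le[where d = ?d])
    fix ss x
    define mk where "mk rr = ((if ?d = 0 then (((rr, ss), fst x), snd x) else ((fst x, (rr, ss)), snd x)) :: seeds)" for rr
    define S0 where "S0 = Ss L (mk (0, 0)) ?d"
    have S: "Ss L (mk rr) ?d = S0" for rr
      by (simp add: S0_def Ss_def mk_def seedS_def)
    have R: "seedR ?d (mk rr) = rr" for rr by (simp add: mk_def seedR_def)
    have "prb W {rr. mk rr \<in> {sd. bad2 L sd ?d ?r}} \<le> 8 / y"
      unfolding bad2_def mem_Collect_eq R S by (rule E)
    thus "prb W {rr. ((if ?d = 0 then (((rr, ss), fst x), snd x) else ((fst x, (rr, ss)), snd x)) :: seeds)
        \<in> {sd. bad2 L sd ?d ?r}} \<le> 8 / y" by (simp add: mk_def)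
  qed simp
qed

lemma pv_indep: "pv L (x, q) i = pv L (x, q') i"
proof -
  have "Rs L (x, q) d = Rs L (x, q') d" "Ss L (x, q) d = Ss L (x, q') d" for d
    by (simp_all add: Rs_def Ss_def seedR_def seedS_def)
  thus ?thesis by (simp add: pv_def)
qed

lemma Ss_indep: "Ss L (x, q) d = Ss L (x, q') d"
  by (simp add: Ss_def seedS_def)

lemma casc_indep: "casc L (x, q) i = casc L (x, q') i"
  by (induction i) (simp_all add: pv_indep[of L x q _ q'])

lemma piv_row_less:
  assumes "proper L" "L 0 \<noteq> []" "L 1 \<noteq> []" "q < YS" "d < 2"
  shows "Ss L sd d ! q < n"
proof -
  have "L (1 - d) \<noteq> []" using assms(2,3) by (cases "d = 0") auto
  from set_Ss[of L d sd, OF this] have "Ss L sd d ! q \<in> set (L (1 - d))" using assms(4) by (metis length_Ss nth_mem subsetD)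
  thus ?thesis using properD[OF assms(1), of "1 - d"] by auto
qed

text \<open>At least \<open>YS div 2 ^ r\<close> sample positions have an entry not below the
  quantile \<open>tau\<close>, which in turn is at least the pivot. The inequality is strict because
  the entries are distinct and the row is not that of the pivot.\<close>

lemma card_hits:
  assumes "proper L" "L 0 \<noteq> []" "L 1 \<noteq> []" "i < 2 * g" "p \<in> GG L sd i"
  shows "hits L sd i p \<subseteq> {..<2 ^ (6 * g)}" "2 ^ (6 * g) \<le> card (hits L sd i p) * 2 ^ (i div 2 + 1)"
proof -
  let ?d = "i mod 2" and ?th = "YS div 2 ^ (i div 2 + 1)" and ?S = "Ss L sd (i mod 2)"
  let ?a = "casc L sd i (i mod 2) ! p" and ?x = "pv L sd i"
  show sub: "hits L sd i p \<subseteq> {..<2 ^ (6 * g)}" by (auto simp: hits_def YS_def)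
  have a: "?a < n"
    using assms(5) properD[OF proper_casc[OF assms(1)], of ?d ?a sd i] by (auto simp: GG_def)
  have fin: "finite (Vo ?d ?a ` {b \<in> set ?S. cnt ?d ?S ?a b < ?th})" by simp
  let ?Q = "{q \<in> {..<YS}. card {q' \<in> {..<YS}. - Vo ?d ?a (?S ! q') < - Vo ?d ?a (?S ! q)} < ?th}"
  have "?Q \<subseteq> hits L sd i p"
  proof
    fix q assume q: "q \<in> ?Q"
    have "card {q' \<in> {..<YS}. - Vo ?d ?a (?S ! q') < - Vo ?d ?a (?S ! q)} = cnt ?d ?S ?a (?S ! q)"
      unfolding cnt_def using card_positions[of ?S "\<lambda>j. Vo ?d ?a (?S ! q) < Vo ?d ?a j"] by simp
    hence "?S ! q \<in> {b \<in> set ?S. cnt ?d ?S ?a b < ?th}" using q by auto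
    hence "tau ?d ?S ?th ?a \<le> Vo ?d ?a (?S ! q)" unfolding tau_def using fin by (intro Min_le) auto
    hence "Vo ?d (fst ?x) (snd ?x) \<le> Vo ?d ?a (?S ! q)" using assms(5) by (auto simp: GG_def)
    moreover have "Vo ?d (fst ?x) (snd ?x) \<noteq> Vo ?d ?a (?S ! q)"
      using Vo_inj[of "fst ?x" "snd ?x" ?a "?S ! q" ?d] pv_less[OF assms(1-4), of sd] a
        piv_row_less[OF assms(1-3), of q ?d sd] q assms(5) by (auto simp: GG_def)
    ultimately show "q \<in> hits L sd i p" using q by (simp add: hits_def above_def)
  qed
  hence "card ?Q \<le> card (hits L sd i p)" using sub by (intro card_mono) (auto intro: finite_subset)
  moreover have "?th \<le> card ?Q" by (rule rank_card) auto
  ultimately have "?th * 2 ^ (i div 2 + 1) \<le> card (hits L sd i p) * 2 ^ (i div 2 + 1)" by simp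
  thus "2 ^ (6 * g) \<le> card (hits L sd i p) * 2 ^ (i div 2 + 1)"
    unfolding YS_div[OF assms(4)] by (simp only: YS_def)
qed

lemma n_ge_y4: "real y ^ 4 \<le> n"
proof -
  have "y ^ 4 \<le> y ^ 20" using y_pos by (intro power_increasing) auto
  hence "y ^ 4 \<le> n" using y20 by simp
  thus ?thesis by (metis of_nat_le_iff of_nat_power)
qed

lemma prb_bad3:
  assumes "proper L" "L 0 \<noteq> []" "L 1 \<noteq> []" "i < 2 * g"
  shows "prb SD {sd. bad3 L sd i} \<le> 49 / y"
  unfolding SD_def
proof (rule prb_pair_snd_le)
  fix x :: "((nat \<times> nat) \<times> nat \<times> nat) \<times> (nat \<times> nat) \<times> nat \<times> nat"
  let ?r = "i div 2 + 1" and ?d = "i mod 2"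
  \<comment> \<open>Lists, pivots and samples do not depend on the test seeds
    (\<open>casc_indep\<close>, \<open>pv_indep\<close>, \<open>Ss_indep\<close>), so any value may
    complete \<open>x\<close>.\<close>
  define sd where "sd = (x, undefined :: ((nat \<times> nat) \<times> nat \<times> nat) \<times> (nat \<times> nat) \<times> nat \<times> nat)"
  let ?m = "length (L ?d)"
  let ?G = "GG L sd i" and ?H = "hits L sd i" and ?xs = "casc L sd i ?d"
  have ne: "L ?d \<noteq> []" using assms(2,3) by (cases "?d = 0") auto
  have m: "0 < ?m" "?m \<le> n" using ne proper_length[OF assms(1), of ?d] by auto
  have xs: "casc L (x, q) i = casc L sd i" for q unfolding sd_def by (rule casc_indep)
  have pvs: "pv L (x, q) i = pv L sd i" for q unfolding sd_def by (rule pv_indep)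
  have Sss: "Ss L (x, q) d = Ss L sd d" for q d unfolding sd_def by (rule Ss_indep)
  have G: "GG L (x, q) i = ?G" for q unfolding GG_def xs pvs Sss ..
  have H: "hits L (x, q) i = ?H" for q unfolding fun_eq_iff hits_def xs pvs Sss by simp
  have Gsub: "?G \<subseteq> {..<length ?xs}" by (auto simp: GG_def)
  have lxs: "length ?xs \<le> ?m" using casc_props[OF assms(1), of ?d sd i] by simp
  have cG: "card ?G \<le> length ?xs" using card_mono[OF _ Gsub] by simp
  have Gk: "?G \<subseteq> {..<2 ^ k}" using Gsub lxs m n_less by auto
  have z: "6 * g \<le> k" "YD \<le> 2 ^ (k - 6 * g)"
    using gk unfolding YD_def by (auto intro!: power_increasing)
  have HH: "?H p \<subseteq> {..<2 ^ (6 * g)} \<and> 2 ^ (6 * g) \<le> card (?H p) * 2 ^ ?r" if "p \<in> ?G" for p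
    using card_hits[OF assms that] by blast
  let ?A = "{q. 3 * real (2 ^ ?r) * card ?G + n \<le> (\<Sum>p\<in>?G. real (cost k (6 * g) (?H p) YD (quad k p q)))}"
  let ?B = "{q. ?m / real y \<le> card {p \<in> ?G. misses k (6 * g) (?H p) (quad k p q) YD}}"
  show "prb (quad_seeds k) {q. (x, q) \<in> {sd. bad3 L sd i}} \<le> 49 / y"
  proof (cases "length ?xs * 2 ^ ?r \<le> 16 * ?m")
    case True
    have "prb (quad_seeds k) ?A \<le> 3 * 2 ^ ?r * real (card ?G) * real YD / (real n)\<^sup>2"
      using tests_cost[OF z Gk, of "2 ^ ?r" "real n" ?H] HH n_pos by simp
    \<comment> \<open>48 is 3 times the 16 of the size condition. With \<open>YD = y ^ 3\<close> and
      \<open>n \<ge> y ^ 4\<close> the quotient drops to \<open>48 / y\<close>.\<close>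
    also have "\<dots> \<le> 48 * real n * YD / (real n)\<^sup>2"
    proof -
      have "2 ^ ?r * card ?G \<le> 2 ^ ?r * length ?xs" by (rule mult_left_mono[OF cG]) simp
      also have "\<dots> = length ?xs * 2 ^ ?r" by (rule mult.commute)
      also have "\<dots> \<le> 16 * ?m" by (rule True)
      also have "\<dots> \<le> 16 * n" using m(2) by simp
      finally have "2 ^ ?r * card ?G \<le> 16 * n" .
      hence "real (2 ^ ?r * card ?G) \<le> real (16 * n)" by (rule of_nat_mono)
      hence "3 * 2 ^ ?r * real (card ?G) \<le> 48 * real n" by simp
      hence "3 * 2 ^ ?r * real (card ?G) * real YD \<le> 48 * real n * real YD" by (rule mult_right_mono) simp
      thus ?thesis by (rule divide_right_mono) simp
    qed
    also have "\<dots> = 48 * real y ^ 3 / real n" using n_pos by (simp add: YD_eq power2_eq_square)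
    also have "\<dots> \<le> 48 * real y ^ 3 / real y ^ 4" using n_ge_y4 y_real n_pos by (intro divide_left_mono mult_pos_pos) auto
    also have "\<dots> = 48 / y" using y_real by (simp add: eval_nat_numeral)
    finally have A: "prb (quad_seeds k) ?A \<le> 48 / y" .
    have "prb (quad_seeds k) ?B \<le> card ?G * (real (2 ^ ?r) / YD)\<^sup>2 / (?m / y)"
      using tests_survivors[OF z Gk, of "2 ^ ?r" "?m / real y" ?H] HH m(1) y_real YD_pos by simp
    also have "\<dots> \<le> ?m * (real y / YD)\<^sup>2 / (?m / y)"
    proof -
      have "real (2 ^ ?r) \<le> real y" using power_r_le[OF assms(4)] by (rule of_nat_mono)
      thus ?thesis using cG lxs y_real
        by (intro divide_right_mono mult_mono power_mono) auto
    qed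
    also have "\<dots> = 1 / real y ^ 3"
      using m(1) y_real by (simp add: YD_eq field_simps eval_nat_numeral)
    also have "\<dots> \<le> 1 / y" using y_real by (intro divide_left_mono self_le_power) auto
    finally have B: "prb (quad_seeds k) ?B \<le> 1 / y" .
    have "prb (quad_seeds k) {q. (x, q) \<in> {sd. bad3 L sd i}} \<le> prb (quad_seeds k) (?A \<union> ?B)"
      by (intro prb_mono) (auto simp: bad3_def G xs tcost_def tmiss_def H)
    also have "\<dots> \<le> 48 / y + 1 / y" using prb_Un_le[of "quad_seeds k" ?A ?B] A B by linarith
    finally show ?thesis by simp
  next
    case False
    hence "{q. (x, q) \<in> {sd. bad3 L sd i}} = {}" by (auto simp: bad3_def xs)
    thus ?thesis by (simp only:) simp
  qed
qed auto

text \<open>The events contribute \<open>1 + 8 + 49 = 58\<close> over \<open>y\<close> in each of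
  the \<open>2 * g\<close> half-rounds.\<close>

lemma prb_bad:
  assumes "proper L" "L 0 \<noteq> []" "L 1 \<noteq> []"
  shows "prb SD {sd. bad L sd} \<le> 116 * g / y"
proof -
  let ?A = "\<lambda>i. {sd. bad1 L sd (i mod 2) (i div 2 + 1)} \<union> {sd. bad2 L sd (i mod 2) (i div 2 + 1)} \<union> {sd. bad3 L sd i}"
  have "prb SD (?A i) \<le> 58 / y" if "i < 2 * g" for i
  proof -
    have "prb SD (?A i) \<le> 1 / y + 8 / y + 49 / y"
      using prb_Un_le[of SD "{sd. bad1 L sd (i mod 2) (i div 2 + 1)} \<union> {sd. bad2 L sd (i mod 2) (i div 2 + 1)}" "{sd. bad3 L sd i}"]
        prb_Un_le[of SD "{sd. bad1 L sd (i mod 2) (i div 2 + 1)}" "{sd. bad2 L sd (i mod 2) (i div 2 + 1)}"]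
        prb_bad1[OF assms that] prb_bad2[OF assms that] prb_bad3[OF assms that] by linarith
    thus ?thesis by simp
  qed
  hence "prb SD (\<Union>i\<in>{..<2 * g}. ?A i) \<le> (2 * g) * (58 / y)"
    by (intro prb_UN_le) auto
  moreover have "{sd. bad L sd} = (\<Union>i\<in>{..<2 * g}. ?A i)" by (auto simp: bad_def)
  ultimately show ?thesis by simp
qed


section \<open>Sizes and costs outside the bad events\<close>

lemma filter_small:
  assumes "proper L" "L 0 \<noteq> []" "L 1 \<noteq> []" "i < 2 * g" "\<not> bad1 L sd (i mod 2) (i div 2 + 1)"
  shows "length (filter (above (i mod 2) (pv L sd i) (fst (pv L sd i))) (L (1 - i mod 2))) * 2 ^ (i div 2 + 1)
    \<le> 8 * length (L (1 - i mod 2))"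
proof (cases "3 \<le> i div 2 + 1")
  case False
  let ?l = "length (filter (above (i mod 2) (pv L sd i) (fst (pv L sd i))) (L (1 - i mod 2)))"
  \<comment> \<open>For \<open>r < 3\<close> the claim is trivial, since \<open>8 / 2 ^ r\<close>
    exceeds 1.\<close>
  have "(2::nat) ^ (i div 2 + 1) \<le> 2 ^ 3" using False by (intro power_increasing) auto
  hence "?l * 2 ^ (i div 2 + 1) \<le> length (L (1 - i mod 2)) * 8" by (intro mult_mono) auto
  thus ?thesis by simp
next
  case True
  let ?d = "i mod 2" and ?r = "i div 2 + 1" and ?x = "pv L sd i"
  let ?m = "length (L (1 - ?d))" and ?a = "fst (pv L sd i)" and ?S = "Ss L sd (i mod 2)"
  let ?P = "above ?d ?x ?a"
  let ?N = "{p. p < ?m \<and> ?P (L (1 - ?d) ! p)}"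
  have ne: "L (1 - ?d) \<noteq> []" using assms(2,3) by (cases "?d = 0") auto
  have m: "0 < ?m" using ne by simp
  have K: "0 < 8 * real ?m / 2 ^ ?r" using m by simp
  have piv: "?a \<in> set (Rs L sd ?d)" "cnt ?d ?S ?a (snd ?x) < YS div 2 ^ ?r"
    using pv_isPiv[OF assms(4), of L sd] by (auto simp: isPiv_def)
  \<comment> \<open>Otherwise the columns above the pivot would include \<open>TT\<close>, the top
    fraction \<open>8 / 2 ^ r\<close> of the row. Outside \<open>bad1\<close> the sample holds at
    least a quarter of the fair share of \<open>TT\<close>, that is \<open>2 * YS / 2 ^ r\<close>
    positions, whereas fewer than \<open>YS / 2 ^ r\<close> sampled entries of the row are above the
    pivot.\<close>
  have "card ?N < nat \<lceil>8 * real ?m / 2 ^ ?r\<rceil>"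
  proof (rule ccontr)
    assume N: "\<not> card ?N < nat \<lceil>8 * real ?m / 2 ^ ?r\<rceil>"
    have sub: "TT L ?d ?r ?a \<subseteq> ?N"
    proof
      fix p assume p: "p \<in> TT L ?d ?r ?a"
      show "p \<in> ?N"
      proof (rule ccontr)
        assume "p \<notin> ?N"
        hence "Vo ?d ?a (L (1 - ?d) ! p) \<le> Vo ?d ?a (snd ?x)" using p by (auto simp: above_def TT_def)
        hence "?N \<subseteq> {p' \<in> {..<?m}. - Vo ?d ?a (L (1 - ?d) ! p') < - Vo ?d ?a (L (1 - ?d) ! p)}"
          by (auto simp: above_def)
        hence "card ?N \<le> card {p' \<in> {..<?m}. - Vo ?d ?a (L (1 - ?d) ! p') < - Vo ?d ?a (L (1 - ?d) ! p)}"
          by (intro card_mono) auto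
        thus False using p N by (auto simp: TT_def)
      qed
    qed
    have "{q. q < YS \<and> idx (seedS ?d sd) ?m q \<in> TT L ?d ?r ?a} \<subseteq> {q. q < length ?S \<and> ?P (?S ! q)}"
      using sub by (auto simp: Ss_def)
    hence "card {q. q < YS \<and> idx (seedS ?d sd) ?m q \<in> TT L ?d ?r ?a} \<le> card {q. q < length ?S \<and> ?P (?S ! q)}"
      by (intro card_mono) auto
    also have "\<dots> = cnt ?d ?S ?a (snd ?x)"
      unfolding cnt_def by (subst card_positions) (simp add: above_def[abs_def])
    also have "\<dots> < YS div 2 ^ ?r" by (rule piv(2))
    finally have "real (card {q. q < YS \<and> idx (seedS ?d sd) ?m q \<in> TT L ?d ?r ?a}) < real (YS div 2 ^ ?r)" by simp
    also have "\<dots> \<le> YS / 2 ^ ?r" using of_nat_div_le_of_nat[of YS "2 ^ ?r", where 'a = real] by simp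
    finally have f1: "YS * card (TT L ?d ?r ?a) / (4 * ?m) < YS / 2 ^ ?r"
      using assms(5) piv(1) True unfolding bad1_def by force
    have f2: "real YS * (8 * real ?m / 2 ^ ?r) / (4 * ?m) \<le> YS * card (TT L ?d ?r ?a) / (4 * ?m)"
      unfolding of_nat_mult
      by (rule divide_right_mono[OF mult_left_mono[OF card_TT[of ?r L ?d ?a]]]) (use True ne in auto)
    have f3: "real YS * (8 * real ?m / 2 ^ ?r) / (4 * ?m) = 2 * (YS / 2 ^ ?r)" using m by (simp add: field_simps)
    have "2 * (YS / (2::real) ^ ?r) < YS / 2 ^ ?r" by (rule order_le_less_trans[OF f2[unfolded f3] f1])
    moreover have "0 \<le> YS / (2::real) ^ ?r" by simp
    ultimately show False by linarith
  qed
  hence "real (card ?N) < 8 * real ?m / 2 ^ ?r" using nat_ceiling_bounds(3)[OF K] by blast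
  hence "real (card ?N) * 2 ^ ?r < 8 * real ?m" by (simp add: field_simps)
  hence "real (card ?N * 2 ^ ?r) < real (8 * ?m)" by simp
  hence "card ?N * 2 ^ ?r < 8 * ?m" by (simp only: of_nat_less_iff)
  thus ?thesis by (simp only: card_positions)
qed

text \<open>Only the latest filtering of each list is used: what it leaves is contained in what the
  same pivot leaves of the initial list, and there \<open>filter_small\<close> applies. Even
  half-rounds filter list 1 and odd ones list 0, whence the two exponents.\<close>

lemma casc_size:
  assumes "proper L" "L 0 \<noteq> []" "L 1 \<noteq> []" "\<not> bad L sd" "i \<le> 2 * g"
  shows "length (casc L sd i 0) * 2 ^ (i div 2) \<le> 8 * length (L 0) \<and>
    length (casc L sd i 1) * 2 ^ ((i + 1) div 2) \<le> 8 * length (L 1)"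
  using assms(5)
proof (induction i)
  case (Suc i)
  let ?d = "i mod 2"
  let ?P = "above ?d (pv L sd i) (fst (pv L sd i))"
  have i: "i < 2 * g" using Suc by simp
  have nb: "\<not> bad1 L sd ?d (i div 2 + 1)" using assms(4) i by (auto simp: bad_def)
  have "length (filter ?P (casc L sd i (1 - ?d))) \<le> length (filter ?P (L (1 - ?d)))"
    using casc_props[OF assms(1), of "1 - ?d" sd i] by (intro length_filter_distinct_le) auto
  hence "length (filter ?P (casc L sd i (1 - ?d))) * 2 ^ (i div 2 + 1) \<le>
      length (filter ?P (L (1 - ?d))) * 2 ^ (i div 2 + 1)" by (rule mult_right_mono) simp
  also have "\<dots> \<le> 8 * length (L (1 - ?d))" by (rule filter_small[OF assms(1-3) i nb])
  finally have f: "length (filter ?P (casc L sd i (1 - ?d))) * 2 ^ (i div 2 + 1) \<le> 8 * length (L (1 - ?d))" .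
  show ?case
  proof (cases "even i")
    case True
    then obtain j where j: "i = 2 * j" by (elim evenE)
    thus ?thesis using f Suc by simp
  next
    case False
    then obtain j where j: "i = 2 * j + 1" by (elim oddE)
    hence d: "?d = 1" by simp
    thus ?thesis using f Suc unfolding j d by simp
  qed
qed simp

text \<open>In an even half-round the current list has been filtered only up to level
  \<open>r - 1\<close>, which turns the 8 into 16.\<close>

lemma casc_current_size:
  assumes "proper L" "L 0 \<noteq> []" "L 1 \<noteq> []" "\<not> bad L sd" "i < 2 * g"
  shows "length (casc L sd i (i mod 2)) * 2 ^ (i div 2 + 1) \<le> 16 * length (L (i mod 2))"
proof (cases "even i")
  case True
  thus ?thesis using casc_size[OF assms(1-4), of i] assms(5) by (auto elim!: evenE)
next
  case False
  then obtain j where j: "i = 2 * j + 1" by (elim oddE)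
  thus ?thesis using casc_size[OF assms(1-4), of i] assms(5) by simp
qed

lemma sum_half_powers: "(\<Sum>i<2 * j. 1 / 2 ^ (i div 2)) \<le> (4::real) - 4 / 2 ^ j"
proof (induction j)
  case (Suc j)
  have "(\<Sum>i<2 * Suc j. 1 / 2 ^ (i div 2)) = (\<Sum>i<2 * j. 1 / 2 ^ (i div 2)) + 2 / (2::real) ^ j"
    by simp
  also have "\<dots> \<le> 4 - 4 / 2 ^ Suc j"
  proof -
    have "4 / (2::real) ^ Suc j = 2 / 2 ^ j" "4 / (2::real) ^ j = 2 * (2 / 2 ^ j)" by simp_all
    thus ?thesis using Suc by linarith
  qed
  finally show ?case .
qed simp

text \<open>The bounds on the lengths halve every two half-rounds, and the geometric series adds up
  to \<open>16 * n * 4\<close>. This is the origin of the 64 in \<open>stop\<close>.\<close>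

lemma wtc_small:
  assumes "proper L" "L 0 \<noteq> []" "L 1 \<noteq> []" "\<not> bad L sd" "i \<le> 2 * g"
  shows "wtc L sd i \<le> 64 * n"
proof -
  have c: "length (casc L sd i' 0) + length (casc L sd i' 1) \<le> 16 * real n * (1 / 2 ^ (i' div 2))" if "i' < 2 * g" for i'
  proof -
    have s: "length (casc L sd i' 0) * 2 ^ (i' div 2) \<le> 8 * n"
      using casc_size[OF assms(1-4), of i'] proper_length[OF assms(1), of 0] that by (meson le_trans less_imp_le mult_le_mono2 pos2)
    have "length (casc L sd i' 1) * 2 ^ (i' div 2) \<le> length (casc L sd i' 1) * 2 ^ ((i' + 1) div 2)"
      by (intro mult_left_mono power_increasing) auto
    also have "\<dots> \<le> 8 * n"
      using casc_size[OF assms(1-4), of i'] proper_length[OF assms(1), of 1] that by (meson le_trans less_imp_le mult_le_mono2 one_less_numeral_iff semiring_norm(76))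
    finally have "(length (casc L sd i' 0) + length (casc L sd i' 1)) * 2 ^ (i' div 2) \<le> 16 * n"
      using s by (simp add: algebra_simps)
    hence "real ((length (casc L sd i' 0) + length (casc L sd i' 1)) * 2 ^ (i' div 2)) \<le> real (16 * n)"
      by (rule of_nat_mono)
    thus ?thesis by (simp add: field_simps)
  qed
  have "real (wtc L sd i) \<le> real (wtc L sd (2 * g))"
    unfolding wtc_def using assms(5) by (intro of_nat_mono sum_mono2) auto
  also have "\<dots> = (\<Sum>i'<2 * g. real (length (casc L sd i' 0) + length (casc L sd i' 1)))"
    unfolding wtc_def by simp
  also have "\<dots> \<le> (\<Sum>i'<2 * g. 16 * real n * (1 / 2 ^ (i' div 2)))"
    using c by (intro sum_mono) auto
  also have "\<dots> = 16 * real n * (\<Sum>i'<2 * g. 1 / 2 ^ (i' div 2))" by (simp add: sum_distrib_left)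
  also have "\<dots> \<le> 16 * real n * 4"
  proof (rule mult_left_mono)
    have "0 \<le> 4 / (2::real) ^ g" by simp
    thus "(\<Sum>i'<2 * g. 1 / 2 ^ (i' div 2)) \<le> (4::real)" using sum_half_powers[of g] by linarith
  qed simp
  finally show ?thesis by linarith
qed

text \<open>Outside \<open>bad2\<close> the row sample meets \<open>T2\<close>. The pivot is a
  minimum over all sampled rows, hence at most the quantile of the row that was met, and fewer than
  \<open>length (L d) / y ^ 3\<close> rows have a smaller quantile.\<close>

lemma low_rows:
  assumes "proper L" "L 0 \<noteq> []" "L 1 \<noteq> []" "i < 2 * g" "\<not> bad2 L sd (i mod 2) (i div 2 + 1)"
  shows "real (card {p. p < length (L (i mod 2)) \<and>
      tau (i mod 2) (Ss L sd (i mod 2)) (YS div 2 ^ (i div 2 + 1)) (L (i mod 2) ! p)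
        < Vo (i mod 2) (fst (pv L sd i)) (snd (pv L sd i))}) < length (L (i mod 2)) / y ^ 3"
proof -
  let ?d = "i mod 2" and ?th = "YS div 2 ^ (i div 2 + 1)" and ?x = "pv L sd i"
  let ?S = "Ss L sd (i mod 2)" and ?m = "length (L (i mod 2))"
  let ?t = "tau ?d ?S ?th" and ?X = "Vo (i mod 2) (fst (pv L sd i)) (snd (pv L sd i))"
  let ?T = "T2 L ?d ?S ?th"
  have ne: "L ?d \<noteq> []" using assms(2,3) by (cases "?d = 0") auto
  have m: "0 < ?m" using ne by simp
  have K: "0 < real ?m / y ^ 3" using m y_real by simp
  have "real ?m / y ^ 3 \<le> ?m / 1" using y_real m by (intro divide_left_mono) auto
  hence h: "nat \<lceil>?m / y ^ 3\<rceil> \<le> card {..<?m}" by simp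
  have "nat \<lceil>?m / y ^ 3\<rceil> \<le> card ?T"
    unfolding T2_def by (rule rank_card[OF finite_lessThan h])
  hence cT: "0 < card ?T" using nat_ceiling_bounds(2)[OF K] by linarith
  have "0 < YR * card ?T / (4 * ?m)" using cT m YR_pos by simp
  hence "0 < real (card {q. q < YR \<and> idx (seedR ?d sd) ?m q \<in> ?T})"
    using assms(5) unfolding bad2_def by linarith
  hence "0 < card {q. q < YR \<and> idx (seedR ?d sd) ?m q \<in> ?T}" by simp
  hence "{q. q < YR \<and> idx (seedR ?d sd) ?m q \<in> ?T} \<noteq> {}" using card_gt_0_iff by blast
  then obtain q where q: "q < YR" "idx (seedR ?d sd) ?m q \<in> ?T" by blast
  let ?p = "idx (seedR ?d sd) ?m q"
  let ?a = "L ?d ! ?p"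
  have aR: "?a \<in> set (Rs L sd ?d)" using q(1) by (auto simp: Rs_def)
  have "?X \<le> ?t ?a"
  proof -
    have "?S \<noteq> []" using YS_pos length_Ss[of L sd ?d] by (metis length_0_conv less_nat_zero_code)
    then obtain b where b: "b \<in> set ?S" "cnt ?d ?S ?a b = 0" using cnt_zero_exists by blast
    have th: "0 < ?th" by (rule th_pos[OF assms(4)])
    have "?t ?a \<in> Vo ?d ?a ` {b \<in> set ?S. cnt ?d ?S ?a b < ?th}"
      unfolding tau_def
    proof (rule Min_in)
      have "b \<in> {b \<in> set ?S. cnt ?d ?S ?a b < ?th}" using b th by simp
      thus "Vo ?d ?a ` {b \<in> set ?S. cnt ?d ?S ?a b < ?th} \<noteq> {}" by blast
    qed simp
    thus ?thesis using pv_isPiv[OF assms(4), of L sd] aR by (auto simp: isPiv_def)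
  qed
  hence "{p. p < ?m \<and> ?t (L ?d ! p) < ?X} \<subseteq> {p \<in> {..<?m}. ?t (L ?d ! p) < ?t ?a}" by auto
  hence "card {p. p < ?m \<and> ?t (L ?d ! p) < ?X} \<le> card {p \<in> {..<?m}. ?t (L ?d ! p) < ?t ?a}"
    by (intro card_mono) auto
  also have "\<dots> < nat \<lceil>?m / y ^ 3\<rceil>" using q(2) by (simp add: T2_def)
  finally show ?thesis using nat_ceiling_bounds(3)[OF K] by blast
qed

lemma nonGG_card:
  assumes "proper L" "L 0 \<noteq> []" "L 1 \<noteq> []" "i < 2 * g" "\<not> bad2 L sd (i mod 2) (i div 2 + 1)"
  shows "real (card ({..<length (casc L sd i (i mod 2))} - GG L sd i)) \<le> length (L (i mod 2)) / y ^ 3 + 1"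
proof -
  let ?d = "i mod 2" and ?xs = "casc L sd i (i mod 2)" and ?x = "pv L sd i"
  let ?t = "tau ?d (Ss L sd ?d) (YS div 2 ^ (i div 2 + 1))" and ?X = "Vo (i mod 2) (fst (pv L sd i)) (snd (pv L sd i))"
  have xs: "distinct ?xs" "set ?xs \<subseteq> set (L ?d)" using casc_props[OF assms(1), of ?d sd i] by auto
  have "{..<length ?xs} - GG L sd i \<subseteq> {p. p < length ?xs \<and> ?xs ! p = fst ?x} \<union> {p. p < length ?xs \<and> ?t (?xs ! p) < ?X}"
    by (auto simp: GG_def)
  hence "card ({..<length ?xs} - GG L sd i) \<le>
      card ({p. p < length ?xs \<and> ?xs ! p = fst ?x} \<union> {p. p < length ?xs \<and> ?t (?xs ! p) < ?X})"
    by (intro card_mono) auto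
  also have "\<dots> \<le> card {p. p < length ?xs \<and> ?xs ! p = fst ?x} + card {p. p < length ?xs \<and> ?t (?xs ! p) < ?X}"
    by (rule card_Un_le)
  finally have 1: "card ({..<length ?xs} - GG L sd i) \<le> card {p. p < length ?xs \<and> ?xs ! p = fst ?x} + card {p. p < length ?xs \<and> ?t (?xs ! p) < ?X}" .
  have 2: "card {p. p < length ?xs \<and> ?xs ! p = fst ?x} \<le> 1"
  proof -
    have "a = b" if "a < length ?xs" "?xs ! a = fst ?x" "b < length ?xs" "?xs ! b = fst ?x" for a b
      using that xs(1) nth_eq_iff_index_eq[of ?xs a b] by simp
    thus ?thesis unfolding One_nat_def by (subst card_le_Suc0_iff_eq) auto
  qed
  have 3: "card {p. p < length ?xs \<and> ?t (?xs ! p) < ?X} \<le> card {p. p < length (L ?d) \<and> ?t (L ?d ! p) < ?X}"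
    using length_filter_distinct_le[OF xs, of "\<lambda>a. ?t a < ?X"]
    by (simp only: card_positions[symmetric])
  have "card ({..<length ?xs} - GG L sd i) \<le> 1 + card {p. p < length (L ?d) \<and> ?t (L ?d ! p) < ?X}" using 1 2 3 by linarith
  thus ?thesis using low_rows[OF assms] by linarith
qed

text \<open>The budget \<open>60 * n\<close> is never reached: rows of \<open>GG\<close> cost less
  than \<open>48 * n + n\<close> since \<open>bad3\<close> fails, and the few others cost at most
  \<open>YD = y ^ 3\<close> each, together at most \<open>2 * n\<close>. So the survivors are rows
  outside \<open>GG\<close> or rows of \<open>GG\<close> whose tests all missed, and both kinds are
  rare.\<close>

lemma strong_small:
  assumes "proper L" "L 0 \<noteq> []" "L 1 \<noteq> []" "i < 2 * g" "\<not> bad L sd"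
  shows "length (strong L sd i) * y \<le> 8 * length (L (i mod 2)) + y"
proof -
  let ?d = "i mod 2" and ?xs = "casc L sd i (i mod 2)" and ?m = "length (L (i mod 2))"
  let ?G = "GG L sd i" and ?r = "i div 2 + 1"
  have nb: "\<not> bad2 L sd ?d ?r" "\<not> bad3 L sd i" using assms(4,5) by (auto simp: bad_def)
  have size: "length ?xs * 2 ^ ?r \<le> 16 * ?m" by (rule casc_current_size[OF assms(1-3,5,4)])
  have m: "?m \<le> n" by (rule proper_length[OF assms(1)]) simp
  have Gsub: "?G \<subseteq> {..<length ?xs}" by (auto simp: GG_def)
  have cG: "card ?G \<le> length ?xs" using card_mono[OF _ Gsub] by simp
  have nG: "real (card ({..<length ?xs} - ?G)) \<le> ?m / y ^ 3 + 1" by (rule nonGG_card[OF assms(1-4) nb(1)])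
  have c_le: "tcost L sd i p \<le> YD" for p
    unfolding tcost_def cost_def by (rule order_trans[OF card_mono[of "{..<YD}"]]) auto
  have y3: "real y ^ 3 \<le> n" using n_ge_y4 power_increasing[of 3 4 "real y"] y_real by linarith
  have "(\<Sum>p<length ?xs. real (tcost L sd i p)) = (\<Sum>p\<in>?G. real (tcost L sd i p)) + (\<Sum>p\<in>{..<length ?xs} - ?G. real (tcost L sd i p))"
    using sum.subset_diff[OF Gsub, of "\<lambda>p. real (tcost L sd i p)"] by simp
  also have "(\<Sum>p\<in>?G. real (tcost L sd i p)) < 3 * 2 ^ ?r * real (card ?G) + n"
    using nb(2) size by (auto simp: bad3_def)
  also have "3 * 2 ^ ?r * real (card ?G) \<le> 48 * n"
  proof -
    have "card ?G * 2 ^ ?r \<le> length ?xs * 2 ^ ?r" by (rule mult_right_mono[OF cG]) simp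
    also have "\<dots> \<le> 16 * n" using size m by linarith
    finally have "real (card ?G * 2 ^ ?r) \<le> real (16 * n)" by (rule of_nat_mono)
    thus ?thesis by simp
  qed
  also have "(\<Sum>p\<in>{..<length ?xs} - ?G. real (tcost L sd i p)) \<le> 2 * n"
  proof -
    have "(\<Sum>p\<in>{..<length ?xs} - ?G. real (tcost L sd i p)) \<le> card ({..<length ?xs} - ?G) * real YD"
      using c_le by (intro sum_bounded_above) auto
    also have "\<dots> \<le> (?m / y ^ 3 + 1) * real YD" using nG by (rule mult_right_mono) simp
    also have "\<dots> = ?m + real y ^ 3" using y_real by (simp add: YD_eq field_simps)
    also have "\<dots> \<le> 2 * n" using of_nat_mono[OF m, where 'a = real] y3 by linarith
    finally show ?thesis by simp
  qed
  finally have "(\<Sum>p<length ?xs. real (tcost L sd i p)) < real (60 * n)" using n_pos by simp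
  hence tot: "(\<Sum>p<length ?xs. tcost L sd i p) < 60 * n" by (simp flip: of_nat_sum)
  have fuel: "fuel L sd i p = (\<Sum>p'<p. tcost L sd i p')" "fuel L sd i p < 60 * n" if "p \<le> length ?xs" for p
  proof -
    have lt: "(\<Sum>p'<q. tcost L sd i p') < 60 * n" if "q \<le> length ?xs" for q
    proof -
      have "(\<Sum>p'<q. tcost L sd i p') \<le> (\<Sum>p<length ?xs. tcost L sd i p)"
        using that by (intro sum_mono2) auto
      thus ?thesis using tot by simp
    qed
    show "fuel L sd i p = (\<Sum>p'<p. tcost L sd i p')" using \<open>p \<le> length ?xs\<close>
      by (induction p) (use lt in \<open>auto simp: less_imp_le\<close>)
    thus "fuel L sd i p < 60 * n" using lt[OF that] by simp
  qed
  have "length (strong L sd i) = length (filter (\<lambda>p. \<not> killed L sd i p) [0..<length ?xs])"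
    by (simp add: strong_def)
  also have "\<dots> = card {p. p < length ?xs \<and> \<not> killed L sd i p}"
    by (subst length_filter_conv_card) (auto intro!: arg_cong[of _ _ card])
  also have "\<dots> \<le> card (({..<length ?xs} - ?G) \<union> {p \<in> ?G. tmiss L sd i p})"
    using fuel(2) by (intro card_mono) (auto simp: killed_def GG_def)
  also have "\<dots> \<le> card ({..<length ?xs} - ?G) + card {p \<in> ?G. tmiss L sd i p}" by (rule card_Un_le)
  finally have "real (length (strong L sd i)) \<le> real (card ({..<length ?xs} - ?G)) + real (card {p \<in> ?G. tmiss L sd i p})"
    by linarith
  also have "\<dots> \<le> (?m / y ^ 3 + 1) + ?m / y"
    using nG nb(2) size by (auto simp: bad3_def)
  also have "\<dots> \<le> 2 * ?m / y + 1"
  proof -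
    have "?m / real y ^ 3 \<le> ?m / real y" using y_real by (intro divide_left_mono self_le_power) auto
    thus ?thesis by simp
  qed
  finally have "real (length (strong L sd i)) * y \<le> 2 * ?m + y" using y_real by (simp add: field_simps)
  hence "real (length (strong L sd i) * y) \<le> real (2 * ?m + y)" by simp
  hence "length (strong L sd i) * y \<le> 2 * ?m + y" by (simp only: of_nat_le_iff)
  thus ?thesis by simp
qed

text \<open>If no half-round stops the reduction, list 0 has passed all \<open>g\<close> levels, and
  \<open>2 ^ g = y\<close>. The summand \<open>y\<close> allows for one extra row, that of the
  pivot.\<close>

lemma reduce_shrinks:
  assumes "proper L" "L 0 \<noteq> []" "L 1 \<noteq> []" "\<not> bad L sd"
  shows "\<exists>d<2. length (reduce L sd d) * y \<le> 8 * length (L d) + y"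
proof (cases "\<exists>i<2 * g. stop L sd i")
  case True
  let ?i = "LEAST i. stop L sd i"
  from True obtain i0 where i0: "i0 < 2 * g" "stop L sd i0" by blast
  have i: "?i < 2 * g" using i0 Least_le[of "stop L sd" i0] by auto
  have "\<not> 64 * n < wtc L sd (Suc ?i)" using wtc_small[OF assms, of "Suc ?i"] i by simp
  hence "reduce L sd (?i mod 2) = strong L sd ?i" using True assms by (simp add: reduce_def outcome_def)
  thus ?thesis using strong_small[OF assms(1-3) i assms(4)] by (intro exI[of _ "?i mod 2"]) simp
next
  case False
  hence "reduce L sd = casc L sd (2 * g)"
    using assms(2,3) unfolding reduce_def by (simp only: if_False simp_thms)
  thus ?thesis using casc_size[OF assms, of "2 * g"]
    by (intro exI[of _ 0]) (simp add: y_def)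
qed

end

section \<open>From coin flips to independent seeds\<close>

definition num :: "bool list \<Rightarrow> nat" where
  "num = foldl (\<lambda>v b. 2 * v + of_bool b) 0"

lemma foldl_num: "foldl (\<lambda>v b. 2 * v + of_bool b) v bs = v * 2 ^ length bs + num bs"
proof (induction bs arbitrary: v)
  case (Cons b bs)
  show ?case
    unfolding num_def foldl_Cons Cons[of "2 * v + of_bool b"] Cons[of "2 * 0 + of_bool b"]
    by (simp add: algebra_simps)
qed (simp add: num_def)

lemma num_Cons: "num (b # bs) = of_bool b * 2 ^ length bs + num bs"
  unfolding num_def foldl_Cons foldl_num[of "2 * 0 + of_bool b"] by (simp add: num_def)

lemma num_snoc: "num (bs @ [b]) = 2 * num bs + of_bool b"
  by (simp add: num_def)

lemma num_less: "num bs < 2 ^ length bs"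
proof (induction bs)
  case (Cons b bs)
  thus ?case by (cases b) (auto simp: num_Cons)
qed (simp add: num_def)

abbreviation coin :: "bool pmf" where "coin \<equiv> bernoulli_pmf (1 / 2)"

lemma map_num_coins: "map_pmf num (replicate_pmf m coin) = U m"
proof (induction m)
  case 0
  show ?case by (simp add: U_def num_def pmf_of_set_singleton lessThan_Suc)
next
  case (Suc m)
  have U1: "map_pmf of_bool coin = U 1"
  proof (rule pmf_eqI)
    fix i :: nat
    have "{..<2::nat} = {0, 1}" by auto
    moreover have "pmf (map_pmf of_bool coin) i = (if i \<in> {0, 1} then 1 / 2 else 0)"
    proof (cases "i \<in> {0, 1}")
      case True
      then obtain b where "i = of_bool b" by (metis insertE of_bool_eq(1,2) singletonD)
      thus ?thesis by (simp add: pmf_map_inj' inj_def)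
    next
      case False
      hence "i \<notin> set_pmf (map_pmf of_bool coin)" by auto
      thus ?thesis using False by (simp add: pmf_eq_0_set_pmf)
    qed
    ultimately show "pmf (map_pmf of_bool coin) i = pmf (U 1) i" by (simp add: U_def)
  qed
  have "map_pmf num (replicate_pmf (Suc m) coin) =
      bind_pmf coin (\<lambda>b. bind_pmf (replicate_pmf m coin) (\<lambda>bs. return_pmf (num (b # bs))))"
    by (simp add: map_bind_pmf)
  also have "\<dots> = bind_pmf coin (\<lambda>b. bind_pmf (replicate_pmf m coin) (\<lambda>bs. return_pmf (of_bool b * 2 ^ m + num bs)))"
    by (intro bind_pmf_cong refl) (auto simp: num_Cons set_replicate_pmf)
  also have "\<dots> = map_pmf (\<lambda>(h, l). h * 2 ^ m + l) (pair_pmf (map_pmf of_bool coin) (map_pmf num (replicate_pmf m coin)))"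
    by (simp add: pair_pmf_def map_pmf_def bind_assoc_pmf bind_return_pmf)
  also have "\<dots> = U (Suc m)" unfolding U1 Suc U_split by simp
  finally show ?case .
qed

definition chunks :: "nat \<Rightarrow> nat \<Rightarrow> bool list \<Rightarrow> nat list" where
  "chunks N m bs = map (\<lambda>j. num (take m (drop (m * j) bs))) [0..<N]"

lemma chunks_Suc: "length xs = m \<Longrightarrow> chunks (Suc N) m (xs @ ys) = num xs # chunks N m ys"
proof (rule nth_equalityI)
  fix i assume "length xs = m" "i < length (chunks (Suc N) m (xs @ ys))"
  thus "chunks (Suc N) m (xs @ ys) ! i = (num xs # chunks N m ys) ! i"
    by (cases i) (auto simp: chunks_def simp del: upt_Suc)
qed (simp add: chunks_def)

lemma map_chunks_coins: "map_pmf (chunks N m) (replicate_pmf (N * m) coin) = replicate_pmf N (U m)"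
proof (induction N)
  case 0
  show ?case by (simp add: chunks_def)
next
  case (Suc N)
  have "map_pmf (chunks (Suc N) m) (replicate_pmf (Suc N * m) coin) =
      bind_pmf (replicate_pmf m coin) (\<lambda>xs. bind_pmf (replicate_pmf (N * m) coin)
        (\<lambda>ys. return_pmf (chunks (Suc N) m (xs @ ys))))"
    by (simp add: replicate_pmf_distrib map_bind_pmf)
  also have "\<dots> = bind_pmf (replicate_pmf m coin) (\<lambda>xs. bind_pmf (replicate_pmf (N * m) coin)
        (\<lambda>ys. return_pmf (num xs # chunks N m ys)))"
    by (intro bind_pmf_cong refl) (auto simp: chunks_Suc set_replicate_pmf)
  also have "\<dots> = bind_pmf (map_pmf num (replicate_pmf m coin)) (\<lambda>x.
      bind_pmf (map_pmf (chunks N m) (replicate_pmf (N * m) coin)) (\<lambda>xs. return_pmf (x # xs)))"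
    by (simp add: bind_map_pmf)
  also have "\<dots> = replicate_pmf (Suc N) (U m)"
    unfolding Suc map_num_coins by simp
  finally show ?case .
qed

text \<open>In order: row and column sample of orientation 0, the same for orientation 1, then the
  eight seeds of the tests. The program addresses the seeds by these offsets.\<close>

definition tup :: "(nat \<Rightarrow> nat) \<Rightarrow> nat \<Rightarrow> seeds" where
  "tup f b = ((((f b, f (b + 1)), (f (b + 2), f (b + 3))), ((f (b + 4), f (b + 5)), (f (b + 6), f (b + 7)))),
    (((f (b + 8), f (b + 9)), (f (b + 10), f (b + 11))), ((f (b + 12), f (b + 13)), (f (b + 14), f (b + 15)))))"

text \<open>
  Of 52 successful reductions, 26 shrink the same list, and shrinking a list of length \<open>n\<close> 26 times by a
  factor \<open>16 / y\<close> leaves at most one element. An attempt fails with probability \<open>O(log n / y)\<close>, where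
  \<open>y ^ 20\<close> is of order \<open>n\<close>; 40 attempts bring this below \<open>1 / n\<close>.
\<close>

definition NR :: nat where "NR = 52"

definition NA :: nat where "NA = 40"

text \<open>A union bound over two stages in which the second experiment may depend on the outcome
  of the first.\<close>

lemma prb_Un_bind:
  assumes "finite (set_pmf p)" "\<And>x. finite (set_pmf (f x))"
    and "prb p A \<le> a" "\<And>x. x \<in> set_pmf p \<Longrightarrow> prb (f x) {y. B x y} \<le> b"
  shows "prb (bind_pmf p (\<lambda>x. bind_pmf (f x) (\<lambda>y. return_pmf (x, y)))) {(x, y). x \<in> A \<or> B x y} \<le> a + b"
proof -
  let ?P = "bind_pmf p (\<lambda>x. bind_pmf (f x) (\<lambda>y. return_pmf (x, y)))"
  have "map_pmf fst ?P = p" by (simp add: map_bind_pmf bind_return_pmf')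
  hence "prb ?P {(x, y). x \<in> A} = prb p A"
    using prb_map[of fst ?P A] by (simp add: case_prod_beta')
  moreover have "prb ?P {(x, y). B x y} \<le> b"
  proof (rule prb_bind_le)
    fix x assume "x \<in> set_pmf p"
    have "bind_pmf (f x) (\<lambda>y. return_pmf (x, y)) = map_pmf (Pair x) (f x)" by (simp add: map_pmf_def)
    thus "prb (bind_pmf (f x) (\<lambda>y. return_pmf (x, y))) {(x, y). B x y} \<le> b"
      using assms(4)[OF \<open>x \<in> set_pmf p\<close>] by (simp add: vimage_def)
  qed (use assms in auto)
  moreover have "{(x, y). x \<in> A \<or> B x y} = {(x, y). x \<in> A} \<union> {(x, y). B x y}" by auto
  ultimately show ?thesis using prb_Un_le[of ?P "{(x, y). x \<in> A}" "{(x, y). B x y}"] assms(3) by simp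
qed

lemma finite_replicate [simp]: "finite (set_pmf p) \<Longrightarrow> finite (set_pmf (replicate_pmf N p))"
  by (induction N) auto

section \<open>Sequences of reductions and independent attempts\<close>

context game
begin

definition full :: "nat \<Rightarrow> nat list" where "full d = [0..<n]"

primrec att :: "(nat \<Rightarrow> nat) \<Rightarrow> nat \<Rightarrow> nat \<Rightarrow> nat \<Rightarrow> nat list" where
  "att f b 0 = full"
| "att f b (Suc j) = reduce (att f b j) (tup f (b + 16 * j))"

definition small :: "(nat \<Rightarrow> nat list) \<Rightarrow> bool" where
  "small L \<longleftrightarrow> length (L 0) * length (L 1) \<le> 4 * n"

lemma proper_full: "proper full"
  by (auto simp: proper_def full_def)

lemma proper_att: "proper (att f b j)"
  by (induction j) (auto simp: proper_full proper_reduce)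

lemma keeps_att: "sad e \<Longrightarrow> keeps e (att f b j)"
  by (induction j) (auto simp: keeps_reduce proper_att, auto simp: keeps_def full_def sad_def)

lemma tup_SD: "map_pmf (\<lambda>ys. tup (nth ys) 0) (replicate_pmf 16 (U (2 * k))) = SD"
  by (simp add: numeral_eq_Suc SD_def quad_seeds_def pair_pmf_def map_pmf_def bind_assoc_pmf
      bind_return_pmf tup_def)

text \<open>An empty list leaves nothing to reduce and already makes the lists \<open>small\<close>,
  so it does not count as bad.\<close>

definition bad' :: "(nat \<Rightarrow> nat list) \<Rightarrow> seeds \<Rightarrow> bool" where
  "bad' L sd \<longleftrightarrow> L 0 \<noteq> [] \<and> L 1 \<noteq> [] \<and> bad L sd"

lemma prb_bad': "proper L \<Longrightarrow> prb SD {sd. bad' L sd} \<le> 116 * g / y"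
  using prb_bad[of L] by (cases "L 0 = [] \<or> L 1 = []") (auto simp: bad'_def)

lemma att_cong: "(\<And>i. i < 16 * j \<Longrightarrow> f (b + i) = f' (b' + i)) \<Longrightarrow> att f b j = att f' b' j"
proof (induction j)
  case (Suc j)
  have key: "f (b + 16 * j + c) = f' (b' + 16 * j + c)" if "c < 16" for c
    using Suc.prems[of "16 * j + c"] that by (simp add: add.assoc)
  have "tup f (b + 16 * j) = tup f' (b' + 16 * j)"
    unfolding tup_def using key[of 0] by (simp only: key add_0_right)
  moreover have "att f b j = att f' b' j" using Suc by auto
  ultimately show ?case by simp
qed simp

text \<open>The lists before reduction \<open>J\<close> are functions of the seeds of earlier
  reductions. The seeds of reduction \<open>J\<close> are therefore fresh, and
  \<open>prb_bad'\<close> applies with the lists fixed.\<close>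

lemma prb_some_bad:
  "prb (replicate_pmf (16 * J) (U (2 * k)))
    {xs. \<exists>j<J. bad' (att (nth xs) 0 j) (tup (nth xs) (16 * j))} \<le> J * (116 * g / y)"
proof (induction J)
  case (Suc J)
  let ?A = "\<lambda>J. {xs. \<exists>j<J. bad' (att (nth xs) 0 j) (tup (nth xs) (16 * j))}"
  let ?p = "replicate_pmf (16 * J) (U (2 * k))" and ?q = "replicate_pmf 16 (U (2 * k))"
  let ?P = "bind_pmf ?p (\<lambda>xs. bind_pmf ?q (\<lambda>ys. return_pmf (xs, ys)))"
  have eq: "replicate_pmf (16 * Suc J) (U (2 * k)) = map_pmf (\<lambda>(xs, ys). xs @ ys) ?P"
    using replicate_pmf_distrib[of "16 * J" 16 "U (2 * k)"]
    by (simp add: map_bind_pmf add.commute)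
  have "prb (replicate_pmf (16 * Suc J) (U (2 * k))) (?A (Suc J)) \<le>
      prb ?P {(xs, ys). xs \<in> ?A J \<or> bad' (att (nth xs) 0 J) (tup (nth ys) 0)}"
    unfolding eq prb_map
  proof (rule prb_mono)
    fix z assume z: "z \<in> set_pmf ?P" "z \<in> {x. (case x of (xs, ys) \<Rightarrow> xs @ ys) \<in> ?A (Suc J)}"
    obtain xs ys where zz: "z = (xs, ys)" by (cases z)
    have len: "length xs = 16 * J" "length ys = 16" using z(1) by (auto simp: zz set_replicate_pmf)
    have att: "att (nth (xs @ ys)) 0 j = att (nth xs) 0 j" if "j \<le> J" for j
      using that len by (intro att_cong) (auto simp: nth_append)
    have t1: "tup (nth (xs @ ys)) (16 * j) = tup (nth xs) (16 * j)" if "j < J" for j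
      using that len by (simp add: tup_def nth_append)
    have t2: "tup (nth (xs @ ys)) (16 * J) = tup (nth ys) 0"
      using len by (simp add: tup_def nth_append numeral_2_eq_2)
    from z(2) obtain j where j: "j < Suc J" "bad' (att (nth (xs @ ys)) 0 j) (tup (nth (xs @ ys)) (16 * j))"
      by (auto simp: zz)
    show "z \<in> {(xs, ys). xs \<in> ?A J \<or> bad' (att (nth xs) 0 J) (tup (nth ys) 0)}"
    proof (cases "j = J")
      case True
      thus ?thesis using j att[of J] t2 by (simp add: zz)
    next
      case False
      hence "j < J" using j by simp
      thus ?thesis using j att[of j] t1[of j] by (auto simp: zz)
    qed
  qed
  also have "\<dots> \<le> J * (116 * g / y) + 116 * g / y"
  proof (rule prb_Un_bind)
    fix xs
    have "prb ?q {ys. bad' (att (nth xs) 0 J) (tup (nth ys) 0)} = prb SD {sd. bad' (att (nth xs) 0 J) sd}"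
      unfolding tup_SD[symmetric] prb_map by simp
    thus "prb ?q {ys. bad' (att (nth xs) 0 J) (tup (nth ys) 0)} \<le> 116 * g / y"
      using prb_bad'[OF proper_att] by simp
  qed (use Suc.IH in auto)
  also have "\<dots> = Suc J * (116 * g / y)" by (simp add: ring_distribs add_divide_distrib)
  finally show ?case .
qed simp

text \<open>As long as \<open>8 * u J \<ge> y\<close>, a shrinking step gains a factor
  \<open>y / 16\<close>. Below that threshold it yields \<open>u (Suc J) * y < 2 * y\<close>, so at
  most one element is left.\<close>

lemma shrink_sequence:
  fixes u :: "nat \<Rightarrow> nat"
  assumes "\<And>j. u (Suc j) \<le> u j" "u 0 \<le> n"
  shows "u J \<le> 1 \<or> u J * y ^ card {j. j < J \<and> u (Suc j) * y \<le> 8 * u j + y}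
    \<le> 16 ^ card {j. j < J \<and> u (Suc j) * y \<le> 8 * u j + y} * n"
proof (induction J)
  case (Suc J)
  let ?P = "\<lambda>j. u (Suc j) * y \<le> 8 * u j + y"
  let ?c = "card {j. j < J \<and> ?P j}"
  have set: "{j. j < Suc J \<and> ?P j} = (if ?P J then insert J {j. j < J \<and> ?P j} else {j. j < J \<and> ?P j})"
    by (auto simp: less_Suc_eq)
  show ?case
  proof (cases "u J \<le> 1")
    case True
    thus ?thesis using assms(1)[of J] by linarith
  next
    case False
    hence IH: "u J * y ^ ?c \<le> 16 ^ ?c * n" using Suc by simp
    show ?thesis
    proof (cases "?P J")
      case True
      have c: "card {j. j < Suc J \<and> ?P j} = Suc ?c" unfolding set using True by simp
      show ?thesis
      proof (cases "8 * u J < y")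
        case True
        hence "u (Suc J) * y < 2 * y" using \<open>?P J\<close> by linarith
        hence "u (Suc J) < 2" by simp
        thus ?thesis by linarith
      next
        case False
        hence "u (Suc J) * y \<le> 16 * u J" using \<open>?P J\<close> by linarith
        hence "u (Suc J) * y * y ^ ?c \<le> 16 * u J * y ^ ?c" by (rule mult_right_mono) simp
        also have "\<dots> \<le> 16 * (16 ^ ?c * n)" using IH by simp
        finally show ?thesis unfolding c by (simp add: mult_ac)
      qed
    next
      case False
      have "u (Suc J) * y ^ ?c \<le> u J * y ^ ?c" using assms(1) by (rule mult_right_mono) simp
      hence "u (Suc J) * y ^ ?c \<le> 16 ^ ?c * n" using IH by (rule order_trans)
      thus ?thesis unfolding set using False by (simp only: if_False) blast
    qed
  qed
qed (use assms in simp)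

lemma many_shrinks:
  fixes u :: "nat \<Rightarrow> nat"
  assumes "\<And>j. u (Suc j) \<le> u j" "u 0 \<le> n" "24 \<le> g"
    and "26 \<le> card {j. j < J \<and> u (Suc j) * y \<le> 8 * u j + y}"
  shows "u J \<le> 1"
proof (rule ccontr)
  let ?c = "card {j. j < J \<and> u (Suc j) * y \<le> 8 * u j + y}"
  assume "\<not> u J \<le> 1"
  hence 1: "u J * y ^ ?c \<le> 16 ^ ?c * n" "1 \<le> u J" using shrink_sequence[OF assms(1,2), of J] by auto
  have "k \<le> 20 * g + 20" by (simp add: g_def)
  hence "(2::nat) ^ k \<le> 2 ^ (20 * g + 20)" by (intro power_increasing) auto
  hence n: "n < 2 ^ (20 * g + 20)" by (rule less_le_trans[OF n_less])
  have "2 ^ (g * ?c) = 1 * y ^ ?c" by (simp add: y_def power_mult)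
  also have "\<dots> \<le> u J * y ^ ?c" using 1(2) by (rule mult_right_mono) simp
  also have "\<dots> \<le> 16 ^ ?c * n" by (rule 1(1))
  also have "\<dots> < 16 ^ ?c * 2 ^ (20 * g + 20)" using n by simp
  also have "\<dots> = 2 ^ (4 * ?c + (20 * g + 20))" by (simp add: power_add power_mult)
  \<comment> \<open>With \<open>c\<close> for \<open>?c\<close> this says
    \<open>(g - 4) * (c - 20) < 100\<close>, but \<open>g \<ge> 24\<close> and
    \<open>c \<ge> 26\<close> make the product at least 120.\<close>
  finally have "g * ?c < 4 * ?c + (20 * g + 20)" by (simp only: power_strict_increasing_iff)
  moreover obtain c' where c': "?c = 26 + c'" using assms(4) le_Suc_ex by blast
  moreover obtain g' where g': "g = 24 + g'" using assms(3) le_Suc_ex by blast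
  ultimately show False by (simp add: algebra_simps)
qed

lemma att_small:
  assumes "24 \<le> g" "\<forall>j<NR. \<not> bad' (att f b j) (tup f (b + 16 * j))"
  shows "small (att f b NR)"
proof (cases "att f b NR 0 = [] \<or> att f b NR 1 = []")
  case False
  let ?u = "\<lambda>d j. length (att f b j d)"
  have mono: "?u d (Suc j) \<le> ?u d j" if "d < 2" for d j
    using reduce_props[OF proper_att that] by simp
  have anti: "?u d j' \<le> ?u d j" if "d < 2" "j \<le> j'" for d j j'
    using lift_Suc_antimono_le[of "?u d" j j'] mono that by blast
  let ?S = "\<lambda>d. {j. j < NR \<and> ?u d (Suc j) * y \<le> 8 * ?u d j + y}"
  have "{..<NR} \<subseteq> ?S 0 \<union> ?S 1"
  proof
    fix j assume j: "j \<in> {..<NR}"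
    have "att f b j d \<noteq> []" if "d < 2" for d
      using anti[OF that, of j NR] False that j by (auto simp: less_2_cases_iff)
    hence ne: "att f b j 0 \<noteq> []" "att f b j 1 \<noteq> []" by auto
    hence "\<not> bad (att f b j) (tup f (b + 16 * j))" using assms(2) j by (auto simp: bad'_def)
    from reduce_shrinks[OF proper_att ne this] show "j \<in> ?S 0 \<union> ?S 1"
      using j by (auto simp: less_2_cases_iff)
  qed
  hence "card {..<NR} \<le> card (?S 0 \<union> ?S 1)" by (intro card_mono) auto
  also have "\<dots> \<le> card (?S 0) + card (?S 1)" by (rule card_Un_le)
  finally have "26 \<le> card (?S 0) \<or> 26 \<le> card (?S 1)" by (auto simp: NR_def)
  moreover have "?u d NR \<le> 1" if "d < 2" "26 \<le> card (?S d)" for d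
    using that mono assms(1) by (intro many_shrinks) (auto simp: full_def)
  ultimately have "?u 0 NR \<le> 1 \<or> ?u 1 NR \<le> 1" by auto
  moreover have "?u 0 NR \<le> n" "?u 1 NR \<le> n" using proper_length[OF proper_att] by auto
  ultimately have "?u 0 NR * ?u 1 NR \<le> 1 * n \<or> ?u 0 NR * ?u 1 NR \<le> n * 1"
    by (meson mult_le_mono)
  thus ?thesis by (auto simp: small_def)
qed (auto simp: small_def)

lemma prb_attempt:
  assumes "24 \<le> g"
  shows "prb (replicate_pmf (16 * NR) (U (2 * k))) {xs. \<not> small (att (nth xs) 0 NR)} \<le> NR * (116 * g / y)"
proof -
  have "prb (replicate_pmf (16 * NR) (U (2 * k))) {xs. \<not> small (att (nth xs) 0 NR)} \<le>
      prb (replicate_pmf (16 * NR) (U (2 * k))) {xs. \<exists>j<NR. bad' (att (nth xs) 0 j) (tup (nth xs) (16 * j))}"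
    using att_small[OF assms, of _ 0] by (intro prb_mono) auto
  also have "\<dots> \<le> NR * (116 * g / y)" by (rule prb_some_bad)
  finally show ?thesis .
qed

text \<open>Each attempt starts again from the full lists and uses its own block of seeds, so
  failures of different attempts are independent.\<close>

lemma prb_all_fail:
  assumes "24 \<le> g"
  shows "prb (replicate_pmf (a * (16 * NR)) (U (2 * k)))
    {xs. \<forall>i<a. \<not> small (att (nth xs) (i * (16 * NR)) NR)} \<le> (NR * (116 * g / y)) ^ a"
proof (induction a)
  case (Suc a)
  let ?F = "\<lambda>a. {xs. \<forall>i<a. \<not> small (att (nth xs) (i * (16 * NR)) NR)}"
  let ?p = "replicate_pmf (a * (16 * NR)) (U (2 * k))" and ?q = "replicate_pmf (16 * NR) (U (2 * k))"
  have eq: "replicate_pmf (Suc a * (16 * NR)) (U (2 * k)) = map_pmf (\<lambda>(xs, ys). xs @ ys) (pair_pmf ?p ?q)"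
    using replicate_pmf_distrib[of "a * (16 * NR)" "16 * NR" "U (2 * k)"]
    by (simp add: map_bind_pmf pair_pmf_def add.commute)
  have "prb (replicate_pmf (Suc a * (16 * NR)) (U (2 * k))) (?F (Suc a)) \<le>
      prb (pair_pmf ?p ?q) (?F a \<times> {xs. \<not> small (att (nth xs) 0 NR)})"
    unfolding eq prb_map
  proof (rule prb_mono)
    fix z assume z: "z \<in> set_pmf (pair_pmf ?p ?q)" "z \<in> {x. (case x of (xs, ys) \<Rightarrow> xs @ ys) \<in> ?F (Suc a)}"
    obtain xs ys where zz: "z = (xs, ys)" by (cases z)
    have len: "length xs = a * (16 * NR)" "length ys = 16 * NR" using z(1) by (auto simp: zz set_replicate_pmf)
    have 1: "att (nth (xs @ ys)) (i * (16 * NR)) NR = att (nth xs) (i * (16 * NR)) NR" if "i < a" for i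
    proof (rule att_cong)
      fix q assume q: "q < 16 * NR"
      have "i * (16 * NR) + q < Suc i * (16 * NR)" using q by simp
      also have "\<dots> \<le> a * (16 * NR)" using that by (intro mult_right_mono) auto
      finally show "(xs @ ys) ! (i * (16 * NR) + q) = xs ! (i * (16 * NR) + q)"
        using len by (simp add: nth_append)
    qed
    have 2: "att (nth (xs @ ys)) (a * (16 * NR)) NR = att (nth ys) 0 NR"
      by (rule att_cong) (simp add: nth_append len)
    have ns: "\<not> small (att (nth (xs @ ys)) (i * (16 * NR)) NR)" if "i < Suc a" for i
      using z(2) that by (auto simp: zz)
    have "\<not> small (att (nth xs) (i * (16 * NR)) NR)" if "i < a" for i
      using ns[of i] that unfolding 1[OF that] by simp
    moreover have "\<not> small (att (nth ys) 0 NR)" using ns[of a] unfolding 2 by simp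
    ultimately show "z \<in> ?F a \<times> {xs. \<not> small (att (nth xs) 0 NR)}" by (simp add: zz)
  qed
  also have "\<dots> = prb ?p (?F a) * prb ?q {xs. \<not> small (att (nth xs) 0 NR)}"
    by (rule prb_pair) auto
  also have "\<dots> \<le> (NR * (116 * g / y)) ^ a * (NR * (116 * g / y))"
    using Suc prb_attempt[OF assms] by (intro mult_mono) auto
  finally show ?case by (simp add: mult_ac)
qed simp

end

section \<open>The program\<close>

text \<open>
  Arrays: \<open>d\<close> holds \<open>L d\<close>, \<open>2 + d\<close> and \<open>4 + d\<close> the samples \<open>Rs\<close> and \<open>Ss\<close>, \<open>6\<close> the lengths of the two lists, \<open>7\<close> the
  seeds. Registers: \<open>3, \<dots>, 10\<close> hold \<open>n, k, 2 ^ k, g, YR, YS, YD, 2 ^ (k - 6 * g)\<close>; \<open>20\<close> the offset of the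
  current seeds; \<open>22\<close> and \<open>23\<close> the current orientation and its opposite; \<open>31, 32\<close> the pivot; \<open>40, 41\<close> the
  position of the walk; \<open>58\<close> whether the reduction has ended; \<open>65\<close> whether an attempt succeeded; \<open>70, 71\<close>
  the candidate. An index \<open>n\<close> lies outside the matrix, so comparisons with it answer False.
\<close>

abbreviation rn where "rn \<equiv> Vr 3"

text \<open>Expressions contain no shifts: the modulus \<open>2 ^ (2 * k)\<close> is the square of
  register 5, and the shift is a division by it.\<close>

definition hash :: "exp \<Rightarrow> exp \<Rightarrow> exp" where
  "hash a q = Divi (Modu (Plus (Times (Ld (Nm 7) a) q) (Ld (Nm 7) (Plus a (Nm 1)))) (Times (Vr 5) (Vr 5))) (Vr 5)"

definition inner :: "nat \<Rightarrow> nat \<Rightarrow> nat \<Rightarrow> exp" where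
  "inner v u q = Divi (Modu (Plus (Times (Vr v) (Vr q)) (Vr u)) (Vr 5)) (Vr 10)"

text \<open>In orientation 1 the entry at \<open>(a, b)\<close> is \<open>- V b a\<close>:
  transposition swaps the indices within each entry, and the sign swaps the two entries.\<close>

definition cmpo :: "nat \<Rightarrow> exp \<Rightarrow> exp \<Rightarrow> exp \<Rightarrow> exp \<Rightarrow> com" where
  "cmpo x a b c d = Cond (Vr 22) (Nm 1) (Cmp x a b c d) (Cmp x d c b a)"

text \<open>The language has no subtraction, so register 13 trails register 4 by one and ends with
  \<open>k - 1\<close>, from which \<open>g\<close> is computed.\<close>

definition p_params :: com where
  "p_params = (3 ::= Vr 0 ;; 4 ::= Nm 0 ;; 5 ::= Nm 1 ;; 13 ::= Nm 0 ;;
     While (Vr 5) (Plus rn (Nm 1)) (13 ::= Vr 4 ;; 4 ::= Plus (Vr 4) (Nm 1) ;; 5 ::= Times (Nm 2) (Vr 5)) ;;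
     6 ::= Divi (Vr 13) (Nm 20) ;; 14 ::= Times (Nm 4) (Vr 6) ;; Pow 7 14 ;; 14 ::= Times (Nm 6) (Vr 6) ;; Pow 8 14 ;;
     14 ::= Times (Nm 3) (Vr 6) ;; Pow 9 14 ;; 10 ::= Divi (Vr 5) (Vr 8))"

definition p_coins :: com where
  "p_coins = For 15 (Nm (NA * (16 * NR))) (16 ::= Nm 0 ;;
     For 17 (Times (Nm 2) (Vr 4)) (Flip 18 ;; 16 ::= Plus (Times (Nm 2) (Vr 16)) (Vr 18)) ;;
     Sto (Nm 7) (Vr 15) (Vr 16))"

definition p_init :: com where
  "p_init = (For 19 rn (Sto (Nm 0) (Vr 19) (Vr 19) ;; Sto (Nm 1) (Vr 19) (Vr 19)) ;;
     Sto (Nm 6) (Nm 0) rn ;; Sto (Nm 6) (Nm 1) rn)"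

definition p_sample1 :: "nat \<Rightarrow> exp \<Rightarrow> exp \<Rightarrow> com" where
  "p_sample1 m dst src = For 26 (Vr m) (27 ::= hash (Vr 24) (Vr 26) ;;
     Sto dst (Vr 26) (Ld src (Modu (Vr 27) (Vr 25))))"

definition p_sample :: com where
  "p_sample = For 22 (Nm 2) (23 ::= Modu (Plus (Vr 22) (Nm 1)) (Nm 2) ;;
     24 ::= Plus (Vr 20) (Times (Nm 4) (Vr 22)) ;; 25 ::= Ld (Nm 6) (Vr 22) ;;
     p_sample1 7 (Plus (Nm 2) (Vr 22)) (Vr 22) ;;
     24 ::= Plus (Vr 24) (Nm 2) ;; 25 ::= Ld (Nm 6) (Vr 23) ;;
     p_sample1 8 (Plus (Nm 4) (Vr 22)) (Vr 23))"

definition p_count :: com where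
  "p_count = (37 ::= Nm 0 ;; For 38 (Vr 8)
     (cmpo 39 (Vr 34) (Vr 36) (Vr 34) (Ld (Plus (Nm 4) (Vr 22)) (Vr 38)) ;; 37 ::= Plus (Vr 37) (Vr 39)))"

text \<open>The search starts from the row \<open>n\<close> outside the matrix. Comparisons with it
  fail, so the first candidate is taken over without a special case.\<close>

definition p_pivot :: com where
  "p_pivot = (31 ::= rn ;; 32 ::= Nm 0 ;;
     For 33 (Vr 7) (34 ::= Ld (Plus (Nm 2) (Vr 22)) (Vr 33) ;;
       For 35 (Vr 8) (36 ::= Ld (Plus (Nm 4) (Vr 22)) (Vr 35) ;; p_count ;;
         Cond (Vr 37) (Vr 30) (cmpo 39 (Vr 31) (Vr 32) (Vr 34) (Vr 36) ;;
           Cond (Vr 39) (Nm 1) (31 ::= Vr 34 ;; 32 ::= Vr 36) Skip) Skip)))"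

text \<open>The counter only bounds the number of steps; once a list is exhausted the remaining
  iterations are idle.\<close>

definition p_walk :: com where
  "p_walk = (40 ::= Nm 0 ;; 41 ::= Nm 0 ;; 42 ::= Ld (Nm 6) (Vr 22) ;; 43 ::= Ld (Nm 6) (Vr 23) ;;
     For 44 (Plus (Vr 42) (Vr 43)) (Cond (Vr 40) (Vr 42) (Cond (Vr 41) (Vr 43)
       (cmpo 39 (Vr 31) (Vr 32) (Ld (Vr 22) (Vr 40)) (Ld (Vr 23) (Vr 41)) ;;
        Cond (Nm 0) (Vr 39) (40 ::= Plus (Vr 40) (Nm 1)) (41 ::= Plus (Vr 41) (Nm 1))) Skip) Skip))"

text \<open>Filtering in place: every element is stored, but the write position 45 moves on only
  past those that are kept, and it never overtakes the read position.\<close>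

definition p_filter :: com where
  "p_filter = (45 ::= Nm 0 ;; For 46 (Vr 43) (47 ::= Ld (Vr 23) (Vr 46) ;;
       cmpo 39 (Vr 31) (Vr 32) (Vr 31) (Vr 47) ;; Sto (Vr 23) (Vr 45) (Vr 47) ;; 45 ::= Plus (Vr 45) (Vr 39)) ;;
     Sto (Nm 6) (Vr 23) (Vr 45))"

text \<open>When the budget is used up, the bound 55 becomes 0; no test is made, 54 stays 0 and the
  row is kept. A hit moves 53 to the bound, which ends the loop.\<close>

definition p_tests :: com where
  "p_tests = (53 ::= Nm 0 ;; 54 ::= Nm 0 ;;
     Cond (Vr 48) (Times (Nm 60) rn) (55 ::= Vr 9) (55 ::= Nm 0) ;;
     While (Vr 53) (Vr 55)
       (cmpo 39 (Vr 31) (Vr 32) (Vr 47) (Ld (Plus (Nm 4) (Vr 22)) (inner 49 50 53)) ;;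
        cmpo 56 (Vr 31) (Vr 32) (Vr 47) (Ld (Plus (Nm 4) (Vr 22)) (inner 51 52 53)) ;;
        48 ::= Plus (Vr 48) (Nm 1) ;;
        Cond (Nm 0) (Plus (Vr 39) (Vr 56)) (54 ::= Nm 1 ;; 53 ::= Vr 55) (53 ::= Plus (Vr 53) (Nm 1))))"

definition p_strong :: com where
  "p_strong = (45 ::= Nm 0 ;; 48 ::= Nm 0 ;; For 46 (Vr 42) (47 ::= Ld (Vr 22) (Vr 46) ;;
       49 ::= hash (Plus (Vr 20) (Nm 8)) (Vr 46) ;; 50 ::= hash (Plus (Vr 20) (Nm 10)) (Vr 46) ;;
       51 ::= hash (Plus (Vr 20) (Nm 12)) (Vr 46) ;; 52 ::= hash (Plus (Vr 20) (Nm 14)) (Vr 46) ;;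
       p_tests ;; Sto (Vr 22) (Vr 45) (Vr 47) ;; Cond (Vr 54) (Nm 1) (45 ::= Plus (Vr 45) (Nm 1)) Skip) ;;
     Sto (Nm 6) (Vr 22) (Vr 45))"

definition p_half :: com where
  "p_half = Cond (Vr 58) (Nm 1) (22 ::= Modu (Vr 57) (Nm 2) ;; 23 ::= Modu (Plus (Vr 22) (Nm 1)) (Nm 2) ;;
     59 ::= Plus (Vr 59) (Plus (Ld (Nm 6) (Nm 0)) (Ld (Nm 6) (Nm 1))) ;;
     Cond (Times (Nm 64) rn) (Vr 59) (58 ::= Nm 1)
       (61 ::= Plus (Divi (Vr 57) (Nm 2)) (Nm 1) ;; Pow 62 61 ;; 30 ::= Divi (Vr 8) (Vr 62) ;;
        p_pivot ;; p_walk ;; Cond (Vr 40) (Vr 42) (p_strong ;; 58 ::= Nm 1) p_filter)) Skip"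

definition p_reduce :: com where
  "p_reduce = Cond (Nm 0) (Times (Ld (Nm 6) (Nm 0)) (Ld (Nm 6) (Nm 1)))
     (p_sample ;; 58 ::= Nm 0 ;; 59 ::= Nm 0 ;; For 57 (Times (Nm 2) (Vr 6)) p_half) Skip"

text \<open>An attempt that fails leaves reduced lists behind. If all of them fail, the full lists
  are restored for the exhaustive search.\<close>

definition p_attempts :: com where
  "p_attempts = (20 ::= Nm 0 ;; 65 ::= Nm 0 ;; For 63 (Nm NA) (Cond (Vr 65) (Nm 1)
     (p_init ;; For 64 (Nm NR) (p_reduce ;; 20 ::= Plus (Vr 20) (Nm 16)) ;;
      Cond (Times (Ld (Nm 6) (Nm 0)) (Ld (Nm 6) (Nm 1))) (Plus (Times (Nm 4) rn) (Nm 1)) (65 ::= Nm 1) Skip) Skip) ;;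
     Cond (Vr 65) (Nm 1) p_init Skip)"

definition p_brute :: com where
  "p_brute = (70 ::= rn ;; 71 ::= Nm 0 ;; 42 ::= Ld (Nm 6) (Nm 0) ;; 43 ::= Ld (Nm 6) (Nm 1) ;;
     For 46 (Vr 42) (47 ::= Ld (Nm 0) (Vr 46) ;; 72 ::= rn ;;
       For 44 (Vr 43) (73 ::= Ld (Nm 1) (Vr 44) ;; Cmp 39 (Vr 47) (Vr 73) (Vr 47) (Vr 72) ;;
         Cond (Vr 39) (Nm 1) (72 ::= Vr 73) Skip) ;;
       Cmp 39 (Vr 70) (Vr 71) (Vr 47) (Vr 72) ;; Cond (Vr 39) (Nm 1) (70 ::= Vr 47 ;; 71 ::= Vr 72) Skip))"

definition p_verify :: com where
  "p_verify = (74 ::= Nm 0 ;; Cond (Vr 70) rn (Cond (Vr 71) rn (74 ::= Nm 1) Skip) Skip ;;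
     For 44 rn (Cmp 39 (Vr 70) (Vr 71) (Vr 70) (Vr 44) ;; Cond (Nm 0) (Vr 39) (74 ::= Nm 0) Skip ;;
       Cmp 39 (Vr 44) (Vr 71) (Vr 70) (Vr 71) ;; Cond (Nm 0) (Vr 39) (74 ::= Nm 0) Skip) ;;
     0 ::= Vr 74 ;; 1 ::= Vr 70 ;; 2 ::= Vr 71)"

definition program :: com where
  "program = (p_params ;; p_coins ;; p_attempts ;; p_brute ;; p_verify)"

lemmas p_defs = hash_def inner_def cmpo_def p_params_def p_coins_def p_init_def p_sample1_def p_sample_def
  p_count_def p_pivot_def p_walk_def p_filter_def p_tests_def p_strong_def p_half_def p_reduce_def
  p_attempts_def p_brute_def p_verify_def program_def

text \<open>The largest constant in the program is the number \<open>NA * (16 * NR) = 33280\<close>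
  of seeds.\<close>

lemma wfc_program: "33281 \<le> B \<Longrightarrow> wfc B program"
  by (simp add: p_defs oke_def NA_def NR_def)

section \<open>Correctness and running time of the program\<close>

text \<open>The square in the bound is for the seeds, which lie below
  \<open>2 ^ (2 * k) \<le> 4 * n * n\<close>; everything else that is stored is constant or linear
  in \<open>n\<close>.\<close>

locale prog = game +
  fixes B :: nat and lt :: comparator
  assumes B_ge: "1000000 * (n + 1) ^ 2 \<le> B"
    and lt_def: "\<And>i j i' j'. lt i j i' j' \<longleftrightarrow> i < n \<and> j < n \<and> i' < n \<and> j' < n \<and> V i j < V i' j'"
begin

abbreviation wps :: "com \<Rightarrow> (st \<Rightarrow> bool) \<Rightarrow> st \<Rightarrow> bool" where "wps \<equiv> wp lt B"

lemma Bn: "1000000 * n + 1000000 \<le> B"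
proof -
  have "1000000 * (n + 1) * 1 \<le> 1000000 * (n + 1) * (n + 1)" by (intro mult_left_mono) auto
  thus ?thesis using B_ge by (simp add: power2_eq_square)
qed

lemma Bn2: "4 * n * n + 100 < B"
proof -
  have "4 * n * n + 100 < 1000000 * (n + 1) ^ 2" by (simp add: power2_eq_square)
  thus ?thesis using B_ge by simp
qed

definition env :: "st \<Rightarrow> bool" where
  "env s \<longleftrightarrow> rg s 3 = n \<and> rg s 4 = k \<and> rg s 5 = 2 ^ k \<and> rg s 6 = g \<and> rg s 7 = YR \<and> rg s 8 = YS \<and>
     rg s 9 = YD \<and> rg s 10 = 2 ^ (k - 6 * g)"

lemma env_frame: "env s \<Longrightarrow> frame c s s' \<Longrightarrow> writes c \<inter> {3..10} = {} \<Longrightarrow> env s'"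
proof -
  assume *: "env s" "frame c s s'" "writes c \<inter> {3..10} = {}"
  have "rg s' r = rg s r" if "3 \<le> r" "r \<le> 10" for r
    using * that by (auto simp: frame_def disjoint_iff)
  thus "env s'" using *(1) by (simp add: env_def)
qed

definition ltO :: "nat \<Rightarrow> nat \<Rightarrow> nat \<Rightarrow> nat \<Rightarrow> nat \<Rightarrow> bool" where
  "ltO d a b a' b' \<longleftrightarrow> a < n \<and> b < n \<and> a' < n \<and> b' < n \<and> Vo d a b < Vo d a' b'"

lemma wp_cmpo:
  "rg s 22 < 2 \<Longrightarrow> wps (cmpo x a b c d) Q s \<longleftrightarrow> gd s a \<and> gd s b \<and> gd s c \<and> gd s d \<and>
    Q (s\<lparr>rg := (rg s)(x := of_bool (ltO (rg s 22) (ev s a) (ev s b) (ev s c) (ev s d)))\<rparr>)"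
  by (auto simp: cmpo_def lt_def ltO_def Vo_def less_2_cases_iff conj_ac)

lemma cmpo_props [simp]: "writes (cmpo x a b c d) = {x}" "nosto (cmpo x a b c d)" "noflip (cmpo x a b c d)"
  by (auto simp: cmpo_def)

lemma k_le_n: "k \<le> n + 1"
proof -
  have "k - 1 < 2 ^ (k - 1)" by (rule less_exp)
  moreover have "2 * 2 ^ (k - 1) \<le> 2 * n" using k_le k_pos by (cases k) auto
  ultimately show ?thesis by linarith
qed

lemma Y_le: "YR \<le> n" "YS \<le> n" "YD \<le> n"
proof -
  have "y ^ c \<le> n" if "c \<le> 20" for c
  proof -
    have "y ^ c \<le> y ^ 20" using that y_pos by (intro power_increasing) auto
    thus ?thesis using y20 by simp
  qed
  from this[of 4] this[of 6] this[of 3] show "YR \<le> n" "YS \<le> n" "YD \<le> n" by (simp_all add: YR_eq YS_eq YD_eq)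
qed

lemma wp_params:
  assumes "rg s 0 = n"
  shows "wps p_params (\<lambda>s'. env s' \<and> mm s' = mm s \<and> bt s' = bt s \<and> nf s' = nf s \<and> tk s' \<le> tk s + n + 1) s"
proof -
  let ?W = "While (Vr 5) (Plus rn (Nm 1)) (13 ::= Vr 4 ;; 4 ::= Plus (Vr 4) (Nm 1) ;; 5 ::= Times (Nm 2) (Vr 5))"
  let ?Q = "\<lambda>s'. rg s' 3 = n \<and> rg s' 4 = k \<and> rg s' 5 = 2 ^ k \<and> rg s' 13 = k - 1 \<and>
      mm s' = mm s \<and> bt s' = bt s \<and> nf s' = nf s \<and> tk s' \<le> tk s + k"
  have loop: "wps ?W ?Q s'" if "rg s' 3 = n" "rg s' 4 = i" "rg s' 5 = 2 ^ i" "rg s' 13 = i - 1" "i \<le> k"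
      "mm s' = mm s" "bt s' = bt s" "nf s' = nf s" "tk s' \<le> tk s + i" for i s'
    using that
  proof (induction "k - i" arbitrary: i s')
    case 0
    hence "i = k" by simp
    thus ?case using 0 n_less by (intro wp_While_end) auto
  next
    case (Suc d)
    hence i: "i < k" by simp
    have "(2::nat) ^ i \<le> 2 ^ (k - 1)" using i by (intro power_increasing) auto
    moreover have "2 * 2 ^ (k - 1) \<le> 2 * n" using k_le k_pos by (cases k) auto
    ultimately have pw: "2 ^ i \<le> n" by linarith
    show ?case
    proof (rule wp_While_step)
      have "wps ?W ?Q (s'\<lparr>rg := (rg s')(13 := i, 4 := i + 1, 5 := 2 * 2 ^ i), tk := Suc (tk s')\<rparr>)"
        using Suc i by (intro Suc.hyps(1)[of "i + 1"]) auto
      thus "wps (13 ::= Vr 4 ;; 4 ::= Plus (Vr 4) (Nm 1) ;; 5 ::= Times (Nm 2) (Vr 5))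
          (\<lambda>s'. wps ?W ?Q (s'\<lparr>tk := Suc (tk s')\<rparr>)) s'"
        using Suc.prems i pw Bn k_le_n by simp
    qed (use Suc pw in auto)
  qed
  have p: "(2::nat) ^ (4 * g) < B" "(2::nat) ^ (6 * g) < B" "(2::nat) ^ (3 * g) < B"
    using Y_le Bn unfolding YR_def YS_def YD_def by linarith+
  have ge: "(k - Suc 0) div 20 = g" by (simp add: g_def)
  have gB: "g \<le> k" using gk by linarith
  have q: "2 ^ k div 2 ^ (6 * g) = (2::nat) ^ (k - 6 * g)" using gk by (simp add: power_diff)
  have "(2::nat) ^ (k - 6 * g) \<le> 2 ^ k" by (intro power_increasing) auto
  hence q2: "(2::nat) ^ (k - 6 * g) < B" using k_le Bn by linarith
  have "wps ?W ?Q (s\<lparr>rg := (rg s)(3 := n, 4 := 0, 5 := 1, 13 := 0)\<rparr>)"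
    by (rule loop[of _ 0]) auto
  hence "wps ?W (wps (6 ::= Divi (Vr 13) (Nm 20) ;; 14 ::= Times (Nm 4) (Vr 6) ;; Pow 7 14 ;; 14 ::= Times (Nm 6) (Vr 6) ;; Pow 8 14 ;;
     14 ::= Times (Nm 3) (Vr 6) ;; Pow 9 14 ;; 10 ::= Divi (Vr 5) (Vr 8))
     (\<lambda>s'. env s' \<and> mm s' = mm s \<and> bt s' = bt s \<and> nf s' = nf s \<and> tk s' \<le> tk s + n + 1))
    (s\<lparr>rg := (rg s)(3 := n, 4 := 0, 5 := 1, 13 := 0)\<rparr>)"
  proof (rule wp_mono)
    fix s' :: st assume "?Q s'"
    thus "wps (6 ::= Divi (Vr 13) (Nm 20) ;; 14 ::= Times (Nm 4) (Vr 6) ;; Pow 7 14 ;; 14 ::= Times (Nm 6) (Vr 6) ;; Pow 8 14 ;;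
     14 ::= Times (Nm 3) (Vr 6) ;; Pow 9 14 ;; 10 ::= Divi (Vr 5) (Vr 8))
     (\<lambda>s'. env s' \<and> mm s' = mm s \<and> bt s' = bt s \<and> nf s' = nf s \<and> tk s' \<le> tk s + n + 1) s'"
      using p q q2 k_le_n Bn gB ge by (simp add: env_def YR_def YS_def YD_def)
  qed
  thus ?thesis using assms Bn by (simp add: p_params_def)
qed


lemma QQ_less: "2 ^ (2 * k) < B"
proof -
  have "(2::nat) ^ (2 * k) = 2 ^ k * 2 ^ k" by (simp add: mult_2 power_add)
  also have "\<dots> \<le> (2 * n) * (2 * n)" using k_le by (intro mult_mono) auto
  finally show ?thesis using Bn2 by simp
qed

lemma wp_flips:
  assumes "env s" "rg s 16 = 0" "2 * k \<le> length (bt s)"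
  shows "wps (For 17 (Times (Nm 2) (Vr 4)) (Flip 18 ;; 16 ::= Plus (Times (Nm 2) (Vr 16)) (Vr 18)))
    (\<lambda>s'. rg s' 16 = num (take (2 * k) (bt s)) \<and> bt s' = drop (2 * k) (bt s) \<and>
      nf s' = nf s + 2 * k \<and> tk s' \<le> tk s + 2 * k) s"
proof (rule wp_For[where m = "2 * k" and J = "\<lambda>i s'. rg s' 16 = num (take i (bt s)) \<and> bt s' = drop i (bt s) \<and>
    nf s' = nf s + i \<and> tk s' \<le> tk s + i"])
  fix i and s' :: st assume *: "i < 2 * k" "rg s' 16 = num (take i (bt s)) \<and> bt s' = drop i (bt s) \<and> nf s' = nf s + i \<and> tk s' \<le> tk s + i"
  have i: "i < length (bt s)" using * assms(3) by simp
  have t: "take (Suc i) (bt s) = take i (bt s) @ [bt s ! i]" using i by (rule take_Suc_conv_app_nth)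
  have "num (take (Suc i) (bt s)) < 2 ^ length (take (Suc i) (bt s))" by (rule num_less)
  also have "\<dots> \<le> 2 ^ (2 * k)" using * i by (intro power_increasing) auto
  finally have "num (take (Suc i) (bt s)) < B" using QQ_less by simp
  moreover have "drop i (bt s) \<noteq> []" "hd (drop i (bt s)) = bt s ! i" "tl (drop i (bt s)) = drop (Suc i) (bt s)"
    using i by (auto simp: hd_drop_conv_nth tl_drop drop_Suc)
  ultimately show "wps (Flip 18 ;; 16 ::= Plus (Times (Nm 2) (Vr 16)) (Vr 18))
      (\<lambda>s''. rg (s''\<lparr>rg := (rg s'')(17 := Suc i), tk := Suc (tk s'')\<rparr>) 16 = num (take (Suc i) (bt s)) \<and>
        bt (s''\<lparr>rg := (rg s'')(17 := Suc i), tk := Suc (tk s'')\<rparr>) = drop (Suc i) (bt s) \<and>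
        nf (s''\<lparr>rg := (rg s'')(17 := Suc i), tk := Suc (tk s'')\<rparr>) = nf s + Suc i \<and>
        tk (s''\<lparr>rg := (rg s'')(17 := Suc i), tk := Suc (tk s'')\<rparr>) \<le> tk s + Suc i) s'"
    using * by (simp add: t num_snoc)
next
  fix i and s' :: st assume "frame (For 17 (Times (Nm 2) (Vr 4)) (Flip 18 ;; 16 ::= Plus (Times (Nm 2) (Vr 16)) (Vr 18))) s s'"
  thus "gd s' (Times (Nm 2) (Vr 4)) \<and> ev s' (Times (Nm 2) (Vr 4)) = 2 * k"
    using assms(1) by (simp add: frame_def env_def)
qed (use assms k_le_n Bn in \<open>auto simp: num_def\<close>)

lemma wp_coins:
  assumes "env s" "NA * (16 * NR) * (2 * k) \<le> length (bt s)"
  shows "wps p_coins (\<lambda>s'. env s' \<and> (\<forall>j<NA * (16 * NR). mm s' 7 j = chunks (NA * (16 * NR)) (2 * k) (bt s) ! j) \<and>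
      (\<forall>c. c \<noteq> 7 \<longrightarrow> mm s' c = mm s c) \<and> nf s' = nf s + NA * (16 * NR) * (2 * k) \<and>
      tk s' \<le> tk s + NA * (16 * NR) * (2 * k + 1)) s"
proof -
  let ?N = "NA * (16 * NR)"
  let ?c = "16 ::= Nm 0 ;; For 17 (Times (Nm 2) (Vr 4)) (Flip 18 ;; 16 ::= Plus (Times (Nm 2) (Vr 16)) (Vr 18)) ;;
     Sto (Nm 7) (Vr 15) (Vr 16)"
  let ?v = "\<lambda>j. num (take (2 * k) (drop (2 * k * j) (bt s)))"
  let ?J = "\<lambda>i s'. bt s' = drop (i * (2 * k)) (bt s) \<and> (\<forall>j<i. mm s' 7 j = ?v j) \<and>
      (\<forall>c. c \<noteq> 7 \<longrightarrow> mm s' c = mm s c) \<and> nf s' = nf s + i * (2 * k) \<and> tk s' \<le> tk s + i * (2 * k + 1)"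
  show ?thesis unfolding p_coins_def
  proof (rule wp_For[where m = ?N and J = ?J])
    fix i and s' :: st assume i: "i < ?N" and J: "?J i s'" and fr: "frame (For 15 (Nm ?N) ?c) s s'" and x: "rg s' 15 = i"
    have e: "env s'" using assms(1) fr by (rule env_frame) auto
    let ?s = "s'\<lparr>rg := (rg s')(16 := 0)\<rparr>"
    have "Suc i * (2 * k) \<le> ?N * (2 * k)" using i by (intro mult_right_mono) auto
    hence len: "2 * k \<le> length (bt ?s)" using J assms(2) by simp
    have "wps (For 17 (Times (Nm 2) (Vr 4)) (Flip 18 ;; 16 ::= Plus (Times (Nm 2) (Vr 16)) (Vr 18)))
       (wps (Sto (Nm 7) (Vr 15) (Vr 16)) (\<lambda>s''. ?J (Suc i) (s''\<lparr>rg := (rg s'')(15 := Suc i), tk := Suc (tk s'')\<rparr>))) ?s"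
    proof (rule wp_frame[OF wp_flips])
      show "env ?s" using e by (simp add: env_def)
      fix s'' assume Q: "rg s'' 16 = num (take (2 * k) (bt ?s)) \<and> bt s'' = drop (2 * k) (bt ?s) \<and>
        nf s'' = nf ?s + 2 * k \<and> tk s'' \<le> tk ?s + 2 * k"
        and fr2: "frame (For 17 (Times (Nm 2) (Vr 4)) (Flip 18 ;; 16 ::= Plus (Times (Nm 2) (Vr 16)) (Vr 18))) ?s s''"
      have m: "mm s'' = mm s'" "rg s'' 15 = i" using fr2 x by (auto simp: frame_def)
      have "num (take (2 * k) (bt ?s)) < 2 ^ length (take (2 * k) (bt ?s))" by (rule num_less)
      also have "\<dots> \<le> 2 ^ (2 * k)" by (intro power_increasing) auto
      finally have "num (take (2 * k) (bt ?s)) < B" using QQ_less by simp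
      thus "wps (Sto (Nm 7) (Vr 15) (Vr 16)) (\<lambda>s''. ?J (Suc i) (s''\<lparr>rg := (rg s'')(15 := Suc i), tk := Suc (tk s'')\<rparr>)) s''"
        using Q J m by (auto simp: less_Suc_eq algebra_simps)
    qed (use len in auto)
    thus "wps ?c (\<lambda>s''. ?J (Suc i) (s''\<lparr>rg := (rg s'')(15 := Suc i), tk := Suc (tk s'')\<rparr>)) s'"
      using Bn by simp
  next
    fix s' :: st assume "?J ?N s'" "frame (For 15 (Nm ?N) ?c) s s'"
    thus "env s' \<and> (\<forall>j<?N. mm s' 7 j = chunks ?N (2 * k) (bt s) ! j) \<and>
      (\<forall>c. c \<noteq> 7 \<longrightarrow> mm s' c = mm s c) \<and> nf s' = nf s + ?N * (2 * k) \<and> tk s' \<le> tk s + ?N * (2 * k + 1)"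
      using env_frame[OF assms(1)] by (auto simp: chunks_def)
  qed (use Bn in \<open>auto simp: NA_def NR_def\<close>)
qed

section \<open>Lists and samples in memory\<close>

definition rep :: "st \<Rightarrow> (nat \<Rightarrow> nat list) \<Rightarrow> bool" where
  "rep s L \<longleftrightarrow> (\<forall>d<2. mm s 6 d = length (L d) \<and> (\<forall>i<length (L d). mm s d i = L d ! i))"

lemma repD: "rep s L \<Longrightarrow> d < 2 \<Longrightarrow> mm s 6 d = length (L d)"
  "rep s L \<Longrightarrow> d < 2 \<Longrightarrow> i < length (L d) \<Longrightarrow> mm s d i = L d ! i"
  by (auto simp: rep_def)

lemma wp_init:
  assumes "env s"
  shows "wps p_init (\<lambda>s'. env s' \<and> rep s' full \<and> mm s' 7 = mm s 7 \<and> tk s' \<le> tk s + n) s"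
proof -
  let ?c = "Sto (Nm 0) (Vr 19) (Vr 19) ;; Sto (Nm 1) (Vr 19) (Vr 19)"
  have "wps (For 19 rn ?c) (\<lambda>s'. env s' \<and> (\<forall>i<n. mm s' 0 i = i \<and> mm s' 1 i = i) \<and> mm s' 7 = mm s 7 \<and> tk s' \<le> tk s + n) s"
  proof (rule wp_For[where m = n and J = "\<lambda>j s'. (\<forall>i<j. mm s' 0 i = i \<and> mm s' 1 i = i) \<and> mm s' 7 = mm s 7 \<and> tk s' \<le> tk s + j"])
    fix s' :: st assume "(\<forall>i<n. mm s' 0 i = i \<and> mm s' 1 i = i) \<and> mm s' 7 = mm s 7 \<and> tk s' \<le> tk s + n" "frame (For 19 rn ?c) s s'"
    thus "env s' \<and> (\<forall>i<n. mm s' 0 i = i \<and> mm s' 1 i = i) \<and> mm s' 7 = mm s 7 \<and> tk s' \<le> tk s + n"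
      using env_frame[OF assms] by auto
  next
    fix i and s' :: st assume "frame (For 19 rn ?c) s s'"
    thus "gd s' rn \<and> ev s' rn = n" using assms by (simp add: frame_def env_def)
  qed (use Bn in \<open>auto simp: less_Suc_eq\<close>)
  thus ?thesis unfolding p_init_def wp_Seq
    by (rule wp_mono) (use Bn in \<open>auto simp: env_def rep_def full_def less_2_cases_iff\<close>)
qed

lemma ev_hash: "env s \<Longrightarrow> ev s (hash a q) = ms k (2 * k) (mm s 7 (ev s a)) (mm s 7 (ev s a + 1)) (ev s q)"
  by (simp add: hash_def ms_def env_def mult_2 power_add)

lemma gd_hash [simp]: "gd s (hash a q) \<longleftrightarrow> gd s a \<and> gd s q"
  by (auto simp: hash_def)

lemma ms_less: "ms k (2 * k) a b q < 2 ^ k"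
proof -
  have "(a * q + b) mod 2 ^ (2 * k) < 2 ^ k * 2 ^ k" by (simp add: mult_2 power_add)
  thus ?thesis unfolding ms_def by (rule less_mult_imp_div_less)
qed

lemma ms_B: "ms k (2 * k) a b q < B"
  using ms_less[of a b q] k_le Bn by linarith

lemma sample1_props [simp]: "writes (p_sample1 m dst src) = {26, 27}" "noflip (p_sample1 m dst src)"
  by (auto simp: p_sample1_def)

lemma wp_sample1:
  assumes "env s" "m \<in> {7, 8}" "M = rg s m" "x \<in> {22, 23}" "rg s x < 2" "rg s 22 < 2" "c \<in> {2, 4}"
    "0 < rg s 25" "\<forall>i<rg s 25. mm s (rg s x) i < n"
  shows "wps (p_sample1 m (Plus (Nm c) (Vr 22)) (Vr x)) (\<lambda>s'. mm s' = (mm s)(c + rg s 22 := (\<lambda>q. if q < M then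
      mm s (rg s x) (ms k (2 * k) (mm s 7 (rg s 24)) (mm s 7 (rg s 24 + 1)) q mod rg s 25) else mm s (c + rg s 22) q)) \<and>
      tk s' \<le> tk s + M) s"
proof -
  let ?D = "c + rg s 22"
  let ?F = "\<lambda>q. mm s (rg s x) (ms k (2 * k) (mm s 7 (rg s 24)) (mm s 7 (rg s 24 + 1)) q mod rg s 25)"
  let ?J = "\<lambda>i s'. mm s' = (mm s)(?D := (\<lambda>q. if q < i then ?F q else mm s ?D q)) \<and> tk s' \<le> tk s + i"
  let ?c = "27 ::= hash (Vr 24) (Vr 26) ;; Sto (Plus (Nm c) (Vr 22)) (Vr 26) (Ld (Vr x) (Modu (Vr 27) (Vr 25)))"
  have M: "M \<le> n" "M < B" using assms(1-3) Y_le Bn by (auto simp: env_def)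
  show ?thesis unfolding p_sample1_def
  proof (rule wp_For[where m = M and J = ?J])
    fix i and s' :: st assume i: "i < M" and J: "?J i s'" and fr: "frame (For 26 (Vr m) ?c) s s'" and xx: "rg s' 26 = i"
    have e: "env s'" using assms(1) fr by (rule env_frame) auto
    have r: "rg s' 24 = rg s 24" "rg s' 25 = rg s 25" "rg s' 22 = rg s 22" "rg s' x = rg s x"
      using fr assms(4) by (auto simp: frame_def)
    have D: "?D \<noteq> 7" "?D \<noteq> rg s x" "?D < 8" "rg s x < 8" using assms(5-7) by auto
    have "?F i < n" using assms(8,9) by simp
    hence F: "?F i < B" using Bn by linarith
    have h: "ev s' (hash (Vr 24) (Vr 26)) = ms k (2 * k) (mm s 7 (rg s 24)) (mm s 7 (rg s 24 + 1)) i"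
      using ev_hash[OF e, of "Vr 24" "Vr 26"] r xx J D by simp
    have "x \<noteq> 27" "x \<noteq> 26" using assms(4) by auto
    thus "wps ?c (\<lambda>s''. ?J (Suc i) (s''\<lparr>rg := (rg s'')(26 := Suc i), tk := Suc (tk s'')\<rparr>)) s'"
      using h r xx J D F ms_B by (auto simp: fun_eq_iff less_Suc_eq)
  next
    fix i and s' :: st assume "frame (For 26 (Vr m) ?c) s s'"
    thus "gd s' (Vr m) \<and> ev s' (Vr m) = M" using assms(2,3) by (auto simp: frame_def)
  qed (use M assms(4) in auto)
qed

definition smp :: "st \<Rightarrow> (nat \<Rightarrow> nat list) \<Rightarrow> (nat \<Rightarrow> nat list) \<Rightarrow> bool" where
  "smp s R S \<longleftrightarrow> (\<forall>d<2. (\<forall>q<YR. mm s (2 + d) q = R d ! q) \<and> (\<forall>q<YS. mm s (4 + d) q = S d ! q))"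

lemma seeds_tup:
  "d < 2 \<Longrightarrow> seedR d (tup f b) = (f (b + 4 * d), f (b + 4 * d + 1))"
  "d < 2 \<Longrightarrow> seedS d (tup f b) = (f (b + 4 * d + 2), f (b + 4 * d + 3))"
  by (auto simp: seedR_def seedS_def tup_def less_2_cases_iff add.commute)

lemma wp_sample:
  assumes "env s" "proper L" "rep s L" "L 0 \<noteq> []" "L 1 \<noteq> []" "mm s 7 = f" "rg s 20 = b" "b + 100 < B"
  shows "wps p_sample (\<lambda>s'. smp s' (Rs L (tup f b)) (Ss L (tup f b)) \<and> (\<forall>c. c \<notin> {2, 3, 4, 5} \<longrightarrow> mm s' c = mm s c) \<and>
      tk s' \<le> tk s + 2 * (YR + YS + 1)) s"
proof -
  let ?R = "Rs L (tup f b)" and ?S = "Ss L (tup f b)"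
  let ?J = "\<lambda>i s'. (\<forall>d<i. (\<forall>q<YR. mm s' (2 + d) q = ?R d ! q) \<and> (\<forall>q<YS. mm s' (4 + d) q = ?S d ! q)) \<and>
      (\<forall>c. c \<notin> {2, 3, 4, 5} \<longrightarrow> mm s' c = mm s c) \<and> tk s' \<le> tk s + i * (YR + YS + 1)"
  let ?c = "23 ::= Modu (Plus (Vr 22) (Nm 1)) (Nm 2) ;;
     24 ::= Plus (Vr 20) (Times (Nm 4) (Vr 22)) ;; 25 ::= Ld (Nm 6) (Vr 22) ;;
     p_sample1 7 (Plus (Nm 2) (Vr 22)) (Vr 22) ;;
     24 ::= Plus (Vr 24) (Nm 2) ;; 25 ::= Ld (Nm 6) (Vr 23) ;;
     p_sample1 8 (Plus (Nm 4) (Vr 22)) (Vr 23)"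
  have lens: "0 < length (L d)" "length (L d) < B" "length (L d) \<le> n" if "d < 2" for d
    using that assms(4,5) proper_length[OF assms(2) that] Bn by (auto simp: less_2_cases_iff)
  have ent: "L d ! i < n" if "d < 2" "i < length (L d)" for d i
    using properD[OF assms(2) that(1)] that(2) by simp
  show ?thesis unfolding p_sample_def
  proof (rule wp_For[where m = 2 and J = ?J])
    fix i and s' :: st assume i: "i < 2" and J: "?J i s'" and fr: "frame (For 22 (Nm 2) ?c) s s'" and xx: "rg s' 22 = i"
    have e: "env s'" using assms(1) fr by (rule env_frame) auto
    have b: "rg s' 20 = b" using fr assms(7) by (simp add: frame_def)
    have r: "mm s' 6 d = length (L d)" "i' < length (L d) \<Longrightarrow> mm s' d i' = L d ! i'" if "d < 2" for d i'
      using J that assms(3) by (auto simp: rep_def less_2_cases_iff)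
    have f7: "mm s' 7 = f" using J assms(6) by simp
    have i1: "Suc i mod 2 = 1 - i" "1 - i < 2" "i \<noteq> 1 - i" using i by (auto simp: less_2_cases_iff)
    let ?s1 = "s'\<lparr>rg := (rg s')(23 := 1 - i, 24 := b + 4 * i, 25 := length (L i))\<rparr>"
    have "wps (p_sample1 7 (Plus (Nm 2) (Vr 22)) (Vr 22)) (wps (24 ::= Plus (Vr 24) (Nm 2) ;; 25 ::= Ld (Nm 6) (Vr 23) ;;
       p_sample1 8 (Plus (Nm 4) (Vr 22)) (Vr 23)) (\<lambda>s''. ?J (Suc i) (s''\<lparr>rg := (rg s'')(22 := Suc i), tk := Suc (tk s'')\<rparr>))) ?s1"
    proof (rule wp_frame[OF wp_sample1])
      show "env ?s1" using e by (simp add: env_def)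
      fix s2 assume Q2: "mm s2 = (mm ?s1)(2 + rg ?s1 22 := (\<lambda>q. if q < rg ?s1 7 then
          mm ?s1 (rg ?s1 22) (ms k (2 * k) (mm ?s1 7 (rg ?s1 24)) (mm ?s1 7 (rg ?s1 24 + 1)) q mod rg ?s1 25)
          else mm ?s1 (2 + rg ?s1 22) q)) \<and> tk s2 \<le> tk ?s1 + rg ?s1 7"
        and fr2: "frame (p_sample1 7 (Plus (Nm 2) (Vr 22)) (Vr 22)) ?s1 s2"
      have YR: "rg ?s1 7 = YR" using e by (simp add: env_def)
      have m2: "mm s2 = (mm s')(2 + i := (\<lambda>q. if q < YR then ?R i ! q else mm s' (2 + i) q))"
        using Q2 YR f7 r[OF i] lens(1)[OF i] by (auto simp: xx fun_eq_iff Rs_def idx_def seeds_tup i)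
      have e2: "env s2" by (rule env_frame[OF _ fr2]) (use e in \<open>auto simp: env_def\<close>)
      have r2: "rg s2 22 = i" "rg s2 23 = 1 - i" "rg s2 24 = b + 4 * i" using fr2 xx by (auto simp: frame_def)
      let ?s3 = "s2\<lparr>rg := (rg s2)(24 := b + 4 * i + 2, 25 := length (L (1 - i)))\<rparr>"
      have e3: "env ?s3" using e2 by (simp add: env_def)
      have m26: "mm s2 6 (1 - i) = length (L (1 - i))" "\<And>i'. i' < length (L (1 - i)) \<Longrightarrow> mm s2 (1 - i) i' = L (1 - i) ! i'"
        using m2 r[OF i1(2)] i1(2) i by auto
      have "wps (p_sample1 8 (Plus (Nm 4) (Vr 22)) (Vr 23)) (\<lambda>s''. ?J (Suc i) (s''\<lparr>rg := (rg s'')(22 := Suc i), tk := Suc (tk s'')\<rparr>)) ?s3"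
      proof (rule wp_frame[OF wp_sample1])
        show "env ?s3" by (rule e3)
        fix s4 assume Q4: "mm s4 = (mm ?s3)(4 + rg ?s3 22 := (\<lambda>q. if q < rg ?s3 8 then
            mm ?s3 (rg ?s3 23) (ms k (2 * k) (mm ?s3 7 (rg ?s3 24)) (mm ?s3 7 (rg ?s3 24 + 1)) q mod rg ?s3 25)
            else mm ?s3 (4 + rg ?s3 22) q)) \<and> tk s4 \<le> tk ?s3 + rg ?s3 8"
        have YS: "rg ?s3 8 = YS" using e3 by (simp add: env_def)
        have f72: "mm s2 7 = f" using m2 f7 i by auto
        have m4: "mm s4 = (mm s2)(4 + i := (\<lambda>q. if q < YS then ?S i ! q else mm s2 (4 + i) q))"
          using Q4 YS f72 m26 lens(1)[OF i1(2)] r2 by (auto simp: fun_eq_iff Ss_def idx_def seeds_tup i numeral_3_eq_3)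
        have t: "tk s4 \<le> tk s' + YR + YS" using Q2 Q4 YR YS by simp
        show "?J (Suc i) (s4\<lparr>rg := (rg s4)(22 := Suc i), tk := Suc (tk s4)\<rparr>)"
        proof (intro conjI allI impI)
          fix d q assume d: "d < Suc i" "q < YR"
          show "mm (s4\<lparr>rg := (rg s4)(22 := Suc i), tk := Suc (tk s4)\<rparr>) (2 + d) q = ?R d ! q"
            using d J i by (auto simp: m4 m2 less_Suc_eq less_2_cases_iff)
        next
          fix d q assume d: "d < Suc i" "q < YS"
          show "mm (s4\<lparr>rg := (rg s4)(22 := Suc i), tk := Suc (tk s4)\<rparr>) (4 + d) q = ?S d ! q"
            using d J i by (auto simp: m4 m2 less_Suc_eq less_2_cases_iff)
        next
          fix c assume "c \<notin> {2, 3, 4, 5::nat}"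
          thus "mm (s4\<lparr>rg := (rg s4)(22 := Suc i), tk := Suc (tk s4)\<rparr>) c = mm s c"
            using J i by (auto simp: m4 m2 less_2_cases_iff)
        qed (use t J in \<open>auto simp: algebra_simps\<close>)
      qed (use e3 r2 lens[OF i1(2)] ent[OF i1(2)] m26 i i1 in \<open>auto\<close>)
      thus "wps (24 ::= Plus (Vr 24) (Nm 2) ;; 25 ::= Ld (Nm 6) (Vr 23) ;;
          p_sample1 8 (Plus (Nm 4) (Vr 22)) (Vr 23)) (\<lambda>s''. ?J (Suc i) (s''\<lparr>rg := (rg s'')(22 := Suc i), tk := Suc (tk s'')\<rparr>)) s2"
        using r2 m26 assms(8) i lens(2)[OF i1(2)] by (simp add: add.assoc)
    qed (use lens[OF i] ent[OF i] r[OF i] xx i in \<open>auto\<close>)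
    thus "wps ?c (\<lambda>s''. ?J (Suc i) (s''\<lparr>rg := (rg s'')(22 := Suc i), tk := Suc (tk s'')\<rparr>)) s'"
      using xx b assms(8) i i1 r(1)[OF i] lens(2)[OF i] Bn by simp
  next
    fix s' :: st assume "?J 2 s'"
    thus "smp s' ?R ?S \<and> (\<forall>c. c \<notin> {2, 3, 4, 5} \<longrightarrow> mm s' c = mm s c) \<and> tk s' \<le> tk s + 2 * (YR + YS + 1)"
      by (auto simp: smp_def)
  qed (use Bn in auto)
qed


section \<open>Pivot search, walk and filter\<close>

lemma count_props [simp]: "writes p_count = {37, 38, 39}" "nosto p_count" "noflip p_count"
  by (auto simp: p_count_def)

lemma wp_count:
  assumes "env s" "rg s 22 = d" "d < 2" "rg s 34 = a" "rg s 36 = b" "a < n" "b < n" "length S = YS"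
    "\<forall>q<YS. mm s (4 + d) q = S ! q" "set S \<subseteq> {..<n}"
  shows "wps p_count (\<lambda>s'. rg s' 37 = cnt d S a b \<and> tk s' \<le> tk s + YS) s"
proof -
  let ?P = "\<lambda>j. Vo d a b < Vo d a j"
  let ?c = "cmpo 39 (Vr 34) (Vr 36) (Vr 34) (Ld (Plus (Nm 4) (Vr 22)) (Vr 38)) ;; 37 ::= Plus (Vr 37) (Vr 39)"
  let ?J = "\<lambda>i s'. rg s' 37 = length (filter ?P (take i S)) \<and> tk s' \<le> tk s + i"
  have "wps (For 38 (Vr 8) ?c) (\<lambda>s'. rg s' 37 = cnt d S a b \<and> tk s' \<le> tk s + YS) (s\<lparr>rg := (rg s)(37 := 0)\<rparr>)"
  proof (rule wp_For[where m = YS and J = ?J])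
    fix i and s' :: st assume i: "i < YS" and J: "?J i s'" and xx: "rg s' 38 = i"
      and fr: "frame (For 38 (Vr 8) ?c) (s\<lparr>rg := (rg s)(37 := 0)\<rparr>) s'"
    have r: "rg s' 22 = d" "rg s' 34 = a" "rg s' 36 = b" "mm s' = mm s"
      using fr assms(2,4,5) by (auto simp: frame_def)
    have v: "mm s' (4 + d) i = S ! i" using r(4) assms(9) i by simp
    have Sn: "S ! i < n" using assms(8,10) i by (metis lessThan_iff nth_mem subsetD)
    have t: "take (Suc i) S = take i S @ [S ! i]" using i assms(8) by (intro take_Suc_conv_app_nth) simp
    have "length (filter ?P (take i S)) \<le> YS"
      using length_filter_le[of ?P "take i S"] assms(8) i by simp
    hence "length (filter ?P (take i S)) + 1 < B" using Y_le Bn by simp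
    thus "wps ?c (\<lambda>s''. ?J (Suc i) (s''\<lparr>rg := (rg s'')(38 := Suc i), tk := Suc (tk s'')\<rparr>)) s'"
      using J xx r v Sn assms(3,6,7) by (simp add: wp_cmpo t ltO_def)
  next
    fix i and s' :: st assume "frame (For 38 (Vr 8) ?c) (s\<lparr>rg := (rg s)(37 := 0)\<rparr>) s'"
    thus "gd s' (Vr 8) \<and> ev s' (Vr 8) = YS" using assms(1) by (simp add: frame_def env_def)
  qed (use assms(8) Y_le Bn in \<open>auto simp: cnt_def\<close>)
  thus ?thesis using Bn by (simp add: p_count_def)
qed

text \<open>Invariant of the search, with \<open>A\<close> the set of positions inspected so far;
  \<open>x = n\<close> encodes that none of them was a candidate.\<close>

definition best :: "nat \<Rightarrow> nat list \<Rightarrow> nat \<Rightarrow> (nat \<times> nat) set \<Rightarrow> nat \<Rightarrow> nat \<Rightarrow> bool" where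
  "best d S th A x z \<longleftrightarrow> ((\<forall>(a, b)\<in>A. \<not> cnt d S a b < th) \<and> x = n) \<or>
    ((x, z) \<in> A \<and> cnt d S x z < th \<and> (\<forall>(a, b)\<in>A. cnt d S a b < th \<longrightarrow> Vo d x z \<le> Vo d a b))"

lemma best_skip: "best d S th A x z \<Longrightarrow> \<not> cnt d S a b < th \<Longrightarrow> best d S th (insert (a, b) A) x z"
  by (auto simp: best_def)

lemma best_keep: "best d S th A x z \<Longrightarrow> ltO d x z a b \<Longrightarrow> best d S th (insert (a, b) A) x z"
  by (auto simp: best_def ltO_def)

text \<open>This covers the first candidate too, since \<open>ltO\<close> is False when the row is
  \<open>n\<close>.\<close>

lemma best_update:
  "best d S th A x z \<Longrightarrow> cnt d S a b < th \<Longrightarrow> \<not> ltO d x z a b \<Longrightarrow> A \<subseteq> {..<n} \<times> {..<n} \<Longrightarrow> a < n \<Longrightarrow> b < n \<Longrightarrow>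
    best d S th (insert (a, b) A) a b"
  by (fastforce simp: best_def ltO_def)

lemma pivot_props [simp]: "writes p_pivot = {31, 32, 33, 34, 35, 36, 37, 38, 39}" "nosto p_pivot" "noflip p_pivot"
  by (auto simp: p_pivot_def)

lemma wp_pivot:
  assumes "env s" "rg s 22 = d" "d < 2" "rg s 30 = th" "length R = YR" "length S = YS" "0 < th"
    "\<forall>q<YR. mm s (2 + d) q = R ! q" "\<forall>q<YS. mm s (4 + d) q = S ! q" "set R \<subseteq> {..<n}" "set S \<subseteq> {..<n}"
  shows "wps p_pivot (\<lambda>s'. (rg s' 31, rg s' 32) = piv d R S th \<and> tk s' \<le> tk s + YR * (YS * (YS + 1) + 1)) s"
proof -
  let ?ci = "36 ::= Ld (Plus (Nm 4) (Vr 22)) (Vr 35) ;; p_count ;;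
         Cond (Vr 37) (Vr 30) (cmpo 39 (Vr 31) (Vr 32) (Vr 34) (Vr 36) ;;
           Cond (Vr 39) (Nm 1) (31 ::= Vr 34 ;; 32 ::= Vr 36) Skip) Skip"
  let ?co = "34 ::= Ld (Plus (Nm 2) (Vr 22)) (Vr 33) ;; For 35 (Vr 8) ?ci"
  have nB: "n < B" using Bn by linarith
  have Rn: "R ! i < n" if "i < YR" for i using assms(5,10) that by (metis lessThan_iff nth_mem subsetD)
  have Sn: "S ! i < n" if "i < YS" for i using assms(6,11) that by (metis lessThan_iff nth_mem subsetD)
  have inner: "wps (For 35 (Vr 8) ?ci) (\<lambda>s'. best d S th (A \<union> {a} \<times> set S) (rg s' 31) (rg s' 32) \<and> tk s' \<le> tk s1 + YS * (YS + 1)) s1"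
    if e: "env s1" and r: "rg s1 22 = d" "rg s1 30 = th" "rg s1 34 = a" "mm s1 = mm s"
      and b: "best d S th A (rg s1 31) (rg s1 32)" and A: "A \<subseteq> {..<n} \<times> {..<n}" "a < n" for s1 A a
  proof (rule wp_For[where m = YS and J = "\<lambda>j s'. best d S th (A \<union> {a} \<times> set (take j S)) (rg s' 31) (rg s' 32) \<and> tk s' \<le> tk s1 + j * (YS + 1)"])
    fix j and s' :: st assume j: "j < YS"
      and J: "best d S th (A \<union> {a} \<times> set (take j S)) (rg s' 31) (rg s' 32) \<and> tk s' \<le> tk s1 + j * (YS + 1)"
      and fr: "frame (For 35 (Vr 8) ?ci) s1 s'" and xx: "rg s' 35 = j"
    have e': "env s'" using e fr by (rule env_frame) auto
    have r': "rg s' 22 = d" "rg s' 30 = th" "rg s' 34 = a" "mm s' = mm s"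
      using fr r by (auto simp: frame_def)
    let ?s = "s'\<lparr>rg := (rg s')(36 := S ! j)\<rparr>"
    let ?A = "A \<union> {a} \<times> set (take j S)"
    let ?cond = "Cond (Vr 37) (Vr 30) (cmpo 39 (Vr 31) (Vr 32) (Vr 34) (Vr 36) ;;
           Cond (Vr 39) (Nm 1) (31 ::= Vr 34 ;; 32 ::= Vr 36) Skip) Skip"
    let ?Q = "\<lambda>s''. best d S th (A \<union> {a} \<times> set (take (Suc j) S)) (rg (s''\<lparr>rg := (rg s'')(35 := Suc j), tk := Suc (tk s'')\<rparr>) 31)
        (rg (s''\<lparr>rg := (rg s'')(35 := Suc j), tk := Suc (tk s'')\<rparr>) 32) \<and>
        tk (s''\<lparr>rg := (rg s'')(35 := Suc j), tk := Suc (tk s'')\<rparr>) \<le> tk s1 + Suc j * (YS + 1)"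
    have A': "?A \<subseteq> {..<n} \<times> {..<n}" using A assms(11) set_take_subset[of j S] by auto
    have t: "A \<union> {a} \<times> set (take (Suc j) S) = insert (a, S ! j) ?A"
      using j assms(6) by (subst take_Suc_conv_app_nth) auto
    have "wps p_count (wps ?cond ?Q) ?s"
    proof (rule wp_frame[OF wp_count])
      show "env ?s" using e' by (simp add: env_def)
      fix s2 assume Q2: "rg s2 37 = cnt d S a (S ! j) \<and> tk s2 \<le> tk ?s + YS" and fr2: "frame p_count ?s s2"
      have r2: "rg s2 22 = d" "rg s2 30 = th" "rg s2 34 = a" "rg s2 36 = S ! j" "rg s2 31 = rg s' 31" "rg s2 32 = rg s' 32"
        using fr2 r' by (auto simp: frame_def)
      have tk: "Suc (tk s2) \<le> tk s1 + Suc j * (YS + 1)" using J Q2 by simp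
      show "wps ?cond ?Q s2"
      proof (cases "cnt d S a (S ! j) < th")
        case False
        thus ?thesis using Q2 r2 J tk best_skip[of d S th ?A "rg s' 31" "rg s' 32" a "S ! j"] by (simp add: t)
      next
        case c: True
        show ?thesis
        proof (cases "ltO d (rg s' 31) (rg s' 32) a (S ! j)")
          case True
          thus ?thesis using c Q2 r2 J tk assms(3) best_keep[of d S th ?A "rg s' 31" "rg s' 32" a "S ! j"] by (simp add: t wp_cmpo)
        next
          case False
          have "best d S th (insert (a, S ! j) ?A) a (S ! j)"
            using best_update[OF _ c False A' A(2) Sn[OF j]] J by blast
          moreover have "a < B" "S ! j < B" using A(2) Sn[OF j] nB by auto
          ultimately show ?thesis using c False Q2 r2 tk assms(3) by (simp add: t wp_cmpo)
        qed
      qed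
    qed (use r' A Sn[OF j] assms in auto)
    thus "wps ?ci ?Q s'" using r' xx assms(3,9) j Sn[OF j] nB by simp
  next
    fix i and s' :: st assume "frame (For 35 (Vr 8) ?ci) s1 s'"
    thus "gd s' (Vr 8) \<and> ev s' (Vr 8) = YS" using e by (simp add: frame_def env_def)
  qed (use b Y_le nB assms(6) in auto)
  let ?s0 = "s\<lparr>rg := (rg s)(31 := n, 32 := 0)\<rparr>"
  have "wps (For 33 (Vr 7) ?co) (\<lambda>s'. best d S th (set R \<times> set S) (rg s' 31) (rg s' 32) \<and> tk s' \<le> tk s + YR * (YS * (YS + 1) + 1)) ?s0"
  proof (rule wp_For[where m = YR and J = "\<lambda>i s'. best d S th (set (take i R) \<times> set S) (rg s' 31) (rg s' 32) \<and> tk s' \<le> tk s + i * (YS * (YS + 1) + 1)"])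
    fix i and s' :: st assume i: "i < YR"
      and J: "best d S th (set (take i R) \<times> set S) (rg s' 31) (rg s' 32) \<and> tk s' \<le> tk s + i * (YS * (YS + 1) + 1)"
      and fr: "frame (For 33 (Vr 7) ?co) ?s0 s'" and xx: "rg s' 33 = i"
    have e': "env s'" by (rule env_frame[OF _ fr]) (use assms(1) in \<open>auto simp: env_def\<close>)
    have r': "rg s' 22 = d" "rg s' 30 = th" "mm s' = mm s"
      using fr assms(2,4) by (auto simp: frame_def)
    let ?s = "s'\<lparr>rg := (rg s')(34 := R ! i)\<rparr>"
    have t: "set (take (Suc i) R) \<times> set S = (set (take i R) \<times> set S) \<union> {R ! i} \<times> set S"
      using i assms(5) by (subst take_Suc_conv_app_nth) auto
    have A: "set (take i R) \<times> set S \<subseteq> {..<n} \<times> {..<n}" using assms(10,11) set_take_subset[of i R] by auto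
    have "wps (For 35 (Vr 8) ?ci) (\<lambda>s''. best d S th (set (take (Suc i) R) \<times> set S) (rg (s''\<lparr>rg := (rg s'')(33 := Suc i), tk := Suc (tk s'')\<rparr>) 31)
        (rg (s''\<lparr>rg := (rg s'')(33 := Suc i), tk := Suc (tk s'')\<rparr>) 32) \<and>
        tk (s''\<lparr>rg := (rg s'')(33 := Suc i), tk := Suc (tk s'')\<rparr>) \<le> tk s + Suc i * (YS * (YS + 1) + 1)) ?s"
    proof (rule wp_mono[OF inner[where A = "set (take i R) \<times> set S" and a = "R ! i"]])
      fix s'' assume "best d S th (set (take i R) \<times> set S \<union> {R ! i} \<times> set S) (rg s'' 31) (rg s'' 32) \<and> tk s'' \<le> tk ?s + YS * (YS + 1)"
      thus "best d S th (set (take (Suc i) R) \<times> set S) (rg (s''\<lparr>rg := (rg s'')(33 := Suc i), tk := Suc (tk s'')\<rparr>) 31)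
        (rg (s''\<lparr>rg := (rg s'')(33 := Suc i), tk := Suc (tk s'')\<rparr>) 32) \<and>
        tk (s''\<lparr>rg := (rg s'')(33 := Suc i), tk := Suc (tk s'')\<rparr>) \<le> tk s + Suc i * (YS * (YS + 1) + 1)"
        unfolding t using J by simp
    qed (use e' r' J A Rn[OF i] in \<open>auto simp: env_def\<close>)
    thus "wps ?co (\<lambda>s''. best d S th (set (take (Suc i) R) \<times> set S) (rg (s''\<lparr>rg := (rg s'')(33 := Suc i), tk := Suc (tk s'')\<rparr>) 31)
        (rg (s''\<lparr>rg := (rg s'')(33 := Suc i), tk := Suc (tk s'')\<rparr>) 32) \<and>
        tk (s''\<lparr>rg := (rg s'')(33 := Suc i), tk := Suc (tk s'')\<rparr>) \<le> tk s + Suc i * (YS * (YS + 1) + 1)) s'"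
      using r' xx assms(3,8) i Rn[OF i] nB by simp
  next
    fix i and s' :: st assume "frame (For 33 (Vr 7) ?co) ?s0 s'"
    thus "gd s' (Vr 7) \<and> ev s' (Vr 7) = YR" using assms(1) by (simp add: frame_def env_def)
  qed (use Y_le nB assms(5) in \<open>auto simp: best_def\<close>)
  hence "wps (For 33 (Vr 7) ?co) (\<lambda>s'. (rg s' 31, rg s' 32) = piv d R S th \<and> tk s' \<le> tk s + YR * (YS * (YS + 1) + 1)) ?s0"
  proof (rule wp_mono)
    fix s' :: st assume J: "best d S th (set R \<times> set S) (rg s' 31) (rg s' 32) \<and> tk s' \<le> tk s + YR * (YS * (YS + 1) + 1)"
    have ne: "R \<noteq> []" "S \<noteq> []" using assms(5,6) YR_pos YS_pos by auto
    obtain b where b: "b \<in> set S" "cnt d S (hd R) b = 0" using cnt_zero_exists[OF ne(2)] by blast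
    hence "(hd R, b) \<in> set R \<times> set S" "cnt d S (hd R) b < th" using ne assms(7) by auto
    hence "isPiv d R S th (rg s' 31, rg s' 32)"
      using J unfolding best_def isPiv_def by (auto simp: Ball_def)
    thus "(rg s' 31, rg s' 32) = piv d R S th \<and> tk s' \<le> tk s + YR * (YS * (YS + 1) + 1)"
      using piv_eqI[OF _ assms(10,11)] J by simp
  qed
  thus ?thesis using assms(1) nB by (simp add: p_pivot_def env_def)
qed

lemma walk_props [simp]: "writes p_walk = {39, 40, 41, 42, 43, 44}" "nosto p_walk" "noflip p_walk"
  by (auto simp: p_walk_def)

lemma wp_walk:
  assumes "rep s L" "proper L" "rg s 22 = d" "d < 2" "rg s 23 = 1 - d" "rg s 31 = fst x" "rg s 32 = snd x"
    "fst x < n" "snd x < n"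
  shows "wps p_walk (\<lambda>s'. (rg s' 40 < rg s' 42 \<longleftrightarrow> \<not> walk (above d x) (L d) (L (1 - d))) \<and>
     rg s' 42 = length (L d) \<and> rg s' 43 = length (L (1 - d)) \<and> tk s' \<le> tk s + length (L d) + length (L (1 - d))) s"
proof -
  let ?I = "L d" and ?K = "L (1 - d)"
  let ?P = "above d x"
  let ?c = "Cond (Vr 40) (Vr 42) (Cond (Vr 41) (Vr 43)
       (cmpo 39 (Vr 31) (Vr 32) (Ld (Vr 22) (Vr 40)) (Ld (Vr 23) (Vr 41)) ;;
        Cond (Nm 0) (Vr 39) (40 ::= Plus (Vr 40) (Nm 1)) (41 ::= Plus (Vr 41) (Nm 1))) Skip) Skip"
  let ?m = "length ?I" and ?m' = "length ?K"
  have d': "1 - d < 2" by simp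
  have len: "?m \<le> n" "?m' \<le> n" using proper_length[OF assms(2)] assms(4) by auto
  let ?s0 = "s\<lparr>rg := (rg s)(40 := 0, 41 := 0, 42 := ?m, 43 := ?m')\<rparr>"
  \<comment> \<open>While neither list is exhausted, the two positions add up to the number of
    iterations. After \<open>?m + ?m'\<close> iterations one list must therefore be
    exhausted.\<close>
  let ?J = "\<lambda>i s'. rg s' 40 \<le> ?m \<and> rg s' 41 \<le> ?m' \<and> walk ?P (drop (rg s' 40) ?I) (drop (rg s' 41) ?K) = walk ?P ?I ?K \<and>
      (rg s' 40 < ?m \<and> rg s' 41 < ?m' \<longrightarrow> rg s' 40 + rg s' 41 = i) \<and> tk s' \<le> tk s + i"
  have "wps (For 44 (Plus (Vr 42) (Vr 43)) ?c) (\<lambda>s'. (rg s' 40 < rg s' 42 \<longleftrightarrow> \<not> walk ?P ?I ?K) \<and>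
     rg s' 42 = ?m \<and> rg s' 43 = ?m' \<and> tk s' \<le> tk s + ?m + ?m') ?s0"
  proof (rule wp_For[where m = "?m + ?m'" and J = ?J])
    fix i and s' :: st assume i: "i < ?m + ?m'" and J: "?J i s'" and fr: "frame (For 44 (Plus (Vr 42) (Vr 43)) ?c) ?s0 s'"
    have r: "rg s' 22 = d" "rg s' 23 = 1 - d" "rg s' 31 = fst x" "rg s' 32 = snd x" "rg s' 42 = ?m" "rg s' 43 = ?m'" "mm s' = mm s"
      using fr assms by (auto simp: frame_def)
    show "wps ?c (\<lambda>s''. ?J (Suc i) (s''\<lparr>rg := (rg s'')(44 := Suc i), tk := Suc (tk s'')\<rparr>)) s'"
    proof (cases "rg s' 40 < ?m \<and> rg s' 41 < ?m'")
      case True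
      let ?a = "?I ! rg s' 40" and ?b = "?K ! rg s' 41"
      have v: "mm s d (rg s' 40) = ?a" "mm s (1 - d) (rg s' 41) = ?b"
        using repD(2)[OF assms(1)] True assms(4) by auto
      have ab: "?a < n" "?b < n" using properD[OF assms(2,4), of ?a] properD[OF assms(2) d', of ?b] True by auto
      have lt: "ltO d (fst x) (snd x) ?a ?b \<longleftrightarrow> ?P ?a ?b" using ab assms(8,9) by (simp add: ltO_def above_def)
      have dr: "drop (rg s' 40) ?I = ?a # drop (Suc (rg s' 40)) ?I" "drop (rg s' 41) ?K = ?b # drop (Suc (rg s' 41)) ?K"
        using True by (simp_all add: Cons_nth_drop_Suc)
      have w: "walk ?P ?I ?K = (if ?P ?a ?b then walk ?P (drop (Suc (rg s' 40)) ?I) (drop (rg s' 41) ?K)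
          else walk ?P (drop (rg s' 40) ?I) (drop (Suc (rg s' 41)) ?K))"
        using J unfolding dr by (auto split: if_splits)
      show ?thesis
      proof (cases "?P ?a ?b")
        case P: True
        hence "walk ?P (drop (Suc (rg s' 40)) ?I) (drop (rg s' 41) ?K) = walk ?P ?I ?K" using w by simp
        thus ?thesis using True P J r v lt assms(4) d' len Bn by (simp add: wp_cmpo)
      next
        case P: False
        hence "walk ?P (drop (rg s' 40) ?I) (drop (Suc (rg s' 41)) ?K) = walk ?P ?I ?K" using w by simp
        thus ?thesis using True P J r v lt assms(4) d' len Bn by (simp add: wp_cmpo)
      qed
    next
      case False
      thus ?thesis using J r by auto
    qed
  next
    fix i and s' :: st assume "frame (For 44 (Plus (Vr 42) (Vr 43)) ?c) ?s0 s'"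
    thus "gd s' (Plus (Vr 42) (Vr 43)) \<and> ev s' (Plus (Vr 42) (Vr 43)) = ?m + ?m'" by (simp add: frame_def)
  next
    fix s' :: st assume J: "?J (?m + ?m') s'" and fr: "frame (For 44 (Plus (Vr 42) (Vr 43)) ?c) ?s0 s'"
    have r: "rg s' 42 = ?m" "rg s' 43 = ?m'" using fr by (auto simp: frame_def)
    have "rg s' 40 < ?m \<longleftrightarrow> \<not> walk ?P ?I ?K"
    proof (cases "rg s' 40 < ?m")
      case True
      have "rg s' 41 = ?m'" using J True by (cases "rg s' 41 < ?m'") auto
      moreover obtain a I' where "drop (rg s' 40) ?I = a # I'" using True by (metis Cons_nth_drop_Suc)
      ultimately have "\<not> walk ?P ?I ?K" using J by auto
      thus ?thesis using True by simp
    next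
      case False
      thus ?thesis using J by auto
    qed
    thus "(rg s' 40 < rg s' 42 \<longleftrightarrow> \<not> walk ?P ?I ?K) \<and> rg s' 42 = ?m \<and> rg s' 43 = ?m' \<and> tk s' \<le> tk s + ?m + ?m'"
      using J r by simp
  qed (use len Bn in auto)
  thus ?thesis using repD(1)[OF assms(1)] assms(3-5) d' len Bn by (simp add: p_walk_def)
qed

lemma filter_props [simp]: "writes p_filter = {39, 45, 46, 47}" "noflip p_filter"
  by (auto simp: p_filter_def)

lemma wp_filter:
  assumes "rep s L" "proper L" "rg s 22 = d" "d < 2" "rg s 23 = 1 - d" "rg s 31 = fst x" "rg s 32 = snd x"
    "fst x < n" "snd x < n" "rg s 43 = length (L (1 - d))"
  shows "wps p_filter (\<lambda>s'. rep s' (L(1 - d := filter (above d x (fst x)) (L (1 - d)))) \<and>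
     (\<forall>c. 2 \<le> c \<longrightarrow> c \<noteq> 6 \<longrightarrow> mm s' c = mm s c) \<and> tk s' \<le> tk s + length (L (1 - d))) s"
proof -
  let ?K = "L (1 - d)" and ?D = "1 - d"
  let ?P = "above d x (fst x)"
  let ?m = "length ?K"
  let ?c = "47 ::= Ld (Vr 23) (Vr 46) ;; cmpo 39 (Vr 31) (Vr 32) (Vr 31) (Vr 47) ;; Sto (Vr 23) (Vr 45) (Vr 47) ;; 45 ::= Plus (Vr 45) (Vr 39)"
  have len: "?m \<le> n" using proper_length[OF assms(2), of ?D] by simp
  have D: "?D < 2" "?D < 8" "?D \<noteq> 6" by auto
  let ?F = "\<lambda>i. filter ?P (take i ?K)"
  let ?s0 = "s\<lparr>rg := (rg s)(45 := 0)\<rparr>"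
  \<comment> \<open>From the read position on the array is still the original one; this survives the
    stores because \<open>length (?F i) \<le> i\<close>.\<close>
  let ?J = "\<lambda>i s'. rg s' 45 = length (?F i) \<and> (\<forall>j<length (?F i). mm s' ?D j = ?F i ! j) \<and>
      (\<forall>j. i \<le> j \<longrightarrow> mm s' ?D j = mm s ?D j) \<and> (\<forall>c. c \<noteq> ?D \<longrightarrow> mm s' c = mm s c) \<and> tk s' \<le> tk s + i"
  have "wps (For 46 (Vr 43) ?c) (\<lambda>s'. ?J ?m s' \<and> rg s' 23 = ?D) ?s0"
  proof (rule wp_For[where m = ?m and J = ?J])
    fix i and s' :: st assume i: "i < ?m" and J: "?J i s'" and fr: "frame (For 46 (Vr 43) ?c) ?s0 s'" and xx: "rg s' 46 = i"
    have r: "rg s' 22 = d" "rg s' 23 = ?D" "rg s' 31 = fst x" "rg s' 32 = snd x"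
      using fr assms by (auto simp: frame_def)
    have v: "mm s' ?D i = ?K ! i" using J repD(2)[OF assms(1) D(1) i] by simp
    have b: "?K ! i < n" using properD[OF assms(2) D(1)] i by simp
    have t: "?F (Suc i) = ?F i @ (if ?P (?K ! i) then [?K ! i] else [])"
      using i by (simp add: take_Suc_conv_app_nth)
    have le: "length (?F i) \<le> i" using length_filter_le[of ?P "take i ?K"] by simp
    have lt: "ltO d (fst x) (snd x) (fst x) (?K ! i) \<longleftrightarrow> ?P (?K ! i)" using b assms(8,9) by (simp add: ltO_def above_def)
    let ?M = "(mm s')(?D := (mm s' ?D)(length (?F i) := ?K ! i))"
    have "wps ?c (\<lambda>s''. ?J (Suc i) (s''\<lparr>rg := (rg s'')(46 := Suc i), tk := Suc (tk s'')\<rparr>)) s' \<longleftrightarrow>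
      length (?F i) + of_bool (?P (?K ! i)) = length (?F (Suc i)) \<and> (\<forall>j<length (?F (Suc i)). ?M ?D j = ?F (Suc i) ! j) \<and>
      (\<forall>j. Suc i \<le> j \<longrightarrow> ?M ?D j = mm s ?D j) \<and> (\<forall>c. c \<noteq> ?D \<longrightarrow> ?M c = mm s c) \<and> Suc (tk s') \<le> tk s + Suc i"
      using J r v b xx assms(4) D lt le i len Bn by (simp add: wp_cmpo)
    also have "\<dots>"
    proof (intro conjI allI impI)
      fix j assume "j < length (?F (Suc i))"
      thus "?M ?D j = ?F (Suc i) ! j" using J unfolding t by (auto simp: nth_append less_Suc_eq split: if_splits)
    next
      fix j assume "Suc i \<le> j"
      thus "?M ?D j = mm s ?D j" using J le by auto
    qed (use J t in auto)
    finally show "wps ?c (\<lambda>s''. ?J (Suc i) (s''\<lparr>rg := (rg s'')(46 := Suc i), tk := Suc (tk s'')\<rparr>)) s'" by blast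
  next
    fix i and s' :: st assume "frame (For 46 (Vr 43) ?c) ?s0 s'"
    thus "gd s' (Vr 43) \<and> ev s' (Vr 43) = ?m" using assms(10) by (simp add: frame_def)
  next
    fix s' :: st assume "?J ?m s'" "frame (For 46 (Vr 43) ?c) ?s0 s'"
    thus "?J ?m s' \<and> rg s' 23 = ?D" using assms(5) by (simp add: frame_def)
  qed (use len Bn in auto)
  hence "wps (For 46 (Vr 43) ?c) (wps (Sto (Nm 6) (Vr 23) (Vr 45)) (\<lambda>s'. rep s' (L(?D := filter ?P ?K)) \<and>
     (\<forall>c. 2 \<le> c \<longrightarrow> c \<noteq> 6 \<longrightarrow> mm s' c = mm s c) \<and> tk s' \<le> tk s + ?m)) ?s0"
  proof (rule wp_mono)
    fix s' :: st assume J: "?J ?m s' \<and> rg s' 23 = ?D"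
    have le: "length (filter ?P ?K) < B" using length_filter_le[of ?P ?K] len Bn by linarith
    let ?M = "(mm s')(6 := (mm s' 6)(?D := length (filter ?P ?K)))"
    have "rep (s'\<lparr>mm := ?M\<rparr>) (L(?D := filter ?P ?K))"
      unfolding rep_def
    proof (intro allI impI)
      fix e assume e: "e < (2::nat)"
      show "mm (s'\<lparr>mm := ?M\<rparr>) 6 e = length ((L(?D := filter ?P ?K)) e) \<and>
        (\<forall>i<length ((L(?D := filter ?P ?K)) e). mm (s'\<lparr>mm := ?M\<rparr>) e i = (L(?D := filter ?P ?K)) e ! i)"
      proof (cases "e = ?D")
        case True
        thus ?thesis using J D by auto
      next
        case False
        thus ?thesis using J D e repD[OF assms(1) e] by auto
      qed
    qed
    thus "wps (Sto (Nm 6) (Vr 23) (Vr 45)) (\<lambda>s'. rep s' (L(?D := filter ?P ?K)) \<and>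
     (\<forall>c. 2 \<le> c \<longrightarrow> c \<noteq> 6 \<longrightarrow> mm s' c = mm s c) \<and> tk s' \<le> tk s + ?m) s'"
      using J le by auto
  qed
  thus ?thesis using Bn by (simp add: p_filter_def)
qed

end

section \<open>The random tests\<close>

lemma misses_mono: "misses k z H w q \<Longrightarrow> q' \<le> q \<Longrightarrow> misses k z H w q'"
  by (auto simp: misses_def)

lemma cost_miss:
  assumes "misses k z H w d"
  shows "cost k z H d w = d"
proof -
  have "{q. q < d \<and> misses k z H w q} = {..<d}" using misses_mono[OF assms] by auto
  thus ?thesis by (simp add: cost_def)
qed

text \<open>The round that hits is itself paid for, hence \<open>Suc q\<close>.\<close>

lemma cost_hit:
  assumes "q < d" "misses k z H w q" "\<not> misses k z H w (Suc q)"
  shows "cost k z H d w = Suc q"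
proof -
  have "{q'. q' < d \<and> misses k z H w q'} = {..q}"
    using misses_mono[OF assms(2)] misses_mono[of k z H w _ "Suc q"] assms(1,3) by (auto simp: not_less_eq_eq[symmetric])
  thus ?thesis by (simp add: cost_def)
qed

lemma cost_le: "cost k z H d w \<le> d"
  unfolding cost_def by (rule order_trans[OF card_mono[of "{..<d}"]]) auto

context prog
begin

lemma inner_less: "ms (k - 6 * g) k a b q < YS"
proof -
  have "(a * q + b) mod 2 ^ k < 2 ^ (6 * g) * 2 ^ (k - 6 * g)"
    using gk by (simp flip: power_add)
  thus ?thesis unfolding ms_def YS_def by (rule less_mult_imp_div_less)
qed

lemma ev_inner: "rg s 5 = 2 ^ k \<Longrightarrow> rg s 10 = 2 ^ (k - 6 * g) \<Longrightarrow>
    ev s (inner v u q) = ms (k - 6 * g) k (rg s v) (rg s u) (rg s q)"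
  by (simp add: inner_def ms_def)

lemma gd_inner: "rg s 5 = 2 ^ k \<Longrightarrow> rg s 10 = 2 ^ (k - 6 * g) \<Longrightarrow> gd s (inner v u q)"
  by (simp add: inner_def)

lemma tests_props [simp]: "writes p_tests = {39, 48, 53, 54, 55, 56}" "nosto p_tests" "noflip p_tests"
  by (auto simp: p_tests_def)

lemma wp_tests:
  assumes "env s" "rg s 22 = d" "d < 2" "rg s 31 = fst x" "rg s 32 = snd x" "fst x < n" "snd x < n"
    "rg s 47 = a" "a < n" "rg s 49 = fst (fst w)" "rg s 50 = snd (fst w)" "rg s 51 = fst (snd w)" "rg s 52 = snd (snd w)"
    "\<forall>q<YS. mm s (4 + d) q = S ! q" "length S = YS" "set S \<subseteq> {..<n}" "rg s 48 = tc"
    "H = {q. q < YS \<and> above d x a (S ! q)}"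
  shows "wps p_tests (\<lambda>s'. rg s' 54 = of_bool (tc < 60 * n \<and> \<not> misses k (6 * g) H w YD) \<and>
     rg s' 48 = tc + (if tc < 60 * n then cost k (6 * g) H YD w else 0) \<and>
     tk s' \<le> tk s + (if tc < 60 * n then cost k (6 * g) H YD w else 0)) s"
proof -
  let ?body = "cmpo 39 (Vr 31) (Vr 32) (Vr 47) (Ld (Plus (Nm 4) (Vr 22)) (inner 49 50 53)) ;;
        cmpo 56 (Vr 31) (Vr 32) (Vr 47) (Ld (Plus (Nm 4) (Vr 22)) (inner 51 52 53)) ;;
        48 ::= Plus (Vr 48) (Nm 1) ;;
        Cond (Nm 0) (Plus (Vr 39) (Vr 56)) (54 ::= Nm 1 ;; 53 ::= Vr 55) (53 ::= Plus (Vr 53) (Nm 1))"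
  let ?W = "While (Vr 53) (Vr 55) ?body"
  have nB: "60 * n + YD + 2 < B" using Bn Y_le by linarith
  let ?fix = "\<lambda>s'. rg s' 5 = 2 ^ k \<and> rg s' 10 = 2 ^ (k - 6 * g) \<and> rg s' 22 = d \<and> rg s' 31 = fst x \<and> rg s' 32 = snd x \<and>
     rg s' 47 = a \<and> rg s' 49 = fst (fst w) \<and> rg s' 50 = snd (fst w) \<and> rg s' 51 = fst (snd w) \<and> rg s' 52 = snd (snd w) \<and> mm s' = mm s"
  let ?Q = "\<lambda>s'. rg s' 54 = of_bool (\<not> misses k (6 * g) H w YD) \<and> rg s' 48 = tc + cost k (6 * g) H YD w \<and>
     tk s' \<le> tk s + cost k (6 * g) H YD w"
  have Sn: "S ! i < n" if "i < YS" for i using assms(15,16) that by (metis lessThan_iff nth_mem subsetD)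
  have loop: "wps ?W ?Q s'" if "?fix s'" "rg s' 53 = q" "rg s' 54 = 0" "rg s' 55 = YD" "rg s' 48 = tc + q"
      "tk s' \<le> tk s + q" "q \<le> YD" "misses k (6 * g) H w q" "tc < 60 * n" for q and s' :: st
    using that
  proof (induction "YD - q" arbitrary: q s')
    case 0
    hence q: "q = YD" by simp
    thus ?case using 0 cost_miss[of k "6 * g" H w YD] by (intro wp_While_end) auto
  next
    case (Suc e)
    hence q: "q < YD" by simp
    let ?i1 = "ms (k - 6 * g) k (fst (fst w)) (snd (fst w)) q" and ?i2 = "ms (k - 6 * g) k (fst (snd w)) (snd (snd w)) q"
    have m: "misses k (6 * g) H w (Suc q) \<longleftrightarrow> ?i1 \<notin> H \<and> ?i2 \<notin> H"
      using Suc.prems(8) by (auto simp: misses_def less_Suc_eq)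
    have lt: "ltO d (fst x) (snd x) a (S ! i) \<longleftrightarrow> i \<in> H" if "i < YS" for i
      using that Sn[OF that] assms(6,7,9) by (simp add: ltO_def above_def assms(18))
    have i: "?i1 < YS" "?i2 < YS" by (rule inner_less)+
    have v: "mm s (4 + d) ?i1 = S ! ?i1" "mm s (4 + d) ?i2 = S ! ?i2" using assms(14) i by auto
    have bnd: "tc + q < B" "tc + q + 1 < B" "YD < B" "q + 1 < B" using Suc.prems(9) q nB by auto
    have r: "rg s' 5 = 2 ^ k" "rg s' 10 = 2 ^ (k - 6 * g)" "rg s' 22 = d" "rg s' 31 = fst x" "rg s' 32 = snd x"
      "rg s' 47 = a" "rg s' 49 = fst (fst w)" "rg s' 50 = snd (fst w)" "rg s' 51 = fst (snd w)" "rg s' 52 = snd (snd w)" "mm s' = mm s"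
      "rg s' 53 = q" "rg s' 54 = 0" "rg s' 55 = YD" "rg s' 48 = tc + q" "tk s' \<le> tk s + q"
      using Suc.prems(1-6) by auto
    show ?case
    proof (rule wp_While_step)
      show "gd s' (Vr 53)" "gd s' (Vr 55)" "ev s' (Vr 53) < ev s' (Vr 55)" using Suc.prems q by auto
      show "wps ?body (\<lambda>s'. wps ?W ?Q (s'\<lparr>tk := Suc (tk s')\<rparr>)) s'"
      proof (cases "misses k (6 * g) H w (Suc q)")
        case True
        let ?s = "s'\<lparr>rg := (rg s')(39 := 0, 56 := 0, 48 := tc + q + 1, 53 := q + 1), tk := Suc (tk s')\<rparr>"
        have "wps ?W ?Q ?s"
          using Suc.prems q True Suc.hyps(2) by (intro Suc.hyps(1)[of "q + 1"]) auto
        moreover have "?i1 \<notin> H" "?i2 \<notin> H" using True m by auto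
        hence "\<not> ltO d (fst x) (snd x) a (S ! ?i1)" "\<not> ltO d (fst x) (snd x) a (S ! ?i2)" using lt i by auto
        ultimately show ?thesis using r assms(3) v q nB bnd
          by (simp add: wp_cmpo ev_inner gd_inner)
      next
        case False
        have c: "cost k (6 * g) H YD w = Suc q" using cost_hit[OF q Suc.prems(8) False] .
        have nm: "\<not> misses k (6 * g) H w YD" using False misses_mono[of k "6 * g" H w YD "Suc q"] q by auto
        have end_: "wps ?W ?Q s''" if "rg s'' 53 = YD" "rg s'' 55 = YD" "rg s'' 54 = 1" "rg s'' 48 = tc + q + 1" "tk s'' \<le> tk s + Suc q" for s'' :: st
          using that c nm by (intro wp_While_end) auto
        let ?t1 = "of_bool (?i1 \<in> H) :: nat" and ?t2 = "of_bool (?i2 \<in> H) :: nat"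
        have pos: "0 < ?t1 + ?t2" using False m by auto
        let ?s = "s'\<lparr>rg := (rg s')(39 := ?t1, 56 := ?t2, 48 := tc + q + 1, 54 := 1, 53 := YD), tk := Suc (tk s')\<rparr>"
        have "wps ?W ?Q ?s" by (rule end_) (use r in auto)
        moreover have "ltO d (fst x) (snd x) a (S ! ?i1) = (?i1 \<in> H)" "ltO d (fst x) (snd x) a (S ! ?i2) = (?i2 \<in> H)"
          using lt i by auto
        moreover have "gd s' (Plus (Vr 39) (Vr 56))" by simp
        ultimately show ?thesis using r assms(3) v q nB pos bnd
          by (simp add: wp_cmpo ev_inner gd_inner del: of_bool_eq_0_iff)
      qed
    qed
  qed
  show ?thesis
  proof (cases "tc < 60 * n")
    case True
    have "wps ?W ?Q (s\<lparr>rg := (rg s)(53 := 0, 54 := 0, 55 := YD)\<rparr>)"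
      by (rule loop[of _ 0]) (use assms True in \<open>auto simp: env_def misses_def\<close>)
    thus ?thesis using True assms(1,17) nB by (simp add: p_tests_def env_def)
  next
    case False
    have "wps ?W (\<lambda>s'. rg s' 54 = 0 \<and> rg s' 48 = tc \<and> tk s' \<le> tk s) (s\<lparr>rg := (rg s)(53 := 0, 54 := 0, 55 := 0)\<rparr>)"
      by (rule wp_While_end) (use assms(17) in auto)
    thus ?thesis using False assms(1,17) nB by (simp add: p_tests_def env_def)
  qed
qed

text \<open>The last row that is tested may start just below the budget, so the budget can be
  exceeded by the cost of one row.\<close>

lemma fuel_le: "fuel L sd i p \<le> 60 * n + YD"
proof (induction p)
  case (Suc p)
  thus ?case using cost_le[of k "6 * g" "hits L sd i p" YD "quad k p (snd sd)"] by (auto simp: tcost_def)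
qed simp

lemma strong_props' [simp]: "writes p_strong = {39, 45, 46, 47, 48, 49, 50, 51, 52, 53, 54, 55, 56}" "noflip p_strong"
  by (auto simp: p_strong_def)

lemma wp_strong:
  assumes "env s" "proper L" "L 0 \<noteq> []" "L 1 \<noteq> []" "sd = tup f b" "rep s (casc L sd i)" "smp s (Rs L sd) (Ss L sd)"
    "mm s 7 = f" "rg s 20 = b" "b + 100 < B" "d = i mod 2" "rg s 22 = d" "(rg s 31, rg s 32) = pv L sd i" "i < 2 * g"
    "rg s 42 = length (casc L sd i d)"
  shows "wps p_strong (\<lambda>s'. rep s' ((casc L sd i)(d := strong L sd i)) \<and>
     (\<forall>c. 2 \<le> c \<longrightarrow> c \<noteq> 6 \<longrightarrow> mm s' c = mm s c) \<and> tk s' \<le> tk s + length (casc L sd i d) + (60 * n + YD)) s"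
proof -
  let ?xs = "casc L sd i d"
  let ?m = "length ?xs"
  let ?x = "pv L sd i" and ?S = "Ss L sd d"
  have d: "d < 2" "d < 8" "d \<noteq> 6" "d \<noteq> 7" using assms(11) by auto
  have x: "fst ?x < n" "snd ?x < n" using pv_less[OF assms(2-4,14), of sd] by auto
  have pc: "proper (casc L sd i)" by (rule proper_casc[OF assms(2)])
  have len: "?m \<le> n" by (rule proper_length[OF pc d(1)])
  have "L (1 - d) \<noteq> []" using assms(3,4) d(1) by (auto simp: less_2_cases_iff)
  hence Sn: "set ?S \<subseteq> {..<n}" using set_Ss[of L d sd] properD[OF assms(2), of "1 - d"] by auto
  have S: "\<forall>q<YS. mm s (4 + d) q = ?S ! q" using assms(7) d(1) by (simp add: smp_def)
  let ?h = "\<lambda>j p. ms k (2 * k) (f (b + j)) (f (b + j + 1)) p"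
  have quad: "quad k p (snd sd) = ((?h 8 p, ?h 10 p), (?h 12 p, ?h 14 p))" for p
    by (simp add: assms(5) quad_def tup_def add.commute)
  let ?KK = "\<lambda>p. map (nth ?xs) (filter (\<lambda>p. \<not> killed L sd i p) [0..<p])"
  have KKle: "length (?KK p) \<le> p" for p using length_filter_le[of "\<lambda>p. \<not> killed L sd i p" "[0..<p]"] by simp
  have KKSuc: "?KK (Suc p) = ?KK p @ (if killed L sd i p then [] else [?xs ! p])" for p by simp
  let ?c = "47 ::= Ld (Vr 22) (Vr 46) ;;
       49 ::= hash (Plus (Vr 20) (Nm 8)) (Vr 46) ;; 50 ::= hash (Plus (Vr 20) (Nm 10)) (Vr 46) ;;
       51 ::= hash (Plus (Vr 20) (Nm 12)) (Vr 46) ;; 52 ::= hash (Plus (Vr 20) (Nm 14)) (Vr 46) ;;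
       p_tests ;; Sto (Vr 22) (Vr 45) (Vr 47) ;; Cond (Vr 54) (Nm 1) (45 ::= Plus (Vr 45) (Nm 1)) Skip"
  let ?s0 = "s\<lparr>rg := (rg s)(45 := 0, 48 := 0)\<rparr>"
  let ?J = "\<lambda>p s'. rg s' 45 = length (?KK p) \<and> rg s' 48 = fuel L sd i p \<and> (\<forall>j<length (?KK p). mm s' d j = ?KK p ! j) \<and>
      (\<forall>j. p \<le> j \<longrightarrow> mm s' d j = mm s d j) \<and> (\<forall>c. c \<noteq> d \<longrightarrow> mm s' c = mm s c) \<and> tk s' \<le> tk s + p + fuel L sd i p"
  have "wps (For 46 (Vr 42) ?c) (\<lambda>s'. ?J ?m s' \<and> rg s' 22 = d) ?s0"
  proof (rule wp_For[where m = ?m and J = ?J])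
    fix p and s' :: st assume p: "p < ?m" and J: "?J p s'" and fr: "frame (For 46 (Vr 42) ?c) ?s0 s'" and xx: "rg s' 46 = p"
    have e: "env s'" by (rule env_frame[OF _ fr]) (use assms(1) in \<open>auto simp: env_def\<close>)
    have r: "rg s' 22 = d" "rg s' 20 = b" "rg s' 31 = fst ?x" "rg s' 32 = snd ?x"
      using fr assms(9,12,13) by (auto simp: frame_def prod_eq_iff)
    have v: "mm s' d p = ?xs ! p" using J repD(2)[OF assms(6) d(1) p] by simp
    have a: "?xs ! p < n" using properD[OF pc d(1)] p by simp
    have f7: "mm s' 7 = f" using J d assms(8) by simp
    let ?rg1 = "(rg s')(47 := ?xs ! p, 49 := ?h 8 p, 50 := ?h 10 p, 51 := ?h 12 p, 52 := ?h 14 p)"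
    let ?s1 = "s'\<lparr>rg := ?rg1\<rparr>"
    let ?Q = "\<lambda>s''. ?J (Suc p) (s''\<lparr>rg := (rg s'')(46 := Suc p), tk := Suc (tk s'')\<rparr>)"
    let ?rest = "Sto (Vr 22) (Vr 45) (Vr 47) ;; Cond (Vr 54) (Nm 1) (45 ::= Plus (Vr 45) (Nm 1)) Skip"
    have main: "wps p_tests (wps ?rest ?Q) ?s1"
    proof (rule wp_frame[OF wp_tests[where x = ?x and a = "?xs ! p" and w = "quad k p (snd sd)" and S = ?S and tc = "fuel L sd i p" and H = "hits L sd i p"]])
      show "env ?s1" using e by (simp add: env_def)
      show "hits L sd i p = {q. q < YS \<and> above d ?x (?xs ! p) (?S ! q)}" by (simp add: hits_def assms(11))
      show "\<forall>q<YS. mm ?s1 (4 + d) q = ?S ! q" using J S d by simp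
      fix s2 assume Q2: "rg s2 54 = of_bool (fuel L sd i p < 60 * n \<and> \<not> misses k (6 * g) (hits L sd i p) (quad k p (snd sd)) YD) \<and>
         rg s2 48 = fuel L sd i p + (if fuel L sd i p < 60 * n then cost k (6 * g) (hits L sd i p) YD (quad k p (snd sd)) else 0) \<and>
         tk s2 \<le> tk ?s1 + (if fuel L sd i p < 60 * n then cost k (6 * g) (hits L sd i p) YD (quad k p (snd sd)) else 0)"
        and fr2: "frame p_tests ?s1 s2"
      have r2: "rg s2 22 = d" "rg s2 45 = length (?KK p)" "rg s2 47 = ?xs ! p" "mm s2 = mm s'"
        using fr2 r J by (auto simp: frame_def)
      have k2: "rg s2 54 = of_bool (killed L sd i p)" "rg s2 48 = fuel L sd i (Suc p)"
        "tk s2 + fuel L sd i p \<le> tk s' + fuel L sd i (Suc p)"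
        using Q2 by (auto simp: killed_def tmiss_def tcost_def)
      have aB: "?xs ! p < B" "length (?KK p) + 1 < B" using a KKle[of p] p len Bn by linarith+
      let ?M = "(mm s')(d := (mm s' d)(length (?KK p) := ?xs ! p))"
      have M1: "\<forall>j<length (?KK (Suc p)). ?M d j = ?KK (Suc p) ! j"
      proof (intro allI impI)
        fix j assume "j < length (?KK (Suc p))"
        thus "?M d j = ?KK (Suc p) ! j" using J unfolding KKSuc
          by (auto simp: nth_append less_Suc_eq simp del: upt_Suc split: if_splits)
      qed
      have M2: "\<forall>j. Suc p \<le> j \<longrightarrow> ?M d j = mm s d j" using J KKle[of p] by auto
      have M3: "\<forall>c. c \<noteq> d \<longrightarrow> ?M c = mm s c" using J by auto
      have T: "Suc (tk s2) \<le> tk s + Suc p + fuel L sd i (Suc p)" using J k2(3) by linarith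
      have L1: "length (?KK (Suc p)) = length (?KK p) + (if killed L sd i p then 0 else 1)" unfolding KKSuc by simp
      have "?Q (s2\<lparr>mm := ?M, rg := (rg s2)(45 := length (?KK (Suc p)))\<rparr>)"
        using M1 M2 M3 T k2(2) by (simp del: fuel.simps upt_Suc)
      moreover have "killed L sd i p \<Longrightarrow> (rg s2)(45 := length (?KK (Suc p))) = rg s2"
        using L1 r2(2) by (auto simp: fun_eq_iff simp del: upt_Suc)
      ultimately show "wps ?rest ?Q s2"
        using r2 k2(1) aB d L1 by (cases "killed L sd i p") (simp_all del: fuel.simps upt_Suc)
    qed (use r J x d a quad Sn p in auto)
    have hs: "ev s' (hash (Plus (Vr 20) (Nm j)) (Vr 46)) = ?h j p" for j
      using ev_hash[OF e, of "Plus (Vr 20) (Nm j)" "Vr 46"] r xx f7 by (simp add: add.commute)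
    have evh: "ev (s'\<lparr>rg := (rg s')(47 := A, 49 := A1, 50 := A2, 51 := A3)\<rparr>) (hash (Plus (Vr 20) (Nm j)) (Vr 46)) = ?h j p"
      "ev (s'\<lparr>rg := (rg s')(47 := A, 49 := A1, 50 := A2)\<rparr>) (hash (Plus (Vr 20) (Nm j)) (Vr 46)) = ?h j p"
      "ev (s'\<lparr>rg := (rg s')(47 := A, 49 := A1)\<rparr>) (hash (Plus (Vr 20) (Nm j)) (Vr 46)) = ?h j p"
      "ev (s'\<lparr>rg := (rg s')(47 := A)\<rparr>) (hash (Plus (Vr 20) (Nm j)) (Vr 46)) = ?h j p" for A A1 A2 A3 j
      using hs[of j] by (simp_all add: hash_def)
    have aB: "?xs ! p < B" using a Bn by linarith
    show "wps ?c ?Q s'"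
      using main r xx v aB d ms_B by (simp add: evh del: fuel.simps upt_Suc)
  next
    fix j and s' :: st assume "frame (For 46 (Vr 42) ?c) ?s0 s'"
    thus "gd s' (Vr 42) \<and> ev s' (Vr 42) = ?m" using assms(15) by (simp add: frame_def)
  next
    fix s' :: st assume "?J ?m s'" "frame (For 46 (Vr 42) ?c) ?s0 s'"
    thus "?J ?m s' \<and> rg s' 22 = d" using assms(12) by (simp add: frame_def)
  qed (use len Bn in auto)
  hence "wps (For 46 (Vr 42) ?c) (wps (Sto (Nm 6) (Vr 22) (Vr 45)) (\<lambda>s'. rep s' ((casc L sd i)(d := strong L sd i)) \<and>
     (\<forall>c. 2 \<le> c \<longrightarrow> c \<noteq> 6 \<longrightarrow> mm s' c = mm s c) \<and> tk s' \<le> tk s + ?m + (60 * n + YD))) ?s0"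
  proof (rule wp_mono)
    fix s' :: st assume J: "?J ?m s' \<and> rg s' 22 = d"
    have st: "strong L sd i = ?KK ?m" by (simp add: strong_def assms(11))
    have le: "length (strong L sd i) < B" using KKle[of ?m] len Bn unfolding st by linarith
    let ?M = "(mm s')(6 := (mm s' 6)(d := length (strong L sd i)))"
    have "rep (s'\<lparr>mm := ?M\<rparr>) ((casc L sd i)(d := strong L sd i))"
      unfolding rep_def
    proof (intro allI impI)
      fix e assume e: "e < (2::nat)"
      show "mm (s'\<lparr>mm := ?M\<rparr>) 6 e = length (((casc L sd i)(d := strong L sd i)) e) \<and>
        (\<forall>j<length (((casc L sd i)(d := strong L sd i)) e). mm (s'\<lparr>mm := ?M\<rparr>) e j = ((casc L sd i)(d := strong L sd i)) e ! j)"
      proof (cases "e = d")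
        case True
        thus ?thesis using J d unfolding st by auto
      next
        case False
        thus ?thesis using J d e repD[OF assms(6) e] by auto
      qed
    qed
    moreover have "rg s' 45 = length (strong L sd i)" using J unfolding st by simp
    ultimately show "wps (Sto (Nm 6) (Vr 22) (Vr 45)) (\<lambda>s'. rep s' ((casc L sd i)(d := strong L sd i)) \<and>
     (\<forall>c. 2 \<le> c \<longrightarrow> c \<noteq> 6 \<longrightarrow> mm s' c = mm s c) \<and> tk s' \<le> tk s + ?m + (60 * n + YD)) s'"
      using J le d fuel_le[of L sd i ?m] by auto
  qed
  thus ?thesis using Bn by (simp add: p_strong_def)
qed


section \<open>Half-rounds and whole reductions\<close>

definition ctx :: "(nat \<Rightarrow> nat list) \<Rightarrow> (nat \<Rightarrow> nat) \<Rightarrow> nat \<Rightarrow> st \<Rightarrow> bool" where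
  "ctx L f b s \<longleftrightarrow> env s \<and> smp s (Rs L (tup f b)) (Ss L (tup f b)) \<and> mm s 7 = f \<and> rg s 20 = b"

lemma ctx_frame:
  assumes "ctx L f b s" "frame c s s'" "writes c \<inter> {3..10} = {}" "20 \<notin> writes c"
    "\<And>c. 2 \<le> c \<Longrightarrow> c \<noteq> 6 \<Longrightarrow> mm s' c = mm s c"
  shows "ctx L f b s'"
proof -
  have "env s'" using assms(1-3) env_frame unfolding ctx_def by blast
  moreover have "rg s' 20 = b" using assms(1,2,4) by (simp add: ctx_def frame_def)
  moreover have "smp s' (Rs L (tup f b)) (Ss L (tup f b))"
    using assms(1,5) by (auto simp: ctx_def smp_def)
  ultimately show ?thesis using assms(1,5) by (simp add: ctx_def)
qed

lemma rep_mm: "rep s L \<Longrightarrow> mm s' = mm s \<Longrightarrow> rep s' L"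
  by (simp add: rep_def)

definition PV :: nat where "PV = YR * (YS * (YS + 1) + 1)"

text \<open>\<open>PV + 1\<close> is at most \<open>4 * y ^ 16\<close>, and \<open>g \<le> y\<close>
  bounds all \<open>2 * g\<close> pivot searches by \<open>8 * y ^ 17\<close>; the parameter
  \<open>y\<close> was chosen with \<open>y ^ 20 \<le> n\<close>.\<close>

lemma PV_le: "2 * g * (PV + 1) \<le> 8 * n"
proof -
  have y: "1 \<le> y" by (rule y_pos)
  have p: "1 \<le> y ^ 4" "1 \<le> y ^ 6" "1 \<le> y ^ 12" "1 \<le> y ^ 16" using y by simp_all
  have g: "g \<le> y" unfolding y_def by (simp add: less_imp_le)
  have "y ^ 6 * (y ^ 6 + 1) + 1 = y ^ 12 + y ^ 6 + 1" by (simp add: ring_distribs flip: power_add)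
  also have "y ^ 6 \<le> y ^ 12" using y by (intro power_increasing) auto
  finally have "y ^ 6 * (y ^ 6 + 1) + 1 \<le> 3 * y ^ 12" using p by linarith
  hence "PV \<le> y ^ 4 * (3 * y ^ 12)" unfolding PV_def YR_eq YS_eq by (rule mult_left_mono) simp
  also have "\<dots> = 3 * y ^ 16" by (simp flip: power_add)
  finally have "PV + 1 \<le> 4 * y ^ 16" using p by linarith
  hence "2 * g * (PV + 1) \<le> 2 * y * (4 * y ^ 16)" using g by (intro mult_mono) auto
  also have "\<dots> = 8 * y ^ 17" using power_Suc[of y 16] by simp
  also have "y ^ 17 \<le> y ^ 20" using y by (intro power_increasing) auto
  finally show ?thesis using y20 by simp
qed

lemma half_props [simp]: "noflip p_half" "57 \<notin> writes p_half" "20 \<notin> writes p_half"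
    "writes p_half \<inter> {3..10} = {}" "63 \<notin> writes p_half" "64 \<notin> writes p_half" "65 \<notin> writes p_half"
  by (auto simp: p_half_def)

text \<open>Walk and filter each cost at most the current total length, which is the increase of
  \<open>wtc\<close>, so \<open>2 * wtc\<close> accounts for both. The \<open>64 * n\<close> of a
  stopping half-round consists of the walk (\<open>2 * n\<close>), one pass over the rows
  (\<open>n\<close>) and the tests (\<open>60 * n + YD\<close>).\<close>

lemma wp_half:
  assumes "ctx L f b s" "proper L" "L 0 \<noteq> []" "L 1 \<noteq> []" "sd = tup f b" "rep s (casc L sd i)" "i < 2 * g"
    "b + 100 < B" "rg s 57 = i" "rg s 58 = 0" "rg s 59 = wtc L sd i" "wtc L sd i \<le> 64 * n"
  shows "wps p_half (\<lambda>s'. ctx L f b s' \<and> (if stop L sd i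
      then rg s' 58 = 1 \<and> rep s' (outcome L sd i) \<and> tk s' \<le> tk s + PV + 64 * n
      else rg s' 58 = 0 \<and> rep s' (casc L sd (Suc i)) \<and> rg s' 59 = wtc L sd (Suc i) \<and> wtc L sd (Suc i) \<le> 64 * n \<and>
        tk s' + 2 * wtc L sd i \<le> tk s + PV + 2 * wtc L sd (Suc i))) s"
    (is "wps _ ?Q s")
proof -
  define Q where "Q = ?Q"
  let ?C = "casc L sd i"
  define d where "d = i mod 2"
  have d: "d < 2" "1 - d < 2" "Suc d mod 2 = 1 - d" by (auto simp: d_def mod_Suc)
  have pc: "proper ?C" by (rule proper_casc[OF assms(2)])
  have len: "length (?C 0) \<le> n" "length (?C 1) \<le> n" using proper_length[OF pc] by auto
  have sum: "length (?C d) + length (?C (1 - d)) = length (?C 0) + length (?C 1)"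
    using d(1) by (auto simp: less_2_cases_iff)
  have wS: "wtc L sd (Suc i) = wtc L sd i + (length (?C 0) + length (?C 1))" by (simp add: wtc_def)
  have m6: "mm s 6 0 = length (?C 0)" "mm s 6 1 = length (?C 1)" using repD(1)[OF assms(6)] by auto
  have wB: "wtc L sd i + (length (?C 0) + length (?C 1)) < B" using assms(12) len Bn by linarith
  have e: "env s" using assms(1) by (simp add: ctx_def)
  let ?fr = "{22, 23, 59::nat}"
  let ?c2 = "Cond (Vr 40) (Vr 42) (p_strong ;; 58 ::= Nm 1) p_filter"
  let ?s1 = "s\<lparr>rg := (rg s)(22 := d, 23 := 1 - d, 59 := wtc L sd (Suc i))\<rparr>"
  have c1: "ctx L f b ?s1" using assms(1) by (simp add: ctx_def env_def smp_def)
  have main: "wps (Cond (Times (Nm 64) rn) (Vr 59) (58 ::= Nm 1)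
       (61 ::= Plus (Divi (Vr 57) (Nm 2)) (Nm 1) ;; Pow 62 61 ;; 30 ::= Divi (Vr 8) (Vr 62) ;;
        p_pivot ;; p_walk ;; ?c2)) Q ?s1"
  proof (cases "64 * n < wtc L sd (Suc i)")
    case True
    have "ctx L f b (?s1\<lparr>rg := (rg ?s1)(58 := 1)\<rparr>)" using c1 by (simp add: ctx_def env_def smp_def)
    moreover have "rep (?s1\<lparr>rg := (rg ?s1)(58 := 1)\<rparr>) ?C" using assms(6) by (simp add: rep_def)
    moreover have "stop L sd i" "outcome L sd i = ?C" using True by (simp_all add: stop_def outcome_def)
    ultimately show ?thesis using True e Bn by (simp add: env_def Q_def)
  next
    case False
    define r where "r = i div 2 + 1"
    define th where "th = YS div 2 ^ r"
    have "r \<le> 6 * g" using assms(7) unfolding r_def by linarith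
    hence "(2::nat) ^ r \<le> YS" unfolding YS_def by (intro power_increasing) auto
    hence pB: "(2::nat) ^ r < B" using Y_le Bn by linarith
    have thB: "th < B" using div_le_dividend[of YS "2 ^ r"] Y_le Bn unfolding th_def by linarith
    let ?s2 = "?s1\<lparr>rg := (rg ?s1)(61 := r, 62 := 2 ^ r, 30 := th)\<rparr>"
    have c2: "ctx L f b ?s2" using c1 by (simp add: ctx_def env_def smp_def)
    have ne: "L d \<noteq> []" "L (1 - d) \<noteq> []" using assms(3,4) d(1) by (auto simp: less_2_cases_iff)
    have sets: "set (Rs L sd d) \<subseteq> {..<n}" "set (Ss L sd d) \<subseteq> {..<n}"
      using set_Rs[of L d sd] set_Ss[of L d sd] ne properD[OF assms(2) d(1)] properD[OF assms(2) d(2)] by blast+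
    let ?x = "pv L sd i"
    have x: "fst ?x < n" "snd ?x < n" using pv_less[OF assms(2-4,7), of sd] by auto
    have smp: "smp s (Rs L sd) (Ss L sd)" using assms(1,5) by (simp add: ctx_def)
    have "wps p_pivot (wps (p_walk ;; ?c2) Q) ?s2"
    proof (rule wp_frame[OF wp_pivot])
      show "env ?s2" using c2 by (simp add: ctx_def)
      show "0 < th" unfolding th_def r_def by (rule th_pos[OF assms(7)])
      show "\<forall>q<YR. mm ?s2 (2 + d) q = Rs L sd d ! q" "\<forall>q<YS. mm ?s2 (4 + d) q = Ss L sd d ! q"
        using smp d(1) by (auto simp: smp_def)
      fix s3 :: st assume Q3: "(rg s3 31, rg s3 32) = piv d (Rs L sd d) (Ss L sd d) th \<and> tk s3 \<le> tk ?s2 + YR * (YS * (YS + 1) + 1)"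
        and fr3: "frame p_pivot ?s2 s3"
      have x3: "(rg s3 31, rg s3 32) = ?x" using Q3 by (simp add: pv_def d_def th_def r_def)
      hence x3': "rg s3 31 = fst ?x" "rg s3 32 = snd ?x" by (simp_all add: prod_eq_iff)
      have mm3: "mm s3 = mm s" using fr3 by (simp add: frame_def)
      have r3: "rg s3 22 = d" "rg s3 23 = 1 - d" "rg s3 58 = 0" "rg s3 59 = wtc L sd (Suc i)"
        using fr3 assms(10) by (auto simp: frame_def)
      have t3: "tk s3 \<le> tk s + PV" using Q3 by (simp add: PV_def)
      have c3: "ctx L f b s3" by (rule ctx_frame[OF c2 fr3]) (use mm3 in auto)
      have rep3: "rep s3 ?C" using assms(6) mm3 by (rule rep_mm)
      show "wps (p_walk ;; ?c2) Q s3" unfolding wp_Seq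
      proof (rule wp_frame[OF wp_walk[OF rep3 pc r3(1) d(1) r3(2) x3' x]])
        fix s4 :: st assume Q4: "(rg s4 40 < rg s4 42 \<longleftrightarrow> \<not> walk (above d ?x) (?C d) (?C (1 - d))) \<and>
            rg s4 42 = length (?C d) \<and> rg s4 43 = length (?C (1 - d)) \<and> tk s4 \<le> tk s3 + length (?C d) + length (?C (1 - d))"
          and fr4: "frame p_walk s3 s4"
        have mm4: "mm s4 = mm s3" using fr4 by (simp add: frame_def)
        have r4: "rg s4 22 = d" "rg s4 23 = 1 - d" "rg s4 58 = 0" "rg s4 59 = wtc L sd (Suc i)"
            "rg s4 31 = fst ?x" "rg s4 32 = snd ?x"
          using fr4 r3 x3' by (auto simp: frame_def)
        have c4: "ctx L f b s4" by (rule ctx_frame[OF c3 fr4]) (use mm4 in auto)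
        have rep4: "rep s4 ?C" using rep3 mm4 by (rule rep_mm)
        have t4: "tk s4 \<le> tk s + PV + (length (?C 0) + length (?C 1))" using Q4 t3 sum by linarith
        have wk: "rg s4 40 < rg s4 42 \<longleftrightarrow> \<not> walks L sd i" using conjunct1[OF Q4] unfolding walks_def d_def .
        show "wps ?c2 Q s4"
        proof (cases "walks L sd i")
          case True
          have ns: "\<not> stop L sd i" using True False by (simp add: stop_def)
          have "wps p_filter Q s4"
          proof (rule wp_frame[OF wp_filter[OF rep4 pc r4(1) d(1) r4(2) r4(5,6) x]])
            show "rg s4 43 = length (?C (1 - d))" using Q4 by simp
            fix s5 :: st assume Q5: "rep s5 (?C(1 - d := filter (above d ?x (fst ?x)) (?C (1 - d)))) \<and>
               (\<forall>c. 2 \<le> c \<longrightarrow> c \<noteq> 6 \<longrightarrow> mm s5 c = mm s4 c) \<and> tk s5 \<le> tk s4 + length (?C (1 - d))"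
              and fr5: "frame p_filter s4 s5"
            have c5: "ctx L f b s5" by (rule ctx_frame[OF c4 fr5]) (use Q5 in auto)
            have "rg s5 58 = 0" "rg s5 59 = wtc L sd (Suc i)" using fr5 r4 by (auto simp: frame_def)
            moreover have "rep s5 (casc L sd (Suc i))" using Q5 by (simp add: d_def)
            moreover have "tk s5 \<le> tk s4 + length (?C (1 - d))" using Q5 by blast
            hence "tk s5 \<le> tk s4 + (length (?C 0) + length (?C 1))" unfolding sum[symmetric] by simp
            hence "tk s5 + 2 * wtc L sd i \<le> tk s + PV + 2 * wtc L sd (Suc i)" using t4 unfolding wS add_mult_distrib2 by linarith
            ultimately show "Q s5" using c5 ns False by (simp add: Q_def)
          qed
          thus ?thesis using wk True by simp
        next
          case w: False
          have st: "stop L sd i" using w by (simp add: stop_def)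
          have "wps p_strong (wps (58 ::= Nm 1) Q) s4"
          proof (rule wp_frame[OF wp_strong[OF _ assms(2-5) rep4]])
            show "env s4" "smp s4 (Rs L sd) (Ss L sd)" "mm s4 7 = f" "rg s4 20 = b" using c4 assms(5) by (auto simp: ctx_def)
            show "(rg s4 31, rg s4 32) = ?x" using r4 by (simp add: prod_eq_iff)
            show "d = i mod 2" by (rule d_def)
            fix s5 :: st assume Q5: "rep s5 (?C(d := strong L sd i)) \<and> (\<forall>c. 2 \<le> c \<longrightarrow> c \<noteq> 6 \<longrightarrow> mm s5 c = mm s4 c) \<and>
                tk s5 \<le> tk s4 + length (?C d) + (60 * n + YD)"
              and fr5: "frame p_strong s4 s5"
            let ?s6 = "s5\<lparr>rg := (rg s5)(58 := 1)\<rparr>"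
            have c5: "ctx L f b s5" by (rule ctx_frame[OF c4 fr5]) (use Q5 in auto)
            have c6: "ctx L f b ?s6" using c5 by (simp add: ctx_def env_def smp_def)
            have oc: "outcome L sd i = ?C(d := strong L sd i)" using False by (simp add: outcome_def d_def)
            have "rep ?s6 (outcome L sd i)" using Q5 unfolding oc by (simp add: rep_def)
            moreover have "length (?C d) \<le> n" using proper_length[OF pc d(1)] .
            hence "tk s5 \<le> tk s + PV + 64 * n" using conjunct2[OF conjunct2[OF Q5]] t4 len Y_le(3) by linarith
            ultimately show "wps (58 ::= Nm 1) Q s5" using Bn c6 st by (simp add: Q_def)
          qed (use assms(7,8) r4 Q4 in auto)
          thus ?thesis using wk w by simp
        qed
      qed
    qed (use assms d sets in auto)
    moreover have "rg s 8 = YS" using e by (simp add: env_def)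
    moreover have "i div 2 + 1 < B" using assms(7) gk k_le_n Bn by linarith
    ultimately show ?thesis using False pB thB e assms(9) unfolding r_def th_def by (simp add: env_def)
  qed
  have "d < B" "1 - d < B" using d Bn by linarith+
  hence "wps p_half Q s" using main assms(9,10,11) d(3) m6 wB by (simp add: p_half_def wS d_def)
  thus ?thesis unfolding Q_def .
qed

lemma wp_reduce:
  assumes "env s" "proper L" "rep s L" "mm s 7 = f" "rg s 20 = b" "b + 100 < B"
  shows "wps p_reduce (\<lambda>s'. env s' \<and> rep s' (reduce L (tup f b)) \<and> mm s' 7 = f \<and> rg s' 20 = b \<and> tk s' \<le> tk s + 210 * n) s"
    (is "wps _ ?Q s")
proof -
  define sd where "sd = tup f b"
  have m6: "mm s 6 0 = length (L 0)" "mm s 6 1 = length (L 1)" using repD(1)[OF assms(3)] by auto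
  show ?thesis
  proof (cases "L 0 = [] \<or> L 1 = []")
    case True
    hence "reduce L (tup f b) = L" by (simp add: reduce_def)
    moreover have "\<not> 0 < mm s 6 0 * mm s 6 1" using True m6 by auto
    ultimately show ?thesis using assms by (auto simp: p_reduce_def)
  next
    case False
    hence ne: "L 0 \<noteq> []" "L 1 \<noteq> []" by auto
    have pos: "0 < mm s 6 0 * mm s 6 1" using ne m6 by simp
    let ?F = "For 57 (Times (Nm 2) (Vr 6)) p_half"
    have "wps p_sample (wps (58 ::= Nm 0 ;; 59 ::= Nm 0 ;; ?F) ?Q) s"
    proof (rule wp_frame[OF wp_sample[OF assms(1-3) ne assms(4-6)]])
      fix s1 :: st assume Q1: "smp s1 (Rs L (tup f b)) (Ss L (tup f b)) \<and> (\<forall>c. c \<notin> {2, 3, 4, 5} \<longrightarrow> mm s1 c = mm s c) \<and>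
          tk s1 \<le> tk s + 2 * (YR + YS + 1)"
        and fr1: "frame p_sample s s1"
      have w: "writes p_sample \<inter> {3..10} = {}" "20 \<notin> writes p_sample" by (auto simp: p_sample_def)
      have e1: "env s1" using env_frame[OF assms(1) fr1 w(1)] .
      have b1: "rg s1 20 = b" using fr1 w(2) assms(5) by (simp add: frame_def)
      let ?s2 = "s1\<lparr>rg := (rg s1)(58 := 0, 59 := 0)\<rparr>"
      have c2: "ctx L f b ?s2" using e1 b1 Q1 assms(4) by (simp add: ctx_def env_def smp_def)
      have mm1: "mm s1 c = mm s c" if "c \<notin> {2, 3, 4, 5}" for c using Q1 that by blast
      have rep2: "rep ?s2 L" using assms(3) mm1[of 0] mm1[of 1] mm1[of 6] by (auto simp: rep_def less_2_cases_iff)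
      have t1: "tk s1 \<le> tk s + 6 * n" using conjunct2[OF conjunct2[OF Q1]] Y_le n_pos unfolding add_mult_distrib2 by linarith
      \<comment> \<open>Either the reduction is still running, or it ended in half-round
        \<open>i'\<close> and the remaining iterations are idle. The \<open>192 * n\<close> is
        \<open>128 * n\<close> for twice \<open>wtc\<close> plus \<open>64 * n\<close> for the
        half-round that stopped.\<close>
      let ?J = "\<lambda>i s'. ctx L f b s' \<and>
         ((rg s' 58 = 0 \<and> (\<forall>i'<i. \<not> stop L sd i') \<and> rep s' (casc L sd i) \<and> rg s' 59 = wtc L sd i \<and> wtc L sd i \<le> 64 * n \<and>
            tk s' \<le> tk s1 + i * (PV + 1) + 2 * wtc L sd i) \<or>
          (rg s' 58 = 1 \<and> (\<exists>i'<i. stop L sd i' \<and> (\<forall>i''<i'. \<not> stop L sd i'') \<and> rep s' (outcome L sd i')) \<and>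
            tk s' \<le> tk s1 + i * (PV + 1) + 192 * n))"
      have "wps ?F ?Q ?s2"
      proof (rule wp_For[where m = "2 * g" and J = ?J])
        have "ctx L f b (?s2\<lparr>rg := (rg ?s2)(57 := 0)\<rparr>)" using c2 by (simp add: ctx_def env_def smp_def)
        moreover have "rep (?s2\<lparr>rg := (rg ?s2)(57 := 0)\<rparr>) L" using rep2 by (simp add: rep_def)
        ultimately show "?J 0 (?s2\<lparr>rg := (rg ?s2)(57 := 0)\<rparr>)" by (simp add: wtc_def)
      next
        fix i and s' :: st assume "?J i s'"
        thus "gd s' (Times (Nm 2) (Vr 6)) \<and> ev s' (Times (Nm 2) (Vr 6)) = 2 * g" by (simp add: ctx_def env_def)
      next
        fix i and s' :: st assume i: "i < 2 * g" and J: "?J i s'" and x: "rg s' 57 = i"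
        let ?u = "\<lambda>s''::st. s''\<lparr>rg := (rg s'')(57 := Suc i), tk := Suc (tk s'')\<rparr>"
        have cu: "ctx L f b (?u s'') \<longleftrightarrow> ctx L f b s''" "rep (?u s'') L' \<longleftrightarrow> rep s'' L'" for s'' L'
          by (auto simp: ctx_def env_def smp_def rep_def)
        show "wps p_half (\<lambda>s''. ?J (Suc i) (?u s'')) s'"
        proof (cases "rg s' 58 = 0")
          case True
          hence J': "ctx L f b s'" "\<forall>i'<i. \<not> stop L sd i'" "rep s' (casc L sd i)" "rg s' 59 = wtc L sd i" "wtc L sd i \<le> 64 * n"
            "tk s' \<le> tk s1 + i * (PV + 1) + 2 * wtc L sd i" using J by auto
          show ?thesis
          proof (rule wp_mono[OF wp_half[OF J'(1) assms(2) ne sd_def J'(3) i assms(6) x True J'(4,5)]])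
            fix s2 :: st
            assume a: "ctx L f b s2 \<and> (if stop L sd i
              then rg s2 58 = 1 \<and> rep s2 (outcome L sd i) \<and> tk s2 \<le> tk s' + PV + 64 * n
              else rg s2 58 = 0 \<and> rep s2 (casc L sd (Suc i)) \<and> rg s2 59 = wtc L sd (Suc i) \<and> wtc L sd (Suc i) \<le> 64 * n \<and>
                tk s2 + 2 * wtc L sd i \<le> tk s' + PV + 2 * wtc L sd (Suc i))"
            have mu: "Suc i * (PV + 1) = i * (PV + 1) + PV + 1" by simp
            show "?J (Suc i) (?u s2)"
            proof (cases "stop L sd i")
              case True
              hence "rep s2 (outcome L sd i)" "rg s2 58 = 1" "tk s2 \<le> tk s' + PV + 64 * n" using a by auto
              moreover have "tk (?u s2) \<le> tk s1 + Suc i * (PV + 1) + 192 * n"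
                unfolding mu using J'(5,6) calculation(3) by simp
              ultimately show ?thesis using a True J'(2) unfolding cu
                by (intro conjI disjI2 exI[of _ i]) auto
            next
              case False
              hence b: "rep s2 (casc L sd (Suc i))" "rg s2 58 = 0" "rg s2 59 = wtc L sd (Suc i)" "wtc L sd (Suc i) \<le> 64 * n"
                "tk s2 + 2 * wtc L sd i \<le> tk s' + PV + 2 * wtc L sd (Suc i)" using a by auto
              have "tk (?u s2) \<le> tk s1 + Suc i * (PV + 1) + 2 * wtc L sd (Suc i)"
                unfolding mu using J'(6) b(5) by simp
              moreover have "\<forall>i'<Suc i. \<not> stop L sd i'" using J'(2) False by (auto simp: less_Suc_eq)
              ultimately show ?thesis using a b unfolding cu by (intro conjI disjI1) (simp_all del: casc.simps)
            qed
          qed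
        next
          case False
          hence one: "rg s' 58 = 1" and J': "ctx L f b s'" "tk s' \<le> tk s1 + i * (PV + 1) + 192 * n" using J by auto
          obtain i' where i': "i' < i" "stop L sd i'" "\<forall>i''<i'. \<not> stop L sd i''" "rep s' (outcome L sd i')"
            using J False by auto
          have "?J (Suc i) (?u s')" unfolding cu
            by (intro conjI disjI2 exI[of _ i']) (use one J' i' in auto)
          thus ?thesis using one by (simp add: p_half_def)
        qed
      next
        fix s' :: st assume J: "?J (2 * g) s'"
        have t: "tk s' \<le> tk s1 + 2 * g * (PV + 1) + 192 * n" using J by auto
        hence "tk s' \<le> tk s + 210 * n" using t1 PV_le by linarith
        moreover have "rep s' (reduce L sd)"
        proof (cases "rg s' 58 = 0")
          case True
          thus ?thesis using J ne by (auto simp: reduce_def)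
        next
          case False
          then obtain i' where i': "i' < 2 * g" "stop L sd i'" "\<forall>i''<i'. \<not> stop L sd i''" "rep s' (outcome L sd i')"
            using J by auto
          have "(LEAST i. stop L sd i) = i'"
            using i'(2,3) by (intro Least_equality) (auto simp: not_less[symmetric])
          moreover have "\<exists>i<2 * g. stop L sd i" using i' by blast
          ultimately show ?thesis using i'(4) ne by (simp add: reduce_def)
        qed
        ultimately show "?Q s'" using J by (simp add: ctx_def sd_def)
      qed (use gk k_le_n Bn in auto)
      thus "wps (58 ::= Nm 0 ;; 59 ::= Nm 0 ;; ?F) ?Q s1" using Bn by simp
    qed
    thus ?thesis using pos by (simp add: p_reduce_def)
  qed
qed

lemma reduce_writes [simp]: "noflip p_reduce" "20 \<notin> writes p_reduce" "63 \<notin> writes p_reduce" "64 \<notin> writes p_reduce"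
    "65 \<notin> writes p_reduce" "writes p_reduce \<inter> {3..10} = {}"
  by (auto simp: p_reduce_def p_sample_def p_half_def)

end

lemma wp_Seq_fun: "wp lt B (a ;; b) Q = wp lt B a (wp lt B b Q)"
  by (rule ext) simp

context prog
begin

section \<open>Attempts\<close>

lemma init_props [simp]: "writes p_init = {19}" "noflip p_init"
  by (auto simp: p_init_def)

lemma wp_attempt:
  assumes "env s" "mm s 7 = f" "rg s 20 = b" "b + 16 * NR + 100 < B"
  shows "wps (p_init ;; For 64 (Nm NR) (p_reduce ;; 20 ::= Plus (Vr 20) (Nm 16)))
    (\<lambda>s'. env s' \<and> rep s' (att f b NR) \<and> mm s' 7 = f \<and> rg s' 20 = b + 16 * NR \<and> tk s' \<le> tk s + n + NR * (210 * n + 1)) s"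
    (is "wps (_ ;; ?F) ?Q s")
  unfolding wp_Seq
proof (rule wp_frame[OF wp_init[OF assms(1)]])
  fix s1 :: st assume Q1: "env s1 \<and> rep s1 full \<and> mm s1 7 = mm s 7 \<and> tk s1 \<le> tk s + n" and fr: "frame p_init s s1"
  have b1: "rg s1 20 = b" using fr assms(3) by (simp add: frame_def)
  let ?J = "\<lambda>j s'. env s' \<and> rep s' (att f b j) \<and> mm s' 7 = f \<and> rg s' 20 = b + 16 * j \<and> tk s' \<le> tk s1 + j * (210 * n + 1)"
  show "wps ?F ?Q s1"
  proof (rule wp_For[where m = NR and J = ?J])
    show "64 \<notin> writes (p_reduce ;; 20 ::= Plus (Vr 20) (Nm 16))" by simp
    show "?J 0 (s1\<lparr>rg := (rg s1)(64 := 0)\<rparr>)" using Q1 b1 assms(2) by (simp add: env_def rep_def)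
    show "NR < B" using Bn by (simp add: NR_def)
  next
    fix j and s' :: st assume j: "j < NR" and J: "?J j s'"
    have bj: "b + 16 * j + 100 < B" using j assms(4) by linarith
    show "wps (p_reduce ;; 20 ::= Plus (Vr 20) (Nm 16)) (\<lambda>s''. ?J (Suc j) (s''\<lparr>rg := (rg s'')(64 := Suc j), tk := Suc (tk s'')\<rparr>)) s'"
      unfolding wp_Seq
    proof (rule wp_mono[OF wp_reduce[of s' "att f b j" f "b + 16 * j"]])
      fix s2 :: st assume Q2: "env s2 \<and> rep s2 (reduce (att f b j) (tup f (b + 16 * j))) \<and> mm s2 7 = f \<and> rg s2 20 = b + 16 * j \<and> tk s2 \<le> tk s' + 210 * n"
      show "wps (20 ::= Plus (Vr 20) (Nm 16)) (\<lambda>s''. ?J (Suc j) (s''\<lparr>rg := (rg s'')(64 := Suc j), tk := Suc (tk s'')\<rparr>)) s2"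
        using Q2 J bj by (simp add: env_def rep_def)
    qed (use J proper_att bj in auto)
  next
    fix s' :: st assume "?J NR s'"
    thus "?Q s'" using Q1 by auto
  qed simp
qed

lemma wp_attempts:
  assumes "env s" "mm s 7 = f"
  shows "wps p_attempts (\<lambda>s'. env s' \<and> (\<exists>L. rep s' L \<and> proper L \<and> (\<forall>e. sad e \<longrightarrow> keeps e L) \<and>
      (small L \<or> (\<forall>i<NA. \<not> small (att f (i * (16 * NR)) NR)))) \<and>
      tk s' \<le> tk s + NA * (n + NR * (210 * n + 1) + 1) + n) s"
    (is "wps _ ?Q s")
proof -
  let ?b = "\<lambda>a. a * (16 * NR)"
  let ?T = "n + NR * (210 * n + 1) + 1"
  let ?A = "p_init ;; For 64 (Nm NR) (p_reduce ;; 20 ::= Plus (Vr 20) (Nm 16))"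
  let ?C = "Cond (Times (Ld (Nm 6) (Nm 0)) (Ld (Nm 6) (Nm 1))) (Plus (Times (Nm 4) rn) (Nm 1)) (65 ::= Nm 1) Skip"
  let ?body = "Cond (Vr 65) (Nm 1) (p_init ;; For 64 (Nm NR) (p_reduce ;; 20 ::= Plus (Vr 20) (Nm 16)) ;; ?C) Skip"
  let ?J = "\<lambda>a s'. env s' \<and> mm s' 7 = f \<and> tk s' \<le> tk s + a * ?T \<and>
    ((rg s' 65 = 0 \<and> rg s' 20 = ?b a \<and> (\<forall>i<a. \<not> small (att f (?b i) NR))) \<or>
     (rg s' 65 = 1 \<and> (\<exists>i<a. small (att f (?b i) NR) \<and> rep s' (att f (?b i) NR))))"
  let ?s0 = "s\<lparr>rg := (rg s)(20 := 0, 65 := 0)\<rparr>"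
  have "wps (For 63 (Nm NA) ?body) (wps (Cond (Vr 65) (Nm 1) p_init Skip) ?Q) ?s0"
  proof (rule wp_For[where m = NA and J = ?J])
    show "63 \<notin> writes ?body" by simp
    show "?J 0 (?s0\<lparr>rg := (rg ?s0)(63 := 0)\<rparr>)" using assms by (simp add: env_def)
    show "NA < B" using Bn by (simp add: NA_def)
  next
    fix a and s' :: st assume a: "a < NA" and J: "?J a s'"
    let ?u = "\<lambda>s''::st. s''\<lparr>rg := (rg s'')(63 := Suc a), tk := Suc (tk s'')\<rparr>"
    have u: "env (?u s'') \<longleftrightarrow> env s''" "rep (?u s'') L \<longleftrightarrow> rep s'' L" for s'' L
      by (auto simp: env_def rep_def)
    show "wps ?body (\<lambda>s''. ?J (Suc a) (?u s'')) s'"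
    proof (cases "rg s' 65 = 0")
      case True
      hence J': "env s'" "mm s' 7 = f" "tk s' \<le> tk s + a * ?T" "rg s' 20 = ?b a" "\<forall>i<a. \<not> small (att f (?b i) NR)"
        using J by auto
      have "a * (16 * NR) \<le> NA * (16 * NR)" using a by (intro mult_right_mono) auto
      hence bB: "?b a + 16 * NR + 100 < B" using Bn by (simp add: NA_def NR_def)
      let ?L = "att f (?b a) NR"
      have "wps ?A (wps ?C (\<lambda>s''. ?J (Suc a) (?u s''))) s'"
      proof (rule wp_frame[OF wp_attempt[OF J'(1,2,4) bB]])
        fix s2 :: st assume Q2: "env s2 \<and> rep s2 ?L \<and> mm s2 7 = f \<and> rg s2 20 = ?b a + 16 * NR \<and> tk s2 \<le> tk s' + n + NR * (210 * n + 1)"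
          and fr: "frame ?A s' s2"
        have r65: "rg s2 65 = 0" using fr True by (simp add: frame_def)
        have m6: "mm s2 6 0 = length (?L 0)" "mm s2 6 1 = length (?L 1)" using Q2 repD(1)[of s2 ?L] by auto
        have t: "tk s2 \<le> tk s' + n + NR * (210 * n + 1)" using Q2 by blast
        have mu: "Suc a * ?T = a * ?T + ?T" by simp
        have t2: "tk (?u s2) \<le> tk s + Suc a * ?T" unfolding mu using t J'(3) by simp
        have ba: "rg s2 20 = ?b (Suc a)" using Q2 by simp
        have g3: "rg s2 3 = n" using Q2 by (simp add: env_def)
        show "wps ?C (\<lambda>s''. ?J (Suc a) (?u s'')) s2"
        proof (cases "small ?L")
          case sm: True
          let ?s3 = "s2\<lparr>rg := (rg s2)(65 := 1)\<rparr>"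
          have "env ?s3" "rep ?s3 ?L" using Q2 by (auto simp: env_def rep_def)
          hence "?J (Suc a) (?u ?s3)" unfolding u using Q2 t2 sm by (intro conjI disjI2 exI[of _ a]) auto
          thus ?thesis using m6 g3 sm Bn by (simp add: small_def)
        next
          case False
          have "\<forall>i<Suc a. \<not> small (att f (?b i) NR)" using J'(5) False by (auto simp: less_Suc_eq)
          hence "?J (Suc a) (?u s2)" unfolding u using Q2 t2 ba r65 by (intro conjI disjI1) auto
          thus ?thesis using m6 g3 False Bn by (simp add: small_def)
        qed
      qed
      hence "wps p_init (wps (For 64 (Nm NR) (p_reduce ;; 20 ::= Plus (Vr 20) (Nm 16)) ;; ?C) (\<lambda>s''. ?J (Suc a) (?u s''))) s'"
        unfolding wp_Seq_fun .
      thus ?thesis using True by simp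
    next
      case False
      hence one: "rg s' 65 = 1" "env s'" "mm s' 7 = f" "tk s' \<le> tk s + a * ?T" using J by auto
      obtain i where i: "i < a" "small (att f (?b i) NR)" "rep s' (att f (?b i) NR)" using J False by auto
      have "?J (Suc a) (?u s')" unfolding u using one i by (intro conjI disjI2 exI[of _ i]) auto
      thus ?thesis using one by simp
    qed
  next
    fix s' :: st assume J: "?J NA s'"
    show "wps (Cond (Vr 65) (Nm 1) p_init Skip) ?Q s'"
    proof (cases "rg s' 65 = 0")
      case True
      hence J': "env s'" "tk s' \<le> tk s + NA * ?T" "\<forall>i<NA. \<not> small (att f (?b i) NR)" using J by auto
      have "wps p_init ?Q s'"
      proof (rule wp_mono[OF wp_init[OF J'(1)]])
        fix s2 :: st assume Q2: "env s2 \<and> rep s2 full \<and> mm s2 7 = mm s' 7 \<and> tk s2 \<le> tk s' + n"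
        have "\<forall>e. sad e \<longrightarrow> keeps e full" using keeps_att[of _ f 0 0] by simp
        hence "\<exists>L. rep s2 L \<and> proper L \<and> (\<forall>e. sad e \<longrightarrow> keeps e L) \<and>
            (small L \<or> (\<forall>i<NA. \<not> small (att f (?b i) NR)))"
          using Q2 J'(3) proper_full by (intro exI[of _ full]) blast
        thus "?Q s2" using Q2 J'(2) by simp
      qed
      thus ?thesis using True by simp
    next
      case False
      then obtain i where i: "small (att f (?b i) NR)" "rep s' (att f (?b i) NR)" using J by auto
      have "\<exists>L. rep s' L \<and> proper L \<and> (\<forall>e. sad e \<longrightarrow> keeps e L) \<and>
            (small L \<or> (\<forall>i<NA. \<not> small (att f (?b i) NR)))"
        using i proper_att keeps_att by (intro exI[of _ "att f (?b i) NR"]) blast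
      thus ?thesis using False J by simp
    qed
  qed simp
  thus ?thesis using Bn by (simp add: p_attempts_def)
qed

section \<open>The minimum of the row maxima\<close>

definition rmax :: "nat \<Rightarrow> nat list \<Rightarrow> nat \<Rightarrow> bool" where
  "rmax a C m \<longleftrightarrow> (C = [] \<and> m = n) \<or> (m \<in> set C \<and> (\<forall>c\<in>set C. V a c \<le> V a m))"

lemma rmax_keep: "rmax a C m \<Longrightarrow> lt a c a m \<Longrightarrow> rmax a (C @ [c]) m"
  by (auto simp: rmax_def lt_def)

lemma rmax_update: "rmax a C m \<Longrightarrow> \<not> lt a c a m \<Longrightarrow> a < n \<Longrightarrow> c < n \<Longrightarrow> set C \<subseteq> {..<n} \<Longrightarrow> rmax a (C @ [c]) c"
  by (fastforce simp: rmax_def lt_def)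

text \<open>The last conjunct says that no row of \<open>R\<close> has a maximum below
  \<open>V p q\<close>, without naming the columns of these maxima.\<close>

definition mmax :: "nat list \<Rightarrow> nat list \<Rightarrow> nat \<Rightarrow> nat \<Rightarrow> bool" where
  "mmax C R p q \<longleftrightarrow> (R = [] \<and> p = n) \<or>
    (p \<in> set R \<and> q \<in> set C \<and> (\<forall>c\<in>set C. V p c \<le> V p q) \<and> (\<forall>a\<in>set R. \<exists>c\<in>set C. V p q \<le> V a c))"

lemma mmax_keep: "mmax C R p q \<Longrightarrow> rmax a C m \<Longrightarrow> lt p q a m \<Longrightarrow> mmax C (R @ [a]) p q"
proof -
  assume a: "mmax C R p q" "rmax a C m" "lt p q a m"
  hence "p < n" "m < n" "V p q < V a m" by (auto simp: lt_def)
  hence "m \<in> set C" "V p q \<le> V a m" "R \<noteq> [] \<or> p \<noteq> n" using a(2) by (auto simp: rmax_def)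
  moreover have "p \<noteq> n" using \<open>p < n\<close> by simp
  ultimately show ?thesis using a(1) unfolding mmax_def by auto
qed

lemma mmax_update:
  assumes "mmax C R p q" "rmax a C m" "\<not> lt p q a m" "C \<noteq> []" "a < n" "set C \<subseteq> {..<n}" "set R \<subseteq> {..<n}"
  shows "mmax C (R @ [a]) a m"
proof -
  have m: "m \<in> set C" "\<forall>c\<in>set C. V a c \<le> V a m" using assms(2,4) by (auto simp: rmax_def)
  have "\<exists>c\<in>set C. V a m \<le> V a' c" if "a' \<in> set R" for a'
  proof -
    have pq: "p \<in> set R" "q \<in> set C" and "\<exists>c\<in>set C. V p q \<le> V a' c" using assms(1) that by (auto simp: mmax_def)
    moreover have "V a m \<le> V p q" using assms(3,5-7) m pq by (auto simp: lt_def)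
    ultimately show ?thesis by (meson order_trans)
  qed
  thus ?thesis using m by (auto simp: mmax_def)
qed

text \<open>The chain \<open>V p q \<le> V (e 0) c \<le> V (e 0) (e 1) \<le> V p (e 1) \<le> V p
  q\<close> uses in turn that \<open>V p q\<close> is a smallest row maximum, that the saddlepoint
  is a row maximum, that it is a column minimum, and that \<open>V p q\<close> is a row maximum.
  Distinct entries then identify the positions.\<close>

lemma mmax_sad:
  assumes "mmax (L 1) (L 0) p q" "sad e" "keeps e L" "proper L"
  shows "p = e 0 \<and> q = e 1"
proof -
  have e: "e 0 \<in> set (L 0)" "e 1 \<in> set (L 1)" using assms(3) by (auto simp: keeps_def)
  hence pq: "p \<in> set (L 0)" "q \<in> set (L 1)" "V p (e 1) \<le> V p q" and "\<exists>c\<in>set (L 1). V p q \<le> V (e 0) c"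
    using assms(1) by (auto simp: mmax_def)
  then obtain c where c: "c \<in> set (L 1)" "V p q \<le> V (e 0) c" by blast
  have b: "p < n" "q < n" "c < n" "e 0 < n" "e 1 < n"
    using properD[OF assms(4), of 0] properD[OF assms(4), of 1] pq c e by auto
  have "V (e 0) c \<le> V (e 0) (e 1)" using sad_row[OF assms(2), of 0 c] b by (simp add: Vo_def)
  moreover have "V (e 0) (e 1) \<le> V p (e 1)" using sad_col[OF assms(2), of 0 p] b by (simp add: Vo_def)
  ultimately have "V p q = V (e 0) (e 1)" using c(2) pq(3) by linarith
  thus ?thesis using V_inj b by blast
qed

lemma brute_props [simp]: "writes p_brute = {39, 42, 43, 44, 46, 47, 70, 71, 72, 73}" "nosto p_brute" "noflip p_brute"
  by (auto simp: p_brute_def)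

lemma wp_brute:
  assumes "env s" "rep s L" "proper L"
  shows "wps p_brute (\<lambda>s'. rg s' 70 \<le> n \<and> rg s' 71 \<le> n \<and> (\<forall>e. sad e \<longrightarrow> keeps e L \<longrightarrow> rg s' 70 = e 0 \<and> rg s' 71 = e 1) \<and>
      tk s' \<le> tk s + length (L 0) * (length (L 1) + 1)) s"
    (is "wps _ ?Q s")
proof -
  let ?R = "L 0" and ?C = "L 1"
  let ?ci = "73 ::= Ld (Nm 1) (Vr 44) ;; Cmp 39 (Vr 47) (Vr 73) (Vr 47) (Vr 72) ;; Cond (Vr 39) (Nm 1) (72 ::= Vr 73) Skip"
  let ?ce = "Cmp 39 (Vr 70) (Vr 71) (Vr 47) (Vr 72) ;; Cond (Vr 39) (Nm 1) (70 ::= Vr 47 ;; 71 ::= Vr 72) Skip"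
  let ?co = "47 ::= Ld (Nm 0) (Vr 46) ;; 72 ::= rn ;; For 44 (Vr 43) ?ci ;; ?ce"
  have len: "length ?R \<le> n" "length ?C \<le> n" using proper_length[OF assms(3)] by auto
  have sub: "set ?R \<subseteq> {..<n}" "set ?C \<subseteq> {..<n}" using assms(3) by (auto simp: proper_def)
  have nB: "n < B" using Bn by linarith
  have ent: "i < length ?R \<Longrightarrow> ?R ! i < n" "j < length ?C \<Longrightarrow> ?C ! j < n" for i j using sub nth_mem by (auto simp: subset_iff)
  have inner: "wps (For 44 (Vr 43) ?ci) (\<lambda>s'. rmax a ?C (rg s' 72) \<and> tk s' \<le> tk s1 + length ?C) s1"
    if "rg s1 43 = length ?C" "rg s1 47 = a" "rg s1 72 = n" "mm s1 = mm s" "a < n" for a s1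
  proof (rule wp_For[where m = "length ?C" and J = "\<lambda>j s'. rmax a (take j ?C) (rg s' 72) \<and> tk s' \<le> tk s1 + j"])
    fix j and s' :: st assume j: "j < length ?C" and J: "rmax a (take j ?C) (rg s' 72) \<and> tk s' \<le> tk s1 + j"
      and fr: "frame (For 44 (Vr 43) ?ci) s1 s'" and x: "rg s' 44 = j"
    have r: "rg s' 47 = a" "mm s' = mm s" using fr that by (auto simp: frame_def)
    have v: "mm s 1 j = ?C ! j" using repD(2)[OF assms(2), of 1] j by simp
    have t: "take (Suc j) ?C = take j ?C @ [?C ! j]" using j by (rule take_Suc_conv_app_nth)
    have sb: "set (take j ?C) \<subseteq> {..<n}" using sub set_take_subset[of j ?C] by blast
    have cB: "?C ! j < n" "?C ! j < B" using ent(2)[OF j] nB by auto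
    show "wps ?ci (\<lambda>s''. rmax a (take (Suc j) ?C) (rg (s''\<lparr>rg := (rg s'')(44 := Suc j), tk := Suc (tk s'')\<rparr>) 72) \<and>
        tk (s''\<lparr>rg := (rg s'')(44 := Suc j), tk := Suc (tk s'')\<rparr>) \<le> tk s1 + Suc j) s'"
    proof (cases "lt a (?C ! j) a (rg s' 72)")
      case True
      have "rmax a (take j ?C @ [?C ! j]) (rg s' 72)" using rmax_keep J True by blast
      thus ?thesis unfolding t using True J r v x cB by simp
    next
      case False
      have "rmax a (take j ?C @ [?C ! j]) (?C ! j)" using rmax_update[OF _ False that(5) cB(1) sb] J by blast
      thus ?thesis unfolding t using False J r v x cB by simp
    qed
  next
    fix j and s' :: st assume "frame (For 44 (Vr 43) ?ci) s1 s'"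
    thus "gd s' (Vr 43) \<and> ev s' (Vr 43) = length ?C" using that by (simp add: frame_def)
  qed (use that len nB in \<open>auto simp: rmax_def\<close>)
  let ?s0 = "s\<lparr>rg := (rg s)(70 := n, 71 := 0, 42 := length ?R, 43 := length ?C)\<rparr>"
  \<comment> \<open>Without columns a row has no maximum and register 72 stays \<open>n\<close>, so
    \<open>mmax\<close> is claimed only for a nonempty list. A saddlepoint kept by \<open>L\<close>
    guarantees that.\<close>
  let ?J = "\<lambda>i s'. rg s' 70 \<le> n \<and> rg s' 71 \<le> n \<and> (?C \<noteq> [] \<longrightarrow> mmax ?C (take i ?R) (rg s' 70) (rg s' 71)) \<and>
     tk s' \<le> tk s + i * (length ?C + 1)"
  have "wps (For 46 (Vr 42) ?co) ?Q ?s0"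
  proof (rule wp_For[where m = "length ?R" and J = ?J])
    fix i and s' :: st assume i: "i < length ?R" and J: "?J i s'"
      and fr: "frame (For 46 (Vr 42) ?co) ?s0 s'" and x: "rg s' 46 = i"
    let ?a = "?R ! i"
    have r: "rg s' 43 = length ?C" "rg s' 3 = n" "mm s' = mm s" using fr assms(1) by (auto simp: frame_def env_def)
    have v: "mm s 0 i = ?a" using repD(2)[OF assms(2), of 0] i by simp
    have t: "take (Suc i) ?R = take i ?R @ [?a]" using i by (rule take_Suc_conv_app_nth)
    have sb: "set (take i ?R) \<subseteq> {..<n}" using sub set_take_subset[of i ?R] by blast
    have aB: "?a < n" "?a < B" using ent(1)[OF i] nB by auto
    let ?s1 = "s'\<lparr>rg := (rg s')(47 := ?a, 72 := n)\<rparr>"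
    let ?Q' = "\<lambda>s''. ?J (Suc i) (s''\<lparr>rg := (rg s'')(46 := Suc i), tk := Suc (tk s'')\<rparr>)"
    have "wps (For 44 (Vr 43) ?ci) (wps ?ce ?Q') ?s1"
    proof (rule wp_frame[OF inner[where a = ?a]])
      fix s2 :: st assume Q2: "rmax ?a ?C (rg s2 72) \<and> tk s2 \<le> tk ?s1 + length ?C" and fr2: "frame (For 44 (Vr 43) ?ci) ?s1 s2"
      have r2: "rg s2 70 = rg s' 70" "rg s2 71 = rg s' 71" "rg s2 47 = ?a" using fr2 by (auto simp: frame_def)
      have m: "rg s2 72 \<le> n" using Q2 sub by (auto simp: rmax_def)
      have tk2: "Suc (tk s2) \<le> tk s + Suc i * (length ?C + 1)" using Q2 J by simp
      show "wps ?ce ?Q' s2"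
      proof (cases "lt (rg s' 70) (rg s' 71) ?a (rg s2 72)")
        case True
        have "?C \<noteq> [] \<longrightarrow> mmax ?C (take (Suc i) ?R) (rg s' 70) (rg s' 71)"
          unfolding t using mmax_keep[OF _ _ True] J Q2 by blast
        thus ?thesis using True r2 J tk2 by simp
      next
        case False
        have "?C \<noteq> [] \<longrightarrow> mmax ?C (take (Suc i) ?R) ?a (rg s2 72)"
          unfolding t using mmax_update[OF _ _ False _ aB(1) sub(2) sb] J Q2 by blast
        thus ?thesis using False r2 m tk2 aB nB by simp
      qed
    qed (use r aB in auto)
    thus "wps ?co ?Q' s'" using r x v aB nB by simp
  next
    fix i and s' :: st assume "frame (For 46 (Vr 42) ?co) ?s0 s'"
    thus "gd s' (Vr 42) \<and> ev s' (Vr 42) = length ?R" by (simp add: frame_def)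
  next
    fix s' :: st assume J: "?J (length ?R) s'"
    have "rg s' 70 = e 0 \<and> rg s' 71 = e 1" if "sad e" "keeps e L" for e
    proof -
      have "e 1 \<in> set ?C" using that(2) by (simp add: keeps_def)
      hence "?C \<noteq> []" by auto
      hence "mmax ?C ?R (rg s' 70) (rg s' 71)" using J by simp
      thus ?thesis using that assms(3) by (rule mmax_sad)
    qed
    thus "?Q s'" using J by blast
  qed (use len nB in \<open>auto simp: mmax_def\<close>)
  thus ?thesis using assms(1) repD(1)[OF assms(2)] len nB by (simp add: p_brute_def env_def)
qed

section \<open>Verification and the whole program\<close>

lemma verify_props [simp]: "nosto p_verify" "noflip p_verify"
  by (auto simp: p_verify_def)

lemma wp_verify:
  assumes "env s" "rg s 70 = p" "rg s 71 = q" "p \<le> n" "q \<le> n"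
  shows "wps p_verify (\<lambda>s'. rg s' 0 = of_bool (sad (\<lambda>d. if d = 0 then p else q)) \<and> rg s' 1 = p \<and> rg s' 2 = q \<and> tk s' \<le> tk s + n) s"
    (is "wps _ ?Q s")
proof -
  define Q where "Q = ?Q"
  let ?c = "Cmp 39 (Vr 70) (Vr 71) (Vr 70) (Vr 44) ;; Cond (Nm 0) (Vr 39) (74 ::= Nm 0) Skip ;;
       Cmp 39 (Vr 44) (Vr 71) (Vr 70) (Vr 71) ;; Cond (Nm 0) (Vr 39) (74 ::= Nm 0) Skip"
  let ?s0 = "s\<lparr>rg := (rg s)(74 := of_bool (p < n \<and> q < n))\<rparr>"
  let ?J = "\<lambda>i s'. rg s' 74 = of_bool (p < n \<and> q < n \<and> (\<forall>j<i. \<not> V p q < V p j \<and> \<not> V j q < V p q)) \<and> tk s' \<le> tk s + i"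
  let ?o = "0 ::= Vr 74 ;; 1 ::= Vr 70 ;; 2 ::= Vr 71"
  have nB: "n + 1 < B" using Bn by linarith
  have sadpq: "sad (\<lambda>d. if d = 0 then p else q) \<longleftrightarrow> p < n \<and> q < n \<and> (\<forall>j<n. \<not> V p q < V p j \<and> \<not> V j q < V p q)"
    by (auto simp: sad_def Vo_def less_2_cases_iff not_less all_conj_distrib)
  have "wps (For 44 rn ?c) (wps ?o Q) ?s0"
  proof (rule wp_For[where m = n and J = ?J])
    fix i and s' :: st assume i: "i < n" and J: "?J i s'" and fr: "frame (For 44 rn ?c) ?s0 s'" and x: "rg s' 44 = i"
    have r: "rg s' 70 = p" "rg s' 71 = q" using fr assms by (auto simp: frame_def)
    have all: "(\<forall>j<Suc i. P j) \<longleftrightarrow> (\<forall>j<i. P j) \<and> P i" for P by (auto simp: less_Suc_eq)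
    show "wps ?c (\<lambda>s''. ?J (Suc i) (s''\<lparr>rg := (rg s'')(44 := Suc i), tk := Suc (tk s'')\<rparr>)) s'"
      using J r x i nB unfolding all by (auto simp: lt_def)
  next
    fix i and s' :: st assume "frame (For 44 rn ?c) ?s0 s'"
    thus "gd s' rn \<and> ev s' rn = n" using assms(1) by (simp add: frame_def env_def)
  next
    fix s' :: st assume J: "?J n s'" and fr: "frame (For 44 rn ?c) ?s0 s'"
    have r: "rg s' 70 = p" "rg s' 71 = q" using fr assms by (auto simp: frame_def)
    show "wps ?o Q s'" unfolding Q_def sadpq using J r assms(4,5) nB by simp
  qed (use nB in auto)
  hence "wps p_verify Q s"
    using assms nB by (cases "p < n"; cases "q < n") (simp_all add: p_verify_def env_def)
  thus ?thesis unfolding Q_def .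
qed

lemma attempts_props [simp]: "noflip p_attempts"
  by (auto simp: p_attempts_def)

lemma wp_program:
  assumes "rg s 0 = n" "NA * (16 * NR) * (2 * k) \<le> length (bt s)"
  defines "xs \<equiv> chunks (NA * (16 * NR)) (2 * k) (bt s)"
  shows "wps program (\<lambda>s'. rg s' 0 = of_bool (\<exists>e. sad e) \<and> (rg s' 0 = 1 \<longrightarrow> sad (\<lambda>d. if d = 0 then rg s' 1 else rg s' 2)) \<and>
      nf s' = nf s + NA * (16 * NR) * (2 * k) \<and>
      tk s' \<le> tk s + 700000 * n + (if \<forall>i<NA. \<not> small (att (nth xs) (i * (16 * NR)) NR) then n * (n + 1) else 0)) s"
    (is "wps _ ?Q s")
proof -
  define Q where "Q = ?Q"
  let ?fail = "\<lambda>f. \<forall>i<NA. \<not> small (att f (i * (16 * NR)) NR)"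
  have "wps p_params (wps (p_coins ;; p_attempts ;; p_brute ;; p_verify) Q) s"
  proof (rule wp_mono[OF wp_params[OF assms(1)]])
    fix s1 :: st assume Q1: "env s1 \<and> mm s1 = mm s \<and> bt s1 = bt s \<and> nf s1 = nf s \<and> tk s1 \<le> tk s + n + 1"
    hence b1: "bt s1 = bt s" by simp
    have "wps p_coins (wps (p_attempts ;; p_brute ;; p_verify) Q) s1"
    proof (rule wp_mono[OF wp_coins])
      fix s2 :: st assume Q2: "env s2 \<and> (\<forall>j<NA * (16 * NR). mm s2 7 j = chunks (NA * (16 * NR)) (2 * k) (bt s1) ! j) \<and>
        (\<forall>c. c \<noteq> 7 \<longrightarrow> mm s2 c = mm s1 c) \<and> nf s2 = nf s1 + NA * (16 * NR) * (2 * k) \<and>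
        tk s2 \<le> tk s1 + NA * (16 * NR) * (2 * k + 1)"
      have e2: "env s2" using Q2 by blast
      have fx: "?fail (mm s2 7) \<longleftrightarrow> ?fail (nth xs)"
      proof -
        have "att (mm s2 7) (i * (16 * NR)) NR = att (nth xs) (i * (16 * NR)) NR" if "i < NA" for i
        proof (rule att_cong)
          fix j assume "j < 16 * NR"
          hence "i * (16 * NR) + j < Suc i * (16 * NR)" by simp
          also have "\<dots> \<le> NA * (16 * NR)" using that by (intro mult_right_mono) auto
          finally show "mm s2 7 (i * (16 * NR) + j) = xs ! (i * (16 * NR) + j)" using Q2 b1 by (simp add: xs_def)
        qed
        thus ?thesis by simp
      qed
      have "wps p_attempts (wps (p_brute ;; p_verify) Q) s2"
      proof (rule wp_frame[OF wp_attempts[OF e2 refl]])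
        fix s3 :: st assume Q3: "env s3 \<and> (\<exists>L. rep s3 L \<and> proper L \<and> (\<forall>e. sad e \<longrightarrow> keeps e L) \<and> (small L \<or> ?fail (mm s2 7))) \<and>
            tk s3 \<le> tk s2 + NA * (n + NR * (210 * n + 1) + 1) + n"
          and fr3: "frame p_attempts s2 s3"
        have e3: "env s3" using Q3 by blast
        obtain L where L: "rep s3 L" "proper L" "\<forall>e. sad e \<longrightarrow> keeps e L" "small L \<or> ?fail (nth xs)"
          using Q3 unfolding fx by blast
        have n3: "nf s3 = nf s2" using fr3 by (simp add: frame_def)
        have "wps p_brute (wps p_verify Q) s3"
        proof (rule wp_frame[OF wp_brute[OF e3 L(1,2)]])
          fix s4 :: st assume Q4: "rg s4 70 \<le> n \<and> rg s4 71 \<le> n \<and> (\<forall>e. sad e \<longrightarrow> keeps e L \<longrightarrow> rg s4 70 = e 0 \<and> rg s4 71 = e 1) \<and>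
             tk s4 \<le> tk s3 + length (L 0) * (length (L 1) + 1)"
            and fr4: "frame p_brute s3 s4"
          have e4: "env s4" by (rule env_frame[OF e3 fr4]) auto
          have n4: "nf s4 = nf s3" using fr4 by (simp add: frame_def)
          have b4: "rg s4 70 \<le> n" "rg s4 71 \<le> n" using Q4 by auto
          have len: "length (L 0) \<le> n" "length (L 1) \<le> n" using proper_length[OF L(2)] by auto
          have t4: "length (L 0) * (length (L 1) + 1) \<le> 5 * n + (if ?fail (nth xs) then n * (n + 1) else 0)"
          proof (cases "?fail (nth xs)")
            case True
            have "length (L 0) * (length (L 1) + 1) \<le> n * (n + 1)" using len by (intro mult_mono) auto
            thus ?thesis using True by simp
          next
            case False
            hence "length (L 0) * length (L 1) \<le> 4 * n" using L(4) by (auto simp: small_def)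
            thus ?thesis using len by (simp add: add_mult_distrib2)
          qed
          show "wps p_verify Q s4"
          proof (rule wp_frame[OF wp_verify[OF e4 refl refl b4]])
            fix s5 :: st
            assume Q5: "rg s5 0 = of_bool (sad (\<lambda>d. if d = 0 then rg s4 70 else rg s4 71)) \<and> rg s5 1 = rg s4 70 \<and>
                rg s5 2 = rg s4 71 \<and> tk s5 \<le> tk s4 + n" and fr5: "frame p_verify s4 s5"
            have n5: "nf s5 = nf s4" using fr5 by (simp add: frame_def)
            have sad: "sad (\<lambda>d. if d = 0 then rg s4 70 else rg s4 71) \<longleftrightarrow> (\<exists>e. sad e)"
            proof
              assume "\<exists>e. sad e"
              then obtain e where e: "sad e" by blast
              hence "rg s4 70 = e 0" "rg s4 71 = e 1" using Q4 L(3) by auto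
              thus "sad (\<lambda>d. if d = 0 then rg s4 70 else rg s4 71)"
                using e by (auto simp: sad_def less_2_cases_iff)
            qed blast
            have T: "tk s1 \<le> tk s + n + 1" "tk s2 \<le> tk s1 + NA * (16 * NR) * (2 * k + 1)"
              "tk s3 \<le> tk s2 + NA * (n + NR * (210 * n + 1) + 1) + n" "tk s4 \<le> tk s3 + length (L 0) * (length (L 1) + 1)"
              "tk s5 \<le> tk s4 + n" using Q1 Q2 Q3 Q4 Q5 by blast+
            \<comment> \<open>There are 33280 seeds, and
              \<open>2 * k + 1 \<le> 2 * n + 3 \<le> 5 * n\<close>.\<close>
            have "NA * (16 * NR) * (2 * k + 1) \<le> 166400 * n" using k_le_n n_pos by (simp add: NA_def NR_def)
            moreover have "NA * (n + NR * (210 * n + 1) + 1) \<le> 438960 * n" using n_pos by (simp add: NA_def NR_def)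
            ultimately have "tk s5 \<le> tk s + 700000 * n + (if ?fail (nth xs) then n * (n + 1) else 0)"
              using T t4 n_pos by linarith
            moreover have "nf s5 = nf s + NA * (16 * NR) * (2 * k)" using n5 n4 n3 Q2 Q1 by simp
            ultimately show "Q s5" unfolding Q_def using Q5 sad by (simp cong: if_cong)
          qed
        qed
        thus "wps (p_brute ;; p_verify) Q s3" unfolding wp_Seq_fun .
      qed
      thus "wps (p_attempts ;; p_brute ;; p_verify) Q s2" unfolding wp_Seq_fun .
    qed (use Q1 assms(2) in auto)
    thus "wps (p_coins ;; p_attempts ;; p_brute ;; p_verify) Q s1" unfolding wp_Seq_fun .
  qed
  thus ?thesis unfolding program_def wp_Seq_fun Q_def .
qed

end

section \<open>Asymptotics and the order of the entries\<close>

definition bits :: "nat \<Rightarrow> nat" where "bits n = (LEAST k. n < 2 ^ k)"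

lemma less_bits: "n < 2 ^ bits n"
  unfolding bits_def by (rule LeastI[of _ n]) (rule less_exp)

lemma bits_le: "1 \<le> n \<Longrightarrow> 2 ^ bits n \<le> 2 * n"
proof (cases "bits n")
  case (Suc k)
  hence "\<not> n < 2 ^ k" using not_less_Least[of k "\<lambda>k. n < 2 ^ k"] by (simp add: bits_def)
  thus ?thesis using Suc by simp
qed simp

lemma bits_ln: assumes "3 \<le> n" shows "real (bits n) \<le> 3 * ln n"
proof -
  have "(2::real) ^ bits n \<le> 2 * n" using bits_le[of n] assms by (metis of_nat_le_iff of_nat_mult of_nat_numeral of_nat_power le_trans one_le_numeral)
  hence "ln ((2::real) ^ bits n) \<le> ln (2 * real n)" using assms by (subst ln_le_cancel_iff) auto
  hence b: "bits n * ln 2 \<le> ln 2 + ln n" using assms by (simp add: ln_mult ln_realpow)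
  have e: "exp 1 \<le> (3::real)" using exp_le by simp
  have l3: "1 \<le> ln (real n)"
    using assms e by (subst ln_ge_iff) auto
  have l2: "1 / 2 \<le> ln (2::real)" using ln2_ge_two_thirds by simp
  have b': "(real (bits n) - 1) * ln 2 \<le> ln n" using b by (simp add: left_diff_distrib)
  show ?thesis
  proof (cases "bits n \<le> 1")
    case True
    hence "real (bits n) \<le> 1" by simp
    thus ?thesis using l3 by linarith
  next
    case False
    hence "(real (bits n) - 1) * (1 / 2) \<le> (real (bits n) - 1) * ln 2" using l2 by (intro mult_left_mono) auto
    thus ?thesis using b' l3 by simp
  qed
qed

lemma bits_bigo: "(\<lambda>n. real (c * bits n)) \<in> O(\<lambda>n. ln (real n))"
proof (rule bigoI[of _ "c * 3"])
  show "\<forall>\<^sub>F n in sequentially. norm (real (c * bits n)) \<le> c * 3 * norm (ln (real n))"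
    using eventually_ge_at_top[of 3]
  proof eventually_elim
    case (elim n)
    have "real c * real (bits n) \<le> c * (3 * ln n)" using bits_ln[OF elim] by (intro mult_left_mono) auto
    thus ?case using elim by simp
  qed
qed

definition failure :: "real \<Rightarrow> nat \<Rightarrow> real" where
  "failure c n = (let g = (bits n - 1) div 20 in if g < 24 then 1 else (c * (116 * g / 2 ^ g)) ^ 40)"

lemma failure_bigo:
  assumes "0 \<le> c"
  shows "failure c \<in> O(\<lambda>n. ln (real n) * ln (ln (real n)) / real n)"
proof -
  let ?C = "(c * 116 * 3) ^ 40 * 2 ^ 40"
  have "failure c \<in> O(\<lambda>n. ln (real n) ^ 40 / real n ^ 2)"
  proof (rule bigoI[of _ ?C])
    show "\<forall>\<^sub>F n in sequentially. norm (failure c n) \<le> ?C * norm (ln (real n) ^ 40 / real n ^ 2)"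
      \<comment> \<open>Such \<open>n\<close> have more than 481 bits, which gives
        \<open>g \<ge> 24\<close>.\<close>
      using eventually_ge_at_top[of "2 ^ 481"]
    proof eventually_elim
      case (elim n)
      define g where "g = (bits n - 1) div 20"
      have n3: "3 \<le> n" using elim by (rule order_trans[rotated]) simp
      have "(2::nat) ^ 481 < 2 ^ bits n" using elim less_bits[of n] by linarith
      hence "481 < bits n" by (rule power_less_imp_less_exp[rotated]) simp
      hence g: "24 \<le> g" unfolding g_def by linarith
      have gk: "bits n \<le> 20 * g + 20" "g \<le> bits n" unfolding g_def by linarith+
      have gl: "real g \<le> 3 * ln n" using gk(2) bits_ln[OF n3] by linarith
      have "n < 2 ^ (20 * g + 20)" using less_bits[of n] gk(1)
        by (meson less_le_trans one_le_numeral power_increasing)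
      hence "real n < real (2 ^ (20 * g + 20))" by (simp only: of_nat_less_iff)
      hence ng: "real n \<le> 2 ^ (20 * g) * 2 ^ 20" by (simp add: power_add)
      have "real n ^ 2 \<le> (2 ^ (20 * g) * 2 ^ 20) ^ 2" using ng by (intro power_mono) auto
      also have "\<dots> = 2 ^ (40 * g) * 2 ^ 40" by (simp add: power_mult_distrib flip: power_mult)
      finally have n2: "real n ^ 2 \<le> 2 ^ (40 * g) * 2 ^ 40" .
      have "failure c n = (c * (116 * g / 2 ^ g)) ^ 40"
        unfolding failure_def Let_def g_def[symmetric] using g by simp
      also have "c * (116 * g / 2 ^ g) = c * 116 * g / 2 ^ g" by simp
      also have "(c * 116 * g / 2 ^ g) ^ 40 = (c * 116 * g) ^ 40 / 2 ^ (40 * g)"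
        unfolding power_divide power_mult[symmetric] mult.commute[of g] ..
      also have "\<dots> \<le> (c * 116 * (3 * ln n)) ^ 40 / 2 ^ (40 * g)"
        using assms gl by (intro divide_right_mono power_mono mult_left_mono) auto
      also have "\<dots> \<le> (c * 116 * (3 * ln n)) ^ 40 / (real n ^ 2 / 2 ^ 40)"
        using n2 n3 assms by (intro divide_left_mono) (auto simp: field_simps)
      also have "\<dots> = ?C * (ln (real n) ^ 40 / real n ^ 2)" by (simp add: power_mult_distrib)
      finally have le: "failure c n \<le> ?C * (ln (real n) ^ 40 / real n ^ 2)" .
      have "0 \<le> failure c n" using assms by (simp add: failure_def Let_def)
      thus ?case using le by simp
    qed
  qed
  \<comment> \<open>The second factor \<open>n\<close> in the denominator absorbs every power of the
    logarithm.\<close>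
  also have "(\<lambda>n::nat. ln (real n) ^ 40 / real n ^ 2) \<in> O(\<lambda>n. ln (real n) * ln (ln (real n)) / real n)"
    by real_asymp
  finally show ?thesis .
qed

text \<open>The transposed orientation negates entries, which an arbitrary linear order does not
  permit. The number of smaller entries is an integer and preserves all comparisons.\<close>

definition entry_rank :: "'a rel \<Rightarrow> 'a mat \<Rightarrow> nat \<Rightarrow> nat \<Rightarrow> nat \<Rightarrow> int" where
  "entry_rank r A n i j = int (card {p \<in> {..<n} \<times> {..<n}. less_in r (A $$ p) (A $$ (i, j))})"

context
  fixes X :: "'a set" and r :: "'a rel" and A :: "'a mat" and n :: nat
  assumes lin: "linear_order_on X r" and A: "A \<in> carrier_mat n n" "elements_mat A \<subseteq> X"
    and inj: "inj_on (\<lambda>p. A $$ p) ({..<n} \<times> {..<n})"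
begin

lemma entry_in: "i < n \<Longrightarrow> j < n \<Longrightarrow> A $$ (i, j) \<in> X"
  using A by blast

lemma less_in_trans: "less_in r x y \<Longrightarrow> less_in r y z \<Longrightarrow> less_in r x z"
  using lin unfolding less_in_def linear_order_on_def partial_order_on_def preorder_on_def
  by (metis antisymD transD)

lemma less_in_total: "x \<in> X \<Longrightarrow> y \<in> X \<Longrightarrow> x \<noteq> y \<Longrightarrow> less_in r x y \<or> less_in r y x"
  using lin unfolding less_in_def linear_order_on_def total_on_def by blast

lemma rank_mono:
  assumes "i < n" "j < n" "less_in r (A $$ (i, j)) (A $$ (i', j'))"
  shows "entry_rank r A n i j < entry_rank r A n i' j'"
proof -
  let ?S = "\<lambda>z. {p \<in> {..<n} \<times> {..<n}. less_in r (A $$ p) z}"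
  have "?S (A $$ (i, j)) \<subseteq> ?S (A $$ (i', j'))" using assms(3) less_in_trans by blast
  moreover have "(i, j) \<in> ?S (A $$ (i', j'))" "(i, j) \<notin> ?S (A $$ (i, j))"
    using assms by (auto simp: less_in_def)
  ultimately have "?S (A $$ (i, j)) \<subset> ?S (A $$ (i', j'))" by blast
  thus ?thesis unfolding entry_rank_def by (simp add: psubset_card_mono)
qed

lemma rank_inj:
  assumes "i < n" "j < n" "i' < n" "j' < n" "entry_rank r A n i j = entry_rank r A n i' j'"
  shows "i = i' \<and> j = j'"
proof -
  have "A $$ (i, j) = A $$ (i', j')"
    using rank_mono[of i j i' j'] rank_mono[of i' j' i j] assms entry_in less_in_total by (metis less_irrefl)
  thus ?thesis using inj_onD[OF inj, of "(i, j)" "(i', j')"] assms by auto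
qed

lemma rank_less:
  assumes "i < n" "j < n" "i' < n" "j' < n"
  shows "entry_rank r A n i j < entry_rank r A n i' j' \<longleftrightarrow> less_in r (A $$ (i, j)) (A $$ (i', j'))"
proof
  assume a: "entry_rank r A n i j < entry_rank r A n i' j'"
  hence "\<not> less_in r (A $$ (i', j')) (A $$ (i, j))" using rank_mono[of i' j' i j] assms by auto
  moreover have "A $$ (i, j) \<noteq> A $$ (i', j')"
    using a inj_onD[OF inj, of "(i, j)" "(i', j')"] assms by auto
  ultimately show "less_in r (A $$ (i, j)) (A $$ (i', j'))" using less_in_total entry_in assms by blast
qed (use rank_mono assms in blast)

lemma entry_less_rank:
  "entry_less r A i j i' j' \<longleftrightarrow> i < n \<and> j < n \<and> i' < n \<and> j' < n \<and> entry_rank r A n i j < entry_rank r A n i' j'"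
  using rank_less A(1) by (auto simp: entry_less_def)

lemma saddlepoint_rank:
  "strict_saddlepoint r A i j \<longleftrightarrow> i < n \<and> j < n \<and>
    (\<forall>j'<n. entry_rank r A n i j' \<le> entry_rank r A n i j) \<and> (\<forall>i'<n. entry_rank r A n i j \<le> entry_rank r A n i' j)"
proof -
  have d: "dim_row A = n" "dim_col A = n" using A(1) by auto
  have "less_in r (A $$ (i, j')) (A $$ (i, j)) \<longleftrightarrow> entry_rank r A n i j' \<le> entry_rank r A n i j"
    if "i < n" "j < n" "j' < n" "j' \<noteq> j" for j'
    using rank_less[of i j' i j] rank_inj[of i j' i j] that by (auto simp: le_less)
  moreover have "less_in r (A $$ (i, j)) (A $$ (i', j)) \<longleftrightarrow> entry_rank r A n i j \<le> entry_rank r A n i' j"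
    if "i < n" "j < n" "i' < n" "i' \<noteq> i" for i'
    using rank_less[of i j i' j] rank_inj[of i j i' j] that by (auto simp: le_less)
  ultimately show ?thesis unfolding strict_saddlepoint_def d by (metis order_refl)
qed

end

section \<open>The machine\<close>

lemma map_take_replicate_pmf: "map_pmf (take m) (replicate_pmf (m + r) p) = replicate_pmf m p"
proof -
  have "map_pmf (take m) (replicate_pmf (m + r) p) =
      bind_pmf (replicate_pmf m p) (\<lambda>xs. bind_pmf (replicate_pmf r p) (\<lambda>ys. return_pmf (take m (xs @ ys))))"
    by (simp add: replicate_pmf_distrib map_bind_pmf)
  also have "\<dots> = bind_pmf (replicate_pmf m p) (\<lambda>xs. bind_pmf (replicate_pmf r p) (\<lambda>ys. return_pmf xs))"
    by (intro bind_pmf_cong refl) (auto simp: set_replicate_pmf)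
  also have "\<dots> = replicate_pmf m p" by (simp add: bind_return_pmf')
  finally show ?thesis .
qed

lemma chunks_take: "N * m \<le> M \<Longrightarrow> chunks N m (take M bs) = chunks N m bs"
proof -
  assume M: "N * m \<le> M"
  have "take m (drop (m * j) (take M bs)) = take m (drop (m * j) bs)" if "j < N" for j
  proof -
    have "Suc j * m \<le> N * m" using that by (intro mult_right_mono) auto
    hence "m \<le> M - m * j" using M by (simp add: mult.commute)
    thus ?thesis by (simp add: drop_take min_absorb1)
  qed
  thus ?thesis by (simp add: chunks_def)
qed

abbreviation code :: "instr list" where "code \<equiv> cc 0 program"

abbreviation draws :: "nat \<Rightarrow> nat" where "draws k \<equiv> NA * (16 * NR) * (2 * k)"

context prog
begin

definition fails :: "bool list \<Rightarrow> bool" where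
  "fails bs \<longleftrightarrow> (\<forall>i<NA. \<not> small (att (nth (chunks (NA * (16 * NR)) (2 * k) bs)) (i * (16 * NR)) NR))"

definition good :: "config \<Rightarrow> bool" where
  "good c \<longleftrightarrow> halted code c \<and> regs c 0 = of_bool (\<exists>e. sad e) \<and>
     (regs c 0 = 1 \<longrightarrow> sad (\<lambda>d. if d = 0 then regs c 1 else regs c 2)) \<and> coins c = draws k"

lemma machine_run:
  assumes "B ^ 20 \<le> 2 ^ w" "draws k \<le> length bs"
    and t: "clen program * (1 + (700000 * n + (if fails bs then n * (n + 1) else 0))) \<le> t"
  shows "good (fst (drun w lt code t (init n, bs)))"
proof -
  interpret width w B lt by unfold_locales (use assms(1) Bn in auto)
  let ?z = "\<lparr>rg = (\<lambda>_. 0)(0 := n), mm = (\<lambda>_ _. 0), bt = bs, nf = 0, tk = 0\<rparr>"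
  have "wps program (\<lambda>s'. rg s' 0 = of_bool (\<exists>e. sad e) \<and> (rg s' 0 = 1 \<longrightarrow> sad (\<lambda>d. if d = 0 then rg s' 1 else rg s' 2)) \<and>
      nf s' = nf ?z + draws k \<and> tk s' \<le> tk ?z + 700000 * n + (if \<forall>i<NA. \<not> small (att (nth (chunks (NA * (16 * NR)) (2 * k) (bt ?z))) (i * (16 * NR)) NR) then n * (n + 1) else 0)) ?z"
    by (rule wp_program) (use assms(2) in auto)
  then obtain z where z: "bigstep lt B program ?z z" "rg z 0 = of_bool (\<exists>e. sad e)"
    "rg z 0 = 1 \<longrightarrow> sad (\<lambda>d. if d = 0 then rg z 1 else rg z 2)" "nf z = draws k"
    "tk z \<le> 700000 * n + (if fails bs then n * (n + 1) else 0)"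
    unfolding wp_def fails_def by auto
  have bd: "bdd B ?z" using Bn by (auto simp: bdd_def)
  have wf: "wfc B program" using Bn n_pos by (intro wfc_program) simp
  have sm: "sim ?z (init n, bs)" by (simp add: sim_def init_def)
  have "code_at code (pc (init n)) (cc (pc (init n)) program)" by (simp add: init_def code_at_self)
  from bigstep_correct[OF z(1) bd wf sm this] obtain y where
    y: "reach code (clen program * (1 + (tk z - tk ?z))) (init n, bs) y" "sim z y" "pc (fst y) = pc (init n) + clen program"
    by blast
  then obtain t' where t': "t' \<le> clen program * (1 + tk z)" "drun w lt code t' (init n, bs) = y"
    by (auto simp: reach_def)
  have h: "halted code (fst y)" using y(3) by (simp add: halted_def init_def length_cc)
  have "clen program * (1 + tk z) \<le> t" using z(5) by (intro order_trans[OF mult_left_mono t]) simp_all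
  hence "t = t' + (t - t')" using t'(1) by simp
  hence "drun w lt code t (init n, bs) = y" using drun_add[of w lt code t' "t - t'"] t'(2) drun_halted[OF h] by metis
  moreover have "regs (fst y) 0 = rg z 0" "regs (fst y) 1 = rg z 1" "regs (fst y) 2 = rg z 2" "coins (fst y) = nf z"
    using y(2) by (auto simp: sim_def)
  ultimately show ?thesis using z(2-4) h by (simp add: good_def cong: if_cong)
qed

text \<open>A run of \<open>t\<close> steps is described by \<open>t\<close> flips, of which the
  seeds take only the first \<open>draws k\<close>; the other \<open>r\<close> are
  marginalized.\<close>

lemma prb_fails:
  assumes "24 \<le> g"
  shows "prb (replicate_pmf (draws k + r) coin) {bs. fails bs} \<le> (NR * (116 * g / 2 ^ g)) ^ 40"
proof -
  let ?N = "NA * (16 * NR)"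
  have "prb (replicate_pmf (draws k + r) coin) {bs. fails bs} = prb (map_pmf (take (draws k)) (replicate_pmf (draws k + r) coin)) {bs. fails bs}"
    unfolding prb_map by (simp add: fails_def chunks_take)
  also have "\<dots> = prb (map_pmf (chunks ?N (2 * k)) (replicate_pmf (?N * (2 * k)) coin))
      {xs. \<forall>i<NA. \<not> small (att (nth xs) (i * (16 * NR)) NR)}"
    unfolding map_take_replicate_pmf prb_map by (simp add: fails_def)
  also have "\<dots> \<le> (NR * (116 * g / y)) ^ NA" unfolding map_chunks_coins by (rule prb_all_fail[OF assms])
  finally show ?thesis by (simp add: NA_def y_def)
qed

end

text \<open>The summand \<open>draws\<close> guarantees that a run of \<open>time n\<close> steps
  comes with at least as many flips as the seeds take.\<close>

definition time :: "nat \<Rightarrow> nat" where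
  "time n = clen program * (1 + 700000 * n) + draws (bits n)"

lemma time_bigo: "(\<lambda>n. real (time n)) \<in> O(\<lambda>n. real n)"
proof -
  let ?c = "NA * (16 * NR) * 2"
  have "(\<lambda>n. real (?c * bits n)) \<in> O(\<lambda>n. ln (real n))" by (rule bits_bigo)
  also have "(\<lambda>n. ln (real n)) \<in> O(\<lambda>n. real n)" by real_asymp
  finally have d: "(\<lambda>n. real (?c * bits n)) \<in> O(\<lambda>n. real n)" .
  have "(\<lambda>n. 1 + 700000 * real n) \<in> O(\<lambda>n. real n)" by real_asymp
  have "(\<lambda>n. real (clen program) * (1 + 700000 * real n)) \<in> O(\<lambda>n. real n)"
    using \<open>(\<lambda>n. 1 + 700000 * real n) \<in> O(\<lambda>n. real n)\<close> clen_pos[of program] by simp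
  from sum_in_bigo(1)[OF this d] show ?thesis
    by (simp add: time_def algebra_simps)
qed

text \<open>600 is 30 times 20: stored values are below \<open>B = (n + 1) ^ 30\<close>, and the
  machine has to hold \<open>B ^ 20\<close>.\<close>

lemma bound_power:
  assumes "1 \<le> n" "600 * log 2 (real n + 1) \<le> real w"
  shows "((n + 1) ^ 30) ^ 20 \<le> (2::nat) ^ w"
proof -
  have "(real n + 1) ^ 600 = (real n + 1) powr 600" by (subst powr_numeral) auto
  also have "\<dots> = (2 powr log 2 (real n + 1)) powr 600" by simp
  also have "\<dots> = 2 powr (600 * log 2 (real n + 1))" unfolding powr_powr by (simp only: mult.commute)
  also have "\<dots> \<le> 2 powr real w" using assms(2) by (intro powr_mono) auto
  also have "\<dots> = 2 ^ w" by (simp add: powr_realpow)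
  finally have "real ((n + 1) ^ 600) \<le> real (2 ^ w)" by (simp add: add.commute)
  hence "(n + 1) ^ 600 \<le> (2::nat) ^ w" by (simp only: of_nat_le_iff)
  thus ?thesis by (simp flip: power_mult)
qed

text \<open>As \<open>n + 1 \<ge> 2\<close>, a power of \<open>n + 1\<close> absorbs the constant
  factor. The requirement on the word length is then a pure multiple of
  \<open>log 2 (n + 1)\<close>.\<close>

lemma bound_ge: assumes "1 \<le> n" shows "1000000 * (n + 1) ^ 2 \<le> ((n::nat) + 1) ^ 30"
proof -
  have "(2::nat) ^ 28 \<le> (n + 1) ^ 28" using assms by (intro power_mono) auto
  hence "1000000 \<le> (n + 1) ^ 28" by simp
  hence "1000000 * (n + 1) ^ 2 \<le> (n + 1) ^ 28 * (n + 1) ^ 2" by (rule mult_right_mono) simp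
  thus ?thesis by (simp flip: power_add)
qed

lemma saddlepoint_machine:
  fixes A :: "'a mat"
  assumes n: "1 \<le> n" and w: "600 * log 2 (real n + 1) \<le> real w" and lin: "linear_order_on X r"
    and A: "A \<in> carrier_mat n n" "elements_mat A \<subseteq> X" "inj_on (\<lambda>p. A $$ p) ({..<n} \<times> {..<n})"
  shows "\<exists>t. \<forall>s \<in> set_pmf (run w (entry_less r A) code t (init n)).
      halted code s \<and> correct_output r A s \<and> coins s \<le> draws (bits n)"
    and "1 - failure (real NR) n \<le> measure_pmf.prob (run w (entry_less r A) code (time n) (init n)) {s. halted code s}"
proof -
  define k where "k = bits n"
  define lt where lt_eq: "lt = entry_less r A"
  define V where "V = entry_rank r A n"
  define B where "B = (n + 1) ^ 30"
  interpret prog V n k B lt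
  proof
    show "1 \<le> n" by (rule n)
    show "i = i' \<and> j = j'" if "i < n" "j < n" "i' < n" "j' < n" "V i j = V i' j'" for i j i' j'
      using rank_inj[OF lin A that(1-4)] that(5) by (simp add: V_def)
    show "n < 2 ^ k" "2 ^ k \<le> 2 * n" unfolding k_def using less_bits bits_le[OF n] by auto
    show "1000000 * (n + 1) ^ 2 \<le> B" unfolding B_def by (rule bound_ge[OF n])
    show "lt i j i' j' \<longleftrightarrow> i < n \<and> j < n \<and> i' < n \<and> j' < n \<and> V i j < V i' j'" for i j i' j'
      unfolding lt_eq V_def by (rule entry_less_rank[OF lin A])
  qed
  have Bw: "B ^ 20 \<le> 2 ^ w" unfolding B_def by (rule bound_power[OF n w])
  have sad: "sad e \<longleftrightarrow> strict_saddlepoint r A (e 0) (e 1)" for e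
    unfolding saddlepoint_rank[OF lin A] V_def[symmetric] sad_def
    by (auto simp: Vo_def less_2_cases_iff)
  have good: "halted code s \<and> correct_output r A s \<and> coins s \<le> draws (bits n)" if "good s" for s
  proof -
    have ex: "(\<exists>e. sad e) \<longleftrightarrow> (\<exists>i j. strict_saddlepoint r A i j)"
    proof
      assume "\<exists>i j. strict_saddlepoint r A i j"
      then obtain i j where "strict_saddlepoint r A i j" by blast
      hence "sad (\<lambda>d. if d = 0 then i else j)" by (simp add: sad)
      thus "\<exists>e. sad e" by blast
    qed (use sad in blast)
    have "correct_output r A s"
      using that unfolding good_def ex correct_output_def sad by (cases "\<exists>i j. strict_saddlepoint r A i j") auto
    thus ?thesis unfolding k_def[symmetric] using that by (simp add: good_def)
  qed
  show "\<exists>t. \<forall>s \<in> set_pmf (run w (entry_less r A) code t (init n)).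
      halted code s \<and> correct_output r A s \<and> coins s \<le> draws (bits n)"
  proof (intro exI ballI)
    \<comment> \<open>Long enough for the exhaustive search in the whole matrix, hence for every
      list of flips.\<close>
    let ?t = "clen program * (1 + (700000 * n + n * (n + 1))) + draws k"
    fix s assume "s \<in> set_pmf (run w (entry_less r A) code ?t (init n))"
    then obtain bs where bs: "length bs = ?t" "s = fst (drun w lt code ?t (init n, bs))"
      unfolding lt_eq[symmetric] run_eq_drun[OF order_refl] by (auto simp: set_replicate_pmf)
    have "clen program * (1 + (700000 * n + (if fails bs then n * (n + 1) else 0))) \<le> clen program * (1 + (700000 * n + n * (n + 1)))"
      by (intro mult_left_mono) auto
    hence le: "clen program * (1 + (700000 * n + (if fails bs then n * (n + 1) else 0))) \<le> ?t" by (rule trans_le_add1)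
    have "good s" unfolding bs(2) by (rule machine_run[OF Bw _ le]) (use bs(1) in simp)
    thus "halted code s \<and> correct_output r A s \<and> coins s \<le> draws (bits n)" by (rule good)
  qed
  show "1 - failure (real NR) n \<le> measure_pmf.prob (run w (entry_less r A) code (time n) (init n)) {s. halted code s}"
  proof (cases "g < 24")
    case True
    hence "failure (real NR) n = 1"
      unfolding failure_def Let_def k_def[symmetric] g_def[symmetric] by simp
    thus ?thesis by simp
  next
    case False
    have q: "failure (real NR) n = (NR * (116 * g / 2 ^ g)) ^ 40"
      unfolding failure_def Let_def k_def[symmetric] g_def[symmetric] using False by simp
    obtain m where m: "time n = draws k + m" by (auto simp: time_def k_def)
    let ?p = "replicate_pmf (draws k + m) coin"
    have "1 - prb ?p {bs. fails bs} = prb ?p {bs. \<not> fails bs}"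
      using measure_pmf.prob_compl[of "{bs. fails bs}" ?p] by (simp add: set_diff_eq)
    also have "\<dots> \<le> prb ?p {bs. halted code (fst (drun w lt code (time n) (init n, bs)))}"
    proof (rule prb_mono)
      fix bs assume bs: "bs \<in> set_pmf ?p" "bs \<in> {bs. \<not> fails bs}"
      hence "length bs = draws k + m" by (auto simp: set_replicate_pmf)
      hence "good (fst (drun w lt code (time n) (init n, bs)))"
        using bs(2) by (intro machine_run[OF Bw]) (auto simp: time_def)
      thus "bs \<in> {bs. halted code (fst (drun w lt code (time n) (init n, bs)))}" by (simp add: good_def)
    qed
    also have "\<dots> = prb (run w lt code (time n) (init n)) {s. halted code s}"
      unfolding run_eq_drun[OF order_refl] prb_map m by simp
    finally show ?thesis using prb_fails[of m] False unfolding q lt_eq by simp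
  qed
qed

theorem theorem5:
  shows "\<exists>(P :: instr list) (c :: real) (T :: nat \<Rightarrow> nat) (b :: nat \<Rightarrow> nat) (q :: nat \<Rightarrow> real).
     c \<ge> 1 \<and>
     (\<lambda>n. real (T n)) \<in> O(\<lambda>n. real n) \<and>
     (\<lambda>n. real (b n)) \<in> O(\<lambda>n. ln (real n)) \<and>
     q \<in> O(\<lambda>n. ln (real n) * ln (ln (real n)) / real n) \<and>
     (\<forall>(n :: nat) (w :: nat) (X :: 'a set) (r :: 'a rel) (A :: 'a mat).
        n \<ge> 1 \<longrightarrow> real w \<ge> c * log 2 (real n + 1) \<longrightarrow>
        linear_order_on X r \<longrightarrow>
        A \<in> carrier_mat n n \<longrightarrow> elements_mat A \<subseteq> X \<longrightarrow>
        inj_on (\<lambda>p. A $$ p) ({..<n} \<times> {..<n}) \<longrightarrow>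
        (\<exists>t. \<forall>s \<in> set_pmf (run w (entry_less r A) P t (init n)).
           halted P s \<and> correct_output r A s \<and> coins s \<le> b n) \<and>
        measure_pmf.prob (run w (entry_less r A) P (T n) (init n)) {s. halted P s} \<ge> 1 - q n)"
proof (rule exI[of _ code], rule exI[of _ 600], rule exI[of _ time], rule exI[of _ "\<lambda>n. draws (bits n)"],
    rule exI[of _ "failure (real NR)"], intro conjI allI impI)
  show "(1::real) \<le> 600" by simp
  show "(\<lambda>n. real (time n)) \<in> O(\<lambda>n. real n)" by (rule time_bigo)
  show "(\<lambda>n. real (draws (bits n))) \<in> O(\<lambda>n. ln (real n))"
    using bits_bigo[of "NA * (16 * NR) * 2"] by (simp add: mult_ac)
  show "failure (real NR) \<in> O(\<lambda>n. ln (real n) * ln (ln (real n)) / real n)" by (rule failure_bigo) simp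
qed (rule saddlepoint_machine; assumption)+

end
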